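(* Let $F$ be an algebraic number field with ring of integers $\mathfrak{g}$, $(V,\varphi)$ a quadratic space of dimension $n\,(>1)$ over $F$, and $L$ a $\mathfrak{g}$-maximal lattice in $V$ with respect to $\varphi$. Let $h\in V$ with $q=\varphi[h]\in F^\times$. Put $W=(Fh)^\perp=\{x\in V\mid\varphi(x,h)=0\}$, let $\psi$ be the restriction of $\varphi$ to $W$, and let $M$ be a $\mathfrak{g}$-maximal lattice in $W$ with respect to $\psi$. Let $\mathfrak{b}(q)$ be the fractional ideal of $F$ determined by $2q[\widetilde L/L]=\mathfrak{b}(q)^2[\widetilde M/M]$. Then $$\varphi(h,L)\,[M/L\cap W]=2^{-1}\mathfrak{b}(q).$$ Moreover, for every nonzero $c\in\mathfrak{g}$ such that $ch\in L$, $$c\,\mathfrak{b}(q)=\mathfrak{b}(c^2q)=\prod_{v\in\mathbf{h}}\mathfrak{p}_v^{\lambda_v(c^2q)},\qquad \mathfrak{b}(q)\subset 2\varphi(h,L)\subset c^{-1}\mathfrak{g}.$$ In particular, if $h\in L$, then $$\mathfrak{b}(q)=\prod_{v\in\mathbf{h}}\mathfrak{p}_v^{\lambda_v(q)},\qquad \mathfrak{b}(q)\subset2\varphi(h,L)\subset\mathfrak{g}.$$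
   Context: A quadratic space $(V,\varphi)$ is a finite-dimensional vector space with a nondegenerate symmetric bilinear form $\varphi$; $\varphi[x]=\varphi(x,x)$. $GL(V)$ acts on $V$ on the right. $\mathbf{h}$ is the set of nonarchimedean primes of $F$, $\mathfrak{p}_v$ the prime ideal corresponding to $v\in\mathbf{h}$, $F_v,\mathfrak{g}_v$ the completions, and a subscript $v$ denotes localization. A $\mathfrak{g}$-lattice in $V$ is a finitely generated $\mathfrak{g}$-submodule containing a basis of $V$. It is $\mathfrak{g}$-maximal with respect to $\varphi$ if it is maximal among the $\mathfrak{g}$-lattices on which all values $\varphi[x]$ lie in $\mathfrak{g}$. For a lattice $L$, $\widetilde L=\{x\in V\mid2\varphi(x,L)\subset\mathfrak{g}\}$ (for lattices in $W$ use $\psi$). For $\mathfrak g$-lattices $L,M$ in the same space $X$, $[L/M]$ is the fractional ideal generated over $\mathfrak{g}$ by $\det(\alpha)$ for all $F$-linear automorphisms $\alpha$ of $X$ with $L\alpha\subset M$. The ideal $[\widetilde L/L]$ for $L$ maximal is the discriminant ideal of $(V,\varphi)$; it does not depend on the choice of $L$. $\varphi(h,L)=\{\varphi(h,x)\mid x\in L\}$ is a fractional ideal. All these notions are used also over $F_v,\mathfrak{g}_v$. For every $q\in\varphi[V]\cap F^\times$, $2q[\widetilde L/L][\widetilde M/M]^{-1}$ is the square of a fractional ideal, so $\mathfrak{b}(q)$ is well defined; it depends only on the isomorphism class of $(V,\varphi)$ and on $q$. $\mathfrak b(c^2q)$ is defined likewise with $c^2q$ in place of $q$ (i.e. with $ch$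 in place of $h$). For $v\in\mathbf{h}$ and $0\neq q'\in\mathfrak{g}_v$ represented by $\varphi_v$ on $L_v$, $\lambda_v(q')$ is the nonnegative integer such that, for every $h'\in L_v$ with $\varphi_v[h']=q'$, $[M'/L_v\cap W']=\mathfrak{p}_v^{\lambda_v(q')-m}$ where $2\varphi_v(h',L_v)=\mathfrak{p}_v^m$, $W'=(F_vh')^\perp$, and $M'$ is a $\mathfrak{g}_v$-maximal lattice in $W'$ with respect to the restriction of $\varphi_v$ (it is known that such an integer exists, depending only on $(V_v,\varphi_v)$ and $q'$). *)

theory Defs
  imports
    "Jordan_Normal_Form.VS_Connect"
    "HOL-Algebra.QuotRing"
    "HOL-Combinatorics.Permutations"
begin

text \<open>
  Lattices, indices and discriminants are needed over a number field and over all its completions,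
  and the completion \<open>F\<^sub>v\<close> depends on the variable \<open>v\<close>.  These notions are therefore stated for a
  field \<open>K\<close> given as a ring record, a subring \<open>R\<close> of \<open>K\<close> given by its carrier, and a \<open>K\<close>-vector
  space \<open>V\<close> given as a module record.  The number field itself is a type \<^typ>\<open>'f::field_char_0\<close>,
  regarded as a record by means of \<^term>\<open>class_ring\<close>.  A subspace \<open>W\<close> of \<open>V\<close> is the record
  \<open>V\<lparr>carrier := W\<rparr>\<close>, and the restriction of \<open>\<phi>\<close> to it is again written \<open>\<phi>\<close>.
\<close>


section \<open>Lattices in quadratic spaces\<close>

definition rspan ::
  "('k, 'm) ring_scheme \<Rightarrow> 'k set \<Rightarrow> ('k, 'v) module \<Rightarrow> 'v set \<Rightarrow> 'v set"
  where "rspan K R V S = LinearCombinations.module.span (K\<lparr>carrier := R\<rparr>) V S"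

definition is_lattice ::
  "('k, 'm) ring_scheme \<Rightarrow> 'k set \<Rightarrow> ('k, 'v) module \<Rightarrow> 'v set \<Rightarrow> bool"
  where "is_lattice K R V L \<longleftrightarrow>
    (\<exists>S. finite S \<and> S \<subseteq> carrier V \<and> L = rspan K R V S) \<and>
    (\<exists>B. B \<subseteq> L \<and> vectorspace.basis K V B)"

definition quadratic_space ::
  "('k, 'm) ring_scheme \<Rightarrow> ('k, 'v) module \<Rightarrow> ('v \<Rightarrow> 'v \<Rightarrow> 'k) \<Rightarrow> bool"
  where "quadratic_space K V \<phi> \<longleftrightarrow>
    vectorspace K V \<and> vectorspace.fin_dim K V \<and>
    (\<forall>x\<in>carrier V. \<forall>y\<in>carrier V. \<phi> x y \<in> carrier K) \<and>
    (\<forall>x\<in>carrier V. \<forall>y\<in>carrier V. \<forall>z\<in>carrier V.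
       \<phi> (x \<oplus>\<^bsub>V\<^esub> y) z = \<phi> x z \<oplus>\<^bsub>K\<^esub> \<phi> y z) \<and>
    (\<forall>a\<in>carrier K. \<forall>x\<in>carrier V. \<forall>y\<in>carrier V. \<phi> (a \<odot>\<^bsub>V\<^esub> x) y = a \<otimes>\<^bsub>K\<^esub> \<phi> x y) \<and>
    (\<forall>x\<in>carrier V. \<forall>y\<in>carrier V. \<phi> x y = \<phi> y x) \<and>
    (\<forall>x\<in>carrier V. (\<forall>y\<in>carrier V. \<phi> x y = \<zero>\<^bsub>K\<^esub>) \<longrightarrow> x = \<zero>\<^bsub>V\<^esub>)"

definition maximal_lattice ::
  "('k, 'm) ring_scheme \<Rightarrow> 'k set \<Rightarrow> ('k, 'v) module \<Rightarrow> ('v \<Rightarrow> 'v \<Rightarrow> 'k) \<Rightarrow> 'v set \<Rightarrow> bool"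
  where "maximal_lattice K R V \<phi> L \<longleftrightarrow>
    VectorSpace.maximal L (\<lambda>L'. is_lattice K R V L' \<and> (\<forall>x\<in>L'. \<phi> x x \<in> R))"

definition dual_lattice ::
  "('k, 'm) ring_scheme \<Rightarrow> 'k set \<Rightarrow> ('k, 'v) module \<Rightarrow> ('v \<Rightarrow> 'v \<Rightarrow> 'k) \<Rightarrow> 'v set \<Rightarrow> 'v set"
  where "dual_lattice K R V \<phi> L = {x \<in> carrier V. \<forall>y\<in>L. \<phi> x y \<oplus>\<^bsub>K\<^esub> \<phi> x y \<in> R}"

text \<open>The subspace \<open>(Kh)\<^sup>\<bottom>\<close>.\<close>

definition orth_space ::
  "('k, 'm) ring_scheme \<Rightarrow> ('k, 'v) module \<Rightarrow> ('v \<Rightarrow> 'v \<Rightarrow> 'k) \<Rightarrow> 'v \<Rightarrow> ('k, 'v) module"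
  where "orth_space K V \<phi> h = V\<lparr>carrier := {x \<in> carrier V. \<phi> x h = \<zero>\<^bsub>K\<^esub>}\<rparr>"


section \<open>Fractional ideals\<close>

definition self_module :: "('k, 'm) ring_scheme \<Rightarrow> ('k, 'k) module"
  where "self_module K =
    \<lparr>carrier = carrier K, mult = mult K, one = one K, zero = zero K, add = add K, smult = mult K\<rparr>"

text \<open>
  A fractional ideal is a nonzero finitely generated \<open>R\<close>-submodule of \<open>K\<close>, that is, an
  \<open>R\<close>-lattice in the one-dimensional space \<open>K\<close>.  Powers with exponents in \<^typ>\<open>nat\<close> and \<^typ>\<open>int\<close>
  and finite products of fractional ideals are those of the following structure.
\<close>

definition frac_ideals :: "('k, 'm) ring_scheme \<Rightarrow> 'k set \<Rightarrow> 'k set monoid"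
  where "frac_ideals K R =
    \<lparr>carrier = {A. is_lattice K R (self_module K) A},
     mult = (\<lambda>A B. rspan K R (self_module K) {a \<otimes>\<^bsub>K\<^esub> b | a b. a \<in> A \<and> b \<in> B}),
     one = R\<rparr>"


section \<open>The index ideal\<close>

definition leibniz_det :: "('k, 'm) ring_scheme \<Rightarrow> nat \<Rightarrow> (nat \<Rightarrow> nat \<Rightarrow> 'k) \<Rightarrow> 'k"
  where "leibniz_det K n A =
    (\<Oplus>\<^bsub>K\<^esub>p\<in>{p. p permutes {..<n}}.
       if evenperm p then (\<Otimes>\<^bsub>K\<^esub>i\<in>{..<n}. A i (p i)) else \<ominus>\<^bsub>K\<^esub> (\<Otimes>\<^bsub>K\<^esub>i\<in>{..<n}. A i (p i)))"

text \<open>The determinant of an endomorphism: that of its matrix with respect to any basis.\<close>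

definition lin_det :: "('k, 'm) ring_scheme \<Rightarrow> ('k, 'v) module \<Rightarrow> ('v \<Rightarrow> 'v) \<Rightarrow> 'k"
  where "lin_det K V \<alpha> =
    (THE d. \<exists>bs A. distinct bs \<and> vectorspace.basis K V (set bs) \<and>
       (\<forall>i<length bs. \<forall>j<length bs. A i j \<in> carrier K) \<and>
       (\<forall>i<length bs. \<alpha> (bs ! i) = (\<Oplus>\<^bsub>V\<^esub>j\<in>{..<length bs}. A i j \<odot>\<^bsub>V\<^esub> (bs ! j))) \<and>
       d = leibniz_det K (length bs) A)"

definition lin_aut :: "('k, 'm) ring_scheme \<Rightarrow> ('k, 'v) module \<Rightarrow> ('v \<Rightarrow> 'v) \<Rightarrow> bool"
  where "lin_aut K V \<alpha> \<longleftrightarrow> \<alpha> \<in> LinearCombinations.module_hom K V V \<and> bij_betw \<alpha> (carrier V) (carrier V)"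

text \<open>\<open>[L/M]\<close>; note that \<open>M \<subseteq> L\<close> is not required.\<close>

definition index_ideal ::
  "('k, 'm) ring_scheme \<Rightarrow> 'k set \<Rightarrow> ('k, 'v) module \<Rightarrow> 'v set \<Rightarrow> 'v set \<Rightarrow> 'k set"
  where "index_ideal K R V L M =
    rspan K R (self_module K) {lin_det K V \<alpha> | \<alpha>. lin_aut K V \<alpha> \<and> \<alpha> ` L \<subseteq> M}"

definition discr_ideal ::
  "('k, 'm) ring_scheme \<Rightarrow> 'k set \<Rightarrow> ('k, 'v) module \<Rightarrow> ('v \<Rightarrow> 'v \<Rightarrow> 'k) \<Rightarrow> 'v set \<Rightarrow> 'k set"
  where "discr_ideal K R V \<phi> L = index_ideal K R V (dual_lattice K R V \<phi> L) L"

text \<open>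
  The ideal \<open>\<bb>(q)\<close> with \<open>2q[L~/L] = \<bb>(q)\<^sup>2[M~/M]\<close>, where \<open>L\<close> and \<open>M\<close> are maximal in \<open>V\<close> and in
  \<open>(Kh)\<^sup>\<bottom>\<close>.  As it depends only on the space and on \<open>q\<close>, the relation is imposed for all choices
  of \<open>h\<close> with \<open>\<phi>[h] = q\<close>, of \<open>L\<close> and of \<open>M\<close>.
\<close>

definition ideal_b ::
  "('k, 'm) ring_scheme \<Rightarrow> 'k set \<Rightarrow> ('k, 'v) module \<Rightarrow> ('v \<Rightarrow> 'v \<Rightarrow> 'k) \<Rightarrow> 'k \<Rightarrow> 'k set"
  where "ideal_b K R V \<phi> q =
    (THE \<bb>. \<bb> \<in> carrier (frac_ideals K R) \<and>
       (\<forall>h L M. h \<in> carrier V \<and> \<phi> h h = q \<and> maximal_lattice K R V \<phi> L \<and>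
          maximal_lattice K R (orth_space K V \<phi> h) \<phi> M \<longrightarrow>
          (q \<oplus>\<^bsub>K\<^esub> q) <#\<^bsub>K\<^esub> discr_ideal K R V \<phi> L =
          \<bb> \<otimes>\<^bsub>frac_ideals K R\<^esub> \<bb> \<otimes>\<^bsub>frac_ideals K R\<^esub>
            discr_ideal K R (orth_space K V \<phi> h) \<phi> M))"

text \<open>
  The exponent \<open>\<lambda>(q)\<close>, for a local field \<open>K\<close> with valuation ring \<open>R\<close> and maximal ideal \<open>\<pp>\<close>, and
  for a nonzero \<open>q\<close> represented by \<open>\<phi>\<close> on the maximal lattice \<open>L\<close>.
\<close>

definition lambda_exp ::
  "('k, 'm) ring_scheme \<Rightarrow> 'k set \<Rightarrow> 'k set \<Rightarrow> ('k, 'v) module \<Rightarrow> ('v \<Rightarrow> 'v \<Rightarrow> 'k) \<Rightarrow> 'v set \<Rightarrow>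
   'k \<Rightarrow> nat"
  where "lambda_exp K R \<pp> V \<phi> L q =
    (THE l. \<forall>h\<in>L. \<phi> h h = q \<longrightarrow>
       (\<exists>m::int.
          {\<phi> h x \<oplus>\<^bsub>K\<^esub> \<phi> h x | x. x \<in> L} = \<pp> [^]\<^bsub>frac_ideals K R\<^esub> m \<and>
          (\<forall>M. maximal_lattice K R (orth_space K V \<phi> h) \<phi> M \<longrightarrow>
             index_ideal K R (orth_space K V \<phi> h) M (L \<inter> carrier (orth_space K V \<phi> h)) =
             \<pp> [^]\<^bsub>frac_ideals K R\<^esub> (int l - m))))"


section \<open>Number fields and their completions\<close>

definition number_field :: "'f::field_char_0 itself \<Rightarrow> bool"
  where "number_field TYPE('f) \<longleftrightarrow>
    (\<exists>B::'f set. finite B \<and> (\<forall>x. \<exists>c::'f \<Rightarrow> rat. x = (\<Sum>b\<in>B. of_rat (c b) * b)))"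

definition alg_ints :: "'f::field_char_0 set"
  where "alg_ints = {x. algebraic_int x}"

abbreviation global_frac_ideals :: "'f::field_char_0 set monoid"
  where "global_frac_ideals \<equiv> frac_ideals class_ring alg_ints"

text \<open>A nonarchimedean prime \<open>v\<close> is represented by the prime ideal \<open>\<pp>\<^sub>v\<close>.\<close>

definition finite_primes :: "'f::field_char_0 set set"
  where "finite_primes = {P. primeideal P (class_ring\<lparr>carrier := alg_ints\<rparr>) \<and> P \<noteq> {0}}"

text \<open>The elements of order at least \<open>k\<close> at \<open>P\<close>.\<close>

definition ord_ge :: "'f::field_char_0 set \<Rightarrow> nat \<Rightarrow> 'f set"
  where "ord_ge P k = {x. \<exists>s\<in>alg_ints. s \<notin> P \<and> s * x \<in> P [^]\<^bsub>global_frac_ideals\<^esub> k}"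

definition cauchy_seqs :: "'f::field_char_0 set \<Rightarrow> (nat \<Rightarrow> 'f) set"
  where "cauchy_seqs P = {s. \<forall>k. \<exists>N. \<forall>i\<ge>N. \<forall>j\<ge>N. s i - s j \<in> ord_ge P k}"

definition null_seqs :: "'f::field_char_0 set \<Rightarrow> (nat \<Rightarrow> 'f) set"
  where "null_seqs P = {s. \<forall>k. \<exists>N. \<forall>i\<ge>N. s i \<in> ord_ge P k}"

definition cauchy_ring :: "'f::field_char_0 set \<Rightarrow> (nat \<Rightarrow> 'f) ring"
  where "cauchy_ring P =
    \<lparr>carrier = cauchy_seqs P, mult = (\<lambda>s t i. s i * t i), one = (\<lambda>_. 1),
     zero = (\<lambda>_. 0), add = (\<lambda>s t i. s i + t i)\<rparr>"

definition completion :: "'f::field_char_0 set \<Rightarrow> (nat \<Rightarrow> 'f) set ring"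
  where "completion P = cauchy_ring P Quot null_seqs P"

definition to_completion :: "'f::field_char_0 set \<Rightarrow> 'f \<Rightarrow> (nat \<Rightarrow> 'f) set"
  where "to_completion P x = null_seqs P +>\<^bsub>cauchy_ring P\<^esub> (\<lambda>_. x)"

text \<open>
  The closure of a subset of the number field in the completion; applied to the ring of integers
  and to \<open>P\<close> it gives the valuation ring \<open>\<gg>\<^sub>v\<close> and its maximal ideal.
\<close>

definition closure_in_completion :: "'f::field_char_0 set \<Rightarrow> 'f set \<Rightarrow> (nat \<Rightarrow> 'f) set set"
  where "closure_in_completion P A =
    {null_seqs P +>\<^bsub>cauchy_ring P\<^esub> s | s. s \<in> cauchy_seqs P \<and> range s \<subseteq> A}"

abbreviation local_ints :: "'f::field_char_0 set \<Rightarrow> (nat \<Rightarrow> 'f) set set"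
  where "local_ints P \<equiv> closure_in_completion P alg_ints"

abbreviation local_prime :: "'f::field_char_0 set \<Rightarrow> (nat \<Rightarrow> 'f) set set"
  where "local_prime P \<equiv> closure_in_completion P P"


section \<open>Localization of a quadratic space\<close>

text \<open>
  The localization \<open>V \<otimes>\<^sub>F F\<^sub>v\<close> is realized as the space of functions from a fixed basis of \<open>V\<close> to
  the completion; \<open>V\<close> is mapped into it by its coordinates.
\<close>

definition some_basis :: "('f::field_char_0, 'v) module \<Rightarrow> 'v set"
  where "some_basis V = (SOME B. vectorspace.basis class_ring V B)"

definition coords :: "('f::field_char_0, 'v) module \<Rightarrow> 'v \<Rightarrow> 'v \<Rightarrow> 'f"
  where "coords V x =
    (THE a. a \<in> some_basis V \<rightarrow>\<^sub>E UNIV \<and>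
       LinearCombinations.module.lincomb V a (some_basis V) = x)"

definition local_space ::
  "'f::field_char_0 set \<Rightarrow> ('f, 'v) module \<Rightarrow> ((nat \<Rightarrow> 'f) set, 'v \<Rightarrow> (nat \<Rightarrow> 'f) set) module"
  where "local_space P V = ring.func_space (completion P) (some_basis V)"

definition to_local_space ::
  "'f::field_char_0 set \<Rightarrow> ('f, 'v) module \<Rightarrow> 'v \<Rightarrow> ('v \<Rightarrow> (nat \<Rightarrow> 'f) set)"
  where "to_local_space P V x = restrict (\<lambda>b. to_completion P (coords V x b)) (some_basis V)"

definition local_form ::
  "'f::field_char_0 set \<Rightarrow> ('f, 'v) module \<Rightarrow> ('v \<Rightarrow> 'v \<Rightarrow> 'f) \<Rightarrow>
   ('v \<Rightarrow> (nat \<Rightarrow> 'f) set) \<Rightarrow> ('v \<Rightarrow> (nat \<Rightarrow> 'f) set) \<Rightarrow> (nat \<Rightarrow> 'f) set"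
  where "local_form P V \<phi> x y =
    (\<Oplus>\<^bsub>completion P\<^esub>b\<in>some_basis V. \<Oplus>\<^bsub>completion P\<^esub>b'\<in>some_basis V.
       x b \<otimes>\<^bsub>completion P\<^esub> y b' \<otimes>\<^bsub>completion P\<^esub> to_completion P (\<phi> b b'))"

definition local_lattice ::
  "'f::field_char_0 set \<Rightarrow> ('f, 'v) module \<Rightarrow> 'v set \<Rightarrow> ('v \<Rightarrow> (nat \<Rightarrow> 'f) set) set"
  where "local_lattice P V L =
    rspan (completion P) (local_ints P) (local_space P V) (to_local_space P V ` L)"

text \<open>\<open>\<lambda>\<^sub>v(q)\<close> for the localizations of \<open>V\<close>, \<open>\<phi>\<close>, \<open>L\<close> at \<open>v\<close> and the image of \<open>q\<close> in \<open>F\<^sub>v\<close>.\<close>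

definition lambda_at ::
  "'f::field_char_0 set \<Rightarrow> ('f, 'v) module \<Rightarrow> ('v \<Rightarrow> 'v \<Rightarrow> 'f) \<Rightarrow> 'v set \<Rightarrow> 'f \<Rightarrow> nat"
  where "lambda_at P V \<phi> L q =
    lambda_exp (completion P) (local_ints P) (local_prime P)
      (local_space P V) (local_form P V \<phi>) (local_lattice P V L) (to_completion P q)"

text \<open>
  \<open>A\<close> is the product of the \<open>\<pp>\<^sub>v\<close> to the powers \<open>e v\<close>, taken over all nonarchimedean primes.
  The library product over an infinite index set is \<open>\<one>\<close> by convention, so the finiteness of the
  support of \<open>e\<close> is stated explicitly.
\<close>

definition is_prime_product :: "'f::field_char_0 set \<Rightarrow> ('f set \<Rightarrow> nat) \<Rightarrow> bool"
  where "is_prime_product A e \<longleftrightarrow>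
    finite {P \<in> finite_primes. e P \<noteq> 0} \<and>
    A = (\<Otimes>\<^bsub>global_frac_ideals\<^esub>P\<in>{P \<in> finite_primes. e P \<noteq> 0}.
           P [^]\<^bsub>global_frac_ideals\<^esub> e P)"

end

(*
For a lattice over a discrete valuation ring let the volume be the order of the determinant of a
basis. Expanding the Gram determinant of a basis of L adapted to the orthogonal complement W of h gives
  ord (2 q) + disc L = 2 ord (2 phi(h,L)) + disc (L Int W),
and disc (L Int W) = disc M + 2 (vol (L Int W) - vol M). Hence 2 phi(h,L) [M / L Int W] satisfies,
locally, the relation defining b(q). That the relation does not depend on the choices follows from
two facts: all maximal lattices of a space have the same volume, by the modular law for volumes,
and vectors of equal nonzero length are exchanged up to sign by a reflection. Since the fractional
ideals of F are determined by their orders at all primes, the global statement follows once the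
localization of a maximal lattice is known to be maximal. Finally, orders, volumes and maximality
are preserved by the passage from F to a completion, because F is dense in it.
*)

theory Submission
  imports Defs "Jordan_Normal_Form.Char_Poly" "HOL-Computational_Algebra.Primes"
begin

hide_const (open) Modules.module_hom Ring_Hom.ring_hom Real_Vector_Spaces.subspace

section \<open>Determinants over a commutative ring\<close>

text \<open>Primes above 2 are treated like all others. Lattice arguments therefore use
  \<open>bil\<close>, which is twice the form: it is integral on integral lattices in every residue
  characteristic, and duals and Gram determinants refer to it. The ideal \<bb>(q) and the exponents
  \<lambda> are descriptions over all vectors of a given length and all maximal lattices, so
  independence of these choices belongs to the existence proof. For \<lambda> the vectors include
  those of the completed lattice that do not come from \<open>V\<close>. This is why the argument by
  reflections is carried out over an abstract discretely valued field: it serves once for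
  \<open>F\<close> with the order at a prime and once for the completion. Between \<open>F\<close>
  and its completions stands the localization inside \<open>F\<close>, where modules at different
  primes lie in one space and can be intersected; the completion enters only through \<lambda>. The
  arithmetic of the ring of integers rests on one fact, the finiteness of its quotients by positive
  integers, proved without an integral basis: few ideals contain a given integer, and powers repeat
  modulo it.\<close>

lemma (in comm_monoid) finprod_swap:
  assumes "finite A" "finite B" "\<And>a b. a \<in> A ==> b \<in> B ==> f a b \<in> carrier G"
  shows "(\<Otimes>a\<in>A. \<Otimes>b\<in>B. f a b) = (\<Otimes>b\<in>B. \<Otimes>a\<in>A. f a b)"
  using assms(1,3)
proof (induction A rule: finite_induct)
  case empty
  thus ?case by (simp add: finprod_one_eqI)
next
  case (insert x A)
  have "(\<Otimes>a\<in>insert x A. \<Otimes>b\<in>B. f a b) = (\<Otimes>b\<in>B. f x b) \<otimes> (\<Otimes>a\<in>A. \<Otimes>b\<in>B. f a b)"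
    using insert by (intro finprod_insert) (auto intro!: finprod_closed)
  also have "\<dots> = (\<Otimes>b\<in>B. f x b) \<otimes> (\<Otimes>b\<in>B. \<Otimes>a\<in>A. f a b)"
    using insert by auto
  also have "\<dots> = (\<Otimes>b\<in>B. f x b \<otimes> (\<Otimes>a\<in>A. f a b))"
    using insert by (intro finprod_multf[symmetric]) (auto intro!: finprod_closed)
  also have "\<dots> = (\<Otimes>b\<in>B. \<Otimes>a\<in>insert x A. f a b)"
    using insert by (intro finprod_cong') (auto intro!: finprod_closed simp: Pi_def)
  finally show ?case .
qed

lemmas (in abelian_monoid) finsum_swap = add.finprod_swap

lemma (in comm_monoid) finprod_fibres:
  assumes "finite A" "finite C" "h \<in> A \<rightarrow> C" "\<And>a. a \<in> A ==> f a \<in> carrier G"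
  shows "(\<Otimes>a\<in>A. f a) = (\<Otimes>c\<in>C. \<Otimes>a\<in>{a\<in>A. h a = c}. f a)"
proof -
  have "A = (\<Union>c\<in>C. {a\<in>A. h a = c})" using assms(3) by auto
  hence "finprod G f A = finprod G f (\<Union>c\<in>C. {a\<in>A. h a = c})" by simp
  also have "\<dots> = (\<Otimes>c\<in>C. \<Otimes>a\<in>{a\<in>A. h a = c}. f a)"
    by (rule finprod_UN_disjoint) (use assms in "auto simp: pairwise_def disjnt_def")
  finally show ?thesis .
qed

lemma (in comm_monoid) finprod_permute:
  assumes "p permutes A" "\<And>a. a \<in> A ==> f a \<in> carrier G"
  shows "(\<Otimes>a\<in>A. f (p a)) = (\<Otimes>a\<in>A. f a)"
proof -
  have "finprod G f (p ` A) = (\<Otimes>a\<in>A. f (p a))"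
    by (rule finprod_reindex) (use assms permutes_image[OF assms(1)] permutes_inj_on[OF assms(1)] in auto)
  thus ?thesis by (simp add: permutes_image[OF assms(1)])
qed

lemma (in comm_monoid) finprod_single:
  assumes "finite A" "i \<in> A" "f i \<in> carrier G" "\<And>j. j \<in> A ==> j \<noteq> i ==> f j = \<one>"
  shows "(\<Otimes>j\<in>A. f j) = f i"
proof -
  have "(\<Otimes>j\<in>insert i (A - {i}). f j) = f i \<otimes> (\<Otimes>j\<in>A - {i}. f j)"
    by (rule finprod_insert) (use assms in auto)
  also have "(\<Otimes>j\<in>A - {i}. f j) = \<one>" by (rule finprod_one_eqI) (use assms in auto)
  finally show ?thesis using assms by (simp add: insert_absorb)
qed

lemmas (in abelian_monoid) finsum_single = add.finprod_single

text \<open>Stated for a bare additive map between two records, so that linear functionals, module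
  homomorphisms, the multiples of a fixed vector and the inclusion of \<open>W\<close> into
  \<open>V\<close> are all instances.\<close>

lemma finsum_additive:
  assumes "abelian_monoid G" "abelian_monoid H" "finite A" "g \<in> A \<rightarrow> carrier G"
    and "\<And>x. x \<in> carrier G ==> f x \<in> carrier H" "f \<zero>\<^bsub>G\<^esub> = \<zero>\<^bsub>H\<^esub>"
    and "\<And>x y. x \<in> carrier G ==> y \<in> carrier G ==> f (x \<oplus>\<^bsub>G\<^esub> y) = f x \<oplus>\<^bsub>H\<^esub> f y"
  shows "f (\<Oplus>\<^bsub>G\<^esub>a\<in>A. g a) = (\<Oplus>\<^bsub>H\<^esub>a\<in>A. f (g a))"
proof -
  interpret G: abelian_monoid G by fact
  interpret H: abelian_monoid H by fact
  show ?thesis using assms(3,4)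
  proof (induction A rule: finite_induct)
    case (insert x F)
    hence "f (\<Oplus>\<^bsub>G\<^esub>a\<in>insert x F. g a) = f (g x) \<oplus>\<^bsub>H\<^esub> f (\<Oplus>\<^bsub>G\<^esub>a\<in>F. g a)"
      using assms(7) by (simp add: G.finsum_insert)
    also have "\<dots> = (\<Oplus>\<^bsub>H\<^esub>a\<in>insert x F. f (g a))"
      using insert assms(5) by (subst H.finsum_insert) (auto simp: Pi_def)
    finally show ?case .
  qed (use assms in simp)
qed

context cring
begin

definition perm_sign :: "(nat => nat) => 'a"
  where "perm_sign p = (if evenperm p then \<one> else \<ominus> \<one>)"

definition diag_prod :: "nat => (nat => nat => 'a) => (nat => nat) => 'a"
  where "diag_prod n A p = (\<Otimes>i\<in>{..<n}. A i (p i))"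

definition is_mat :: "nat => (nat => nat => 'a) => bool"
  where "is_mat n A \<longleftrightarrow> (\<forall>i<n. \<forall>j<n. A i j \<in> carrier R)"

lemma is_matD: "is_mat n A ==> i < n ==> j < n ==> A i j \<in> carrier R"
  by (simp add: is_mat_def)

lemma perm_sign_closed [simp]: "perm_sign p \<in> carrier R"
  by (simp add: perm_sign_def)

lemma perm_sign_sq [simp]: "perm_sign p \<otimes> perm_sign p = \<one>"
  by (simp add: perm_sign_def l_minus r_minus)

lemma perm_sign_comp:
  assumes "p permutes {..<n}" "q permutes {..<n}"
  shows "perm_sign (p \<circ> q) = perm_sign p \<otimes> perm_sign q"
  using evenperm_comp[of p q] permutes_imp_permutation[of "{..<n}"] assms
  by (simp add: perm_sign_def l_minus r_minus)

lemma perm_sign_inv: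
  assumes "p permutes {..<n}"
  shows "perm_sign (inv_into UNIV p) = perm_sign p"
  using evenperm_inv[of p] permutes_imp_permutation[of "{..<n}" p] assms
  by (simp add: perm_sign_def)

lemma permutes_less: "p permutes {..<n} ==> i < n ==> p i < n"
  using permutes_in_image[of p "{..<n}" i] by simp

lemma diag_prod_closed [simp]:
  assumes "is_mat n A" "f \<in> {..<n} \<rightarrow> {..<n}"
  shows "diag_prod n A f \<in> carrier R"
  unfolding diag_prod_def by (rule finprod_closed) (use assms in "auto simp: is_mat_def Pi_def")

lemma diag_prod_closed_perm [simp]:
  assumes "is_mat n A" "p permutes {..<n}"
  shows "diag_prod n A p \<in> carrier R"
  by (rule diag_prod_closed) (use assms permutes_less in auto)

lemma finite_perms: "finite {p. p permutes {..<n::nat}}"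
  by (rule finite_permutations) simp

lemma leibniz_det_alt:
  assumes "is_mat n A"
  shows "leibniz_det R n A = (\<Oplus>p\<in>{p. p permutes {..<n}}. perm_sign p \<otimes> diag_prod n A p)"
  unfolding leibniz_det_def
  by (rule finsum_cong') (use assms in "auto simp: diag_prod_def[symmetric] perm_sign_def l_minus")

lemma leibniz_det_closed [simp]:
  assumes "is_mat n A"
  shows "leibniz_det R n A \<in> carrier R"
  unfolding leibniz_det_alt[OF assms] by (rule finsum_closed) (use assms in auto)

lemma leibniz_det_cong:
  assumes "\<And>i j. i < n ==> j < n ==> A i j = B i j" "is_mat n B"
  shows "leibniz_det R n A = leibniz_det R n B"
proof -
  have A: "is_mat n A" using assms by (simp add: is_mat_def)
  have "diag_prod n A p = diag_prod n B p" if "p permutes {..<n}" for p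
    unfolding diag_prod_def
    by (rule finprod_cong') (use assms permutes_less[OF that] in "auto simp: is_mat_def")
  thus ?thesis unfolding leibniz_det_alt[OF A] leibniz_det_alt[OF assms(2)]
    by (intro finsum_cong') (use assms(2) in auto)
qed

text \<open>The sum is reindexed by inversion of permutations, which preserves the sign; each
  product is reindexed by the permutation itself.\<close>

lemma leibniz_det_transpose:
  assumes A: "is_mat n A"
  shows "leibniz_det R n (\<lambda>i j. A j i) = leibniz_det R n A"
proof -
  let ?P = "{p. p permutes {..<n}}"
  have A': "is_mat n (\<lambda>i j. A j i)" using A by (simp add: is_mat_def)
  have "leibniz_det R n (\<lambda>i j. A j i) = (\<Oplus>p\<in>?P. perm_sign p \<otimes> diag_prod n (\<lambda>i j. A j i) p)"
    by (rule leibniz_det_alt[OF A'])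
  also have "\<dots> = (\<Oplus>p\<in>?P. perm_sign (inv_into UNIV p) \<otimes> diag_prod n A (inv_into UNIV p))"
  proof (rule finsum_cong', simp, rule funcsetI)
    fix p assume "p \<in> ?P"
    hence p: "p permutes {..<n}" by simp
    thus "perm_sign (inv_into UNIV p) \<otimes> diag_prod n A (inv_into UNIV p) \<in> carrier R"
      using A permutes_inv[OF p] by simp
  next
    fix p assume "p \<in> ?P"
    hence p: "p permutes {..<n}" by simp
    have "diag_prod n A (inv_into UNIV p) = (\<Otimes>i\<in>{..<n}. A (p i) (inv_into UNIV p (p i)))"
      unfolding diag_prod_def
      by (rule finprod_permute[OF p, symmetric])
        (use A permutes_less[OF permutes_inv[OF p]] in "auto simp: is_mat_def")
    hence "diag_prod n A (inv_into UNIV p) = diag_prod n (\<lambda>i j. A j i) p"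
      using permutes_inverses[OF p] by (simp add: diag_prod_def)
    thus "perm_sign p \<otimes> diag_prod n (\<lambda>i j. A j i) p = perm_sign (inv_into UNIV p) \<otimes> diag_prod n A (inv_into UNIV p)"
      using perm_sign_inv[OF p] by simp
  qed
  also have "\<dots> = (\<Oplus>p\<in>inv_into UNIV ` ?P. perm_sign p \<otimes> diag_prod n A p)"
  proof (rule finsum_reindex[symmetric])
    show "inj_on (inv_into UNIV) ?P" by (rule inj_onI) (metis mem_Collect_eq permutes_inv_inv)
  qed (use A in "auto intro!: m_closed diag_prod_closed_perm permutes_inv")
  also have "inv_into UNIV ` ?P = ?P"
  proof
    show "?P \<subseteq> inv_into UNIV ` ?P"
    proof
      fix p assume "p \<in> ?P"
      hence "p = inv_into UNIV (inv_into UNIV p)" "inv_into UNIV p \<in> ?P"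
        by (simp_all add: permutes_inv_inv permutes_inv)
      thus "p \<in> inv_into UNIV ` ?P" by blast
    qed
  qed (auto intro: permutes_inv)
  finally show ?thesis by (simp add: leibniz_det_alt[OF A])
qed

lemma leibniz_det_permute_rows:
  assumes A: "is_mat n A" and q: "q permutes {..<n}"
  shows "leibniz_det R n (\<lambda>i. A (q i)) = perm_sign q \<otimes> leibniz_det R n A"
proof -
  let ?P = "{p. p permutes {..<n}}"
  have A': "is_mat n (\<lambda>i. A (q i))" using A permutes_less[OF q] by (simp add: is_mat_def)
  have dp: "diag_prod n (\<lambda>i. A (q i)) (p \<circ> q) = diag_prod n A p" if p: "p permutes {..<n}" for p
    unfolding diag_prod_def o_def
    by (rule finprod_permute[OF q]) (use A permutes_less[OF p] in "auto simp: is_mat_def")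
  have img: "(\<lambda>p. p \<circ> q) ` ?P = ?P"
  proof
    show "?P \<subseteq> (\<lambda>p. p \<circ> q) ` ?P"
    proof
      fix p assume "p \<in> ?P"
      hence "p = (p \<circ> inv_into UNIV q) \<circ> q" "p \<circ> inv_into UNIV q \<in> ?P"
        using q by (auto simp: o_assoc[symmetric] permutes_inv_o permutes_compose permutes_inv)
      thus "p \<in> (\<lambda>p. p \<circ> q) ` ?P" by blast
    qed
  qed (use q in "auto intro: permutes_compose")
  have inj: "inj_on (\<lambda>p. p \<circ> q) ?P"
    by (rule inj_onI) (metis (no_types, lifting) comp_id o_assoc permutes_inv_o(1) q)
  have "leibniz_det R n (\<lambda>i. A (q i)) = (\<Oplus>p\<in>?P. perm_sign p \<otimes> diag_prod n (\<lambda>i. A (q i)) p)"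
    by (rule leibniz_det_alt[OF A'])
  also have "\<dots> = (\<Oplus>p\<in>(\<lambda>p. p \<circ> q) ` ?P. perm_sign p \<otimes> diag_prod n (\<lambda>i. A (q i)) p)"
    by (simp only: img)
  also have "\<dots> = (\<Oplus>p\<in>?P. perm_sign (p \<circ> q) \<otimes> diag_prod n (\<lambda>i. A (q i)) (p \<circ> q))"
    by (rule finsum_reindex) (use A' inj img in auto)
  also have "\<dots> = (\<Oplus>p\<in>?P. perm_sign q \<otimes> (perm_sign p \<otimes> diag_prod n A p))"
    by (rule finsum_cong') (use A q in "auto simp: dp perm_sign_comp m_ac")
  also have "\<dots> = perm_sign q \<otimes> leibniz_det R n A"
    unfolding leibniz_det_alt[OF A] by (rule finsum_rdistr[symmetric]) (use A finite_perms in auto)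
  finally show ?thesis .
qed

text \<open>Expands the diagonal products of a matrix product. In the induction the choice functions
  on \<open>{..<Suc n}\<close> are fibred over their value at \<open>n\<close>.\<close>

lemma finprod_finsum_distrib:
  fixes n m :: nat
  assumes "\<And>i k. i < n ==> k < m ==> x i k \<in> carrier R"
  shows "(\<Otimes>i\<in>{..<n}. \<Oplus>k\<in>{..<m}. x i k) = (\<Oplus>f\<in>{..<n} \<rightarrow>\<^sub>E {..<m}. \<Otimes>i\<in>{..<n}. x i (f i))"
  using assms
proof (induction n)
  case 0
  show ?case by simp
next
  case (Suc n)
  let ?E = "\<lambda>n::nat. {..<n} \<rightarrow>\<^sub>E {..<m}"
  have fin: "finite (?E n)" for n by (auto intro: finite_PiE)
  have xc: "(\<Otimes>i\<in>{..<l}. x i (f i)) \<in> carrier R" if "f \<in> {..<l} \<rightarrow> {..<m}" "l \<le> Suc n" for f l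
    by (rule finprod_closed) (use Suc.prems that in "auto simp: Pi_def")
  have xc': "(\<Otimes>i\<in>{..<l}. x i (f i)) \<in> carrier R" if "f \<in> ?E l" "l \<le> Suc n" for f l
    using xc that by (auto simp: PiE_def)
  have fib: "(\<Oplus>f\<in>{f\<in>?E (Suc n). f n = k}. \<Otimes>i\<in>{..<Suc n}. x i (f i))
      = x n k \<otimes> (\<Oplus>f\<in>?E n. \<Otimes>i\<in>{..<n}. x i (f i))" if k: "k < m" for k
  proof -
    have eq: "{f\<in>?E (Suc n). f n = k} = (\<lambda>f. f(n := k)) ` ?E n" (is "?X = ?Y")
    proof
      show "?X \<subseteq> ?Y"
      proof
        fix f assume f: "f \<in> ?X"
        have "f = (restrict f {..<n})(n := k)"
          using f by (auto simp: fun_eq_iff PiE_def extensional_def restrict_def)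
        moreover have "restrict f {..<n} \<in> ?E n" using f by (auto simp: PiE_def)
        ultimately show "f \<in> ?Y" by blast
      qed
    qed (use k in "auto simp: PiE_def extensional_def Pi_def")
    have inj: "inj_on (\<lambda>f. f(n := k)) (?E n)"
    proof (rule inj_onI)
      fix f g assume fg: "f \<in> ?E n" "g \<in> ?E n" "f(n := k) = g(n := k)"
      show "f = g"
      proof
        fix i show "f i = g i"
          using fun_cong[OF fg(3), of i] fg(1,2) by (cases "i = n") (auto simp: PiE_def extensional_def)
      qed
    qed
    have "(\<Oplus>f\<in>?X. \<Otimes>i\<in>{..<Suc n}. x i (f i))
        = (\<Oplus>f\<in>?E n. \<Otimes>i\<in>{..<Suc n}. x i ((f(n := k)) i))"
      unfolding eq
    proof (rule finsum_reindex[OF _ inj], rule funcsetI)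
      fix f assume "f \<in> (\<lambda>f. f(n := k)) ` ?E n"
      hence "f \<in> ?E (Suc n)" using eq by blast
      thus "(\<Otimes>i\<in>{..<Suc n}. x i (f i)) \<in> carrier R" by (rule xc') simp
    qed
    also have "\<dots> = (\<Oplus>f\<in>?E n. x n k \<otimes> (\<Otimes>i\<in>{..<n}. x i (f i)))"
    proof (rule finsum_cong', simp, rule funcsetI)
      fix f assume "f \<in> ?E n"
      thus "x n k \<otimes> (\<Otimes>i\<in>{..<n}. x i (f i)) \<in> carrier R"
        using xc'[of f n] Suc.prems k by simp
    next
      fix f assume f: "f \<in> ?E n"
      have "(\<Otimes>i\<in>{..<Suc n}. x i ((f(n := k)) i))
          = x n k \<otimes> (\<Otimes>i\<in>{..<n}. x i ((f(n := k)) i))"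
        unfolding lessThan_Suc using f k Suc.prems by (subst finprod_insert) (auto simp: PiE_def Pi_def)
      also have "(\<Otimes>i\<in>{..<n}. x i ((f(n := k)) i)) = (\<Otimes>i\<in>{..<n}. x i (f i))"
        using f Suc.prems by (intro finprod_cong') (auto simp: PiE_def Pi_def)
      finally show "(\<Otimes>i\<in>{..<Suc n}. x i ((f(n := k)) i)) = x n k \<otimes> (\<Otimes>i\<in>{..<n}. x i (f i))" .
    qed
    also have "\<dots> = x n k \<otimes> (\<Oplus>f\<in>?E n. \<Otimes>i\<in>{..<n}. x i (f i))"
      by (rule finsum_rdistr[symmetric]) (use fin Suc.prems k xc' in auto)
    finally show ?thesis .
  qed
  have cl: "(\<Oplus>f\<in>?E n. \<Otimes>i\<in>{..<n}. x i (f i)) \<in> carrier R"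
    by (rule finsum_closed) (use xc' in auto)
  have "(\<Oplus>f\<in>?E (Suc n). \<Otimes>i\<in>{..<Suc n}. x i (f i))
      = (\<Oplus>k\<in>{..<m}. \<Oplus>f\<in>{f\<in>?E (Suc n). f n = k}. \<Otimes>i\<in>{..<Suc n}. x i (f i))"
    by (rule add.finprod_fibres) (use fin xc' in "auto simp: PiE_def")
  also have "\<dots> = (\<Oplus>k\<in>{..<m}. x n k \<otimes> (\<Oplus>f\<in>?E n. \<Otimes>i\<in>{..<n}. x i (f i)))"
    by (rule finsum_cong') (use fib cl Suc.prems in auto)
  also have "\<dots> = (\<Oplus>k\<in>{..<m}. x n k) \<otimes> (\<Oplus>f\<in>?E n. \<Otimes>i\<in>{..<n}. x i (f i))"
    by (rule finsum_ldistr[symmetric]) (use cl Suc.prems in auto)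
  also have "\<dots> = (\<Oplus>k\<in>{..<m}. x n k) \<otimes> (\<Otimes>i\<in>{..<n}. \<Oplus>k\<in>{..<m}. x i k)"
    using Suc by simp
  also have "\<dots> = (\<Otimes>i\<in>{..<Suc n}. \<Oplus>k\<in>{..<m}. x i k)"
    unfolding lessThan_Suc using Suc.prems
    by (subst finprod_insert) (auto intro!: finsum_closed)
  finally show ?case by simp
qed

definition mat_prod :: "nat => (nat => nat => 'a) => (nat => nat => 'a) => nat => nat => 'a"
  where "mat_prod n A B i j = (\<Oplus>k\<in>{..<n}. A i k \<otimes> B k j)"

lemma is_mat_prod [simp]:
  "is_mat n A ==> is_mat n B ==> is_mat n (mat_prod n A B)"
  unfolding is_mat_def mat_prod_def by (auto intro!: finsum_closed)

text \<open>Only permutations fixing \<open>n\<close> contribute, and these are the permutations of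
  \<open>{..<n}\<close>.\<close>

lemma leibniz_det_last_row:
  assumes A: "is_mat (Suc n) A" and z: "\<And>j. j < n ==> A n j = \<zero>"
  shows "leibniz_det R (Suc n) A = A n n \<otimes> leibniz_det R n A"
proof -
  let ?P = "\<lambda>n::nat. {p. p permutes {..<n}}"
  have A': "is_mat n A" using A by (simp add: is_mat_def)
  have sub: "?P n \<subseteq> ?P (Suc n)" by (auto intro: permutes_subset)
  have "leibniz_det R (Suc n) A = (\<Oplus>p\<in>?P (Suc n). perm_sign p \<otimes> diag_prod (Suc n) A p)"
    by (rule leibniz_det_alt[OF A])
  also have "\<dots> = (\<Oplus>p\<in>?P n. perm_sign p \<otimes> diag_prod (Suc n) A p)"
  proof (rule add.finprod_mono_neutral_cong_left[symmetric, OF finite_perms sub])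
    fix p assume p: "p \<in> ?P (Suc n) - ?P n"
    hence ps: "p permutes {..<Suc n}" by simp
    have "p n \<noteq> n"
    proof
      assume e: "p n = n"
      hence "p permutes {..<n}"
        by (intro permutes_superset[OF ps]) (auto simp: less_Suc_eq)
      thus False using p by simp
    qed
    hence pn: "p n < n" using permutes_less[OF ps, of n] by simp
    have An: "A n (p n) \<in> carrier R" using is_matD[OF A, of n "p n"] pn by simp
    have "diag_prod (Suc n) A p = A n (p n) \<otimes> (\<Otimes>i\<in>{..<n}. A i (p i))"
      unfolding diag_prod_def lessThan_Suc
      by (rule finprod_insert) (use A An permutes_less[OF ps] in "auto simp: is_mat_def less_Suc_eq Pi_def")
    moreover have "(\<Otimes>i\<in>{..<n}. A i (p i)) \<in> carrier R"
      by (rule finprod_closed) (use A permutes_less[OF ps] in "auto simp: is_mat_def Pi_def")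
    ultimately show "perm_sign p \<otimes> diag_prod (Suc n) A p = \<zero>" using z[OF pn] by simp
  qed (use A in auto)
  also have "\<dots> = (\<Oplus>p\<in>?P n. A n n \<otimes> (perm_sign p \<otimes> diag_prod n A p))"
  proof (rule finsum_cong')
    fix p assume "p \<in> ?P n"
    hence p: "p permutes {..<n}" by simp
    hence pn: "p n = n" by (simp add: permutes_not_in)
    have "diag_prod (Suc n) A p = A n (p n) \<otimes> (\<Otimes>i\<in>{..<n}. A i (p i))"
      unfolding diag_prod_def lessThan_Suc
      by (rule finprod_insert) (use A pn permutes_less[OF p] in "auto simp: is_mat_def less_Suc_eq Pi_def")
    hence "diag_prod (Suc n) A p = A n n \<otimes> diag_prod n A p" by (simp add: pn diag_prod_def)
    thus "perm_sign p \<otimes> diag_prod (Suc n) A p = A n n \<otimes> (perm_sign p \<otimes> diag_prod n A p)"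
      using is_matD[OF A, of n n] A' p by (simp add: m_ac)
  qed (use A A' in \<open>auto simp: is_mat_def[of "Suc n"]\<close>)
  also have "\<dots> = A n n \<otimes> leibniz_det R n A"
    unfolding leibniz_det_alt[OF A']
    by (rule finsum_rdistr[symmetric]) (use A A' finite_perms in \<open>auto simp: is_mat_def[of "Suc n"]\<close>)
  finally show ?thesis .
qed

text \<open>A permutation other than the identity moves an index different from \<open>j\<close>,
  and the row of that index is a row of the unit matrix. The matrix describes the replacement of one
  vector in a tuple.\<close>

lemma leibniz_det_one_row:
  assumes a: "\<And>i. i < n ==> a i \<in> carrier R" and j: "j < n"
  shows "leibniz_det R n (\<lambda>i k. if i = j then a k else if i = k then \<one> else \<zero>) = a j" (is "leibniz_det R n ?A = _")
proof -
  have A: "is_mat n ?A" using a by (simp add: is_mat_def)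
  have z: "perm_sign p \<otimes> diag_prod n ?A p = \<zero>" if p: "p permutes {..<n}" and "p \<noteq> id" for p
  proof -
    have "\<exists>i<n. i \<noteq> j \<and> p i \<noteq> i"
    proof (rule ccontr)
      assume "\<not> ?thesis"
      hence h: "p i = i" if "i \<noteq> j" for i using that p by (cases "i < n") (auto simp: permutes_not_in)
      have "p j = j" by (metis h p permutes_inverses(1))
      with h have "p i = i" for i by (cases "i = j") auto
      hence "p = id" by auto
      with that show False by simp
    qed
    then obtain i where i: "i < n" "i \<noteq> j" "p i \<noteq> i" by blast
    have "diag_prod n ?A p = ?A i (p i) \<otimes> (\<Otimes>k\<in>{..<n} - {i}. ?A k (p k))"
    proof -
      have "diag_prod n ?A p = (\<Otimes>k\<in>insert i ({..<n} - {i}). ?A k (p k))"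
        unfolding diag_prod_def using i(1) by (simp add: insert_absorb)
      also have "\<dots> = ?A i (p i) \<otimes> (\<Otimes>k\<in>{..<n} - {i}. ?A k (p k))"
        by (rule finprod_insert) (use A permutes_less[OF p] i in "auto simp: is_mat_def")
      finally show ?thesis .
    qed
    moreover have "(\<Otimes>k\<in>{..<n} - {i}. ?A k (p k)) \<in> carrier R"
      by (rule finprod_closed) (use A permutes_less[OF p] a in "auto simp: is_mat_def")
    ultimately show ?thesis using i by simp
  qed
  have "leibniz_det R n ?A = perm_sign id \<otimes> diag_prod n ?A id"
    unfolding leibniz_det_alt[OF A]
    by (rule finsum_single[OF finite_perms])
      (use A z permutes_id in "auto intro!: m_closed diag_prod_closed_perm simp del: id_apply")
  also have "\<dots> = diag_prod n ?A id"
    using diag_prod_closed_perm[OF A permutes_id] by (simp add: perm_sign_def)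
  also have "\<dots> = ?A j (id j)"
    unfolding diag_prod_def by (rule finprod_single) (use a j in auto)
  finally show ?thesis by simp
qed

lemma leibniz_det_one: "leibniz_det R n (\<lambda>i k. if i = k then \<one> else \<zero>) = \<one>"
proof (cases n)
  case 0
  thus ?thesis by (simp add: leibniz_det_def)
next
  case (Suc m)
  have "leibniz_det R n (\<lambda>i k. if i = k then \<one> else \<zero>)
      = leibniz_det R n (\<lambda>i k. if i = 0 then (if k = 0 then \<one> else \<zero>) else if i = k then \<one> else \<zero>)"
    by (rule leibniz_det_cong) (auto simp: is_mat_def)
  also have "\<dots> = (if (0::nat) = 0 then \<one> else \<zero>)"
    by (rule leibniz_det_one_row) (use Suc in auto)
  finally show ?thesis by simp
qed

end

text \<open>Over a domain of characteristic not 2, a determinant with two equal rows equals its negative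
  and hence vanishes.\<close>

locale domain_not2 = domain R for R (structure) +
  assumes two_nonzero: "\<one> \<oplus> \<one> \<noteq> \<zero>"
begin

lemma double_eq_zero: "x \<in> carrier R ==> x \<oplus> x = \<zero> ==> x = \<zero>"
proof -
  assume x: "x \<in> carrier R" "x \<oplus> x = \<zero>"
  hence "(\<one> \<oplus> \<one>) \<otimes> x = \<zero>" by (simp add: l_distr)
  thus "x = \<zero>" using integral[of "\<one> \<oplus> \<one>" x] two_nonzero x(1) by auto
qed

lemma leibniz_det_equal_rows:
  assumes A: "is_mat n A" and rs: "r < n" "s < n" "r \<noteq> s" and e: "A r = A s"
  shows "leibniz_det R n A = \<zero>"
proof -
  let ?t = "Transposition.transpose r s"
  have t: "?t permutes {..<n}" using rs by (auto intro!: permutes_swap_id)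
  have "(\<lambda>i. A (?t i)) = A" using e by (auto simp: fun_eq_iff Transposition.transpose_def)
  hence e: "perm_sign ?t \<otimes> leibniz_det R n A = leibniz_det R n A"
    using leibniz_det_permute_rows[OF A t] by simp
  have "perm_sign ?t = \<ominus> \<one>" using rs by (simp add: perm_sign_def evenperm_swap)
  hence "perm_sign ?t \<otimes> leibniz_det R n A = \<ominus> leibniz_det R n A" using A by (simp add: l_minus)
  hence "leibniz_det R n A \<oplus> leibniz_det R n A = \<zero>"
    using A e by (metis leibniz_det_closed r_neg)
  thus ?thesis by (rule double_eq_zero[OF leibniz_det_closed[OF A]])
qed

text \<open>A function \<open>f\<close> chooses one entry of \<open>A\<close> in each row and leaves
  the determinant of the matrix whose rows are the rows \<open>f i\<close> of \<open>B\<close>. A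
  repeated row gives zero, so only permutations survive.\<close>

lemma leibniz_det_mult:
  assumes A: "is_mat n A" and B: "is_mat n B"
  shows "leibniz_det R n (mat_prod n A B) = leibniz_det R n A \<otimes> leibniz_det R n B"
proof -
  let ?P = "{p. p permutes {..<n}}" and ?E = "{..<n} \<rightarrow>\<^sub>E {..<n}"
  have finE: "finite ?E" by (auto intro: finite_PiE)
  let ?B = "\<lambda>f i. B (f i)"
  have Bf: "is_mat n (?B f)" if "f \<in> ?E" for f using that B by (auto simp: is_mat_def PiE_def Pi_def)
  have dA: "diag_prod n A f \<in> carrier R" if "f \<in> ?E" for f
    using that A by (auto intro!: diag_prod_closed)
  have dp: "diag_prod n (mat_prod n A B) p
      = (\<Oplus>f\<in>?E. diag_prod n A f \<otimes> diag_prod n (?B f) p)" if p: "p permutes {..<n}" for p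
  proof -
    have "diag_prod n (mat_prod n A B) p = (\<Oplus>f\<in>?E. \<Otimes>i\<in>{..<n}. A i (f i) \<otimes> B (f i) (p i))"
      unfolding diag_prod_def mat_prod_def
      by (rule finprod_finsum_distrib) (use A B permutes_less[OF p] in "auto simp: is_mat_def")
    also have "\<dots> = (\<Oplus>f\<in>?E. diag_prod n A f \<otimes> diag_prod n (?B f) p)"
    proof (rule finsum_cong')
      fix f assume f: "f \<in> ?E"
      show "(\<Otimes>i\<in>{..<n}. A i (f i) \<otimes> B (f i) (p i)) = diag_prod n A f \<otimes> diag_prod n (?B f) p"
        unfolding diag_prod_def
        by (rule finprod_multf) (use A B f permutes_less[OF p] in "auto simp: is_mat_def PiE_def Pi_def")
    qed (use p dA Bf in auto)
    finally show ?thesis .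
  qed
  have "leibniz_det R n (mat_prod n A B)
      = (\<Oplus>p\<in>?P. perm_sign p \<otimes> (\<Oplus>f\<in>?E. diag_prod n A f \<otimes> diag_prod n (?B f) p))"
    unfolding leibniz_det_alt[OF is_mat_prod[OF A B]]
    by (rule finsum_cong') (use dp A B dA Bf in "auto intro!: finsum_closed")
  also have "\<dots> = (\<Oplus>p\<in>?P. \<Oplus>f\<in>?E. perm_sign p \<otimes> (diag_prod n A f \<otimes> diag_prod n (?B f) p))"
    by (rule finsum_cong') (use finE dA Bf in "auto intro!: finsum_closed finsum_rdistr")
  also have "\<dots> = (\<Oplus>f\<in>?E. \<Oplus>p\<in>?P. perm_sign p \<otimes> (diag_prod n A f \<otimes> diag_prod n (?B f) p))"
    by (rule finsum_swap) (use finE finite_perms dA Bf in auto)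
  also have "\<dots> = (\<Oplus>f\<in>?E. diag_prod n A f \<otimes> leibniz_det R n (?B f))"
  proof (rule finsum_cong')
    fix f assume f: "f \<in> ?E"
    have "(\<Oplus>p\<in>?P. perm_sign p \<otimes> (diag_prod n A f \<otimes> diag_prod n (?B f) p))
        = (\<Oplus>p\<in>?P. diag_prod n A f \<otimes> (perm_sign p \<otimes> diag_prod n (?B f) p))"
      by (rule finsum_cong') (use dA[OF f] Bf[OF f] in "auto simp: m_lcomm")
    also have "\<dots> = diag_prod n A f \<otimes> leibniz_det R n (?B f)"
      unfolding leibniz_det_alt[OF Bf[OF f]]
      by (rule finsum_rdistr[symmetric]) (use dA[OF f] Bf[OF f] finite_perms in auto)
    finally show "(\<Oplus>p\<in>?P. perm_sign p \<otimes> (diag_prod n A f \<otimes> diag_prod n (?B f) p))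
        = diag_prod n A f \<otimes> leibniz_det R n (?B f)" .
  qed (use dA Bf in auto)
  \<comment> \<open>The choice functions are extensional, whereas permutations act on all naturals;
    permutations therefore enter through their restrictions to \<open>{..<n}\<close>.\<close>
  also have "\<dots> = (\<Oplus>f\<in>(\<lambda>p. restrict p {..<n}) ` ?P. diag_prod n A f \<otimes> leibniz_det R n (?B f))"
  proof (rule add.finprod_mono_neutral_cong_left[symmetric, OF finE])
    show "(\<lambda>p. restrict p {..<n}) ` ?P \<subseteq> ?E"
      using permutes_less by (auto split: if_splits)
    fix f assume f: "f \<in> ?E - (\<lambda>p. restrict p {..<n}) ` ?P"
    have "\<not> inj_on f {..<n}"
    proof
      assume i: "inj_on f {..<n}"
      have "f ` {..<n} = {..<n}" using f i by (intro endo_inj_surj) auto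
      hence "bij_betw f {..<n} {..<n}" using i by (simp add: bij_betw_def)
      hence "(\<lambda>i. if i \<in> {..<n} then f i else i) permutes {..<n}"
        by (intro bij_imp_permutes) (subst bij_betw_cong[of _ _ f], auto)
      moreover have "f = restrict (\<lambda>i. if i \<in> {..<n} then f i else i) {..<n}"
        using f by (auto simp: fun_eq_iff PiE_def extensional_def)
      ultimately show False using f by blast
    qed
    then obtain r s where rs: "r < n" "s < n" "r \<noteq> s" "f r = f s" by (auto simp: inj_on_def)
    have "leibniz_det R n (?B f) = \<zero>"
      by (rule leibniz_det_equal_rows[OF Bf rs(1-3)]) (use f rs in auto)
    thus "diag_prod n A f \<otimes> leibniz_det R n (?B f) = \<zero>" using dA f by simp
  qed (use dA Bf in auto)
  also have "\<dots> = (\<Oplus>p\<in>?P. diag_prod n A (restrict p {..<n}) \<otimes> leibniz_det R n (?B (restrict p {..<n})))"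
  proof (rule finsum_reindex)
    show "inj_on (\<lambda>p. restrict p {..<n}) ?P"
    proof (rule inj_onI)
      fix p q assume pq: "p \<in> ?P" "q \<in> ?P" "restrict p {..<n} = restrict q {..<n}"
      show "p = q"
      proof
        fix i show "p i = q i"
          using fun_cong[OF pq(3), of i] pq(1,2) by (cases "i < n") (auto simp: permutes_not_in)
      qed
    qed
    show "(\<lambda>f. diag_prod n A f \<otimes> leibniz_det R n (?B f)) \<in> (\<lambda>p. restrict p {..<n}) ` ?P \<rightarrow> carrier R"
    proof (rule funcsetI)
      fix f assume "f \<in> (\<lambda>p. restrict p {..<n}) ` ?P"
      hence "f \<in> ?E" using permutes_less by (auto split: if_splits)
      thus "diag_prod n A f \<otimes> leibniz_det R n (?B f) \<in> carrier R" using dA Bf by simp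
    qed
  qed
  also have "\<dots> = (\<Oplus>p\<in>?P. (perm_sign p \<otimes> diag_prod n A p) \<otimes> leibniz_det R n B)"
  proof (rule finsum_cong')
    fix p assume "p \<in> ?P"
    hence p: "p permutes {..<n}" by simp
    have 1: "diag_prod n A (restrict p {..<n}) = diag_prod n A p"
      unfolding diag_prod_def
      by (rule finprod_cong') (use A permutes_less[OF p] in "auto simp: is_mat_def")
    have 2: "leibniz_det R n (?B (restrict p {..<n})) = leibniz_det R n (?B p)"
      by (rule leibniz_det_cong) (use B permutes_less[OF p] in "auto simp: is_mat_def")
    show "diag_prod n A (restrict p {..<n}) \<otimes> leibniz_det R n (?B (restrict p {..<n}))
        = (perm_sign p \<otimes> diag_prod n A p) \<otimes> leibniz_det R n B"
      unfolding 1 2 leibniz_det_permute_rows[OF B p] using A B p by (simp add: m_ac)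
  qed (use A B in auto)
  also have "\<dots> = leibniz_det R n A \<otimes> leibniz_det R n B"
    unfolding leibniz_det_alt[OF A]
    by (rule finsum_ldistr[symmetric]) (use A B finite_perms in auto)
  finally show ?thesis .
qed

end

section \<open>Submodules over a subring and tuples of vectors\<close>

text \<open>Conditions on a subset of the carrier, so that the ring of integers, the valuation rings
  and the whole field are all covered; the last case turns statements on lattices into statements on
  vector spaces.\<close>

definition is_subring :: "('k, 'm) ring_scheme => 'k set => bool"
  where "is_subring K R \<longleftrightarrow> R \<subseteq> carrier K \<and> \<zero>\<^bsub>K\<^esub> \<in> R \<and> \<one>\<^bsub>K\<^esub> \<in> R \<and>
    (\<forall>x\<in>R. \<forall>y\<in>R. x \<oplus>\<^bsub>K\<^esub> y \<in> R \<and> x \<otimes>\<^bsub>K\<^esub> y \<in> R) \<and> (\<forall>x\<in>R. \<ominus>\<^bsub>K\<^esub> x \<in> R)"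

text \<open>Here \<open>R\<close> is just a set of scalars, which makes restriction of scalars
  immediate (\<open>rsub_mono\<close>).\<close>

definition rsub :: "'k set => ('k, 'v) module => 'v set => bool"
  where "rsub R V N \<longleftrightarrow> N \<subseteq> carrier V \<and> \<zero>\<^bsub>V\<^esub> \<in> N \<and>
    (\<forall>x\<in>N. \<forall>y\<in>N. x \<oplus>\<^bsub>V\<^esub> y \<in> N) \<and> (\<forall>r\<in>R. \<forall>x\<in>N. r \<odot>\<^bsub>V\<^esub> x \<in> N)"

lemma is_subringD:
  assumes "is_subring K R"
  shows "R \<subseteq> carrier K" "\<zero>\<^bsub>K\<^esub> \<in> R" "\<one>\<^bsub>K\<^esub> \<in> R"
    "x \<in> R ==> y \<in> R ==> x \<oplus>\<^bsub>K\<^esub> y \<in> R" "x \<in> R ==> y \<in> R ==> x \<otimes>\<^bsub>K\<^esub> y \<in> R"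
    "x \<in> R ==> \<ominus>\<^bsub>K\<^esub> x \<in> R"
  using assms by (auto simp: is_subring_def)

lemma rsubD:
  assumes "rsub R V N"
  shows "N \<subseteq> carrier V" "\<zero>\<^bsub>V\<^esub> \<in> N" "x \<in> N ==> y \<in> N ==> x \<oplus>\<^bsub>V\<^esub> y \<in> N"
    "r \<in> R ==> x \<in> N ==> r \<odot>\<^bsub>V\<^esub> x \<in> N"
  using assms by (auto simp: rsub_def)

lemma rsub_mono: "rsub R V N ==> R' \<subseteq> R ==> rsub R' V N"
  by (auto simp: rsub_def)

text \<open>Combinations of indexed tuples instead of sets: determinants depend on the order of the
  vectors, and a tuple may repeat a vector.\<close>

definition lc :: "('k, 'v) module => nat => (nat => 'k) => (nat => 'v) => 'v"
  where "lc V n a b = (\<Oplus>\<^bsub>V\<^esub>i\<in>{..<n}. a i \<odot>\<^bsub>V\<^esub> b i)"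

definition lspan :: "'k set => ('k, 'v) module => nat => (nat => 'v) => 'v set"
  where "lspan R V n b = {lc V n a b | a. a \<in> {..<n} \<rightarrow> R}"

definition btuple :: "'k ring => ('k, 'v) module => nat => (nat => 'v) => bool"
  where "btuple K V n b \<longleftrightarrow> b \<in> {..<n} \<rightarrow> carrier V \<and> carrier V \<subseteq> lspan (carrier K) V n b \<and>
    (\<forall>a\<in>{..<n} \<rightarrow> carrier K. lc V n a b = \<zero>\<^bsub>V\<^esub> --> (\<forall>i<n. a i = \<zero>\<^bsub>K\<^esub>))"

text \<open>Only the values below \<open>n\<close> are determined by the choice; equalities of
  coordinates are therefore stated with a bound on the index.\<close>

definition tcoord :: "'k ring => ('k, 'v) module => nat => (nat => 'v) => 'v => nat => 'k"
  where "tcoord K V n b x = (SOME a. a \<in> {..<n} \<rightarrow> carrier K \<and> x = lc V n a b)"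

text \<open>The volume form on \<open>V\<close> normalised to take the value one at
  \<open>e\<close>. Lattices are compared through the order of its values.\<close>

definition tdet :: "'k ring => ('k, 'v) module => nat => (nat => 'v) => (nat => 'v) => 'k"
  where "tdet K V n e b = leibniz_det K n (\<lambda>i. tcoord K V n e (b i))"

locale vspace = vectorspace K V for K :: "'k ring" (structure) and V :: "('k, 'v) module"
begin

abbreviation smult_V (infixl "*\<^sub>V" 70) where "a *\<^sub>V x \<equiv> a \<odot>\<^bsub>V\<^esub> x"
abbreviation add_V (infixl "+\<^sub>V" 65) where "x +\<^sub>V y \<equiv> x \<oplus>\<^bsub>V\<^esub> y"
abbreviation zero_V ("0\<^sub>V") where "0\<^sub>V \<equiv> \<zero>\<^bsub>V\<^esub>"
abbreviation ktup where "ktup n \<equiv> {..<n::nat} \<rightarrow> carrier K"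
abbreviation vtup where "vtup n \<equiv> {..<n::nat} \<rightarrow> carrier V"

lemma lc_closed [simp]:
  "a \<in> ktup n ==> b \<in> vtup n ==> lc V n a b \<in> carrier V"
  unfolding lc_def by (rule M.finsum_closed) auto

lemma lc_cong:
  assumes "\<And>i. i < n ==> a i = a' i" "\<And>i. i < n ==> b i = b' i"
    "a' \<in> ktup n" "b' \<in> vtup n"
  shows "lc V n a b = lc V n a' b'"
  unfolding lc_def by (rule M.finsum_cong') (use assms in auto)

lemma lc_add:
  assumes "a \<in> ktup n" "a' \<in> ktup n" "b \<in> vtup n"
  shows "lc V n (\<lambda>i. a i \<oplus> a' i) b = lc V n a b +\<^sub>V lc V n a' b"
proof -
  have "lc V n (\<lambda>i. a i \<oplus> a' i) b = (\<Oplus>\<^bsub>V\<^esub>i\<in>{..<n}. a i *\<^sub>V b i +\<^sub>V a' i *\<^sub>V b i)"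
    unfolding lc_def by (rule M.finsum_cong') (use assms in "auto simp: Pi_def smult_l_distr")
  also have "\<dots> = lc V n a b +\<^sub>V lc V n a' b"
    unfolding lc_def by (rule M.finsum_addf) (use assms in auto)
  finally show ?thesis .
qed

lemma lc_smult:
  assumes "a \<in> ktup n" "b \<in> vtup n" "r \<in> carrier K"
  shows "lc V n (\<lambda>i. r \<otimes> a i) b = r *\<^sub>V lc V n a b"
proof -
  have "lc V n (\<lambda>i. r \<otimes> a i) b = (\<Oplus>\<^bsub>V\<^esub>i\<in>{..<n}. r *\<^sub>V (a i *\<^sub>V b i))"
    unfolding lc_def by (rule M.finsum_cong') (use assms in "auto simp: Pi_def smult_assoc1")
  also have "\<dots> = r *\<^sub>V lc V n a b"
    unfolding lc_def by (rule finsum_smult[symmetric]) (use assms in auto)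
  finally show ?thesis .
qed

lemma lc_zero:
  assumes "\<And>i. i < n ==> a i = \<zero>" "b \<in> vtup n"
  shows "lc V n a b = 0\<^sub>V"
  unfolding lc_def by (rule M.add.finprod_one_eqI) (use assms in "auto simp: Pi_def")

lemma lc_single:
  assumes "j < n" "b \<in> vtup n"
  shows "lc V n (\<lambda>i. if i = j then \<one> else \<zero>) b = b j"
proof -
  have "lc V n (\<lambda>i. if i = j then \<one> else \<zero>) b = (if j = j then \<one> else \<zero>) *\<^sub>V b j"
    unfolding lc_def by (rule M.finsum_single) (use assms in "auto simp: Pi_def")
  thus ?thesis using assms by (auto simp: Pi_def)
qed

lemma lc_Suc:
  assumes "a \<in> ktup (Suc n)" "b \<in> vtup (Suc n)"
  shows "lc V (Suc n) a b = a n *\<^sub>V b n +\<^sub>V lc V n a b"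
  unfolding lc_def lessThan_Suc by (rule M.finsum_insert) (use assms in "auto simp: Pi_def")

lemma lc_lc:
  assumes "a \<in> ktup m" "c \<in> vtup n"
    "\<And>i j. i < m ==> j < n ==> A i j \<in> carrier K"
  shows "lc V m a (\<lambda>i. lc V n (A i) c) = lc V n (\<lambda>j. \<Oplus>i\<in>{..<m}. a i \<otimes> A i j) c"
proof -
  have "lc V m a (\<lambda>i. lc V n (A i) c) = (\<Oplus>\<^bsub>V\<^esub>i\<in>{..<m}. \<Oplus>\<^bsub>V\<^esub>j\<in>{..<n}. (a i \<otimes> A i j) *\<^sub>V c j)"
    unfolding lc_def
  proof (rule M.finsum_cong')
    fix i assume i: "i \<in> {..<m}"
    have "a i *\<^sub>V (\<Oplus>\<^bsub>V\<^esub>j\<in>{..<n}. A i j *\<^sub>V c j) = (\<Oplus>\<^bsub>V\<^esub>j\<in>{..<n}. a i *\<^sub>V (A i j *\<^sub>V c j))"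
      by (rule finsum_smult) (use assms i in auto)
    also have "\<dots> = (\<Oplus>\<^bsub>V\<^esub>j\<in>{..<n}. (a i \<otimes> A i j) *\<^sub>V c j)"
      by (rule M.finsum_cong') (use assms i in "auto simp: Pi_def smult_assoc1")
    finally show "a i *\<^sub>V (\<Oplus>\<^bsub>V\<^esub>j\<in>{..<n}. A i j *\<^sub>V c j) = (\<Oplus>\<^bsub>V\<^esub>j\<in>{..<n}. (a i \<otimes> A i j) *\<^sub>V c j)" .
  qed (use assms in "auto intro!: M.finsum_closed simp: Pi_def")
  also have "\<dots> = (\<Oplus>\<^bsub>V\<^esub>j\<in>{..<n}. \<Oplus>\<^bsub>V\<^esub>i\<in>{..<m}. (a i \<otimes> A i j) *\<^sub>V c j)"
    by (rule M.finsum_swap) (use assms in "auto simp: Pi_def")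
  also have "\<dots> = lc V n (\<lambda>j. \<Oplus>i\<in>{..<m}. a i \<otimes> A i j) c"
    unfolding lc_def
  proof (rule M.finsum_cong')
    fix j assume j: "j \<in> {..<n}"
    show "(\<Oplus>\<^bsub>V\<^esub>i\<in>{..<m}. (a i \<otimes> A i j) *\<^sub>V c j) = (\<Oplus>i\<in>{..<m}. a i \<otimes> A i j) *\<^sub>V c j"
      by (rule finsum_additive[symmetric, OF R.abelian_monoid_axioms M.abelian_monoid_axioms,
            where f = "\<lambda>x. x *\<^sub>V c j"]) (use assms j in "auto simp: Pi_def smult_l_distr")
  qed (use assms in "auto intro!: M.finsum_closed R.finsum_closed simp: Pi_def")
  finally show ?thesis .
qed

lemma lc_rsub:
  assumes "is_subring K R" "rsub R V N" "a \<in> {..<n} \<rightarrow> R" "b \<in> {..<n} \<rightarrow> N"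
  shows "lc V n a b \<in> N"
  using assms(3,4)
proof (induction n)
  case 0
  thus ?case using rsubD(2)[OF assms(2)] by (simp add: lc_def)
next
  case (Suc n)
  have "lc V (Suc n) a b = a n *\<^sub>V b n +\<^sub>V lc V n a b"
    by (rule lc_Suc) (use Suc.prems is_subringD(1)[OF assms(1)] rsubD(1)[OF assms(2)] in "auto simp: Pi_def")
  moreover have "a n \<in> R" "b n \<in> N" "lc V n a b \<in> N" using Suc by (auto simp: Pi_def)
  ultimately show ?case using rsubD(3,4)[OF assms(2)] by simp
qed

lemma is_subring_carrier: "is_subring K (carrier K)"
  by (auto simp: is_subring_def)

lemma rsub_lspan:
  assumes R: "is_subring K R" and b: "b \<in> vtup n"
  shows "rsub R V (lspan R V n b)"
  unfolding rsub_def
proof (intro conjI ballI)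
  have sub: "a \<in> ktup n" if "a \<in> {..<n} \<rightarrow> R" for a
    using that is_subringD(1)[OF R] by auto
  show "lspan R V n b \<subseteq> carrier V" using sub b by (auto simp: lspan_def)
  show "0\<^sub>V \<in> lspan R V n b"
  proof -
    have "0\<^sub>V = lc V n (\<lambda>_. \<zero>) b" using lc_zero[of n "\<lambda>_. \<zero>" b] b by simp
    moreover have "(\<lambda>_. \<zero>) \<in> {..<n} \<rightarrow> R" using is_subringD(2)[OF R] by auto
    ultimately show ?thesis unfolding lspan_def by blast
  qed
  show "x +\<^sub>V y \<in> lspan R V n b" if xy: "x \<in> lspan R V n b" "y \<in> lspan R V n b" for x y
  proof -
    obtain a c where *: "x = lc V n a b" "a \<in> {..<n} \<rightarrow> R" "y = lc V n c b" "c \<in> {..<n} \<rightarrow> R"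
      using xy by (auto simp: lspan_def)
    have "x +\<^sub>V y = lc V n (\<lambda>i. a i \<oplus> c i) b" using * lc_add sub b by simp
    moreover have "(\<lambda>i. a i \<oplus> c i) \<in> {..<n} \<rightarrow> R" using * is_subringD(4)[OF R] by (auto simp: Pi_def)
    ultimately show ?thesis unfolding lspan_def by blast
  qed
  show "r *\<^sub>V x \<in> lspan R V n b" if r: "r \<in> R" and x: "x \<in> lspan R V n b" for r x
  proof -
    obtain a where *: "x = lc V n a b" "a \<in> {..<n} \<rightarrow> R" using x by (auto simp: lspan_def)
    have "r *\<^sub>V x = lc V n (\<lambda>i. r \<otimes> a i) b"
      using * lc_smult[OF sub b] r is_subringD(1)[OF R] by auto
    moreover have "(\<lambda>i. r \<otimes> a i) \<in> {..<n} \<rightarrow> R" using * r is_subringD(5)[OF R] by (auto simp: Pi_def)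
    ultimately show ?thesis unfolding lspan_def by blast
  qed
qed

lemma lspan_gen:
  assumes "is_subring K R" "b \<in> vtup n" "i < n"
  shows "b i \<in> lspan R V n b"
proof -
  let ?a = "\<lambda>j. if j = i then \<one> else \<zero>"
  have "b i = lc V n ?a b" using lc_single[OF assms(3,2)] by simp
  moreover have "?a \<in> {..<n} \<rightarrow> R" using is_subringD(2,3)[OF assms(1)] by auto
  ultimately show ?thesis unfolding lspan_def by blast
qed

lemma lspan_least:
  assumes "is_subring K R" "rsub R V N" "b \<in> {..<n} \<rightarrow> N"
  shows "lspan R V n b \<subseteq> N"
  using lc_rsub[OF assms(1,2) _ assms(3)] by (auto simp: lspan_def)

lemma lspan_eqI:
  assumes R: "is_subring K R" and b: "b \<in> vtup n" and c: "c \<in> vtup m"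
    and "\<And>i. i < n ==> b i \<in> lspan R V m c" "\<And>i. i < m ==> c i \<in> lspan R V n b"
  shows "lspan R V n b = lspan R V m c"
  using lspan_least[OF R rsub_lspan[OF R b], of c m] lspan_least[OF R rsub_lspan[OF R c], of b n] assms
  by (auto simp: Pi_def)

lemma lspan_cong:
  assumes "is_subring K R" "\<And>i. i < n ==> b i = c i" "c \<in> vtup n"
  shows "lspan R V n b = lspan R V n c"
proof -
  have "lc V n a b = lc V n a c" if "a \<in> {..<n} \<rightarrow> R" for a
    by (rule lc_cong) (use assms that is_subringD(1)[OF assms(1)] in auto)
  thus ?thesis unfolding lspan_def by (metis (no_types, lifting))
qed

lemma subring_module:
  assumes "is_subring K R"
  shows "Module.module (K\<lparr>carrier := R\<rparr>) V"
proof -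
  note d = is_subringD[OF assms]
  have m: "x \<in> R ==> x \<in> carrier K" for x using d(1) by auto
  have "cring (K\<lparr>carrier := R\<rparr>)"
  proof (rule cringI)
    show "abelian_group (K\<lparr>carrier := R\<rparr>)"
    proof (rule abelian_groupI)
      fix x assume "x \<in> carrier (K\<lparr>carrier := R\<rparr>)"
      thus "\<exists>y\<in>carrier (K\<lparr>carrier := R\<rparr>). y \<oplus>\<^bsub>K\<lparr>carrier := R\<rparr>\<^esub> x = \<zero>\<^bsub>K\<lparr>carrier := R\<rparr>\<^esub>"
        using d(6)[of x] m[of x] by (auto intro!: bexI[of _ "\<ominus> x"] simp: R.l_neg)
    qed (use d m in "auto simp: R.a_ac")
    show "comm_monoid (K\<lparr>carrier := R\<rparr>)"
      by (rule comm_monoidI) (use d m in "auto simp: R.m_ac")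
  qed (use m in "auto simp: R.l_distr")
  thus ?thesis
    by (intro moduleI M.abelian_group_axioms) (auto simp: m smult_l_distr smult_r_distr smult_assoc1)
qed

text \<open>Together with \<open>rsub_rspan\<close> this is the universal property through which
  spans are used from here on.\<close>

lemma rspan_least:
  assumes R: "is_subring K R" and "S \<subseteq> N" and N: "rsub R V N"
  shows "rspan K R V S \<subseteq> N"
proof -
  interpret RM: Module.module "K\<lparr>carrier := R\<rparr>" V by (rule subring_module[OF R])
  have "submodule (K\<lparr>carrier := R\<rparr>) N V"
    using N RM.module_axioms by (auto simp: submodule_def rsub_def)
  thus ?thesis unfolding rspan_def using RM.span_is_subset[of S N] assms(2) by auto
qed

lemma rsub_rspan:
  assumes R: "is_subring K R" and S: "S \<subseteq> carrier V"
  shows "rsub R V (rspan K R V S)" and "S \<subseteq> rspan K R V S"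
proof -
  interpret RM: Module.module "K\<lparr>carrier := R\<rparr>" V by (rule subring_module[OF R])
  have "submodule (K\<lparr>carrier := R\<rparr>) (RM.span S) V" using RM.span_is_submodule S by blast
  thus "rsub R V (rspan K R V S)" unfolding rspan_def by (auto simp: submodule_def rsub_def)
  show "S \<subseteq> rspan K R V S" unfolding rspan_def using RM.in_own_span S by blast
qed

lemma rspan_lspan:
  assumes R: "is_subring K R" and b: "b \<in> vtup n"
  shows "rspan K R V (b ` {..<n}) = lspan R V n b"
proof
  show "rspan K R V (b ` {..<n}) \<subseteq> lspan R V n b"
    by (rule rspan_least[OF R _ rsub_lspan[OF R b]]) (use lspan_gen[OF R b] in auto)
  have "b ` {..<n} \<subseteq> carrier V" using b by auto
  from rsub_rspan[OF R this] show "lspan R V n b \<subseteq> rspan K R V (b ` {..<n})"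
    by (intro lspan_least[OF R]) auto
qed

lemma lincomb_image:
  assumes "inj_on b {..<n}" "b \<in> vtup n" "a \<in> b ` {..<n} \<rightarrow> carrier K"
  shows "lincomb a (b ` {..<n}) = lc V n (a \<circ> b) b"
  unfolding lincomb_def lc_def
  by (subst M.finsum_reindex) (use assms in "auto simp: Pi_def")

lemma span_lspan:
  assumes "b \<in> vtup n"
  shows "span (b ` {..<n}) = lspan (carrier K) V n b"
  using rspan_lspan[OF is_subring_carrier assms] by (simp add: rspan_def)

section \<open>Bases as tuples, coordinates and linear maps\<close>

lemma btupleD:
  assumes "btuple K V n b"
  shows "b \<in> vtup n" "lspan (carrier K) V n b = carrier V"
    "a \<in> ktup n ==> lc V n a b = 0\<^sub>V ==> i < n ==> a i = \<zero>"
proof -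
  show b: "b \<in> vtup n" using assms by (simp add: btuple_def)
  show "lspan (carrier K) V n b = carrier V"
    using assms rsubD(1)[OF rsub_lspan[OF is_subring_carrier b]] by (auto simp: btuple_def)
qed (use assms in "auto simp: btuple_def")

lemma lc_diff:
  assumes "a \<in> ktup n" "a' \<in> ktup n" "b \<in> vtup n"
    and "lc V n a b = lc V n a' b"
  shows "lc V n (\<lambda>i. a i \<ominus> a' i) b = 0\<^sub>V"
proof -
  have "lc V n (\<lambda>i. a i \<ominus> a' i) b = lc V n (\<lambda>i. a i \<oplus> (\<ominus> \<one>) \<otimes> a' i) b"
    by (rule lc_cong) (use assms in "auto simp: Pi_def R.minus_eq R.l_minus")
  also have "\<dots> = lc V n a b +\<^sub>V (\<ominus> \<one>) *\<^sub>V lc V n a' b"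
    using assms lc_add[of a n "\<lambda>i. (\<ominus> \<one>) \<otimes> a' i" b] lc_smult[of a' n b "\<ominus> \<one>"] by (auto simp: Pi_def)
  also have "\<dots> = 0\<^sub>V" using assms by (simp add: smult_minus_1 M.r_neg)
  finally show ?thesis .
qed

lemma tuple_independent_inj:
  assumes b: "b \<in> vtup n"
    and li: "\<And>a i. a \<in> ktup n ==> lc V n a b = 0\<^sub>V ==> i < n ==> a i = \<zero>"
  shows "inj_on b {..<n}" "lin_indpt (b ` {..<n})"
proof -
  show inj: "inj_on b {..<n}"
  proof (rule inj_onI, rule ccontr)
    fix i j assume ij: "i \<in> {..<n}" "j \<in> {..<n}" "b i = b j" "i \<noteq> j"
    let ?d = "\<lambda>j i. if i = j then \<one> else \<zero>"
    have "lc V n (\<lambda>k. ?d i k \<ominus> ?d j k) b = 0\<^sub>V"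
      by (rule lc_diff) (use b ij in "auto simp: lc_single")
    hence "?d i i \<ominus> ?d j i = \<zero>" using ij by (intro li[of "\<lambda>k. ?d i k \<ominus> ?d j k" i]) auto
    thus False using ij by simp
  qed
  show "lin_indpt (b ` {..<n})"
  proof (rule finite_lin_indpt2)
    fix a assume a: "a \<in> b ` {..<n} \<rightarrow> carrier K" "lincomb a (b ` {..<n}) = 0\<^sub>V"
    hence "lc V n (a \<circ> b) b = 0\<^sub>V" using lincomb_image[OF inj b a(1)] by simp
    hence "\<And>i. i < n ==> (a \<circ> b) i = \<zero>" using a(1) by (intro li[of "a \<circ> b"]) auto
    thus "\<forall>v\<in>b ` {..<n}. a v = \<zero>" by auto
  qed (use b in auto)
qed

lemma btuple_basis:
  assumes "btuple K V n b"
  shows "inj_on b {..<n}" "basis (b ` {..<n})" "fin_dim" "dim = n"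
proof -
  note d = btupleD[OF assms]
  show inj: "inj_on b {..<n}" using tuple_independent_inj(1)[OF d(1)] d(3) by blast
  have li: "lin_indpt (b ` {..<n})" using tuple_independent_inj(2)[OF d(1)] d(3) by blast
  have gs: "gen_set (b ` {..<n})" using span_lspan[OF d(1)] d(2) by simp
  show bas: "basis (b ` {..<n})" using li gs d(1) by (auto simp: basis_def)
  show "fin_dim" unfolding fin_dim_def using gs d(1) by (intro exI[of _ "b ` {..<n}"]) auto
  show "dim = n" using dim_basis[OF _ bas] card_image[OF inj] by simp
qed

lemma basis_btuple:
  assumes "basis (b ` {..<n})" "inj_on b {..<n}"
  shows "btuple K V n b"
proof -
  have b: "b \<in> vtup n" and li: "lin_indpt (b ` {..<n})" and gs: "gen_set (b ` {..<n})"
    using assms by (auto simp: basis_def)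
  have "a i = \<zero>" if a: "a \<in> ktup n" "lc V n a b = 0\<^sub>V" "i < n" for a i
  proof -
    let ?g = "the_inv_into {..<n} b"
    have g: "?g (b j) = j" if "j < n" for j using the_inv_into_f_f[OF assms(2)] that by simp
    have c: "a \<circ> ?g \<in> b ` {..<n} \<rightarrow> carrier K" using a(1) g by auto
    have "lincomb (a \<circ> ?g) (b ` {..<n}) = lc V n ((a \<circ> ?g) \<circ> b) b"
      by (rule lincomb_image[OF assms(2) b c])
    also have "\<dots> = lc V n a b" by (rule lc_cong) (use a g b in auto)
    finally have "lincomb (a \<circ> ?g) (b ` {..<n}) = 0\<^sub>V" using a by simp
    hence "(a \<circ> ?g) (b i) = \<zero>"
      using not_lindepD[OF li _ _ c] a(3) by auto
    thus ?thesis using g[OF a(3)] by simp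
  qed
  thus ?thesis unfolding btuple_def using b gs span_lspan[OF b] by auto
qed

lemma fin_dim_btuple:
  assumes fin_dim
  shows "\<exists>b. btuple K V dim b"
proof -
  obtain B where B: "finite B" "basis B" using finite_basis_exists[OF assms] by blast
  obtain b where b: "bij_betw b {..<card B} B"
    using ex_bij_betw_nat_finite[OF B(1)] by (auto simp: atLeast0LessThan)
  have "btuple K V (card B) b" by (rule basis_btuple) (use b B in "auto simp: bij_betw_def")
  thus ?thesis using dim_basis[OF B] by auto
qed

lemma independent_btuple:
  assumes fd: fin_dim and b: "b \<in> vtup dim"
    and li: "\<And>a i. a \<in> ktup dim ==> lc V dim a b = 0\<^sub>V ==> i < dim ==> a i = \<zero>"
  shows "btuple K V dim b"
proof (rule basis_btuple)
  show inj: "inj_on b {..<dim}" by (rule tuple_independent_inj(1)[OF b]) (rule li)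
  have "lin_indpt (b ` {..<dim})" by (rule tuple_independent_inj(2)[OF b]) (rule li)
  thus "basis (b ` {..<dim})"
    by (intro dim_li_is_basis[OF fd]) (use b card_image[OF inj] in auto)
qed

lemma spanning_btuple:
  assumes b: "b \<in> vtup n" and sp: "lspan (carrier K) V n b = carrier V" and "n = dim"
  shows "btuple K V n b"
proof (rule basis_btuple)
  have gs: "gen_set (b ` {..<n})" using span_lspan[OF b] sp by simp
  have "card (b ` {..<n}) \<ge> dim" by (rule gen_ge_dim) (use gs b in auto)
  hence "card (b ` {..<n}) = n" using assms(3) card_image_le[of "{..<n}" b] by simp
  thus "inj_on b {..<n}" by (intro eq_card_imp_inj_on) auto
  show "basis (b ` {..<n})"
    by (rule dim_gen_is_basis) (use gs b \<open>card (b ` {..<n}) = n\<close> assms(3) in auto)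
qed

lemma tcoord:
  assumes "btuple K V n b" "x \<in> carrier V"
  shows "tcoord K V n b x \<in> ktup n" "lc V n (tcoord K V n b x) b = x"
    "i < n ==> tcoord K V n b x i \<in> carrier K"
proof -
  have "\<exists>a. a \<in> ktup n \<and> x = lc V n a b"
    using btupleD(2)[OF assms(1)] assms(2) by (auto simp: lspan_def)
  from someI_ex[OF this] show "tcoord K V n b x \<in> ktup n"
      "lc V n (tcoord K V n b x) b = x"
    by (auto simp: tcoord_def)
  thus "i < n ==> tcoord K V n b x i \<in> carrier K" by auto
qed

lemma lc_inject:
  assumes "btuple K V n b" "a \<in> ktup n" "a' \<in> ktup n"
    "lc V n a b = lc V n a' b" "i < n"
  shows "a i = a' i"
proof -
  have "a i \<ominus> a' i = \<zero>"
    using btupleD(3)[OF assms(1) _ lc_diff[OF assms(2,3) btupleD(1)[OF assms(1)] assms(4)] assms(5)]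
      assms(2,3) by auto
  thus ?thesis using assms by (auto simp: Pi_def)
qed

lemma tcoord_lc:
  assumes "btuple K V n b" "a \<in> ktup n" "i < n"
  shows "tcoord K V n b (lc V n a b) i = a i"
  by (rule lc_inject[OF assms(1)])
    (use assms tcoord[OF assms(1)] btupleD(1)[OF assms(1)] in auto)

lemma tcoord_self:
  assumes "btuple K V n b" "i < n" "j < n"
  shows "tcoord K V n b (b i) j = (if i = j then \<one> else \<zero>)"
  using tcoord_lc[OF assms(1) _ assms(3), of "\<lambda>k. if k = i then \<one> else \<zero>"]
    lc_single[OF assms(2) btupleD(1)[OF assms(1)]] by auto

lemma is_mat_tcoord:
  assumes "btuple K V n e" "b \<in> vtup n"
  shows "R.is_mat n (\<lambda>i. tcoord K V n e (b i))"
  unfolding R.is_mat_def using tcoord(3)[OF assms(1)] assms(2) by auto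

lemma tdet_closed [simp]:
  assumes "btuple K V n e" "b \<in> vtup n"
  shows "tdet K V n e b \<in> carrier K"
  unfolding tdet_def using is_mat_tcoord[OF assms] by simp

lemma tdet_self: "btuple K V n e ==> tdet K V n e e = \<one>"
  unfolding tdet_def
  by (subst R.leibniz_det_cong[where B = "\<lambda>i k. if i = k then \<one> else \<zero>"])
    (auto simp: tcoord_self R.is_mat_def R.leibniz_det_one)

text \<open>Common form of \<open>\<phi>\<close> and \<open>bil\<close> with one argument fixed, and
  of the evaluation of functions at a basis vector in the localized space.\<close>

definition linfun :: "('v => 'k) => bool"
  where "linfun f \<longleftrightarrow> (\<forall>x\<in>carrier V. f x \<in> carrier K) \<and>
    (\<forall>x\<in>carrier V. \<forall>y\<in>carrier V. f (x +\<^sub>V y) = f x \<oplus> f y) \<and>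
    (\<forall>a\<in>carrier K. \<forall>x\<in>carrier V. f (a *\<^sub>V x) = a \<otimes> f x)"

lemma linfun_zero:
  assumes "linfun f"
  shows "f 0\<^sub>V = \<zero>"
proof -
  have "f (\<zero> *\<^sub>V 0\<^sub>V) = \<zero> \<otimes> f 0\<^sub>V"
    using assms unfolding linfun_def by (metis M.zero_closed R.zero_closed)
  thus ?thesis using assms unfolding linfun_def by simp
qed

lemma linfun_lc:
  assumes f: "linfun f" and a: "a \<in> ktup n" and b: "b \<in> vtup n"
  shows "f (lc V n a b) = (\<Oplus>i\<in>{..<n}. a i \<otimes> f (b i))"
proof -
  have "f (lc V n a b) = (\<Oplus>i\<in>{..<n}. f (a i *\<^sub>V b i))"
    unfolding lc_def
    by (rule finsum_additive[OF M.abelian_monoid_axioms R.abelian_monoid_axioms])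
      (use f a b linfun_zero[OF f] in "auto simp: linfun_def")
  also have "\<dots> = (\<Oplus>i\<in>{..<n}. a i \<otimes> f (b i))"
    by (rule R.finsum_cong') (use f a b in "auto simp: linfun_def Pi_def")
  finally show ?thesis .
qed

lemma hom_lc:
  assumes f: "f \<in> module_hom K V V" and a: "a \<in> ktup n" and b: "b \<in> vtup n"
  shows "f (lc V n a b) = lc V n a (f \<circ> b)"
proof -
  have f0: "f 0\<^sub>V = 0\<^sub>V"
  proof -
    have "f (\<zero> *\<^sub>V 0\<^sub>V) = \<zero> *\<^sub>V f 0\<^sub>V"
      using f by (intro module_hom_smult) auto
    moreover have "f 0\<^sub>V \<in> carrier V" using module_hom_closed[OF f] by auto
    ultimately show ?thesis by simp
  qed
  have "f (lc V n a b) = (\<Oplus>\<^bsub>V\<^esub>i\<in>{..<n}. f (a i *\<^sub>V b i))"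
    unfolding lc_def
    by (rule finsum_additive[OF M.abelian_monoid_axioms M.abelian_monoid_axioms])
      (use f f0 a b module_hom_closed[OF f] in "auto simp: LinearCombinations.module_hom_add[OF f]")
  also have "\<dots> = lc V n a (f \<circ> b)" unfolding lc_def
    by (rule M.finsum_cong') (use a b module_hom_closed[OF f] in "auto simp: module_hom_smult[OF f] Pi_def")
  finally show ?thesis .
qed

text \<open>The linear map that takes \<open>b i\<close> to \<open>c i\<close>. For bases of two
  lattices its determinant generates their index ideal (\<open>index_ideal_eq\<close>).\<close>

definition tmap :: "nat => (nat => 'v) => (nat => 'v) => 'v => 'v"
  where "tmap n b c x = lc V n (tcoord K V n b x) c"

lemma tcoord_add:
  assumes "btuple K V n b" "x \<in> carrier V" "y \<in> carrier V" "i < n"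
  shows "tcoord K V n b (x +\<^sub>V y) i = tcoord K V n b x i \<oplus> tcoord K V n b y i"
  using tcoord_lc[OF assms(1) _ assms(4), of "\<lambda>i. tcoord K V n b x i \<oplus> tcoord K V n b y i"]
    tcoord[OF assms(1,2)] tcoord[OF assms(1,3)] btupleD(1)[OF assms(1)]
  by (simp add: lc_add Pi_def)

lemma tcoord_smult:
  assumes "btuple K V n b" "x \<in> carrier V" "r \<in> carrier K" "i < n"
  shows "tcoord K V n b (r *\<^sub>V x) i = r \<otimes> tcoord K V n b x i"
  using tcoord_lc[OF assms(1) _ assms(4), of "\<lambda>i. r \<otimes> tcoord K V n b x i"]
    tcoord[OF assms(1,2)] assms(3) btupleD(1)[OF assms(1)]
  by (simp add: lc_smult Pi_def)

lemma tmap: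
  assumes b: "btuple K V n b" and c: "c \<in> vtup n"
  shows "tmap n b c \<in> module_hom K V V" "i < n ==> tmap n b c (b i) = c i"
proof -
  have "tmap n b c (x +\<^sub>V y) = tmap n b c x +\<^sub>V tmap n b c y"
    if "x \<in> carrier V" "y \<in> carrier V" for x y
  proof -
    have "tmap n b c (x +\<^sub>V y) = lc V n (\<lambda>i. tcoord K V n b x i \<oplus> tcoord K V n b y i) c"
      unfolding tmap_def
      by (rule lc_cong) (use that b c tcoord(3)[OF b] in "auto simp: tcoord_add")
    thus ?thesis unfolding tmap_def using that b c by (simp add: lc_add tcoord(1))
  qed
  moreover have "tmap n b c (r *\<^sub>V x) = r *\<^sub>V tmap n b c x"
    if "x \<in> carrier V" "r \<in> carrier K" for x r
  proof -
    have "tmap n b c (r *\<^sub>V x) = lc V n (\<lambda>i. r \<otimes> tcoord K V n b x i) c"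
      unfolding tmap_def
      by (rule lc_cong) (use that b c tcoord(3)[OF b] in "auto simp: tcoord_smult")
    thus ?thesis unfolding tmap_def using that b c by (simp add: lc_smult tcoord(1))
  qed
  moreover have "tmap n b c x \<in> carrier V" if "x \<in> carrier V" for x
    using that tcoord(1)[OF b] c by (simp add: tmap_def)
  ultimately show "tmap n b c \<in> module_hom K V V" by (auto simp: LinearCombinations.module_hom_def)
  show "tmap n b c (b i) = c i" if i: "i < n"
  proof -
    have "tmap n b c (b i) = lc V n (\<lambda>j. if j = i then \<one> else \<zero>) c"
      unfolding tmap_def by (rule lc_cong) (use i b c in "auto simp: tcoord_self")
    thus ?thesis using lc_single[OF i c] by simp
  qed
qed

lemma lin_aut_tmap:
  assumes b: "btuple K V n b" and c: "btuple K V n c"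
  shows "lin_aut K V (tmap n b c)"
  unfolding lin_aut_def
proof
  note cc = btupleD(1)[OF c]
  show h: "tmap n b c \<in> module_hom K V V" by (rule tmap[OF b cc])
  show "bij_betw (tmap n b c) (carrier V) (carrier V)"
    unfolding bij_betw_def
  proof
    show "inj_on (tmap n b c) (carrier V)"
    proof (rule inj_onI)
      fix x y assume xy: "x \<in> carrier V" "y \<in> carrier V" "tmap n b c x = tmap n b c y"
      have "tcoord K V n b x i = tcoord K V n b y i" if "i < n" for i
        by (rule lc_inject[OF c]) (use that xy tcoord(1)[OF b] in "auto simp: tmap_def")
      hence "lc V n (tcoord K V n b x) b = lc V n (tcoord K V n b y) b"
        using tcoord(1)[OF b] xy btupleD(1)[OF b] by (intro lc_cong) auto
      thus "x = y" using tcoord(2)[OF b] xy by simp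
    qed
    show "tmap n b c ` carrier V = carrier V"
    proof
      show "tmap n b c ` carrier V \<subseteq> carrier V" using module_hom_closed[OF h] by auto
      show "carrier V \<subseteq> tmap n b c ` carrier V"
      proof
        fix x assume x: "x \<in> carrier V"
        let ?y = "lc V n (tcoord K V n c x) b"
        have y: "?y \<in> carrier V" using tcoord(1)[OF c x] btupleD(1)[OF b] by simp
        have "tmap n b c ?y = lc V n (tcoord K V n c x) c"
          unfolding tmap_def
          by (rule lc_cong) (use tcoord(1)[OF c x] cc tcoord_lc[OF b] in auto)
        thus "x \<in> tmap n b c ` carrier V" using tcoord(2)[OF c x] y by force
      qed
    qed
  qed
qed

end

section \<open>Determinants of tuples and of endomorphisms\<close>

locale vspace_not2 = vspace K V for K (structure) and V +
  assumes two_ne: "\<one> \<oplus> \<one> \<noteq> \<zero>"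
begin

sublocale D: domain_not2 K
  by unfold_locales (rule two_ne)

lemma tdet_lc:
  assumes e: "btuple K V n e" and c: "c \<in> vtup n" and A: "R.is_mat n A"
    and b: "\<And>i. i < n ==> b i = lc V n (A i) c"
  shows "tdet K V n e b = leibniz_det K n A \<otimes> tdet K V n e c"
proof -
  let ?C = "\<lambda>i. tcoord K V n e (c i)"
  have C: "R.is_mat n ?C" by (rule is_mat_tcoord[OF e c])
  have co: "tcoord K V n e (b i) j = R.mat_prod n A ?C i j" if ij: "i < n" "j < n" for i j
  proof -
    have Ai: "A i \<in> ktup n" using A ij by (auto simp: R.is_mat_def)
    have "b i = lc V n (A i) (\<lambda>k. lc V n (?C k) e)"
      unfolding b[OF ij(1)]
      by (rule lc_cong) (use Ai c tcoord[OF e] btupleD(1)[OF e] in "auto simp: Pi_def")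
    also have "\<dots> = lc V n (\<lambda>j. \<Oplus>k\<in>{..<n}. A i k \<otimes> ?C k j) e"
      by (rule lc_lc) (use Ai C btupleD(1)[OF e] in "auto simp: R.is_mat_def")
    finally have "b i = lc V n (R.mat_prod n A ?C i) e" by (simp add: R.mat_prod_def[abs_def])
    moreover have "R.mat_prod n A ?C i \<in> ktup n"
      using R.is_mat_prod[OF A C] ij by (auto simp: R.is_mat_def)
    ultimately show ?thesis using tcoord_lc[OF e _ ij(2)] by simp
  qed
  have "tdet K V n e b = leibniz_det K n (R.mat_prod n A ?C)"
    unfolding tdet_def by (rule R.leibniz_det_cong) (use co A C in auto)
  thus ?thesis using D.leibniz_det_mult[OF A C] by (simp add: tdet_def)
qed

text \<open>Expressing \<open>e\<close> in the basis \<open>b\<close> makes this determinant a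
  factor of one.\<close>

lemma tdet_nonzero:
  assumes e: "btuple K V n e" and b: "btuple K V n b"
  shows "tdet K V n e b \<noteq> \<zero>"
proof
  assume z: "tdet K V n e b = \<zero>"
  have m: "R.is_mat n (\<lambda>i. tcoord K V n b (e i))" by (rule is_mat_tcoord[OF b btupleD(1)[OF e]])
  have "tdet K V n e e = leibniz_det K n (\<lambda>i. tcoord K V n b (e i)) \<otimes> tdet K V n e b"
    by (rule tdet_lc[OF e btupleD(1)[OF b] m])
      (use tcoord(2)[OF b] btupleD(1)[OF e] in "auto simp: Pi_def")
  thus False using z m tdet_self[OF e] by simp
qed

text \<open>Cramer's rule. It allows single coordinates, and in particular their orders, to be read
  off from determinants.\<close>

lemma tdet_replace:
  assumes e: "btuple K V n e" and b: "b \<in> vtup n"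
    and a: "a \<in> ktup n" and j: "j < n"
  shows "tdet K V n e (b(j := lc V n a b)) = a j \<otimes> tdet K V n e b"
proof -
  let ?A = "\<lambda>i k. if i = j then a k else if i = k then \<one> else \<zero>"
  have A: "R.is_mat n ?A" using a by (auto simp: R.is_mat_def)
  have "tdet K V n e (b(j := lc V n a b)) = leibniz_det K n ?A \<otimes> tdet K V n e b"
  proof (rule tdet_lc[OF e b A])
    fix i assume i: "i < n"
    have "lc V n (\<lambda>k. if i = k then \<one> else \<zero>) b = b i"
      using lc_single[OF i b] by (simp add: eq_commute)
    thus "(b(j := lc V n a b)) i = lc V n (?A i) b" by simp
  qed
  also have "leibniz_det K n ?A = a j"
    by (rule R.leibniz_det_one_row) (use a j in auto)
  finally show ?thesis .
qed

text \<open>Replacing the \<open>i\<close>-th vector by a vanishing combination multiplies the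
  determinant by the \<open>i\<close>-th coefficient, whereas a tuple containing the zero vector has
  determinant zero.\<close>

lemma tdet_btuple:
  assumes e: "btuple K V n e" and b: "b \<in> vtup n" and nz: "tdet K V n e b \<noteq> \<zero>"
  shows "btuple K V n b"
proof -
  have n: "dim = n" and fd: fin_dim using btuple_basis[OF e] by auto
  have "a i = \<zero>" if a: "a \<in> ktup n" "lc V n a b = 0\<^sub>V" "i < n" for a i
  proof -
    have "tdet K V n e (b(i := lc V n a b)) = a i \<otimes> tdet K V n e b"
      by (rule tdet_replace[OF e b a(1,3)])
    \<comment> \<open>Cramer's rule is applied to the tuple that already contains the zero vector,
      with all coefficients zero.\<close>
    moreover have "tdet K V n e (b(i := 0\<^sub>V)) = \<zero> \<otimes> tdet K V n e (b(i := 0\<^sub>V))"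
    proof -
      have b0: "b(i := 0\<^sub>V) \<in> vtup n" using b by auto
      have "lc V n (\<lambda>_. \<zero>) (b(i := 0\<^sub>V)) = 0\<^sub>V" using b0 by (intro lc_zero) auto
      thus ?thesis using tdet_replace[OF e b0 _ a(3), of "\<lambda>_. \<zero>"] by simp
    qed
    moreover have "b(i := 0\<^sub>V) \<in> vtup n" using b by auto
    ultimately have "a i \<otimes> tdet K V n e b = \<zero>"
      using a(2) tdet_closed[OF e] R.l_null by metis
    thus ?thesis using nz integral[of "a i" "tdet K V n e b"] a(1,3) tdet_closed[OF e b] by auto
  qed
  thus ?thesis using independent_btuple[OF fd] b n by auto
qed

text \<open>\<open>lin_det\<close> is a description over all bases, so independence of the basis is
  part of the claim. For a second basis the determinant of its image under \<open>\<alpha>\<close>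
  is evaluated twice, through the matrix of \<open>\<alpha>\<close> and through the expansion in
  \<open>e\<close>; the determinant of the second basis cancels.\<close>

lemma lin_det_eq:
  assumes e: "btuple K V n e" and \<alpha>: "\<alpha> \<in> module_hom K V V"
  shows "lin_det K V \<alpha> = tdet K V n e (\<alpha> \<circ> e)"
  unfolding lin_det_def
proof (rule the_equality)
  let ?A = "\<lambda>i. tcoord K V n e (\<alpha> (e i))"
  have ec: "e \<in> vtup n" by (rule btupleD(1)[OF e])
  have \<alpha>e: "\<alpha> \<circ> e \<in> vtup n" using ec module_hom_closed[OF \<alpha>] by auto
  let ?bs = "map e [0..<n]"
  have s: "set ?bs = e ` {..<n}" by (auto simp: atLeast0LessThan[symmetric])
  have "distinct ?bs" using btuple_basis(1)[OF e] by (simp add: distinct_map atLeast0LessThan)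
  moreover have "basis (set ?bs)" unfolding s by (rule btuple_basis(2)[OF e])
  moreover have "\<forall>i<length ?bs. \<forall>j<length ?bs. ?A i j \<in> carrier K"
    using tcoord(3)[OF e] \<alpha>e by (auto simp: Pi_def)
  moreover have "\<alpha> (?bs ! i) = (\<Oplus>\<^bsub>V\<^esub>j\<in>{..<length ?bs}. ?A i j *\<^sub>V (?bs ! j))" if "i < length ?bs" for i
  proof -
    have i: "i < n" using that by simp
    have "\<alpha> (e i) = lc V n (?A i) e" using tcoord(2)[OF e] \<alpha>e i by (auto simp: Pi_def)
    also have "\<dots> = lc V n (?A i) (\<lambda>j. ?bs ! j)"
      by (rule lc_cong) (use tcoord(1)[OF e] \<alpha>e ec i in "auto simp: Pi_def")
    finally show ?thesis using i by (simp add: lc_def)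
  qed
  moreover have "tdet K V n e (\<alpha> \<circ> e) = leibniz_det K (length ?bs) ?A" by (simp add: tdet_def)
  ultimately show "\<exists>bs A. distinct bs \<and> basis (set bs) \<and>
      (\<forall>i<length bs. \<forall>j<length bs. A i j \<in> carrier K) \<and>
      (\<forall>i<length bs. \<alpha> (bs ! i) = (\<Oplus>\<^bsub>V\<^esub>j\<in>{..<length bs}. A i j *\<^sub>V (bs ! j))) \<and>
      tdet K V n e (\<alpha> \<circ> e) = leibniz_det K (length bs) A"
    by (intro exI[of _ ?bs] exI[of _ ?A]) auto
  fix d assume "\<exists>bs A. distinct bs \<and> basis (set bs) \<and>
      (\<forall>i<length bs. \<forall>j<length bs. A i j \<in> carrier K) \<and>
      (\<forall>i<length bs. \<alpha> (bs ! i) = (\<Oplus>\<^bsub>V\<^esub>j\<in>{..<length bs}. A i j *\<^sub>V (bs ! j))) \<and>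
      d = leibniz_det K (length bs) A"
  then obtain bs A where bs: "distinct bs" "basis (set bs)"
    and A: "\<forall>i<length bs. \<forall>j<length bs. A i j \<in> carrier K"
    and \<alpha>b: "\<forall>i<length bs. \<alpha> (bs ! i) = (\<Oplus>\<^bsub>V\<^esub>j\<in>{..<length bs}. A i j *\<^sub>V (bs ! j))"
    and d: "d = leibniz_det K (length bs) A"
    by blast
  have "dim = length bs" using dim_basis[OF _ bs(2)] distinct_card[OF bs(1)] by simp
  hence len: "length bs = n" using btuple_basis(4)[OF e] by simp
  let ?b = "\<lambda>i. bs ! i"
  have "?b ` {..<n} = set bs" using len by (auto simp: in_set_conv_nth)
  hence b: "btuple K V n ?b"
    using bs len by (intro basis_btuple) (auto simp: inj_on_def nth_eq_iff_index_eq)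
  have bc: "?b \<in> vtup n" by (rule btupleD(1)[OF b])
  have Am: "R.is_mat n A" using A len by (simp add: R.is_mat_def)
  let ?C = "\<lambda>i. tcoord K V n e (?b i)"
  have C: "R.is_mat n ?C" by (rule is_mat_tcoord[OF e bc])
  have 1: "tdet K V n e (\<alpha> \<circ> ?b) = leibniz_det K n A \<otimes> tdet K V n e ?b"
    by (rule tdet_lc[OF e bc Am]) (use \<alpha>b len in "auto simp: lc_def")
  have 2: "tdet K V n e (\<alpha> \<circ> ?b) = leibniz_det K n ?C \<otimes> tdet K V n e (\<alpha> \<circ> e)"
  proof (rule tdet_lc[OF e \<alpha>e C])
    fix i assume i: "i < n"
    have "\<alpha> (?b i) = \<alpha> (lc V n (?C i) e)" using tcoord(2)[OF e] bc i by (auto simp: Pi_def)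
    also have "\<dots> = lc V n (?C i) (\<alpha> \<circ> e)"
      by (rule hom_lc[OF \<alpha> _ ec]) (use tcoord(1)[OF e] bc i in auto)
    finally show "(\<alpha> \<circ> ?b) i = lc V n (?C i) (\<alpha> \<circ> e)" by simp
  qed
  have "leibniz_det K n A \<otimes> tdet K V n e ?b = tdet K V n e (\<alpha> \<circ> e) \<otimes> tdet K V n e ?b"
    using 1 2 tdet_closed[OF e bc] tdet_closed[OF e \<alpha>e] by (simp add: tdet_def R.m_comm)
  thus "d = tdet K V n e (\<alpha> \<circ> e)"
    using m_rcancel[OF tdet_nonzero[OF e b]] tdet_closed[OF e bc] tdet_closed[OF e \<alpha>e] Am d len by simp
qed

lemma tdet_image:
  assumes e: "btuple K V n e" and \<alpha>: "\<alpha> \<in> module_hom K V V" and b: "b \<in> vtup n"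
  shows "tdet K V n e (\<alpha> \<circ> b) = lin_det K V \<alpha> \<otimes> tdet K V n e b"
proof -
  have ec: "e \<in> vtup n" by (rule btupleD(1)[OF e])
  have \<alpha>e: "\<alpha> \<circ> e \<in> vtup n" using ec module_hom_closed[OF \<alpha>] by auto
  let ?C = "\<lambda>i. tcoord K V n e (b i)"
  have "tdet K V n e (\<alpha> \<circ> b) = leibniz_det K n ?C \<otimes> tdet K V n e (\<alpha> \<circ> e)"
  proof (rule tdet_lc[OF e \<alpha>e is_mat_tcoord[OF e b]])
    fix i assume i: "i < n"
    have "\<alpha> (b i) = \<alpha> (lc V n (?C i) e)" using tcoord(2)[OF e] b i by (auto simp: Pi_def)
    also have "\<dots> = lc V n (?C i) (\<alpha> \<circ> e)"
      by (rule hom_lc[OF \<alpha> _ ec]) (use tcoord(1)[OF e] b i in auto)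
    finally show "(\<alpha> \<circ> b) i = lc V n (?C i) (\<alpha> \<circ> e)" by simp
  qed
  thus ?thesis
    using tdet_closed[OF e b] tdet_closed[OF e \<alpha>e] lin_det_eq[OF e \<alpha>] by (simp add: tdet_def R.m_comm)
qed

end

section \<open>Lattices over a discrete valuation ring\<close>

text \<open>The value of \<open>val\<close> at zero is left open, whence the many conditions of
  nonvanishing. The residue characteristic may be 2. The locale is instantiated by the number field
  with the order at a prime and by its completion.\<close>

locale dvf = field K for K :: "'k ring" (structure) +
  fixes val :: "'k => int"
  assumes val_mult: "x \<in> carrier K ==> y \<in> carrier K ==> x \<noteq> \<zero> ==> y \<noteq> \<zero> ==> val (x \<otimes> y) = val x + val y"
    and val_add: "x \<in> carrier K ==> y \<in> carrier K ==> x \<noteq> \<zero> ==> y \<noteq> \<zero> ==> x \<oplus> y \<noteq> \<zero> ==>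
      min (val x) (val y) \<le> val (x \<oplus> y)"
    and ex_val_1: "\<exists>x\<in>carrier K. x \<noteq> \<zero> \<and> val x = 1"
    and two_neq: "\<one> \<oplus> \<one> \<noteq> \<zero>"
begin

text \<open>The \<open>k\<close>-th power of the maximal ideal; \<open>pid 0\<close> is the
  valuation ring and plays the part of \<open>R\<close> in the general definitions.\<close>

definition pid :: "int => 'k set"
  where "pid k = {x \<in> carrier K. x = \<zero> \<or> k \<le> val x}"

lemma inv_nz [simp]:
  assumes "x \<in> carrier K" "x \<noteq> \<zero>"
  shows "inv x \<in> carrier K" "inv x \<noteq> \<zero>" "x \<otimes> inv x = \<one>" "inv x \<otimes> x = \<one>"
proof -
  have u: "x \<in> Units K" using assms field_Units by auto
  show "inv x \<in> carrier K" "x \<otimes> inv x = \<one>" "inv x \<otimes> x = \<one>" using u by auto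
  thus "inv x \<noteq> \<zero>" using assms r_null[of x] zero_not_one by metis
qed

lemma val_one [simp]: "val \<one> = 0"
  using val_mult[of \<one> \<one>] by simp

lemma val_inv:
  assumes "x \<in> carrier K" "x \<noteq> \<zero>"
  shows "val (inv x) = - val x"
  using val_mult[of x "inv x"] assms by simp

lemma val_uminus [simp]: assumes "x \<in> carrier K" shows "val (\<ominus> x) = val x"
proof (cases "x = \<zero>")
  case False
  have 1: "(\<ominus> \<one>) \<otimes> (\<ominus> \<one>) = \<one>" by (simp add: l_minus r_minus)
  have n: "\<ominus> \<one> \<noteq> \<zero>" using 1 by (metis r_null zero_not_one one_closed add.inv_closed)
  have "val (\<ominus> \<one>) + val (\<ominus> \<one>) = 0" using val_mult[of "\<ominus> \<one>" "\<ominus> \<one>"] n 1 by simp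
  hence "val (\<ominus> \<one>) = 0" by simp
  thus ?thesis using val_mult[of "\<ominus> \<one>" x] n False assms by (simp add: l_minus)
qed simp

lemma mult_nz [simp]: "x \<in> carrier K ==> y \<in> carrier K ==> x \<noteq> \<zero> ==> y \<noteq> \<zero> ==> x \<otimes> y \<noteq> \<zero>"
  using integral by blast

lemma ex_val: "\<exists>x\<in>carrier K. x \<noteq> \<zero> \<and> val x = k"
proof -
  obtain p where p: "p \<in> carrier K" "p \<noteq> \<zero>" "val p = 1" using ex_val_1 by blast
  have pos: "\<exists>x\<in>carrier K. x \<noteq> \<zero> \<and> val x = int m" for m
  proof (induction m)
    case (Suc m)
    then obtain x where "x \<in> carrier K" "x \<noteq> \<zero>" "val x = int m" by blast
    thus ?case using p by (intro bexI[of _ "p \<otimes> x"]) (auto simp: val_mult)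
  qed (intro bexI[of _ \<one>], auto)
  show ?thesis
  proof (cases "k \<ge> 0")
    case True
    thus ?thesis using pos[of "nat k"] by simp
  next
    case False
    obtain x where "x \<in> carrier K" "x \<noteq> \<zero>" "val x = int (nat (- k))" using pos by blast
    thus ?thesis using False by (intro bexI[of _ "inv x"]) (auto simp: val_inv)
  qed
qed

lemma pid_carrier: "pid k \<subseteq> carrier K" by (auto simp: pid_def)

lemma pid_closed [dest]: "x \<in> pid k ==> x \<in> carrier K" by (auto simp: pid_def)

lemma pid_zero [simp]: "\<zero> \<in> pid k" by (simp add: pid_def)

lemma pid_one [simp]: "\<one> \<in> pid 0" by (simp add: pid_def)

lemma pid_mult: "x \<in> pid k ==> y \<in> pid l ==> x \<otimes> y \<in> pid (k + l)"
  by (cases "x = \<zero>"; cases "y = \<zero>") (auto simp: pid_def val_mult)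

lemma pid_add: "x \<in> pid k ==> y \<in> pid k ==> x \<oplus> y \<in> pid k"
  using val_add[of x y]
  by (cases "x = \<zero>"; cases "y = \<zero>"; cases "x \<oplus> y = \<zero>") (auto simp: pid_def)

lemma pid_uminus: "x \<in> pid k ==> \<ominus> x \<in> pid k"
  by (auto simp: pid_def)

lemma pid_subring: "is_subring K (pid 0)"
  unfolding is_subring_def
  using pid_mult[of _ 0 _ 0] pid_add[of _ 0] pid_uminus[of _ 0] pid_carrier[of 0] by simp

lemma pid_eq_iff [simp]: "pid k = pid l \<longleftrightarrow> k = l"
proof
  assume e: "pid k = pid l"
  obtain x y where x: "x \<in> carrier K" "x \<noteq> \<zero>" "val x = k" and y: "y \<in> carrier K" "y \<noteq> \<zero>" "val y = l"
    using ex_val[of k] ex_val[of l] by blast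
  have "x \<in> pid k" "y \<in> pid l" using x y by (auto simp: pid_def)
  hence "x \<in> pid l" "y \<in> pid k" using e by auto
  thus "k = l" using x y by (auto simp: pid_def)
qed simp

lemma pid_divide:
  assumes "x \<in> carrier K" "x \<noteq> \<zero>" "y \<in> pid k"
  shows "y \<otimes> inv x \<in> pid (k - val x)"
  using pid_mult[OF assms(3), of "inv x" "- val x"] assms(1,2) by (auto simp: pid_def val_inv)

lemma cancel_inv [simp]:
  assumes "x \<in> carrier K" "x \<noteq> \<zero>" "y \<in> carrier K"
  shows "x \<otimes> (inv x \<otimes> y) = y" "inv x \<otimes> (x \<otimes> y) = y" "y \<otimes> inv x \<otimes> x = y" "y \<otimes> x \<otimes> inv x = y"
  using assms by (simp_all add: m_assoc[symmetric]) (simp_all add: m_assoc)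

lemma pid_eq_multiples:
  assumes "x \<in> carrier K" "x \<noteq> \<zero>"
  shows "pid (val x) = {r \<otimes> x | r. r \<in> pid 0}"
proof
  show "pid (val x) \<subseteq> {r \<otimes> x | r. r \<in> pid 0}"
  proof
    fix y assume y: "y \<in> pid (val x)"
    have "y = (y \<otimes> inv x) \<otimes> x" using pid_closed[OF y] assms by simp
    moreover have "y \<otimes> inv x \<in> pid 0" using pid_divide[OF assms y] by simp
    ultimately show "y \<in> {r \<otimes> x | r. r \<in> pid 0}" by blast
  qed
  have "x \<in> pid (val x)" using assms by (simp add: pid_def)
  thus "{r \<otimes> x | r. r \<in> pid 0} \<subseteq> pid (val x)" using pid_mult[of _ 0 x "val x"] by auto
qed

lemma det_in_subring:
  assumes R: "is_subring K R" and A: "\<And>i j. i < n ==> j < n ==> A i j \<in> R"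
  shows "leibniz_det K n A \<in> R"
proof -
  note d = is_subringD[OF R]
  have Rc: "x \<in> R ==> x \<in> carrier K" for x using d(1) by auto
  have Am: "is_mat n A" using A Rc by (auto simp: is_mat_def)
  have prod: "(\<Otimes>i\<in>I. f i) \<in> R" if "finite I" "f \<in> I \<rightarrow> R" for f :: "nat => 'k" and I
    using that
  proof (induction I rule: finite_induct)
    case (insert x F)
    hence "f x \<otimes> finprod K f F \<in> R" using d by auto
    thus ?case using insert Rc by (subst finprod_insert) (auto simp: Pi_def)
  qed (use d in simp)
  have sum: "(\<Oplus>i\<in>I. f i) \<in> R" if "finite I" "f \<in> I \<rightarrow> R" for f :: "(nat => nat) => 'k" and I
    using that
  proof (induction I rule: finite_induct)
    case (insert x F)
    hence "f x \<oplus> finsum K f F \<in> R" using d by auto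
    thus ?case using insert Rc by (subst finsum_insert) (auto simp: Pi_def)
  qed (use d in simp)
  show ?thesis
    unfolding leibniz_det_alt[OF Am]
  proof (rule sum[OF finite_perms], rule funcsetI)
    fix p assume "p \<in> {p. p permutes {..<n}}"
    hence "diag_prod n A p \<in> R"
      unfolding diag_prod_def by (intro prod) (auto intro!: A dest: permutes_less)
    moreover have "perm_sign p \<in> R" using d by (simp add: perm_sign_def)
    ultimately show "perm_sign p \<otimes> diag_prod n A p \<in> R" using d by simp
  qed
qed

end

section \<open>Free lattices and their volumes\<close>

locale dvspace = vspace K V + dvf K val for K :: "'k ring" (structure) and V :: "('k, 'v) module" and val +
  assumes fin_dim: "vectorspace.fin_dim K V"
begin

sublocale vspace_not2 K V
  by unfold_locales (rule two_neq)

text \<open>Normalises volumes; only differences of volumes have a meaning independent of this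
  choice.\<close>

definition ref :: "nat => 'v"
  where "ref = (SOME e. btuple K V dim e)"

abbreviation isb :: "(nat => 'v) => bool"
  where "isb \<equiv> btuple K V dim"

abbreviation lat :: "(nat => 'v) => 'v set"
  where "lat \<equiv> lspan (pid 0) V dim"

abbreviation Dt :: "(nat => 'v) => 'k"
  where "Dt \<equiv> tdet K V dim ref"

lemma ref: "isb ref"
  unfolding ref_def using fin_dim_btuple[OF fin_dim] by (rule someI_ex)

definition latt :: "'v set => bool"
  where "latt L \<longleftrightarrow> (\<exists>b. isb b \<and> L = lat b)"

text \<open>The order of the determinant of a basis, so that larger lattices have smaller volume.
  \<open>vol_lat\<close> removes the choice of the basis.\<close>

definition vol :: "'v set => int"
  where "vol L = val (Dt (SOME b. isb b \<and> L = lat b))"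

lemma lattE: assumes "latt L" obtains b where "isb b" "L = lat b"
  using assms by (auto simp: latt_def)

lemma isbD: "isb b ==> b \<in> vtup dim"
  by (rule btupleD(1))

lemma rsub_lat: "isb b ==> rsub (pid 0) V (lat b)"
  by (rule rsub_lspan[OF pid_subring isbD])

lemma latt_rsub: "latt L ==> rsub (pid 0) V L"
  by (auto simp: latt_def rsub_lat)

lemma lat_gen: "isb b ==> i < dim ==> b i \<in> lat b"
  by (rule lspan_gen[OF pid_subring isbD])

lemma Dt_nz: "isb b ==> Dt b \<noteq> \<zero>" "isb b ==> Dt b \<in> carrier K"
  using tdet_nonzero[OF ref] tdet_closed[OF ref] isbD by auto

text \<open>The transition matrix has entries in the valuation ring, hence a determinant of
  nonnegative order.\<close>

lemma lat_subset_val: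
  assumes c: "isb c" and b: "isb b" and sub: "b \<in> {..<dim} \<rightarrow> lat c"
  shows "val (Dt c) \<le> val (Dt b)"
proof -
  have "\<forall>i\<in>{..<dim}. \<exists>a. a \<in> {..<dim} \<rightarrow> pid 0 \<and> b i = lc V dim a c"
    using sub by (auto simp: lspan_def Pi_def)
  then obtain A where A: "\<And>i. i < dim ==> A i \<in> {..<dim} \<rightarrow> pid 0 \<and> b i = lc V dim (A i) c"
    by (metis lessThan_iff)
  have Am: "is_mat dim A" using A pid_closed[of _ 0] by (auto simp: is_mat_def)
  have e: "Dt b = leibniz_det K dim A \<otimes> Dt c"
    by (rule tdet_lc[OF ref isbD[OF c] Am]) (use A in auto)
  have dR: "leibniz_det K dim A \<in> pid 0"
    by (rule det_in_subring[OF pid_subring]) (use A in auto)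
  have "leibniz_det K dim A \<noteq> \<zero>" using e Dt_nz[OF b] Dt_nz[OF c] by auto
  thus ?thesis using e dR Dt_nz[OF c] by (auto simp: val_mult pid_def)
qed

lemma vol_lat: assumes b: "isb b" shows "vol (lat b) = val (Dt b)"
proof -
  let ?c = "SOME c. isb c \<and> lat b = lat c"
  have c: "isb ?c" "lat b = lat ?c" using someI[of "\<lambda>c. isb c \<and> lat b = lat c" b] b by auto
  have "val (Dt ?c) \<le> val (Dt b)" by (rule lat_subset_val[OF c(1) b]) (use lat_gen[OF b] c(2) in auto)
  moreover have "val (Dt b) \<le> val (Dt ?c)"
    by (rule lat_subset_val[OF b c(1)]) (use lat_gen[OF c(1)] c(2) in auto)
  ultimately show ?thesis by (simp add: vol_def)
qed

lemma vol_mono: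
  assumes "latt A" "latt B" "A \<subseteq> B" shows "vol B \<le> vol A"
proof -
  obtain a b where ab: "isb a" "A = lat a" "isb b" "B = lat b" using assms by (auto simp: latt_def)
  have "val (Dt b) \<le> val (Dt a)" by (rule lat_subset_val) (use ab lat_gen[OF ab(1)] assms(3) in auto)
  thus ?thesis using ab by (simp add: vol_lat)
qed

text \<open>A basis of \<open>V\<close> inside a submodule \<open>N\<close> whose determinant has least order generates \<open>N\<close>:
  otherwise, replacing one basis vector by an element of \<open>N\<close> would lower the order.\<close>

lemma minimal_tuple_generates:
  assumes N: "rsub (pid 0) V N" and b: "isb b" "b \<in> {..<dim} \<rightarrow> N"
    and min: "\<And>c. isb c ==> c \<in> {..<dim} \<rightarrow> N ==> val (Dt b) \<le> val (Dt c)"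
  shows "N = lat b"
proof
  show "lat b \<subseteq> N" by (rule lspan_least[OF pid_subring N b(2)])
  show "N \<subseteq> lat b"
  proof
    fix x assume x: "x \<in> N"
    hence xV: "x \<in> carrier V" using rsubD(1)[OF N] by auto
    let ?a = "tcoord K V dim b x"
    have xa: "x = lc V dim ?a b" "?a \<in> ktup dim" using tcoord[OF b(1) xV] by auto
    have "?a j \<in> pid 0" if j: "j < dim" for j
    proof (cases "?a j = \<zero>")
      case False
      have ac: "?a j \<in> carrier K" using xa j by auto
      have "Dt (b(j := x)) = ?a j \<otimes> Dt b"
        using tdet_replace[OF ref isbD[OF b(1)] xa(2) j] xa(1) by simp
      hence d: "Dt (b(j := x)) \<noteq> \<zero>" "val (Dt (b(j := x))) = val (?a j) + val (Dt b)"
        using ac False Dt_nz[OF b(1)] by (auto simp: val_mult)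
      have "isb (b(j := x))"
        by (rule tdet_btuple[OF ref _ d(1)]) (use isbD[OF b(1)] xV in auto)
      hence "val (Dt b) \<le> val (Dt (b(j := x)))" using b(2) x by (intro min) auto
      thus ?thesis using d ac by (simp add: pid_def)
    qed simp
    thus "x \<in> lat b" unfolding lspan_def using xa by blast
  qed
qed

text \<open>The orders of the bases contained in \<open>N\<close> are bounded below by the volume of
  \<open>D\<close>, so one of least order exists and \<open>minimal_tuple_generates\<close> applies.
  Freeness is obtained in this way instead of by elementary divisors.\<close>

lemma latt_sub:
  assumes N: "rsub (pid 0) V N" and c: "isb c" "c \<in> {..<dim} \<rightarrow> N" and D: "latt D" "N \<subseteq> D"
  shows "latt N"
proof -
  obtain d where d: "isb d" "D = lat d" using D(1) by (rule lattE)
  let ?P = "\<lambda>b. isb b \<and> b \<in> {..<dim} \<rightarrow> N"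
  \<comment> \<open>A natural number, so that a least value exists; by \<open>lb\<close> the
    difference is nonnegative on all tuples considered and \<open>nat\<close> loses nothing.\<close>
  define f where "f b = nat (val (Dt b) - val (Dt d))" for b
  have lb: "val (Dt d) \<le> val (Dt b)" if "?P b" for b
    by (rule lat_subset_val[OF d(1)]) (use that d D(2) in auto)
  obtain b where b: "?P b" "\<And>b'. ?P b' ==> f b \<le> f b'"
    using ex_has_least_nat[of ?P c f] c by blast
  have "N = lat b"
  proof (rule minimal_tuple_generates[OF N])
    fix b' assume "isb b'" "b' \<in> {..<dim} \<rightarrow> N"
    thus "val (Dt b) \<le> val (Dt b')" using b(2)[of b'] lb[of b'] lb[OF b(1)] by (simp add: f_def)
  qed (use b in auto)
  thus ?thesis using b(1) by (auto simp: latt_def)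
qed

lemma isb_scale:
  assumes b: "isb b" and x: "x \<in> carrier K" "x \<noteq> \<zero>"
  shows "isb (\<lambda>i. x *\<^sub>V b i)"
proof (rule independent_btuple[OF fin_dim])
  note bc = isbD[OF b]
  show "(\<lambda>i. x *\<^sub>V b i) \<in> vtup dim" using bc x by auto
  fix a i assume a: "a \<in> ktup dim" "lc V dim a (\<lambda>i. x *\<^sub>V b i) = 0\<^sub>V" "i < dim"
  have "lc V dim (\<lambda>i. a i \<otimes> x) b = lc V dim a (\<lambda>i. x *\<^sub>V b i)"
    unfolding lc_def by (rule M.finsum_cong') (use a x bc in "auto simp: smult_assoc1 Pi_def")
  hence "a i \<otimes> x = \<zero>" using a x by (intro btupleD(3)[OF b, of "\<lambda>i. a i \<otimes> x"]) auto
  thus "a i = \<zero>" using x a integral[of "a i" x] by auto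
qed

lemma smult_inv_cancel:
  assumes "x \<in> carrier K" "x \<noteq> \<zero>" "u \<in> carrier V"
  shows "x *\<^sub>V (inv x *\<^sub>V u) = u" "inv x *\<^sub>V (x *\<^sub>V u) = u"
  using assms by (simp_all add: smult_assoc1[symmetric])

lemma bounded_denominators:
  assumes "finite S" "S \<subseteq> carrier V" and d: "isb d"
  shows "\<exists>x\<in>carrier K. x \<noteq> \<zero> \<and> (\<forall>s\<in>S. x *\<^sub>V s \<in> lat d)"
proof -
  have fin: "finite ((\<lambda>(s, i). - val (tcoord K V dim d s i)) ` (S \<times> {..<dim}))" using assms(1) by auto
  obtain k where k: "\<And>s i. s \<in> S ==> i < dim ==> - val (tcoord K V dim d s i) \<le> k"
    using bdd_above_finite[OF fin] by (auto simp: bdd_above_def)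
  obtain x where x: "x \<in> carrier K" "x \<noteq> \<zero>" "val x = k" using ex_val by blast
  have "x *\<^sub>V s \<in> lat d" if s: "s \<in> S" for s
  proof -
    let ?a = "tcoord K V dim d s"
    have sV: "s \<in> carrier V" using s assms(2) by auto
    have a: "?a \<in> ktup dim" "lc V dim ?a d = s" using tcoord[OF d sV] by auto
    have "x *\<^sub>V s = lc V dim (\<lambda>i. x \<otimes> ?a i) d"
      using lc_smult[OF a(1) isbD[OF d] x(1)] a(2) by simp
    moreover have "x \<otimes> ?a i \<in> pid 0" if i: "i < dim" for i
    proof (cases "?a i = \<zero>")
      case False
      moreover have "?a i \<in> carrier K" using a(1) i by auto
      ultimately show ?thesis using k[OF s i] x by (simp add: pid_def val_mult)
    qed (use x in simp)
    ultimately show ?thesis unfolding lspan_def by blast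
  qed
  thus ?thesis using x by blast
qed

lemma latt_superset:
  assumes "finite S" "S \<subseteq> carrier V"
  shows "\<exists>D. latt D \<and> S \<subseteq> D"
proof -
  obtain x where x: "x \<in> carrier K" "x \<noteq> \<zero>" "\<And>s. s \<in> S ==> x *\<^sub>V s \<in> lat ref"
    using bounded_denominators[OF assms ref] by blast
  let ?d = "\<lambda>i. inv x *\<^sub>V ref i"
  have d: "isb ?d" by (rule isb_scale[OF ref]) (use x in auto)
  have "s \<in> lat ?d" if s: "s \<in> S" for s
  proof -
    have sV: "s \<in> carrier V" using s assms(2) by auto
    obtain a where a: "a \<in> {..<dim} \<rightarrow> pid 0" "x *\<^sub>V s = lc V dim a ref"
      using x(3)[OF s] by (auto simp: lspan_def)
    have ac: "a \<in> ktup dim" using a(1) by auto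
    have "s = inv x *\<^sub>V lc V dim a ref" using smult_inv_cancel(2)[OF x(1,2) sV] a(2) by simp
    also have "\<dots> = lc V dim (\<lambda>i. inv x \<otimes> a i) ref"
      using lc_smult[OF ac isbD[OF ref], of "inv x"] x by simp
    also have "\<dots> = lc V dim a ?d"
      unfolding lc_def
      by (rule M.finsum_cong') (use ac x isbD[OF ref] in \<open>auto simp: Pi_def smult_assoc1 m_comm[of "inv x"]\<close>)
    finally show ?thesis using a(1) unfolding lspan_def by blast
  qed
  thus ?thesis using d by (auto simp: latt_def)
qed

text \<open>A finitely generated submodule containing a basis lies between the lattice of that basis
  and a free lattice containing the generators, hence is free by \<open>latt_sub\<close>.\<close>

lemma is_lattice_iff_latt: "is_lattice K (pid 0) V L \<longleftrightarrow> latt L"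
proof
  assume "is_lattice K (pid 0) V L"
  then obtain S B where S: "finite S" "S \<subseteq> carrier V" "L = rspan K (pid 0) V S"
    and B: "B \<subseteq> L" "basis B" by (auto simp: is_lattice_def)
  have N: "rsub (pid 0) V L" using rsub_rspan(1)[OF pid_subring S(2)] S(3) by simp
  obtain D where D: "latt D" "S \<subseteq> D" using latt_superset[OF S(1,2)] by blast
  have LD: "L \<subseteq> D" unfolding S(3) by (rule rspan_least[OF pid_subring D(2) latt_rsub[OF D(1)]])
  have finB: "finite B" using B(2) fin_dim_li_fin[OF fin_dim] by (auto simp: basis_def)
  obtain b where b: "bij_betw b {..<card B} B"
    using ex_bij_betw_nat_finite[OF finB] by (auto simp: atLeast0LessThan)
  have "card B = dim" using dim_basis[OF finB B(2)] by simp
  hence "isb b" "b \<in> {..<dim} \<rightarrow> L" using basis_btuple[of b dim] b B by (auto simp: bij_betw_def)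
  thus "latt L" using latt_sub[OF N _ _ D(1) LD] by blast
next
  assume "latt L"
  then obtain b where b: "isb b" "L = lat b" by (rule lattE)
  have "L = rspan K (pid 0) V (b ` {..<dim})" using rspan_lspan[OF pid_subring isbD[OF b(1)]] b(2) by simp
  moreover have "b ` {..<dim} \<subseteq> L" using lat_gen[OF b(1)] b(2) by auto
  ultimately show "is_lattice K (pid 0) V L"
    unfolding is_lattice_def using btuple_basis(2)[OF b(1)] isbD[OF b(1)]
    by (intro conjI exI[of _ "b ` {..<dim}"]) auto
qed

section \<open>Sums, intersections and the modular law\<close>

definition lsum :: "'v set => 'v set => 'v set"
  where "lsum A B = {a +\<^sub>V b | a b. a \<in> A \<and> b \<in> B}"

lemma rsub_lsum:
  assumes R: "is_subring K R" and A: "rsub R V A" and B: "rsub R V B"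
  shows "rsub R V (lsum A B)" "A \<subseteq> lsum A B" "B \<subseteq> lsum A B"
proof -
  note a = rsubD[OF A] and b = rsubD[OF B]
  have ac: "x \<in> carrier V" if "x \<in> A" for x using a(1) that by auto
  have bc: "x \<in> carrier V" if "x \<in> B" for x using b(1) that by auto
  show "A \<subseteq> lsum A B"
  proof
    fix x assume "x \<in> A"
    hence "x = x +\<^sub>V 0\<^sub>V" using ac by simp
    thus "x \<in> lsum A B" unfolding lsum_def using \<open>x \<in> A\<close> b(2) by blast
  qed
  show "B \<subseteq> lsum A B"
  proof
    fix x assume "x \<in> B"
    hence "x = 0\<^sub>V +\<^sub>V x" using bc by simp
    thus "x \<in> lsum A B" unfolding lsum_def using \<open>x \<in> B\<close> a(2) by blast
  qed
  show "rsub R V (lsum A B)"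
    unfolding rsub_def
  proof (intro conjI ballI)
    show "lsum A B \<subseteq> carrier V" using ac bc by (auto simp: lsum_def)
    show "0\<^sub>V \<in> lsum A B" using \<open>A \<subseteq> lsum A B\<close> a(2) by auto
    show "x +\<^sub>V y \<in> lsum A B" if xy: "x \<in> lsum A B" "y \<in> lsum A B" for x y
    proof -
      obtain u v u' v' where *: "x = u +\<^sub>V v" "y = u' +\<^sub>V v'" "u \<in> A" "u' \<in> A" "v \<in> B" "v' \<in> B"
        using xy by (auto simp: lsum_def)
      have "x +\<^sub>V y = (u +\<^sub>V u') +\<^sub>V (v +\<^sub>V v')" using * ac bc by (simp add: M.a_ac)
      thus ?thesis using * a(3) b(3) unfolding lsum_def by blast
    qed
    show "r *\<^sub>V x \<in> lsum A B" if r: "r \<in> R" and x: "x \<in> lsum A B" for r x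
    proof -
      obtain u v where *: "x = u +\<^sub>V v" "u \<in> A" "v \<in> B" using x by (auto simp: lsum_def)
      have "r *\<^sub>V x = r *\<^sub>V u +\<^sub>V r *\<^sub>V v"
        using * ac bc r is_subringD(1)[OF R] by (auto simp: smult_r_distr)
      thus ?thesis using * r a(4) b(4) unfolding lsum_def by blast
    qed
  qed
qed

lemma lsum_least:
  assumes "rsub R V N" "A \<subseteq> N" "B \<subseteq> N"
  shows "lsum A B \<subseteq> N"
  using assms rsubD(3)[OF assms(1)] by (auto simp: lsum_def)

lemma latt_lsum:
  assumes A: "latt A" and B: "latt B" shows "latt (lsum A B)"
proof -
  obtain a b where ab: "isb a" "A = lat a" "isb b" "B = lat b" using A B by (auto simp: latt_def)
  have "a ` {..<dim} \<union> b ` {..<dim} \<subseteq> carrier V" using isbD ab by blast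
  then obtain D where D: "latt D" "a ` {..<dim} \<union> b ` {..<dim} \<subseteq> D"
    using latt_superset[of "a ` {..<dim} \<union> b ` {..<dim}"] by auto
  have "A \<subseteq> D" "B \<subseteq> D" unfolding ab(2,4)
    by (intro lspan_least[OF pid_subring latt_rsub[OF D(1)]]; use D(2) in auto)+
  hence "lsum A B \<subseteq> D" by (rule lsum_least[OF latt_rsub[OF D(1)]])
  moreover have "a \<in> {..<dim} \<rightarrow> lsum A B"
    using rsub_lsum(2)[OF pid_subring latt_rsub[OF A] latt_rsub[OF B]] lat_gen[OF ab(1)] ab(2) by auto
  ultimately show ?thesis
    using latt_sub[OF rsub_lsum(1)[OF pid_subring latt_rsub[OF A] latt_rsub[OF B]] ab(1) _ D(1)] by blast
qed

lemma rsub_Int: "rsub R V A ==> rsub R V B ==> rsub R V (A \<inter> B)"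
  by (auto simp: rsub_def)

lemma latt_Int:
  assumes A: "latt A" and B: "latt B" shows "latt (A \<inter> B)"
proof -
  obtain a b where ab: "isb a" "A = lat a" "isb b" "B = lat b" using A B by (auto simp: latt_def)
  have "finite (a ` {..<dim})" "a ` {..<dim} \<subseteq> carrier V" using isbD[OF ab(1)] by auto
  from bounded_denominators[OF this ab(3)] obtain x
    where x: "x \<in> carrier K" "x \<noteq> \<zero>" "\<And>i. i < dim ==> x *\<^sub>V a i \<in> B" using ab(4) by auto
  \<comment> \<open>The order is chosen such that both \<open>y\<close> and
    \<open>y \<otimes> x\<close> are integral; multiplication by \<open>y \<otimes> x\<close> then
    keeps the basis of \<open>A\<close> in \<open>A\<close> and moves it into
    \<open>B\<close>.\<close>
  obtain y where y: "y \<in> carrier K" "y \<noteq> \<zero>" "val y = max 0 (- val x)" using ex_val by blast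
  let ?z = "y \<otimes> x"
  have z: "?z \<in> carrier K" "?z \<noteq> \<zero>" "?z \<in> pid 0" "y \<in> pid 0" using x y by (auto simp: pid_def val_mult)
  have c: "isb (\<lambda>i. ?z *\<^sub>V a i)" by (rule isb_scale[OF ab(1) z(1,2)])
  have "?z *\<^sub>V a i \<in> A \<inter> B" if i: "i < dim" for i
  proof
    show "?z *\<^sub>V a i \<in> A" using rsubD(4)[OF latt_rsub[OF A] z(3)] lat_gen[OF ab(1) i] ab(2) by auto
    have "?z *\<^sub>V a i = y *\<^sub>V (x *\<^sub>V a i)"
      using x y isbD[OF ab(1)] i by (auto simp: smult_assoc1 Pi_def)
    thus "?z *\<^sub>V a i \<in> B" using rsubD(4)[OF latt_rsub[OF B] z(4) x(3)[OF i]] by simp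
  qed
  thus ?thesis using latt_sub[OF rsub_Int[OF latt_rsub[OF A] latt_rsub[OF B]] c _ A] by auto
qed

definition line :: "'v => 'v set"
  where "line b = {r *\<^sub>V b | r. r \<in> pid 0}"

lemma rsub_line:
  assumes "b \<in> carrier V"
  shows "rsub (pid 0) V (line b)" "b \<in> line b"
proof -
  have "b = \<one> *\<^sub>V b" using smult_one[OF assms] by simp
  thus "b \<in> line b" unfolding line_def using pid_one by blast
  show "rsub (pid 0) V (line b)"
    unfolding rsub_def
  proof (intro conjI ballI)
    show "0\<^sub>V \<in> line b" unfolding line_def using pid_zero[of 0] lmult_0[OF assms] by (metis (mono_tags, lifting) mem_Collect_eq)
    show "x +\<^sub>V y \<in> line b" if xy: "x \<in> line b" "y \<in> line b" for x y :: 'v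
    proof -
      obtain r s where *: "x = r *\<^sub>V b" "r \<in> pid 0" "y = s *\<^sub>V b" "s \<in> pid 0" using xy by (auto simp: line_def)
      have "x +\<^sub>V y = (r \<oplus> s) *\<^sub>V b" using * assms smult_l_distr[OF pid_closed pid_closed] by simp
      thus ?thesis unfolding line_def using pid_add[OF *(2,4)] by blast
    qed
    show "r *\<^sub>V x \<in> line b" if r: "r \<in> pid 0" and x: "x \<in> line b" for r x
    proof -
      obtain s where *: "x = s *\<^sub>V b" "s \<in> pid 0" using x by (auto simp: line_def)
      have "r *\<^sub>V x = (r \<otimes> s) *\<^sub>V b" using * r assms smult_assoc1[OF pid_closed pid_closed] by simp
      thus ?thesis unfolding line_def using pid_mult[OF r *(2)] by auto
    qed
  qed (use assms in "auto simp: line_def")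
qed

lemma line_least: "rsub (pid 0) V N ==> b \<in> N ==> line b \<subseteq> N"
  by (auto simp: line_def rsub_def)

lemma lc_split:
  assumes a: "a \<in> ktup n" and c: "c \<in> vtup n" and j: "j < n"
  shows "lc V n a c = a j *\<^sub>V c j +\<^sub>V lc V n (a(j := \<zero>)) c"
proof -
  have "lc V n a c = lc V n (\<lambda>i. a j \<otimes> (if i = j then \<one> else \<zero>) \<oplus> (a(j := \<zero>)) i) c"
    by (rule lc_cong) (use a c j in "auto simp: Pi_def")
  also have "\<dots> = lc V n (\<lambda>i. a j \<otimes> (if i = j then \<one> else \<zero>)) c +\<^sub>V lc V n (a(j := \<zero>)) c"
    by (rule lc_add) (use a c j in auto)
  also have "lc V n (\<lambda>i. a j \<otimes> (if i = j then \<one> else \<zero>)) c = a j *\<^sub>V c j"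
    by (subst lc_smult) (use a c j lc_single[OF j c] in auto)
  finally show ?thesis .
qed

text \<open>Some coordinate of \<open>b\<close> in a basis of \<open>A\<close> has order exactly -1:
  all are at least -1 and not all are integral. Exchanging the corresponding basis vector for
  \<open>b\<close> gives a basis of the sum.\<close>

lemma vol_step:
  assumes A: "latt A" and b: "b \<in> carrier V" "b \<notin> A" and p: "p \<in> carrier K" "p \<noteq> \<zero>" "val p = 1"
    and pb: "p *\<^sub>V b \<in> A"
  shows "latt (lsum A (line b))" "vol (lsum A (line b)) = vol A - 1"
proof -
  obtain c where c: "isb c" "A = lat c" using A by (rule lattE)
  note cc = isbD[OF c(1)]
  let ?a = "tcoord K V dim c b"
  have a: "?a \<in> ktup dim" "lc V dim ?a c = b" using tcoord[OF c(1) b(1)] by auto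
  have pa: "p \<otimes> ?a i \<in> pid 0" if i: "i < dim" for i
  proof -
    obtain r where r: "r \<in> {..<dim} \<rightarrow> pid 0" "p *\<^sub>V b = lc V dim r c" using pb c(2) by (auto simp: lspan_def)
    have "lc V dim (\<lambda>i. p \<otimes> ?a i) c = lc V dim r c" using r(2) a lc_smult[OF a(1) cc p(1)] by simp
    hence "p \<otimes> ?a i = r i"
      using lc_inject[OF c(1), of "\<lambda>i. p \<otimes> ?a i" r i] a r p i pid_closed[of _ 0] by auto
    thus ?thesis using r i by auto
  qed
  have ge: "?a i = \<zero> \<or> - 1 \<le> val (?a i)" if i: "i < dim" for i
  proof (cases "?a i = \<zero>")
    case False
    moreover have "?a i \<in> carrier K" using a(1) i by auto
    ultimately show ?thesis using pa[OF i] p by (simp add: pid_def val_mult)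
  qed simp
  have "\<exists>j<dim. ?a j \<notin> pid 0"
  proof (rule ccontr)
    assume "\<not> ?thesis"
    hence "?a \<in> {..<dim} \<rightarrow> pid 0" by auto
    hence "b \<in> A" unfolding c(2) lspan_def using a(2)[symmetric] by blast
    thus False using b(2) by simp
  qed
  then obtain j where j: "j < dim" "?a j \<notin> pid 0" by blast
  have aj: "?a j \<in> carrier K" "?a j \<noteq> \<zero>" "val (?a j) = -1"
    using j ge[OF j(1)] a(1) by (auto simp: pid_def)
  let ?c = "c(j := b)"
  have Dc: "Dt ?c = ?a j \<otimes> Dt c" using tdet_replace[OF ref cc a(1) j(1)] a(2) by simp
  have cc': "?c \<in> vtup dim" using cc b by auto
  have ic: "isb ?c"
    by (rule tdet_btuple[OF ref cc']) (use Dc aj Dt_nz[OF c(1)] in auto)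
  have vc: "vol (lat ?c) = vol A - 1"
    using vol_lat[OF ic] vol_lat[OF c(1)] c(2) Dc aj Dt_nz[OF c(1)] by (simp add: val_mult)
  \<comment> \<open>The expansion of \<open>b\<close> is solved for \<open>c j\<close>. The inverse
    of \<open>?a j\<close> has order 1 and so absorbs the coordinates of order -1 in the remaining
    part \<open>?w\<close>.\<close>
  have cj: "c j \<in> lat ?c"
  proof -
    let ?w = "lc V dim (?a(j := \<zero>)) c"
    have a0: "?a(j := \<zero>) \<in> ktup dim" using a(1) by auto
    have w: "?w \<in> carrier V" using a0 cc by simp
    have cjV: "c j \<in> carrier V" using cc j by auto
    have bw: "b = ?a j *\<^sub>V c j +\<^sub>V ?w" using lc_split[OF a(1) cc j(1)] a(2) by simp
    have solve: "(inv y) *\<^sub>V (y *\<^sub>V u +\<^sub>V z) +\<^sub>V (\<ominus> (inv y)) *\<^sub>V z = u"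
      if "y \<in> carrier K" "y \<noteq> \<zero>" "u \<in> carrier V" "z \<in> carrier V" for y u z
      using that by (simp add: smult_r_distr smult_inv_cancel M.a_assoc smult_l_minus M.r_neg)
    have "inv (?a j) *\<^sub>V b +\<^sub>V (\<ominus> (inv (?a j))) *\<^sub>V ?w = c j"
      using solve[OF aj(1,2) cjV w] arg_cong[OF bw, of "\<lambda>z. inv (?a j) *\<^sub>V z +\<^sub>V ((\<ominus> (inv (?a j))) *\<^sub>V ?w)"]
      by (rule trans[rotated])
    moreover have "(\<ominus> (inv (?a j))) *\<^sub>V ?w \<in> lat ?c"
    proof -
      have "(\<ominus> (inv (?a j))) *\<^sub>V ?w = lc V dim (\<lambda>i. (\<ominus> (inv (?a j))) \<otimes> (?a(j := \<zero>)) i) c"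
        by (rule lc_smult[symmetric, OF a0 cc]) (use aj in auto)
      also have "\<dots> = lc V dim (\<lambda>i. (\<ominus> (inv (?a j))) \<otimes> (?a(j := \<zero>)) i) ?c"
        unfolding lc_def
        by (rule M.finsum_cong') (use a0 aj cc' cc b in "auto simp: Pi_def")
      finally have e: "(\<ominus> (inv (?a j))) *\<^sub>V ?w = lc V dim (\<lambda>i. (\<ominus> (inv (?a j))) \<otimes> (?a(j := \<zero>)) i) ?c" .
      have "(\<ominus> (inv (?a j))) \<otimes> (?a(j := \<zero>)) i \<in> pid 0" if i: "i < dim" for i
      proof -
        have "(?a(j := \<zero>)) i \<in> pid (-1)" using ge[OF i] a(1) i by (auto simp: pid_def)
        moreover have "\<ominus> (inv (?a j)) \<in> pid 1" using aj by (simp add: pid_def val_inv)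
        ultimately show ?thesis using pid_mult[of _ 1 _ "-1"] by auto
      qed
      thus ?thesis unfolding e lspan_def by blast
    qed
    moreover have "inv (?a j) *\<^sub>V b \<in> lat ?c"
      using rsubD(4)[OF rsub_lat[OF ic], of "inv (?a j)" b] lat_gen[OF ic j(1)] aj
      by (simp add: pid_def val_inv)
    ultimately show ?thesis using rsubD(3)[OF rsub_lat[OF ic]] by metis
  qed
  have gen: "c i \<in> lat ?c" if "i < dim" for i
    using cj lat_gen[OF ic that] by (cases "i = j") auto
  have "lsum A (line b) = lat ?c"
  proof
    have "A \<subseteq> lat ?c" unfolding c(2) by (rule lspan_least[OF pid_subring rsub_lat[OF ic]]) (use gen in auto)
    moreover have "line b \<subseteq> lat ?c" by (rule line_least[OF rsub_lat[OF ic]]) (use lat_gen[OF ic j(1)] in simp)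
    ultimately show "lsum A (line b) \<subseteq> lat ?c" by (rule lsum_least[OF rsub_lat[OF ic]])
    note rs = rsub_lsum[OF pid_subring latt_rsub[OF A] rsub_line(1)[OF b(1)]]
    have "b \<in> lsum A (line b)" using rs(3) rsub_line(2)[OF b(1)] by blast
    moreover have "c i \<in> lsum A (line b)" if "i < dim" for i
      using rs(2) lat_gen[OF c(1) that] c(2) by blast
    ultimately show "lat ?c \<subseteq> lsum A (line b)"
      by (intro lspan_least[OF pid_subring rs(1)]) auto
  qed
  thus "latt (lsum A (line b))" "vol (lsum A (line b)) = vol A - 1"
    using ic vc by (auto simp: latt_def)
qed

text \<open>Among the multiples of a vector of \<open>B\<close> outside \<open>A\<close> by powers
  of \<open>p\<close>, the last one outside \<open>A\<close> has the property.\<close>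

lemma ex_step:
  assumes A: "latt A" and B: "latt B" and nsub: "\<not> B \<subseteq> A" and p: "p \<in> carrier K" "p \<noteq> \<zero>" "val p = 1"
  shows "\<exists>b\<in>B. b \<notin> A \<and> p *\<^sub>V b \<in> A"
proof -
  obtain x where x: "x \<in> B" "x \<notin> A" using nsub by blast
  have xV: "x \<in> carrier V" using x(1) rsubD(1)[OF latt_rsub[OF B]] by auto
  obtain a where a: "isb a" "A = lat a" using A by (rule lattE)
  obtain y where y: "y \<in> carrier K" "y \<noteq> \<zero>" "y *\<^sub>V x \<in> A"
    using bounded_denominators[of "{x}", OF _ _ a(1)] xV a(2) by auto
  have pR: "p \<in> pid 0" using p by (simp add: pid_def)
  \<comment> \<open>With \<open>y x\<close> in \<open>A\<close>, the power of \<open>p\<close> with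
    exponent \<open>nat (val y)\<close> suffices, because its quotient by \<open>y\<close> is
    integral.\<close>
  have ex: "\<exists>m::nat. (p [^] m) *\<^sub>V x \<in> A"
  proof
    let ?m = "nat (val y)"
    have pm: "p [^] m \<in> carrier K" "p [^] m \<noteq> \<zero>" "val (p [^] m) = int m" for m :: nat
      by (induction m) (use p in "auto simp: val_mult")
    let ?r = "p [^] ?m \<otimes> inv y"
    have "?r \<in> pid 0" using pm[of ?m] y by (auto simp: pid_def val_mult val_inv)
    hence "?r *\<^sub>V (y *\<^sub>V x) \<in> A" using rsubD(4)[OF latt_rsub[OF A]] y by blast
    moreover have "?r *\<^sub>V (y *\<^sub>V x) = (p [^] ?m) *\<^sub>V x"
      using pm(1)[of ?m] y xV by (simp add: smult_assoc1[symmetric])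
    ultimately show "(p [^] ?m) *\<^sub>V x \<in> A" by simp
  qed
  define m where "m = (LEAST m::nat. (p [^] m) *\<^sub>V x \<in> A)"
  have m: "(p [^] m) *\<^sub>V x \<in> A" unfolding m_def using ex by (rule LeastI_ex)
  have "m \<noteq> 0" using m x(2) xV by (metis nat_pow_0 smult_one)
  then obtain k where k: "m = Suc k" by (cases m) auto
  have nk: "(p [^] k) *\<^sub>V x \<notin> A" using not_less_Least[of k "\<lambda>m. (p [^] m) *\<^sub>V x \<in> A"] k m_def by simp
  have "p [^] k \<in> pid 0" by (induction k) (use pR pid_mult[of _ 0 _ 0] in auto)
  hence "(p [^] k) *\<^sub>V x \<in> B" using rsubD(4)[OF latt_rsub[OF B]] x by blast
  moreover have "p *\<^sub>V ((p [^] k) *\<^sub>V x) = (p [^] m) *\<^sub>V x"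
    using p xV k by (simp add: smult_assoc1[symmetric] m_comm)
  ultimately show ?thesis using nk m by (intro bexI[of _ "(p [^] k) *\<^sub>V x"]) auto
qed

text \<open>Vectors of \<open>B\<close> are adjoined to \<open>A\<close> one at a time. Each step
  leaves the sum unchanged and lowers the volumes of \<open>A\<close> and of the intersection by
  one; the induction is on the distance from \<open>A\<close> to the sum.\<close>

lemma vol_modular:
  assumes "latt A" "latt B"
  shows "vol A + vol B = vol (lsum A B) + vol (A \<inter> B)"
proof -
  obtain p where p: "p \<in> carrier K" "p \<noteq> \<zero>" "val p = 1" using ex_val by blast
  show ?thesis
    using assms
  proof (induction "nat (vol A - vol (lsum A B))" arbitrary: A rule: less_induct)
    case less
    note A = \<open>latt A\<close> and B = \<open>latt B\<close>
    note rA = latt_rsub[OF A] and rB = latt_rsub[OF B]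
    note S = rsub_lsum[OF pid_subring rA rB]
    show ?case
    proof (cases "B \<subseteq> A")
      case True
      hence "lsum A B = A" using S(2) lsum_least[OF rA] by blast
      thus ?thesis using True by (simp add: Int_absorb1)
    next
      case False
      obtain b where b: "b \<in> B" "b \<notin> A" "p *\<^sub>V b \<in> A" using ex_step[OF A B False p] by blast
      have bV: "b \<in> carrier V" using b rsubD(1)[OF rB] by auto
      let ?A = "lsum A (line b)"
      note st = vol_step[OF A bV b(2) p b(3)]
      note rA' = latt_rsub[OF st(1)]
      note T = rsub_lsum[OF pid_subring rA rsub_line(1)[OF bV]]
      have e1: "lsum ?A B = lsum A B"
      proof
        show "lsum ?A B \<subseteq> lsum A B"
          by (intro lsum_least[OF S(1)] S) (use S line_least[OF rB b(1)] in auto)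
        show "lsum A B \<subseteq> lsum ?A B"
          using T rsub_lsum[OF pid_subring rA' rB] by (intro lsum_least[OF rsub_lsum(1)[OF pid_subring rA' rB]]) auto
      qed
      have lI: "latt (A \<inter> B)" by (rule latt_Int[OF A B])
      have pB: "p *\<^sub>V b \<in> B" using rsubD(4)[OF rB _ b(1)] p by (simp add: pid_def)
      have bI: "b \<notin> A \<inter> B" "p *\<^sub>V b \<in> A \<inter> B" using b pB by auto
      note st2 = vol_step[OF lI bV bI(1) p bI(2)]
      \<comment> \<open>The modular law of submodules: multiples of \<open>b\<close> lie in
        \<open>B\<close>, so a vector of the enlarged lattice lies in \<open>B\<close> exactly when
        its part in \<open>A\<close> does.\<close>
      have e2: "?A \<inter> B = lsum (A \<inter> B) (line b)"
      proof
        show "lsum (A \<inter> B) (line b) \<subseteq> ?A \<inter> B"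
          by (rule lsum_least[OF rsub_Int[OF rA' rB]]) (use T line_least[OF rB b(1)] in auto)
        show "?A \<inter> B \<subseteq> lsum (A \<inter> B) (line b)"
        proof
          fix x assume x: "x \<in> ?A \<inter> B"
          then obtain u l where ul: "u \<in> A" "l \<in> line b" "x = u +\<^sub>V l" by (auto simp: lsum_def)
          have lB: "l \<in> B" using ul line_least[OF rB b(1)] by auto
          have cs: "u \<in> carrier V" "l \<in> carrier V" using ul lB rsubD(1)[OF rA] rsubD(1)[OF rB] by auto
          have "u = x +\<^sub>V (\<ominus> \<one>) *\<^sub>V l" using ul(3) cs by (simp add: M.a_assoc smult_minus_1 M.r_neg)
          moreover have "(\<ominus> \<one>) *\<^sub>V l \<in> B" using rsubD(4)[OF rB _ lB] pid_uminus[OF pid_one] by simp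
          ultimately have "u \<in> B" using rsubD(3)[OF rB] x by auto
          thus "x \<in> lsum (A \<inter> B) (line b)" using ul by (auto simp: lsum_def)
        qed
      qed
      have "vol (lsum A B) \<le> vol ?A"
        using vol_mono[OF st(1) latt_lsum[OF st(1) B]] e1 rsub_lsum(2)[OF pid_subring rA' rB] by simp
      hence "nat (vol ?A - vol (lsum ?A B)) < nat (vol A - vol (lsum A B))" using st(2) e1 by simp
      from less.hyps[OF this st(1) B] show ?thesis using st(2) st2(2) e1 e2 by simp
    qed
  qed
qed

end

section \<open>Quadratic lattices over a discrete valuation ring\<close>

locale dvquad = dvspace K V val for K :: "'k ring" (structure) and V :: "('k, 'v) module" and val +
  fixes \<phi> :: "'v => 'v => 'k"
  assumes qs: "quadratic_space K V \<phi>"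
begin

text \<open>The polar form of the quadratic form. \<open>dual_lattice\<close> is defined with
  respect to it.\<close>

definition bil :: "'v => 'v => 'k"
  where "bil x y = \<phi> x y \<oplus> \<phi> x y"

lemma phi_closed [simp]: "x \<in> carrier V ==> y \<in> carrier V ==> \<phi> x y \<in> carrier K"
  using qs by (simp add: quadratic_space_def)

lemma phi_add_l: "x \<in> carrier V ==> y \<in> carrier V ==> z \<in> carrier V ==> \<phi> (x +\<^sub>V y) z = \<phi> x z \<oplus> \<phi> y z"
  using qs unfolding quadratic_space_def by blast

lemma phi_smult_l: "a \<in> carrier K ==> x \<in> carrier V ==> y \<in> carrier V ==> \<phi> (a *\<^sub>V x) y = a \<otimes> \<phi> x y"
  using qs unfolding quadratic_space_def by blast

lemma phi_sym: "x \<in> carrier V ==> y \<in> carrier V ==> \<phi> x y = \<phi> y x"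
  using qs by (simp add: quadratic_space_def)

lemma phi_nondeg: "x \<in> carrier V ==> (\<And>y. y \<in> carrier V ==> \<phi> x y = \<zero>) ==> x = 0\<^sub>V"
  using qs by (simp add: quadratic_space_def)

lemma phi_add_r: "x \<in> carrier V ==> y \<in> carrier V ==> z \<in> carrier V ==> \<phi> z (x +\<^sub>V y) = \<phi> z x \<oplus> \<phi> z y"
  using phi_add_l[of x y z] phi_sym[of z x] phi_sym[of z y] phi_sym[of z "x +\<^sub>V y"] by simp

lemma phi_smult_r: "a \<in> carrier K ==> x \<in> carrier V ==> y \<in> carrier V ==> \<phi> y (a *\<^sub>V x) = a \<otimes> \<phi> y x"
  using phi_smult_l[of a x y] phi_sym[of y x] phi_sym[of y "a *\<^sub>V x"] by simp

lemma bil_closed [simp]: "x \<in> carrier V ==> y \<in> carrier V ==> bil x y \<in> carrier K"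
  by (simp add: bil_def)

lemma bil_sym: "x \<in> carrier V ==> y \<in> carrier V ==> bil x y = bil y x"
  using phi_sym by (simp add: bil_def)

lemma bil_linfun:
  assumes "y \<in> carrier V"
  shows "linfun (\<lambda>x. bil x y)" "linfun (bil y)"
  using assms unfolding linfun_def
  by (auto simp: bil_def phi_add_l phi_smult_l phi_add_r phi_smult_r R.a_ac R.r_distr)

lemma phi_linfun:
  assumes "y \<in> carrier V"
  shows "linfun (\<lambda>x. \<phi> x y)" "linfun (\<phi> y)"
  using assms unfolding linfun_def
  by (auto simp: phi_add_l phi_smult_l phi_add_r phi_smult_r)

lemma bil_eq_zero: "x \<in> carrier V ==> y \<in> carrier V ==> bil x y = \<zero> ==> \<phi> x y = \<zero>"
  using D.double_eq_zero[of "\<phi> x y"] by (simp add: bil_def)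

lemma phi_square_add:
  assumes "x \<in> carrier V" "y \<in> carrier V"
  shows "\<phi> (x +\<^sub>V y) (x +\<^sub>V y) = \<phi> x x \<oplus> (\<phi> y y \<oplus> bil x y)"
  using assms phi_sym[of x y] by (simp add: phi_add_l phi_add_r bil_def R.a_ac)

lemma phi_square_smult:
  "a \<in> carrier K ==> x \<in> carrier V ==> \<phi> (a *\<^sub>V x) (a *\<^sub>V x) = a \<otimes> (a \<otimes> \<phi> x x)"
  by (simp add: phi_smult_l phi_smult_r)

definition integral_on :: "'v set => bool"
  where "integral_on L \<longleftrightarrow> (\<forall>x\<in>L. \<phi> x x \<in> pid 0)"

text \<open>Polarization: \<open>bil x y\<close> is the value at the sum minus the values at
  \<open>x\<close> and at \<open>y\<close>.\<close>

lemma integral_bil: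
  assumes "rsub (pid 0) V L" "integral_on L" "x \<in> L" "y \<in> L"
  shows "bil x y \<in> pid 0"
proof -
  have c: "x \<in> carrier V" "y \<in> carrier V" using rsubD(1)[OF assms(1)] assms by auto
  have "\<phi> (x +\<^sub>V y) (x +\<^sub>V y) \<in> pid 0" "\<phi> x x \<in> pid 0" "\<phi> y y \<in> pid 0"
    using assms rsubD(3)[OF assms(1)] by (auto simp: integral_on_def)
  hence "(\<phi> x x \<oplus> (\<phi> y y \<oplus> bil x y)) \<oplus> (\<ominus> \<phi> x x \<oplus> \<ominus> \<phi> y y) \<in> pid 0"
    using phi_square_add[OF c] by (simp add: pid_add pid_uminus)
  moreover have "(\<phi> x x \<oplus> (\<phi> y y \<oplus> bil x y)) \<oplus> (\<ominus> \<phi> x x \<oplus> \<ominus> \<phi> y y) = bil x y"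
  proof -
    have "(a \<oplus> (b \<oplus> z)) \<oplus> (\<ominus> a \<oplus> \<ominus> b) = z" if "a \<in> carrier K" "b \<in> carrier K" "z \<in> carrier K" for a b z
      using that by algebra
    thus ?thesis using c by simp
  qed
  ultimately show ?thesis by simp
qed

section \<open>Duality and discriminants\<close>

abbreviation dual :: "'v set => 'v set"
  where "dual L \<equiv> dual_lattice K (pid 0) V \<phi> L"

lemma dual_def: "dual L = {x \<in> carrier V. \<forall>y\<in>L. bil x y \<in> pid 0}"
  by (simp add: dual_lattice_def bil_def)

definition gram :: "(nat => 'v) => nat => nat => 'k"
  where "gram b i j = bil (b i) (b j)"

lemma is_mat_gram: "b \<in> vtup n ==> R.is_mat n (gram b)"
  by (auto simp: R.is_mat_def gram_def Pi_def)

text \<open>The map \<open>T\<close>, which takes \<open>x\<close> to the combination of the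
  \<open>b i\<close> with coefficients \<open>bil x (b i)\<close>, is injective by nondegeneracy;
  the preimages of the \<open>b j\<close> form the dual basis.\<close>

lemma ex_dual_basis:
  assumes b: "isb b"
  shows "\<exists>c. isb c \<and> (\<forall>i<dim. \<forall>j<dim. bil (c j) (b i) = (if i = j then \<one> else \<zero>))"
proof -
  note bc = isbD[OF b]
  have bi: "b i \<in> carrier V" if "i < dim" for i using bc that by auto
  define T where "T x = lc V dim (\<lambda>i. bil x (b i)) b" for x
  have Tc: "(\<lambda>i. bil x (b i)) \<in> ktup dim" if "x \<in> carrier V" for x using that bi by auto
  have "T (x +\<^sub>V y) = T x +\<^sub>V T y" if "x \<in> carrier V" "y \<in> carrier V" for x y
  proof -
    have "T (x +\<^sub>V y) = lc V dim (\<lambda>i. bil x (b i) \<oplus> bil y (b i)) b"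
      unfolding T_def
      by (rule lc_cong) (use that bi bc bil_linfun(1) in "auto simp: linfun_def")
    thus ?thesis unfolding T_def using lc_add[OF Tc Tc bc] that by simp
  qed
  moreover have "T (r *\<^sub>V x) = r *\<^sub>V T x" if "x \<in> carrier V" "r \<in> carrier K" for x r
  proof -
    have "T (r *\<^sub>V x) = lc V dim (\<lambda>i. r \<otimes> bil x (b i)) b"
      unfolding T_def
      by (rule lc_cong) (use that bi bc bil_linfun(1) in "auto simp: linfun_def")
    thus ?thesis unfolding T_def using lc_smult[OF Tc bc] that by simp
  qed
  moreover have TV: "T x \<in> carrier V" if "x \<in> carrier V" for x
    unfolding T_def using Tc[OF that] bc by simp
  ultimately have Thom: "T \<in> module_hom K V V" by (auto simp: LinearCombinations.module_hom_def)
  have "isb (T \<circ> b)"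
  proof (rule independent_btuple[OF fin_dim])
    show "T \<circ> b \<in> vtup dim" using bi TV by auto
    fix a i assume a: "a \<in> ktup dim" "lc V dim a (T \<circ> b) = 0\<^sub>V" "i < dim"
    let ?x = "lc V dim a b"
    have xV: "?x \<in> carrier V" using a bc by simp
    have "T ?x = 0\<^sub>V" using hom_lc[OF Thom a(1) bc] a(2) by simp
    hence z: "bil ?x (b j) = \<zero>" if "j < dim" for j
      using btupleD(3)[OF b Tc[OF xV] _ that] by (simp add: T_def)
    have "\<phi> ?x y = \<zero>" if y: "y \<in> carrier V" for y
    proof (rule bil_eq_zero[OF xV y])
      have "bil ?x y = bil ?x (lc V dim (tcoord K V dim b y) b)" using tcoord(2)[OF b y] by simp
      also have "\<dots> = (\<Oplus>i\<in>{..<dim}. tcoord K V dim b y i \<otimes> bil ?x (b i))"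
        by (rule linfun_lc[OF bil_linfun(2)[OF xV] tcoord(1)[OF b y] bc])
      also have "\<dots> = \<zero>"
        by (rule R.add.finprod_one_eqI) (use z tcoord(3)[OF b y] in auto)
      finally show "bil ?x y = \<zero>" .
    qed
    hence "?x = 0\<^sub>V" by (intro phi_nondeg[OF xV])
    thus "a i = \<zero>" using btupleD(3)[OF b a(1) _ a(3)] by simp
  qed
  note Tb = this
  define c where "c j = lc V dim (tcoord K V dim (T \<circ> b) (b j)) b" for j
  have cV: "c j \<in> carrier V" if "j < dim" for j
    unfolding c_def using tcoord(1)[OF Tb bi[OF that]] bc by simp
  have Tcj: "T (c j) = b j" if "j < dim" for j
    unfolding c_def
    using hom_lc[OF Thom tcoord(1)[OF Tb bi[OF that]] bc] tcoord(2)[OF Tb bi[OF that]] by simp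
  have bil: "bil (c j) (b i) = (if i = j then \<one> else \<zero>)" if ij: "i < dim" "j < dim" for i j
  proof (rule lc_inject[OF b Tc[OF cV[OF ij(2)]] _ _ ij(1)])
    show "lc V dim (\<lambda>i. bil (c j) (b i)) b = lc V dim (\<lambda>i. if i = j then \<one> else \<zero>) b"
      using Tcj[OF ij(2)] lc_single[OF ij(2) bc] by (simp add: T_def)
  qed auto
  have cc: "c \<in> vtup dim" using cV by auto
  have "isb c"
  proof (rule independent_btuple[OF fin_dim cc])
    fix a i assume a: "a \<in> ktup dim" "lc V dim a c = 0\<^sub>V" "i < dim"
    have "\<zero> = bil (lc V dim a c) (b i)"
      using linfun_zero[OF bil_linfun(1)[OF bi[OF a(3)]]] a(2) by simp
    also have "\<dots> = (\<Oplus>j\<in>{..<dim}. a j \<otimes> bil (c j) (b i))"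
      by (rule linfun_lc[OF bil_linfun(1)[OF bi[OF a(3)]] a(1) cc])
    also have "\<dots> = a i \<otimes> bil (c i) (b i)"
      by (rule R.finsum_single) (use a bil[OF a(3)] in "auto simp: Pi_def")
    finally show "a i = \<zero>" using bil[OF a(3,3)] a by (auto simp: Pi_def)
  qed
  thus ?thesis using bil by blast
qed

lemma dual_coords:
  assumes b: "isb b" and c: "isb c" and bc: "\<And>i j. i < dim ==> j < dim ==> bil (c j) (b i) = (if i = j then \<one> else \<zero>)"
    and x: "x \<in> carrier V"
  shows "x = lc V dim (\<lambda>i. bil x (b i)) c"
proof -
  note t = tcoord[OF c x] and cc = isbD[OF c]
  have bi: "b i \<in> carrier V" if "i < dim" for i using isbD[OF b] that by auto
  have "bil x (b i) = tcoord K V dim c x i" if i: "i < dim" for i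
  proof -
    have "bil x (b i) = bil (lc V dim (tcoord K V dim c x) c) (b i)" using t(2) by simp
    also have "\<dots> = (\<Oplus>j\<in>{..<dim}. tcoord K V dim c x j \<otimes> bil (c j) (b i))"
      by (rule linfun_lc[OF bil_linfun(1)[OF bi[OF i]] t(1) cc])
    also have "\<dots> = tcoord K V dim c x i \<otimes> bil (c i) (b i)"
      by (rule R.finsum_single) (use i t bc in auto)
    finally show ?thesis using bc[OF i i] t(3)[OF i] by simp
  qed
  hence "lc V dim (\<lambda>i. bil x (b i)) c = lc V dim (tcoord K V dim c x) c"
    using t(1) cc by (intro lc_cong) auto
  thus ?thesis using t(2) by simp
qed

lemma lat_bil_mem:
  assumes b: "b \<in> vtup n" and x: "x \<in> carrier V"
    and i: "\<And>i. i < n ==> bil x (b i) \<in> pid 0" and y: "y \<in> lspan (pid 0) V n b"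
  shows "bil x y \<in> pid 0"
proof -
  note f = bil_linfun(2)[OF x]
  have "rsub (pid 0) V {y \<in> carrier V. bil x y \<in> pid 0}"
    unfolding rsub_def
    using f linfun_zero[OF f] pid_mult[of _ 0 _ 0] pid_closed[of _ 0]
    by (auto simp: linfun_def pid_add)
  hence "lspan (pid 0) V n b \<subseteq> {y \<in> carrier V. bil x y \<in> pid 0}"
    by (rule lspan_least[OF pid_subring]) (use i b in auto)
  thus ?thesis using y by auto
qed

text \<open>Expanding the value at a sum brings in \<open>bil\<close> on pairs of generators, not
  \<open>\<phi>\<close>; this is the condition that remains meaningful in residue characteristic
  2.\<close>

lemma integral_lspan:
  assumes b: "b \<in> vtup n" and q: "\<And>i. i < n ==> \<phi> (b i) (b i) \<in> pid 0"
    and g: "\<And>i j. i < n ==> j < n ==> bil (b i) (b j) \<in> pid 0"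
  shows "integral_on (lspan (pid 0) V n b)"
proof -
  have "\<phi> (lc V n a b) (lc V n a b) \<in> pid 0" if "a \<in> {..<n} \<rightarrow> pid 0" for a
    using that b q g
  proof (induction n)
    case 0
    have "\<phi> 0\<^sub>V 0\<^sub>V = \<zero>" using linfun_zero[OF phi_linfun(1)] by simp
    thus ?case by (simp add: lc_def)
  next
    case (Suc n)
    let ?x = "lc V n a b"
    have a: "a \<in> {..<n} \<rightarrow> pid 0" "a n \<in> pid 0" and b: "b \<in> vtup n" "b n \<in> carrier V" using Suc.prems by auto
    have aK: "a \<in> ktup (Suc n)" using Suc.prems(1) pid_carrier[of 0] by auto
    have c: "a n \<in> carrier K" "?x \<in> carrier V" using aK b by (auto intro!: lc_closed)
    have "bil (b n) ?x \<in> pid 0"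
      by (rule lat_bil_mem[OF b]) (use Suc.prems(4) a(1) in "auto simp: lspan_def")
    hence "a n \<otimes> bil (b n) ?x \<in> pid 0" "a n \<otimes> (a n \<otimes> \<phi> (b n) (b n)) \<in> pid 0"
      using pid_mult[of _ 0 _ 0] a(2) Suc.prems(3)[of n] by auto
    moreover have "\<phi> ?x ?x \<in> pid 0" using Suc.IH[OF a(1) b(1)] Suc.prems(3,4) by simp
    moreover have "bil (a n *\<^sub>V b n) ?x = a n \<otimes> bil (b n) ?x"
      using bil_linfun(1)[OF c(2)] c(1) b(2) by (simp add: linfun_def)
    ultimately show ?case
      unfolding lc_Suc[OF aK Suc.prems(2)]
      using c b(2) by (simp add: phi_square_add phi_square_smult pid_add)
  qed
  thus ?thesis by (auto simp: integral_on_def lspan_def)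
qed

lemma dual_lat:
  assumes b: "isb b" and c: "isb c" and bc: "\<And>i j. i < dim ==> j < dim ==> bil (c j) (b i) = (if i = j then \<one> else \<zero>)"
  shows "dual (lat b) = lat c"
proof
  have cb: "bil (b i) (c j) = (if i = j then \<one> else \<zero>)" if "i < dim" "j < dim" for i j
    using bc[OF that] bil_sym[of "b i" "c j"] isbD[OF b] isbD[OF c] that by (auto simp: Pi_def)
  show "dual (lat b) \<subseteq> lat c"
  proof
    fix x assume x: "x \<in> dual (lat b)"
    hence "x \<in> carrier V" "(\<lambda>i. bil x (b i)) \<in> {..<dim} \<rightarrow> pid 0"
      using lat_gen[OF b] by (auto simp: dual_def)
    thus "x \<in> lat c" using dual_coords[OF b c bc] unfolding lspan_def by blast
  qed
  show "lat c \<subseteq> dual (lat b)"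
  proof
    fix x assume x: "x \<in> lat c"
    hence xV: "x \<in> carrier V" using rsubD(1)[OF rsub_lat[OF c]] by auto
    have bx: "bil x (b i) \<in> pid 0" if i: "i < dim" for i
    proof -
      have "b i \<in> carrier V" using isbD[OF b] i by auto
      moreover have "bil (b i) x \<in> pid 0"
        by (rule lat_bil_mem[OF isbD[OF c] _ _ x]) (use cb[OF i] calculation in auto)
      ultimately show ?thesis using bil_sym xV by simp
    qed
    thus "x \<in> dual (lat b)" using lat_bil_mem[OF isbD[OF b] xV bx] xV by (auto simp: dual_def)
  qed
qed

lemma latt_dual: "latt L ==> latt (dual L)"
proof -
  assume "latt L"
  then obtain b where b: "isb b" "L = lat b" by (rule lattE)
  obtain c where "isb c" "\<And>i j. i < dim ==> j < dim ==> bil (c j) (b i) = (if i = j then \<one> else \<zero>)"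
    using ex_dual_basis[OF b(1)] by blast
  thus ?thesis using dual_lat[OF b(1)] b(2) by (auto simp: latt_def)
qed

text \<open>Being dual bases is a symmetric relation.\<close>

lemma dual_dual: assumes L: "latt L" shows "dual (dual L) = L"
proof -
  obtain b where b: "isb b" "L = lat b" using L by (rule lattE)
  obtain c where c: "isb c" "\<And>i j. i < dim ==> j < dim ==> bil (c j) (b i) = (if i = j then \<one> else \<zero>)"
    using ex_dual_basis[OF b(1)] by blast
  have cb: "bil (b i) (c j) = (if j = i then \<one> else \<zero>)" if "i < dim" "j < dim" for i j
    using c(2)[OF that] bil_sym[of "b i" "c j"] isbD[OF b(1)] isbD[OF c(1)] that by (auto simp: Pi_def)
  have "dual (lat b) = lat c" by (rule dual_lat[OF b(1) c])
  moreover have "dual (lat c) = lat b" by (rule dual_lat[OF c(1) b(1)]) (rule cb)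
  ultimately show ?thesis using b(2) by simp
qed

text \<open>The order of the discriminant ideal, as \<open>index_ideal_eq\<close> will show.\<close>

definition disc :: "'v set => int"
  where "disc L = vol L - vol (dual L)"

text \<open>The Gram matrix is the transition matrix from the dual basis to
  \<open>b\<close>.\<close>

lemma disc_lat:
  assumes b: "isb b"
  shows "disc (lat b) = val (leibniz_det K dim (gram b))" "leibniz_det K dim (gram b) \<noteq> \<zero>"
proof -
  obtain c where c: "isb c" "\<And>i j. i < dim ==> j < dim ==> bil (c j) (b i) = (if i = j then \<one> else \<zero>)"
    using ex_dual_basis[OF b] by blast
  have G: "R.is_mat dim (gram b)" by (rule is_mat_gram[OF isbD[OF b]])
  have "Dt b = leibniz_det K dim (gram b) \<otimes> Dt c"
  proof (rule tdet_lc[OF ref isbD[OF c(1)] G])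
    fix i assume "i < dim"
    hence "b i \<in> carrier V" using isbD[OF b] by auto
    thus "b i = lc V dim (gram b i) c" using dual_coords[OF b c] by (simp add: gram_def[abs_def])
  qed
  note e = this
  thus nz: "leibniz_det K dim (gram b) \<noteq> \<zero>"
    using Dt_nz[OF b] Dt_nz[OF c(1)] by auto
  have "val (Dt b) = val (leibniz_det K dim (gram b)) + val (Dt c)"
    unfolding e by (rule val_mult) (use nz Dt_nz[OF c(1)] G in auto)
  thus "disc (lat b) = val (leibniz_det K dim (gram b))"
    by (simp add: disc_def vol_lat b dual_lat[OF b c] c(1))
qed

text \<open>The Gram matrix transforms into \<open>A G A^T\<close>, which produces the square of the
  determinant of \<open>A\<close>.\<close>

lemma det_gram_change:
  assumes d: "d \<in> vtup n" and A: "R.is_mat n A" and b: "\<And>i. i < n ==> b i = lc V n (A i) d"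
  shows "leibniz_det K n (gram b) = leibniz_det K n A \<otimes> (leibniz_det K n A \<otimes> leibniz_det K n (gram d))"
proof -
  let ?G = "gram d" and ?At = "\<lambda>i j. A j i"
  have G: "R.is_mat n ?G" by (rule is_mat_gram[OF d])
  have At: "R.is_mat n ?At" using A by (simp add: R.is_mat_def)
  have Ai: "A i \<in> ktup n" if "i < n" for i using A that by (auto simp: R.is_mat_def)
  have dk: "d k \<in> carrier V" if "k < n" for k using d that by auto
  have bV: "b i \<in> carrier V" if "i < n" for i using b[OF that] Ai[OF that] d by simp
  have 1: "bil (d k) (b j) = R.mat_prod n ?G ?At k j" if kj: "k < n" "j < n" for k j
  proof -
    have "bil (d k) (b j) = (\<Oplus>l\<in>{..<n}. A j l \<otimes> bil (d k) (d l))"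
      unfolding b[OF kj(2)] by (rule linfun_lc[OF bil_linfun(2)[OF dk[OF kj(1)]] Ai[OF kj(2)] d])
    also have "\<dots> = R.mat_prod n ?G ?At k j"
      unfolding R.mat_prod_def
      by (rule R.finsum_cong') (use Ai[OF kj(2)] dk kj in "auto simp: gram_def R.m_comm Pi_def")
    finally show ?thesis .
  qed
  have 2: "gram b i j = R.mat_prod n A (R.mat_prod n ?G ?At) i j" if ij: "i < n" "j < n" for i j
  proof -
    have "gram b i j = (\<Oplus>k\<in>{..<n}. A i k \<otimes> bil (d k) (b j))"
      unfolding gram_def b[OF ij(1)]
      by (rule linfun_lc[OF bil_linfun(1)[OF bV[OF ij(2)]] Ai[OF ij(1)] d])
    also have "\<dots> = R.mat_prod n A (R.mat_prod n ?G ?At) i j"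
      unfolding R.mat_prod_def[of n A]
      by (rule R.finsum_cong') (use 1 ij Ai[OF ij(1)] R.is_mat_prod[OF G At] in "auto simp: R.is_mat_def Pi_def")
    finally show ?thesis .
  qed
  have "leibniz_det K n (gram b) = leibniz_det K n (R.mat_prod n A (R.mat_prod n ?G ?At))"
    by (rule R.leibniz_det_cong[OF 2]) (use A G At in auto)
  also have "\<dots> = leibniz_det K n A \<otimes> (leibniz_det K n ?G \<otimes> leibniz_det K n ?At)"
    using A G At by (simp add: D.leibniz_det_mult)
  finally show ?thesis using A G by (simp add: R.leibniz_det_transpose R.m_ac)
qed

lemma disc_change:
  assumes "latt L" "latt N"
  shows "disc N = disc L + 2 * (vol N - vol L)"
proof -
  obtain b d where bd: "isb b" "N = lat b" "isb d" "L = lat d" using assms by (auto simp: latt_def)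
  let ?A = "\<lambda>i. tcoord K V dim d (b i)"
  have A: "R.is_mat dim ?A" by (rule is_mat_tcoord[OF bd(3) isbD[OF bd(1)]])
  have bA: "b i = lc V dim (?A i) d" if "i < dim" for i
    using tcoord(2)[OF bd(3)] isbD[OF bd(1)] that by (auto simp: Pi_def)
  have 1: "Dt b = leibniz_det K dim ?A \<otimes> Dt d"
    by (rule tdet_lc[OF ref isbD[OF bd(3)] A bA])
  hence nz: "leibniz_det K dim ?A \<noteq> \<zero>" using Dt_nz[OF bd(1)] Dt_nz[OF bd(3)] by auto
  have v: "vol N = val (leibniz_det K dim ?A) + vol L"
    using 1 nz A Dt_nz[OF bd(3)] by (simp add: bd vol_lat val_mult)
  have "leibniz_det K dim (gram b) = leibniz_det K dim ?A \<otimes> (leibniz_det K dim ?A \<otimes> leibniz_det K dim (gram d))"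
    by (rule det_gram_change[OF isbD[OF bd(3)] A bA])
  hence "disc N = 2 * val (leibniz_det K dim ?A) + disc L"
    using nz A disc_lat[OF bd(3)] is_mat_gram[OF isbD[OF bd(3)]]
    by (simp add: bd disc_lat val_mult)
  thus ?thesis using v by simp
qed

lemma maximal_lattice_iff:
  "maximal_lattice K (pid 0) V \<phi> M \<longleftrightarrow>
    latt M \<and> integral_on M \<and> (\<forall>L. latt L \<and> integral_on L \<and> M \<subseteq> L --> L = M)"
  unfolding maximal_lattice_def VectorSpace.maximal_def is_lattice_iff_latt integral_on_def by blast

text \<open>For integral \<open>N\<close> and maximal \<open>M\<close>, the lattice \<open>M + (M~ \<inter> N)\<close> is integral, so \<open>M~ \<inter> N \<subseteq> M\<close>.
  Comparing indices by means of the modular law and of duality yields the inequality of volumes.\<close>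

lemma vol_maximal_le:
  assumes M: "maximal_lattice K (pid 0) V \<phi> M" and N: "latt N" "integral_on N"
  shows "vol M \<le> vol N"
proof -
  have lM: "latt M" and iM: "integral_on M" and mx: "\<And>L. latt L ==> integral_on L ==> M \<subseteq> L ==> L = M"
    using M by (auto simp: maximal_lattice_iff)
  note rM = latt_rsub[OF lM] and rN = latt_rsub[OF N(1)]
  note lD = latt_dual[OF lM]
  note rD = latt_rsub[OF lD]
  let ?C = "dual M \<inter> N"
  have lC: "latt ?C" by (rule latt_Int[OF lD N(1)])
  note S = rsub_lsum[OF pid_subring rM latt_rsub[OF lC]]
  have "integral_on (lsum M ?C)"
    unfolding integral_on_def
  proof
    fix x assume "x \<in> lsum M ?C"
    then obtain a c where ac: "a \<in> M" "c \<in> dual M" "c \<in> N" "x = a +\<^sub>V c" by (auto simp: lsum_def)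
    have cs: "a \<in> carrier V" "c \<in> carrier V" using ac rsubD(1)[OF rM] by (auto simp: dual_def)
    have "bil a c \<in> pid 0" using ac(1,2) bil_sym[OF cs] by (auto simp: dual_def)
    moreover have "\<phi> a a \<in> pid 0" "\<phi> c c \<in> pid 0" using ac iM N(2) by (auto simp: integral_on_def)
    ultimately show "\<phi> x x \<in> pid 0" using phi_square_add[OF cs] ac(4) by (simp add: pid_add)
  qed
  hence "lsum M ?C = M" using mx[OF latt_lsum[OF lM lC] _ S(2)] by blast
  hence CM: "?C \<subseteq> M" using S(3) by simp
  have MD: "M \<subseteq> dual M" using integral_bil[OF rM iM] rsubD(1)[OF rM] by (auto simp: dual_def)
  have ND: "N \<subseteq> dual N" using integral_bil[OF rN N(2)] rsubD(1)[OF rN] by (auto simp: dual_def)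
  have CI: "?C = M \<inter> N" using CM MD by blast
  have 1: "vol (dual M) + vol N = vol (lsum (dual M) N) + vol (M \<inter> N)"
    using vol_modular[OF lD N(1)] CI by simp
  have lS: "latt (lsum (dual M) N)" by (rule latt_lsum[OF lD N(1)])
  note T = rsub_lsum[OF pid_subring rD rN]
  \<comment> \<open>Duality turns the sum into an intersection, and \<open>M\<close> is its own
    double dual.\<close>
  have "dual (lsum (dual M) N) = M \<inter> dual N"
  proof
    show "dual (lsum (dual M) N) \<subseteq> M \<inter> dual N"
    proof
      fix x assume x: "x \<in> dual (lsum (dual M) N)"
      hence "x \<in> dual (dual M)" using T(2) by (auto simp: dual_def[of "lsum (dual M) N"] dual_def[of "dual M"])
      moreover have "x \<in> dual N" using x T(3) by (auto simp: dual_def[of "lsum (dual M) N"] dual_def[of N])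
      ultimately show "x \<in> M \<inter> dual N" using dual_dual[OF lM] by simp
    qed
    show "M \<inter> dual N \<subseteq> dual (lsum (dual M) N)"
    proof
      fix x assume x: "x \<in> M \<inter> dual N"
      hence xV: "x \<in> carrier V" by (auto simp: dual_def)
      have xdd: "x \<in> dual (dual M)" using x dual_dual[OF lM] by simp
      have "bil x y \<in> pid 0" if "y \<in> lsum (dual M) N" for y
      proof -
        obtain u v where uv: "y = u +\<^sub>V v" "u \<in> dual M" "v \<in> N" using \<open>y \<in> _\<close> by (auto simp: lsum_def)
        have cs: "u \<in> carrier V" "v \<in> carrier V" using uv rsubD(1)[OF rN] by (auto simp: dual_def)
        have "bil x y = bil x u \<oplus> bil x v"
          using bil_linfun(2)[OF xV] cs uv(1) by (simp add: linfun_def)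
        moreover have "bil x u \<in> pid 0" using xdd uv(2) by (auto simp: dual_def)
        moreover have "bil x v \<in> pid 0" using x uv(3) by (auto simp: dual_def)
        ultimately show ?thesis by (simp add: pid_add)
      qed
      thus "x \<in> dual (lsum (dual M) N)" using xV by (auto simp: dual_def)
    qed
  qed
  hence "disc (lsum (dual M) N) = vol (lsum (dual M) N) - vol (M \<inter> dual N)" by (simp add: disc_def)
  \<comment> \<open>The discriminant of the sum is computed a second time, by comparison with
    \<open>M\<close>. Together with \<open>1\<close> this gives that the volume of \<open>N\<close>
    exceeds that of \<open>M\<close> by as much as the volume of \<open>M \<inter> N\<close> exceeds
    that of \<open>M \<inter> dual N\<close>.\<close>
  moreover have "disc (lsum (dual M) N) = disc M + 2 * (vol (lsum (dual M) N) - vol M)"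
    by (rule disc_change[OF lM lS])
  ultimately have 2: "vol (lsum (dual M) N) + vol (M \<inter> dual N) = vol (dual M) + vol M"
    by (simp add: disc_def)
  have "vol (M \<inter> dual N) \<le> vol (M \<inter> N)"
    by (rule vol_mono[OF latt_Int[OF lM N(1)] latt_Int[OF lM latt_dual[OF N(1)]]]) (use ND in auto)
  thus ?thesis using 1 2 by simp
qed

lemma disc_maximal_unique:
  assumes "maximal_lattice K (pid 0) V \<phi> M" "maximal_lattice K (pid 0) V \<phi> M'"
  shows "vol M = vol M'" "disc M = disc M'"
proof -
  have l: "latt M" "latt M'" "integral_on M" "integral_on M'" using assms by (auto simp: maximal_lattice_iff)
  show "vol M = vol M'" using vol_maximal_le[OF assms(1) l(2,4)] vol_maximal_le[OF assms(2) l(1,3)] by simp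
  thus "disc M = disc M'" using disc_change[OF l(1,2)] by simp
qed

end

subsection \<open>The orthogonal complement of a vector\<close>

locale dvquad_vec = dvquad K V val \<phi> for K :: "'k ring" (structure) and V :: "('k, 'v) module" and val and \<phi> +
  fixes h :: 'v
  assumes hV: "h \<in> carrier V" and hq: "\<phi> h h \<noteq> \<zero>"
begin

abbreviation W :: "('k, 'v) module" where "W \<equiv> orth_space K V \<phi> h"

lemma carrier_W: "carrier W = {x \<in> carrier V. \<phi> x h = \<zero>}"
  by (simp add: orth_space_def)

lemma W_ops [simp]: "x \<oplus>\<^bsub>W\<^esub> y = x +\<^sub>V y" "\<zero>\<^bsub>W\<^esub> = 0\<^sub>V" "a \<odot>\<^bsub>W\<^esub> x = a *\<^sub>V x"
  by (simp_all add: orth_space_def)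

lemma W_V: "x \<in> carrier W ==> x \<in> carrier V" by (simp add: carrier_W)

lemma vspace_W: "vectorspace K W"
proof -
  note f = phi_linfun(1)[OF hV]
  have "submodule K (carrier W) V"
    unfolding submodule_def
    using f linfun_zero[OF f] module_axioms
    by (auto simp: carrier_W linfun_def)
  hence "subspace K (carrier W) V" by (simp add: VectorSpace.subspace_def vectorspace_axioms)
  hence "vectorspace K (V\<lparr>carrier := carrier W\<rparr>)" by (rule subspace_is_vs)
  thus ?thesis by (simp add: orth_space_def)
qed

sublocale W: vspace K W
  using vspace_W by (simp add: vspace_def)

lemma lc_W:
  assumes "a \<in> ktup n" "b \<in> {..<n} \<rightarrow> carrier W"
  shows "lc W n a b = lc V n a b"
proof -
  have "(\<lambda>x. x) (\<Oplus>\<^bsub>W\<^esub>i\<in>{..<n}. a i \<odot>\<^bsub>W\<^esub> b i) = (\<Oplus>\<^bsub>V\<^esub>i\<in>{..<n}. a i \<odot>\<^bsub>W\<^esub> b i)"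
    by (rule finsum_additive[OF W.M.abelian_monoid_axioms M.abelian_monoid_axioms])
      (use assms W_V W.smult_closed in "auto simp: Pi_def")
  thus ?thesis by (simp add: lc_def)
qed

lemma lspan_W:
  assumes "R' \<subseteq> carrier K" "b \<in> {..<n} \<rightarrow> carrier W"
  shows "lspan R' W n b = lspan R' V n b"
proof -
  have "lc W n a b = lc V n a b" if "a \<in> {..<n} \<rightarrow> R'" for a
    by (rule lc_W) (use assms that in auto)
  thus ?thesis unfolding lspan_def by (metis (no_types, lifting))
qed

text \<open>The last vector of the basis need not be a multiple of \<open>h\<close>: in general a
  lattice is not the sum of its section by \<open>W\<close> and of its section by the line of
  \<open>h\<close>.\<close>

definition adapted :: "nat => (nat => 'v) => bool"
  where "adapted k c \<longleftrightarrow> dim = Suc k \<and> isb c \<and> c \<in> {..<k} \<rightarrow> carrier W \<and> \<phi> h (c k) \<noteq> \<zero>"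

lemma adapted_coords:
  assumes c: "adapted k c" and a: "a \<in> ktup (Suc k)"
  shows "\<phi> h (lc V (Suc k) a c) = a k \<otimes> \<phi> h (c k)"
proof -
  have cc: "c \<in> vtup (Suc k)" using c isbD[of c] by (auto simp: adapted_def)
  have "\<phi> h (lc V (Suc k) a c) = (\<Oplus>i\<in>{..<Suc k}. a i \<otimes> \<phi> h (c i))"
    by (rule linfun_lc[OF phi_linfun(2)[OF hV] a cc])
  also have "\<dots> = a k \<otimes> \<phi> h (c k)"
  proof (rule R.finsum_single)
    fix j assume "j \<in> {..<Suc k}" "j \<noteq> k"
    hence "j < k" by simp
    hence "c j \<in> carrier W" using c by (auto simp: adapted_def)
    hence "\<phi> h (c j) = \<zero>" using phi_sym[OF hV] by (auto simp: carrier_W)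
    thus "a j \<otimes> \<phi> h (c j) = \<zero>" using a \<open>j < k\<close> by (auto simp: Pi_def)
  qed (use a cc hV in "auto simp: Pi_def")
  finally show ?thesis .
qed

lemma adapted_carrier:
  assumes "adapted k c"
  shows "c \<in> vtup (Suc k)" "c \<in> {..<k} \<rightarrow> carrier W" "c \<in> vtup k" "c k \<in> carrier V"
  using assms isbD[of c] by (auto simp: adapted_def Pi_def)

text \<open>With the valuation ring this describes the section of a lattice by \<open>W\<close>;
  with the whole field it yields a basis of \<open>W\<close>.\<close>

lemma adapted_Int:
  assumes c: "adapted k c" and R: "is_subring K R'"
  shows "lspan R' V (Suc k) c \<inter> carrier W = lspan R' W k c"
proof -
  note cc = adapted_carrier[OF c]
  have Rc: "R' \<subseteq> carrier K" by (rule is_subringD(1)[OF R])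
  have "lspan R' V (Suc k) c \<inter> carrier W = lspan R' V k c"
  proof
    show "lspan R' V (Suc k) c \<inter> carrier W \<subseteq> lspan R' V k c"
    proof
      fix x assume x: "x \<in> lspan R' V (Suc k) c \<inter> carrier W"
      then obtain a where a: "a \<in> {..<Suc k} \<rightarrow> R'" "x = lc V (Suc k) a c" by (auto simp: lspan_def)
      have ac: "a \<in> ktup (Suc k)" using a Rc by auto
      have "\<phi> h x = \<zero>" using x phi_sym[OF hV] by (auto simp: carrier_W)
      hence "a k \<otimes> \<phi> h (c k) = \<zero>" using adapted_coords[OF c ac] a(2) by simp
      hence "a k = \<zero>" using c ac cc(4) hV integral[of "a k" "\<phi> h (c k)"] by (auto simp: adapted_def)
      moreover have "lc V k a c \<in> carrier V" using ac cc by (intro lc_closed) auto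
      ultimately have "x = lc V k a c" using lc_Suc[OF ac cc(1)] a(2) cc(4) by simp
      moreover have "a \<in> {..<k} \<rightarrow> R'" using a(1) by auto
      ultimately show "x \<in> lspan R' V k c" unfolding lspan_def by blast
    qed
    show "lspan R' V k c \<subseteq> lspan R' V (Suc k) c \<inter> carrier W"
    proof
      fix x assume "x \<in> lspan R' V k c"
      then obtain a where a: "a \<in> {..<k} \<rightarrow> R'" "x = lc V k a c" by (auto simp: lspan_def)
      have aW: "x \<in> carrier W" using a lc_W[of a k c] cc(2) Rc W.lc_closed[of a k c] by auto
      let ?a = "\<lambda>i. if i < k then a i else \<zero>"
      have a': "?a \<in> {..<Suc k} \<rightarrow> R'" using a is_subringD(2)[OF R] by auto
      hence ac: "?a \<in> ktup (Suc k)" using Rc by auto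
      have aK: "a \<in> ktup k" using a Rc by auto
      have e: "lc V k ?a c = lc V k a c" by (rule lc_cong) (use aK cc in auto)
      have "lc V (Suc k) ?a c = x"
        using lc_Suc[OF ac cc(1)] e a(2) cc(4) lc_closed[OF aK cc(3)] by simp
      thus "x \<in> lspan R' V (Suc k) c \<inter> carrier W" using a' aW unfolding lspan_def by blast
    qed
  qed
  thus ?thesis using lspan_W[OF Rc cc(2)] by simp
qed

lemma adapted_btuple_W:
  assumes c: "adapted k c" shows "btuple K W k c"
  unfolding btuple_def
proof (intro conjI ballI impI allI)
  note cc = adapted_carrier[OF c]
  show "c \<in> {..<k} \<rightarrow> carrier W" by (rule cc)
  have "lspan (carrier K) V (Suc k) c = carrier V" using c btupleD(2)[of dim c] by (auto simp: adapted_def)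
  thus "carrier W \<subseteq> lspan (carrier K) W k c"
    using adapted_Int[OF c is_subring_carrier] W_V by auto
  fix a i assume a: "a \<in> ktup k" "lc W k a c = \<zero>\<^bsub>W\<^esub>" "i < k"
  let ?a = "\<lambda>i. if i < k then a i else \<zero>"
  have ac: "?a \<in> ktup (Suc k)" using a by auto
  have e: "lc V k ?a c = lc V k a c" by (rule lc_cong) (use a cc in auto)
  have "lc V (Suc k) ?a c = 0\<^sub>V"
    using lc_Suc[OF ac cc(1)] e a lc_W[OF a(1) cc(2)] cc(4) by simp
  hence "?a i = \<zero>" using c ac a(3) by (intro btupleD(3)[of dim c ?a]) (auto simp: adapted_def)
  thus "a i = \<zero>" using a(3) by simp
qed

text \<open>Elimination. The pivot is a basis vector whose product with \<open>h\<close> has least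
  order, so that the multiples of it subtracted from the other vectors are integral.\<close>

lemma ex_adapted:
  assumes b: "isb b"
  shows "\<exists>k c. adapted k c \<and> lat c = lat b"
proof -
  note bc = isbD[OF b]
  have bi: "b i \<in> carrier V" if "i < dim" for i using bc that by auto
  have ex: "\<exists>i<dim. \<phi> h (b i) \<noteq> \<zero>"
  proof (rule ccontr)
    assume "\<not> ?thesis"
    hence z: "\<And>i. i < dim ==> \<phi> h (b i) = \<zero>" by blast
    have "\<phi> h h = \<phi> h (lc V dim (tcoord K V dim b h) b)" using tcoord(2)[OF b hV] by simp
    also have "\<dots> = (\<Oplus>i\<in>{..<dim}. tcoord K V dim b h i \<otimes> \<phi> h (b i))"
      by (rule linfun_lc[OF phi_linfun(2)[OF hV] tcoord(1)[OF b hV] bc])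
    also have "\<dots> = \<zero>" by (rule R.add.finprod_one_eqI) (use z tcoord(3)[OF b hV] in auto)
    finally show False using hq by simp
  qed
  then obtain k where k: "dim = Suc k" by (cases dim) auto
  let ?I = "{i. i < dim \<and> \<phi> h (b i) \<noteq> \<zero>}"
  have "finite ?I" "?I \<noteq> {}" using ex by auto
  then obtain p where p: "p \<in> ?I" "\<And>i. i \<in> ?I ==> val (\<phi> h (b p)) \<le> val (\<phi> h (b i))"
    using arg_min_if_finite[of ?I "\<lambda>i. val (\<phi> h (b i))"] by (metis (no_types, lifting) not_le)
  let ?t = "Transposition.transpose p k"
  have tl: "?t i < dim" if "i < dim" for i using that p(1) k by (auto simp: Transposition.transpose_def)
  have tt: "?t (?t i) = i" for i by simp
  let ?b = "b \<circ> ?t"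
  have b'c: "?b \<in> vtup dim" using bi tl by auto
  have bk: "?b k = b p" by simp
  define \<alpha> where "\<alpha> = \<phi> h (b p)"
  have \<alpha>: "\<alpha> \<in> carrier K" "\<alpha> \<noteq> \<zero>" using p(1) bi hV by (auto simp: \<alpha>_def)
  define r where "r i = \<phi> h (?b i) \<otimes> inv \<alpha>" for i
  have phb: "\<phi> h (?b i) \<in> carrier K" if "i < dim" for i using hV b'c that by (auto simp: Pi_def)
  have rK: "r i \<in> carrier K" if "i < dim" for i using phb[OF that] \<alpha> by (simp add: r_def)
  have rR: "r i \<in> pid 0" if i: "i < dim" for i
  proof (cases "\<phi> h (?b i) = \<zero>")
    case False
    hence "val \<alpha> \<le> val (\<phi> h (?b i))" using p(2)[of "?t i"] tl[OF i] by (simp add: \<alpha>_def)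
    thus ?thesis using False phb[OF i] \<alpha> by (simp add: r_def pid_def val_mult val_inv)
  qed (use \<alpha> in "simp add: r_def")
  define c where "c i = (if i < k then ?b i +\<^sub>V (\<ominus> r i) *\<^sub>V ?b k else ?b k)" for i
  have kd: "k < dim" using k by simp
  have cV: "c i \<in> carrier V" if "i < dim" for i using funcset_mem[OF b'c, of i] funcset_mem[OF b'c, of k] that kd rK by (auto simp: c_def)
  have cc: "c \<in> vtup dim" using cV by auto
  \<comment> \<open>The elimination is read over two rings: over the valuation ring it preserves the
    lattice, and over the field it shows that the new vectors still span \<open>V\<close>.\<close>
  have eq: "lspan R' V dim c = lspan R' V dim b" if R: "is_subring K R'" and rR': "\<And>i. i < dim ==> r i \<in> R'" for R'
  proof (rule lspan_eqI[OF R cc bc])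
    note rb = rsub_lspan[OF R bc] and rc = rsub_lspan[OF R cc]
    have b'm: "?b i \<in> lspan R' V dim b" if "i < dim" for i
      using lspan_gen[OF R bc tl[OF that]] by simp
    show "c i \<in> lspan R' V dim b" if i: "i < dim" for i
      using b'm[OF i] b'm[OF kd] rR'[OF i] is_subringD(6)[OF R] rsubD(3,4)[OF rb] by (simp add: c_def)
    have ck: "?b k \<in> lspan R' V dim c" using lspan_gen[OF R cc kd] by (simp add: c_def)
    have b'c': "?b i \<in> lspan R' V dim c" if i: "i < dim" for i
    proof (cases "i < k")
      case True
      have "?b i = c i +\<^sub>V r i *\<^sub>V ?b k"
      proof -
        have cancel: "u = (u +\<^sub>V (\<ominus> s) *\<^sub>V v) +\<^sub>V s *\<^sub>V v"
          if "u \<in> carrier V" "v \<in> carrier V" "s \<in> carrier K" for u v s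
          using that by (simp add: M.a_assoc smult_l_minus M.l_neg)
        have ci: "c i = ?b i +\<^sub>V (\<ominus> r i) *\<^sub>V ?b k" using True by (simp add: c_def)
        show ?thesis unfolding ci
          by (rule cancel[OF funcset_mem[OF b'c] funcset_mem[OF b'c] rK[OF i]]) (use i kd in auto)
      qed
      thus ?thesis
        using rsubD(3)[OF rc lspan_gen[OF R cc i] rsubD(4)[OF rc rR'[OF i] ck]] by simp
    next
      case False
      hence "i = k" using i k by simp
      thus ?thesis using ck by simp
    qed
    show "b i \<in> lspan R' V dim c" if i: "i < dim" for i using b'c'[OF tl[OF i]] by simp
  qed
  have latc: "lat c = lat b" by (rule eq[OF pid_subring rR])
  have "lspan (carrier K) V dim c = carrier V"
    using eq[OF is_subring_carrier rK] btupleD(2)[OF b] by simp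
  hence "isb c" by (intro spanning_btuple[OF cc]) auto
  moreover have "c i \<in> carrier W" if i: "i < k" for i
  proof -
    have id: "i < dim" using i k by simp
    have bs: "?b i \<in> carrier V" "?b k \<in> carrier V"
      using funcset_mem[OF b'c, of i] funcset_mem[OF b'c, of k] id kd by auto
    have "\<phi> h (c i) = \<phi> h (?b i) \<oplus> (\<ominus> r i) \<otimes> \<alpha>"
      using i bs hV rK[OF id] by (simp add: c_def phi_add_r phi_smult_r \<alpha>_def)
    also have "\<dots> = \<zero>" using phb[OF id] \<alpha> rK[OF id] by (simp add: l_minus r_def R.r_neg)
    finally show ?thesis using phi_sym[OF hV cV[OF id]] cV[OF id] by (simp add: carrier_W)
  qed
  moreover have "\<phi> h (c k) \<noteq> \<zero>" using \<alpha> by (simp add: c_def \<alpha>_def)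
  ultimately have "adapted k c" using k by (auto simp: adapted_def)
  thus ?thesis using latc by blast
qed

lemma W_decompose:
  assumes x: "x \<in> carrier V"
  shows "x +\<^sub>V (\<ominus> (\<phi> h x \<otimes> inv (\<phi> h h))) *\<^sub>V h \<in> carrier W"
proof -
  let ?r = "\<phi> h x \<otimes> inv (\<phi> h h)"
  have r: "?r \<in> carrier K" using x hV hq by simp
  have "\<phi> (x +\<^sub>V (\<ominus> ?r) *\<^sub>V h) h = \<phi> x h \<oplus> (\<ominus> ?r) \<otimes> \<phi> h h"
    using x hV r by (simp add: phi_add_l phi_smult_l)
  also have "\<dots> = \<zero>" using x hV hq r phi_sym[OF x hV] by (simp add: l_minus R.r_neg)
  finally show ?thesis using x hV r by (simp add: carrier_W)
qed

text \<open>A vector of \<open>W\<close> orthogonal to \<open>W\<close> is orthogonal to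
  \<open>h\<close> as well, hence to all of \<open>V\<close> by \<open>W_decompose\<close>.\<close>

lemma quadratic_space_W: "quadratic_space K W \<phi>"
  unfolding quadratic_space_def
proof (intro conjI ballI impI)
  show "vectorspace K W" by (rule vspace_W)
  obtain k c where "adapted k c" using ex_adapted[OF ref] by blast
  thus "vectorspace.fin_dim K W" using W.btuple_basis(3)[OF adapted_btuple_W] by blast
  fix x assume xW: "x \<in> carrier W"
  hence x: "x \<in> carrier V" by (rule W_V)
  assume z: "\<forall>y\<in>carrier W. \<phi> x y = \<zero>"
  have "\<phi> x y = \<zero>" if y: "y \<in> carrier V" for y
  proof -
    let ?r = "\<phi> h y \<otimes> inv (\<phi> h h)"
    have r: "?r \<in> carrier K" using y hV hq by simp
    have "\<phi> x (y +\<^sub>V (\<ominus> ?r) *\<^sub>V h) = \<zero>" using z W_decompose[OF y] by blast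
    moreover have "\<phi> x (y +\<^sub>V (\<ominus> ?r) *\<^sub>V h) = \<phi> x y \<oplus> (\<ominus> ?r) \<otimes> \<phi> x h"
      using x y hV r by (simp add: phi_add_r phi_smult_r)
    moreover have "\<phi> x h = \<zero>" using xW by (simp add: carrier_W)
    ultimately show ?thesis using x y r by simp
  qed
  thus "x = \<zero>\<^bsub>W\<^esub>" using phi_nondeg[OF x] by simp
next
  fix x y assume "x \<in> carrier W" "y \<in> carrier W"
  thus "\<phi> x y = \<phi> y x" using phi_sym W_V by simp
qed (use W_V in "auto simp: phi_add_l phi_smult_l")

sublocale W: dvquad K W val \<phi>
proof (unfold_locales)
  show "vectorspace.fin_dim K W" using quadratic_space_W by (simp add: quadratic_space_def)
  show "quadratic_space K W \<phi>" by (rule quadratic_space_W)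
qed

end

context dvquad_vec
begin

text \<open>The Gram matrix of an adapted tuple is related to the one of \<open>(c\<^sub>0, \<dots>, c\<^sub>k\<^sub>-\<^sub>1, h)\<close>, which is
  block diagonal, by a triangular matrix with last diagonal entry \<open>\<phi>(h, c\<^sub>k) / \<phi>[h]\<close>.\<close>

lemma det_gram_adapted:
  assumes c: "adapted k c"
  defines "\<alpha> \<equiv> \<phi> h (c k)" and "q \<equiv> \<phi> h h"
  shows "leibniz_det K (Suc k) (gram c)
    = (\<alpha> \<otimes> inv q) \<otimes> ((\<alpha> \<otimes> inv q) \<otimes> ((q \<oplus> q) \<otimes> leibniz_det K k (gram c)))"
proof -
  note cc = adapted_carrier[OF c]
  have \<alpha>: "\<alpha> \<in> carrier K" and q: "q \<in> carrier K" "q \<noteq> \<zero>" using cc(4) hV hq by (auto simp: \<alpha>_def q_def)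
  let ?r = "\<alpha> \<otimes> inv q"
  have r: "?r \<in> carrier K" using \<alpha> q by simp
  let ?w = "c k +\<^sub>V (\<ominus> ?r) *\<^sub>V h"
  have wW: "?w \<in> carrier W" using W_decompose[OF cc(4)] by (simp add: \<alpha>_def q_def)
  have bW: "btuple K W k c" by (rule adapted_btuple_W[OF c])
  let ?t = "tcoord K W k c ?w"
  have t: "?t \<in> ktup k" "lc V k ?t c = ?w"
    using W.tcoord[OF bW wW] lc_W[of ?t k c] cc(2) by auto
  let ?d = "c(k := h)"
  have dV: "?d \<in> vtup (Suc k)" using cc(3) hV by (auto simp: less_Suc_eq)
  let ?C = "\<lambda>i j. if i < k then (if j = i then \<one> else \<zero>) else if j < k then ?t j else ?r"
  have Cm: "R.is_mat (Suc k) ?C" using t r by (auto simp: R.is_mat_def Pi_def)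
  have Cc: "c i = lc V (Suc k) (?C i) ?d" if i: "i < Suc k" for i
  proof (cases "i < k")
    case True
    hence "lc V (Suc k) (\<lambda>j. if j = i then \<one> else \<zero>) ?d = c i" using lc_single[OF i dV] by simp
    thus ?thesis using True by simp
  next
    case False
    hence ik: "i = k" using i by simp
    have Ck: "?C k \<in> ktup (Suc k)" using t r by auto
    have "lc V k (?C k) ?d = lc V k ?t c" by (rule lc_cong) (use t cc in auto)
    hence "lc V (Suc k) (?C k) ?d = ?r *\<^sub>V h +\<^sub>V ?w" using lc_Suc[OF Ck dV] t(2) by simp
    also have "\<dots> = c k"
    proof -
      have "s *\<^sub>V h +\<^sub>V (u +\<^sub>V (\<ominus> s) *\<^sub>V h) = u" if "s \<in> carrier K" "u \<in> carrier V" for s u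
      proof -
        have "s *\<^sub>V h +\<^sub>V (u +\<^sub>V (\<ominus> s) *\<^sub>V h) = u +\<^sub>V (s *\<^sub>V h +\<^sub>V (\<ominus> s) *\<^sub>V h)"
          using that hV by (simp add: M.a_ac)
        also have "\<dots> = u" using that hV by (simp add: smult_l_minus M.r_neg)
        finally show ?thesis .
      qed
      thus ?thesis using r cc(4) by blast
    qed
    finally show ?thesis using ik by simp
  qed
  \<comment> \<open>The zeros of \<open>?C\<close> stand in the last column, whereas
    \<open>leibniz_det_last_row\<close> expands along the last row; hence the transposition.\<close>
  have detC: "leibniz_det K (Suc k) ?C = ?r"
  proof -
    let ?T = "\<lambda>i j. ?C j i"
    have Tm: "R.is_mat (Suc k) ?T" using Cm by (simp add: R.is_mat_def)
    have "leibniz_det K (Suc k) ?C = leibniz_det K (Suc k) ?T"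
      using R.leibniz_det_transpose[OF Cm] by simp
    also have "\<dots> = ?T k k \<otimes> leibniz_det K k ?T"
      by (rule R.leibniz_det_last_row[OF Tm]) auto
    also have "leibniz_det K k ?T = leibniz_det K k (\<lambda>i j. if i = j then \<one> else \<zero>)"
      by (rule R.leibniz_det_cong) (auto simp: R.is_mat_def)
    finally show ?thesis using r by (simp add: R.leibniz_det_one)
  qed
  have detd: "leibniz_det K (Suc k) (gram ?d) = (q \<oplus> q) \<otimes> leibniz_det K k (gram c)"
  proof -
    have "leibniz_det K (Suc k) (gram ?d) = gram ?d k k \<otimes> leibniz_det K k (gram ?d)"
    proof (rule R.leibniz_det_last_row[OF is_mat_gram[OF dV]])
      fix j assume j: "j < k"
      hence "c j \<in> carrier W" using cc(2) by auto
      hence "\<phi> h (c j) = \<zero>" using phi_sym[OF hV] by (auto simp: carrier_W)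
      thus "gram ?d k j = \<zero>" using j by (simp add: gram_def bil_def)
    qed
    also have "leibniz_det K k (gram ?d) = leibniz_det K k (gram c)"
      by (rule R.leibniz_det_cong) (use is_mat_gram[OF cc(3)] in "auto simp: gram_def")
    also have "gram ?d k k = q \<oplus> q" by (simp add: gram_def bil_def q_def)
    finally show ?thesis .
  qed
  have "leibniz_det K (Suc k) (gram c)
      = leibniz_det K (Suc k) ?C \<otimes> (leibniz_det K (Suc k) ?C \<otimes> leibniz_det K (Suc k) (gram ?d))"
    by (rule det_gram_change[OF dV Cm Cc])
  thus ?thesis by (simp only: detC detd)
qed

lemma W_dim: "adapted k c ==> vectorspace.dim K W = k"
  using W.btuple_basis(4)[OF adapted_btuple_W] .

lemma bil_image_adapted:
  assumes c: "adapted k c"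
  shows "{bil h x | x. x \<in> lat c} = pid (val (bil h (c k)))" "bil h (c k) \<noteq> \<zero>"
proof -
  note cc = adapted_carrier[OF c]
  have dk: "dim = Suc k" using c by (simp add: adapted_def)
  have ic: "isb c" using c unfolding adapted_def by blast
  show nz: "bil h (c k) \<noteq> \<zero>" using bil_eq_zero[OF hV cc(4)] c by (auto simp: adapted_def)
  have bK: "bil h (c k) \<in> carrier K" using hV cc by simp
  have co: "bil h (lc V (Suc k) a c) = a k \<otimes> bil h (c k)" if "a \<in> ktup (Suc k)" for a
    using adapted_coords[OF c that] that hV cc(4) by (simp add: bil_def R.r_distr Pi_def)
  have "{bil h x | x. x \<in> lat c} = {r \<otimes> bil h (c k) | r. r \<in> pid 0}"
  proof
    show "{bil h x | x. x \<in> lat c} \<subseteq> {r \<otimes> bil h (c k) | r. r \<in> pid 0}"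
    proof
      fix y assume "y \<in> {bil h x | x. x \<in> lat c}"
      then obtain a where a: "a \<in> {..<Suc k} \<rightarrow> pid 0" "y = bil h (lc V (Suc k) a c)"
        by (auto simp: lspan_def dk)
      hence "y = a k \<otimes> bil h (c k)" using co[of a] pid_carrier[of 0] by auto
      moreover have "a k \<in> pid 0" using a by auto
      ultimately show "y \<in> {r \<otimes> bil h (c k) | r. r \<in> pid 0}" by blast
    qed
    show "{r \<otimes> bil h (c k) | r. r \<in> pid 0} \<subseteq> {bil h x | x. x \<in> lat c}"
    proof
      fix y assume "y \<in> {r \<otimes> bil h (c k) | r. r \<in> pid 0}"
      then obtain r where r: "r \<in> pid 0" "y = r \<otimes> bil h (c k)" by blast
      have ckl: "c k \<in> lat c" using lat_gen[OF ic] dk by simp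
      have "r *\<^sub>V c k \<in> lat c" using rsubD(4)[OF rsub_lat[OF ic] r(1) ckl] .
      moreover have "bil h (r *\<^sub>V c k) = y"
        using bil_linfun(2)[OF hV] r cc(4) pid_closed[OF r(1)] by (simp add: linfun_def)
      ultimately show "y \<in> {bil h x | x. x \<in> lat c}" by blast
    qed
  qed
  thus "{bil h x | x. x \<in> lat c} = pid (val (bil h (c k)))"
    using pid_eq_multiples[OF bK nz] by simp
qed

lemma lattice_section:
  assumes c: "adapted k c"
  shows "lat c \<inter> carrier W = W.lat c" "W.isb c"
proof -
  have dk: "dim = Suc k" using c by (simp add: adapted_def)
  show "lat c \<inter> carrier W = W.lat c" using adapted_Int[OF c pid_subring] dk W_dim[OF c] by simp
  show "W.isb c" using adapted_btuple_W[OF c] W_dim[OF c] by simp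
qed

text \<open>Take orders in \<open>det_gram_adapted\<close>. After adding the order of
  \<open>bil h h\<close> it occurs twice, and that of \<open>\<phi> h h\<close> is subtracted twice;
  what is left is twice the order of 2, which turns \<open>\<phi> h (c k)\<close> into
  \<open>bil h (c k)\<close>.\<close>

theorem disc_section:
  assumes L: "latt L"
  shows "\<exists>m. {bil h x | x. x \<in> L} = pid m \<and> W.latt (L \<inter> carrier W) \<and>
    val (bil h h) + disc L = 2 * m + W.disc (L \<inter> carrier W)"
proof -
  obtain b where b: "isb b" "L = lat b" using L by (rule lattE)
  obtain k c where c: "adapted k c" "lat c = L" using ex_adapted[OF b(1)] b(2) by auto
  note cc = adapted_carrier[OF c(1)]
  note s = lattice_section[OF c(1)]
  have ic: "isb c" and dk: "dim = Suc k" using c(1) unfolding adapted_def by blast+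
  let ?\<alpha> = "\<phi> h (c k)" and ?q = "\<phi> h h"
  have nz: "?\<alpha> \<in> carrier K" "?\<alpha> \<noteq> \<zero>" "?q \<in> carrier K" "?q \<noteq> \<zero>" using c cc(4) hV hq by (auto simp: adapted_def)
  have q2: "?q \<oplus> ?q \<noteq> \<zero>" using D.double_eq_zero[OF nz(3)] nz by auto
  have two: "\<one> \<oplus> \<one> \<in> carrier K" "\<one> \<oplus> \<one> \<noteq> \<zero>" using two_neq by auto
  have dbl: "x \<oplus> x = (\<one> \<oplus> \<one>) \<otimes> x" if "x \<in> carrier K" for x using that by (simp add: R.l_distr)
  have vq: "val (?q \<oplus> ?q) = val (\<one> \<oplus> \<one>) + val ?q" and va: "val (?\<alpha> \<oplus> ?\<alpha>) = val (\<one> \<oplus> \<one>) + val ?\<alpha>"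
    unfolding dbl[OF nz(3)] dbl[OF nz(1)] using two nz by (simp_all add: val_mult del: R.one_closed)
  have WN: "W.disc (W.lat c) = val (leibniz_det K k (gram c))" "leibniz_det K k (gram c) \<noteq> \<zero>"
    using W.disc_lat[OF s(2)] W_dim[OF c(1)] by simp_all
  have G: "leibniz_det K k (gram c) \<in> carrier K" using is_mat_gram[OF cc(3)] by simp
  have "disc L = val (leibniz_det K (Suc k) (gram c))" using disc_lat(1)[OF ic] dk c(2) by simp
  also have "\<dots> = 2 * (val ?\<alpha> - val ?q) + val (?q \<oplus> ?q) + val (leibniz_det K k (gram c))"
    unfolding det_gram_adapted[OF c(1)] using nz q2 G WN(2) by (simp add: val_mult val_inv)
  finally have "val (bil h h) + disc L = 2 * val (bil h (c k)) + W.disc (W.lat c)"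
    using vq va WN(1) by (simp add: bil_def)
  moreover have "W.latt (L \<inter> carrier W)" using s c(2) by (auto simp: W.latt_def)
  ultimately show ?thesis using bil_image_adapted(1)[OF c(1)] s(1) c(2) by auto
qed

text \<open>Passing from the section of \<open>L\<close> to \<open>M\<close> changes the
  discriminant by twice the difference of volumes. The number that is doubled on the right is thus
  the order that \<bb>(q) must have.\<close>

theorem order_formula:
  assumes L: "latt L" and M: "maximal_lattice K (pid 0) W \<phi> M"
  shows "\<exists>m. {bil h x | x. x \<in> L} = pid m \<and> W.latt (L \<inter> carrier W) \<and>
    val (bil h h) + disc L = 2 * (m + W.vol (L \<inter> carrier W) - W.vol M) + W.disc M"
proof -
  obtain m where m: "{bil h x | x. x \<in> L} = pid m" "W.latt (L \<inter> carrier W)"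
    "val (bil h h) + disc L = 2 * m + W.disc (L \<inter> carrier W)" using disc_section[OF L] by blast
  have "W.latt M" using M by (simp add: W.maximal_lattice_iff)
  thus ?thesis using m W.disc_change[OF _ m(2)] by (intro exI[of _ m]) auto
qed

text \<open>The section is an integral lattice of \<open>W\<close>. Globally this becomes the
  inclusion of \<bb>(q) in the ideal of values of \<open>bil h\<close> on \<open>L\<close>.\<close>

lemma vol_section_ge:
  assumes L: "latt L" "integral_on L" and M: "maximal_lattice K (pid 0) W \<phi> M"
  shows "W.vol M \<le> W.vol (L \<inter> carrier W)"
proof -
  have "W.latt (L \<inter> carrier W)" using order_formula[OF L(1) M] by blast
  moreover have "W.integral_on (L \<inter> carrier W)" using L(2) by (auto simp: W.integral_on_def integral_on_def)
  ultimately show ?thesis by (rule W.vol_maximal_le[OF M])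
qed

end

subsection \<open>Dependence on the vector\<close>

context dvquad
begin

abbreviation orth where "orth \<equiv> orth_space K V \<phi>"

definition reflect :: "'v => 'v => 'v"
  where "reflect u x = x +\<^sub>V (\<ominus> (bil x u \<otimes> inv (\<phi> u u))) *\<^sub>V u"

lemma reflect_closed: "u \<in> carrier V ==> \<phi> u u \<noteq> \<zero> ==> x \<in> carrier V ==> reflect u x \<in> carrier V"
  by (simp add: reflect_def)

lemma reflect_isometry:
  assumes u: "u \<in> carrier V" "\<phi> u u \<noteq> \<zero>" and xy: "x \<in> carrier V" "y \<in> carrier V"
  shows "\<phi> (reflect u x) (reflect u y) = \<phi> x y"
proof -
  let ?i = "inv (\<phi> u u)"
  \<comment> \<open>Here \<open>p\<close>, \<open>s\<close>, \<open>t\<close>, \<open>d\<close>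
    stand for the values of \<open>\<phi>\<close> at the pairs \<open>x y\<close>,
    \<open>x u\<close>, \<open>u y\<close>, \<open>u u\<close>, and \<open>i\<close> for the inverse
    of \<open>d\<close>.\<close>
  have key: "(p \<oplus> (\<ominus> ((t \<oplus> t) \<otimes> i)) \<otimes> s) \<oplus> (\<ominus> ((s \<oplus> s) \<otimes> i)) \<otimes> (t \<oplus> (\<ominus> ((t \<oplus> t) \<otimes> i)) \<otimes> d) = p"
    if c: "p \<in> carrier K" "s \<in> carrier K" "t \<in> carrier K" "d \<in> carrier K" "i \<in> carrier K" and di: "i \<otimes> d = \<one>"
    for p s t d i
  proof -
    have "(\<ominus> ((t \<oplus> t) \<otimes> i)) \<otimes> d = \<ominus> (t \<oplus> t)" using c di by (simp add: l_minus m_assoc)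
    moreover have "t \<oplus> \<ominus> (t \<oplus> t) = \<ominus> t" using c by (simp add: R.minus_add R.a_assoc[symmetric] R.r_neg)
    ultimately have "(\<ominus> ((s \<oplus> s) \<otimes> i)) \<otimes> (t \<oplus> (\<ominus> ((t \<oplus> t) \<otimes> i)) \<otimes> d) = ((s \<oplus> s) \<otimes> i) \<otimes> t"
      using c by (simp add: l_minus r_minus)
    also have "\<dots> = ((t \<oplus> t) \<otimes> i) \<otimes> s" using c by (simp add: R.l_distr R.r_distr m_ac)
    finally show ?thesis using c by (simp add: l_minus R.a_assoc R.l_neg)
  qed
  have c: "\<phi> x y \<in> carrier K" "\<phi> u y \<in> carrier K" "\<phi> x u \<in> carrier K" "\<phi> u u \<in> carrier K" "?i \<in> carrier K"
    using u xy by auto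
  have b: "bil x u = \<phi> x u \<oplus> \<phi> x u" "bil y u = \<phi> u y \<oplus> \<phi> u y" using phi_sym[OF u(1) xy(2)] by (auto simp: bil_def)
  have ru: "reflect u y \<in> carrier V" by (rule reflect_closed[OF u xy(2)])
  have "\<phi> (reflect u x) (reflect u y) = \<phi> x (reflect u y) \<oplus> (\<ominus> (bil x u \<otimes> ?i)) \<otimes> \<phi> u (reflect u y)"
    unfolding reflect_def[of u x] using u xy ru by (simp add: phi_add_l phi_smult_l)
  also have "\<phi> x (reflect u y) = \<phi> x y \<oplus> (\<ominus> (bil y u \<otimes> ?i)) \<otimes> \<phi> x u"
    unfolding reflect_def using u xy by (simp add: phi_add_r phi_smult_r)
  also have "\<phi> u (reflect u y) = \<phi> u y \<oplus> (\<ominus> (bil y u \<otimes> ?i)) \<otimes> \<phi> u u"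
    unfolding reflect_def using u xy by (simp add: phi_add_r phi_smult_r)
  finally show ?thesis using key[of "\<phi> x y" "\<phi> x u" "\<phi> u y" "\<phi> u u" ?i] c u by (simp add: b)
qed

lemma reflect_hom:
  assumes u: "u \<in> carrier V" "\<phi> u u \<noteq> \<zero>"
  shows "reflect u \<in> module_hom K V V"
proof -
  let ?i = "inv (\<phi> u u)"
  have i: "?i \<in> carrier K" using u by simp
  note f = bil_linfun(1)[OF u(1)]
  have "reflect u (x +\<^sub>V y) = reflect u x +\<^sub>V reflect u y" if xy: "x \<in> carrier V" "y \<in> carrier V" for x y
  proof -
    have "bil (x +\<^sub>V y) u = bil x u \<oplus> bil y u" using f xy by (simp add: linfun_def)
    hence "\<ominus> (bil (x +\<^sub>V y) u \<otimes> ?i) = (\<ominus> (bil x u \<otimes> ?i)) \<oplus> (\<ominus> (bil y u \<otimes> ?i))"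
      using xy u i by (simp add: R.l_distr R.minus_add)
    thus ?thesis unfolding reflect_def using xy u i by (simp add: smult_l_distr M.a_ac)
  qed
  moreover have "reflect u (r *\<^sub>V x) = r *\<^sub>V reflect u x" if xy: "x \<in> carrier V" "r \<in> carrier K" for x r
  proof -
    have "bil (r *\<^sub>V x) u = r \<otimes> bil x u" using f xy by (simp add: linfun_def)
    hence "\<ominus> (bil (r *\<^sub>V x) u \<otimes> ?i) = r \<otimes> (\<ominus> (bil x u \<otimes> ?i))"
      using xy u i by (simp add: r_minus m_assoc)
    thus ?thesis unfolding reflect_def using xy u i by (simp add: smult_r_distr smult_assoc1)
  qed
  ultimately show ?thesis using reflect_closed[OF u] by (auto simp: LinearCombinations.module_hom_def)
qed

text \<open>The reflection along \<open>h - t\<close> takes \<open>h\<close> to \<open>t\<close> and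
  hence \<open>M\<close> to an integral lattice in the complement of \<open>t\<close> with the same
  Gram matrix; a maximal lattice there has at most this discriminant. Equality will come from
  exchanging \<open>h\<close> and \<open>t\<close> rather than from maximality of the image.\<close>

lemma disc_orth_le:
  assumes h: "h \<in> carrier V" "\<phi> h h \<noteq> \<zero>" and t: "t \<in> carrier V" "\<phi> t t = \<phi> h h"
    and u: "\<phi> (h \<ominus>\<^bsub>V\<^esub> t) (h \<ominus>\<^bsub>V\<^esub> t) \<noteq> \<zero>"
    and M: "maximal_lattice K (pid 0) (orth h) \<phi> M"
    and M': "maximal_lattice K (pid 0) (orth t) \<phi> M'"
  shows "dvquad.disc K (orth t) val \<phi> M' \<le> dvquad.disc K (orth h) val \<phi> M"
proof -
  interpret H: dvquad_vec K V val \<phi> h by unfold_locales (use h in auto)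
  interpret T: dvquad_vec K V val \<phi> t by unfold_locales (use h t in auto)
  let ?u = "h \<ominus>\<^bsub>V\<^esub> t"
  have uV: "?u \<in> carrier V" using h t by simp
  have ud: "?u = h +\<^sub>V (\<ominus> \<one>) *\<^sub>V t" using h t by (simp add: M.minus_eq smult_minus_1)
  let ?s = "reflect ?u"
  note sV = reflect_closed[OF uV u] and iso = reflect_isometry[OF uV u] and hom = reflect_hom[OF uV u]
  \<comment> \<open>As \<open>h\<close> and \<open>t\<close> have equal length,
    \<open>bil h ?u\<close> equals \<open>\<phi> ?u ?u\<close>, so the reflection subtracts
    \<open>?u\<close> from \<open>h\<close> exactly once.\<close>
  have st: "?s h = t"
  proof -
    have "\<phi> h ?u = \<phi> h h \<oplus> (\<ominus> \<phi> h t)" "\<phi> t ?u = \<phi> h t \<oplus> (\<ominus> \<phi> h h)"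
      unfolding ud using h t phi_sym[OF h(1) t(1)] by (simp_all add: phi_add_r phi_smult_r l_minus)
    moreover have "\<phi> ?u ?u = \<phi> h ?u \<oplus> (\<ominus> \<phi> t ?u)"
    proof -
      have "\<phi> (h +\<^sub>V (\<ominus> \<one>) *\<^sub>V t) ?u = \<phi> h ?u \<oplus> (\<ominus> \<one>) \<otimes> \<phi> t ?u"
        using h t uV by (simp add: phi_add_l phi_smult_l)
      thus ?thesis using ud h t uV by (simp add: l_minus)
    qed
    ultimately have "\<phi> ?u ?u = bil h ?u" using h t by (simp add: bil_def R.minus_add R.a_ac)
    hence "bil h ?u \<otimes> inv (\<phi> ?u ?u) = \<one>" using u uV by (metis inv_nz(3) phi_closed)
    hence "?s h = h +\<^sub>V (\<ominus> \<one>) *\<^sub>V ?u" by (simp add: reflect_def)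
    also have "\<dots> = t" using h t by (simp add: smult_minus_1 M.minus_eq M.minus_add M.a_assoc[symmetric] M.r_neg)
    finally show ?thesis .
  qed
  have lM: "H.W.latt M" and iM: "H.W.integral_on M" using M by (auto simp: H.W.maximal_lattice_iff)
  obtain w where w: "H.W.isb w" "M = H.W.lat w" using lM by (rule H.W.lattE)
  obtain k c where ad: "H.adapted k c" using H.ex_adapted[OF ref] by blast
  obtain k' c' where ad': "T.adapted k' c'" using T.ex_adapted[OF ref] by blast
  have "k' = k" using ad ad' by (simp add: H.adapted_def T.adapted_def)
  hence dk: "H.W.dim = k" "T.W.dim = k" using H.W_dim[OF ad] T.W_dim[OF ad'] by auto
  have wW: "w \<in> {..<k} \<rightarrow> carrier H.W" using H.W.isbD[OF w(1)] dk by simp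
  have wV: "w \<in> vtup k" using wW H.W_V by auto
  let ?w = "?s \<circ> w"
  have w'V: "?w \<in> vtup k" using wV sV by (auto simp: Pi_def)
  have w'T: "?w \<in> {..<k} \<rightarrow> carrier T.W"
  proof
    fix i assume i: "i \<in> {..<k}"
    hence "w i \<in> carrier V" "\<phi> (w i) h = \<zero>" using wW by (auto simp: H.carrier_W Pi_def)
    thus "?w i \<in> carrier T.W" using iso[of "w i" h] h sV st by (simp add: T.carrier_W)
  qed
  have slc: "?s (lc V k a w) = lc V k a ?w" if "a \<in> ktup k" for a
    by (rule hom_lc[OF hom that wV])
  have "T.W.isb ?w"
  proof (rule T.W.independent_btuple[OF T.W.fin_dim])
    show "?w \<in> {..<T.W.dim} \<rightarrow> carrier T.W" using w'T dk by simp
    fix a i assume a: "a \<in> {..<T.W.dim} \<rightarrow> carrier K" "lc T.W T.W.dim a ?w = \<zero>\<^bsub>T.W\<^esub>" "i < T.W.dim"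
    have ak: "a \<in> ktup k" using a dk by simp
    let ?x = "lc V k a w"
    have xV: "?x \<in> carrier V" using ak wV by simp
    have "lc V k a ?w = 0\<^sub>V" using a T.lc_W[OF ak w'T] dk by simp
    hence s0: "?s ?x = 0\<^sub>V" using slc[OF ak] by simp
    have "\<phi> ?x y = \<zero>" if y: "y \<in> carrier V" for y
      using iso[OF xV y] s0 linfun_zero[OF phi_linfun(1)[OF sV[OF y]]] by simp
    hence "?x = 0\<^sub>V" by (rule phi_nondeg[OF xV])
    hence "lc H.W k a w = \<zero>\<^bsub>H.W\<^esub>" using H.lc_W[OF ak wW] by simp
    thus "a i = \<zero>" using H.W.btupleD(3)[OF w(1), of a i] a dk by simp
  qed
  note iw = this
  let ?N = "T.W.lat ?w"
  have lN: "T.W.latt ?N" using iw by (auto simp: T.W.latt_def)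
  have "T.W.integral_on ?N"
    unfolding T.W.integral_on_def
  proof
    fix x assume "x \<in> ?N"
    then obtain a where a: "a \<in> {..<k} \<rightarrow> pid 0" "x = lc T.W k a ?w" by (auto simp: lspan_def dk)
    have ak: "a \<in> ktup k" using a pid_carrier[of 0] by auto
    have x: "x = ?s (lc V k a w)" using a T.lc_W[OF ak w'T] slc[OF ak] by simp
    have "lc V k a w \<in> M" using w(2) a(1) H.lc_W[OF ak wW] unfolding lspan_def dk by force
    thus "\<phi> x x \<in> pid 0" using iso[of "lc V k a w" "lc V k a w"] ak wV iM x
      by (simp add: H.W.integral_on_def)
  qed
  hence "T.W.vol M' \<le> T.W.vol ?N" by (rule T.W.vol_maximal_le[OF M' lN])
  moreover have lM': "T.W.latt M'" using M' by (simp add: T.W.maximal_lattice_iff)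
  ultimately have 1: "T.W.disc M' \<le> T.W.disc ?N" using T.W.disc_change[OF lN] by simp
  have "leibniz_det K k (gram ?w) = leibniz_det K k (gram w)"
  proof (rule R.leibniz_det_cong[OF _ is_mat_gram[OF wV]])
    fix i j assume "i < k" "j < k"
    hence "w i \<in> carrier V" "w j \<in> carrier V" using wV by auto
    thus "gram ?w i j = gram w i j" using iso by (simp add: gram_def bil_def)
  qed
  hence "T.W.disc ?N = H.W.disc M"
    using T.W.disc_lat(1)[OF iw] H.W.disc_lat(1)[OF w(1)] w(2) dk by simp
  thus ?thesis using 1 by simp
qed

lemma orth_space_uminus:
  assumes "t \<in> carrier V"
  shows "orth (\<ominus>\<^bsub>V\<^esub> t) = orth t"
proof -
  have "\<phi> x (\<ominus>\<^bsub>V\<^esub> t) = \<ominus> \<phi> x t" if "x \<in> carrier V" for x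
    using phi_smult_r[of "\<ominus> \<one>" t x] that assms by (simp add: smult_minus_1 l_minus)
  moreover have "\<ominus> y = \<zero> \<longleftrightarrow> y = \<zero>" if "y \<in> carrier K" for y
    using that R.add.inv_eq_1_iff by simp
  ultimately have "{x \<in> carrier V. \<phi> x (\<ominus>\<^bsub>V\<^esub> t) = \<zero>} = {x \<in> carrier V. \<phi> x t = \<zero>}"
    using assms by auto
  thus ?thesis by (simp add: orth_space_def)
qed

text \<open>Witt's theorem for vectors: since \<open>\<phi>[h - t] + \<phi>[h + t] = 4 \<phi>[h]\<close>, one of the reflections
  mapping \<open>h\<close> to \<open>t\<close> or to \<open>-t\<close> exists.\<close>

theorem disc_orth_unique:
  assumes h: "h \<in> carrier V" "\<phi> h h \<noteq> \<zero>" and t: "t \<in> carrier V" "\<phi> t t = \<phi> h h"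
    and M: "maximal_lattice K (pid 0) (orth h) \<phi> M"
    and M': "maximal_lattice K (pid 0) (orth t) \<phi> M'"
  shows "dvquad.disc K (orth h) val \<phi> M = dvquad.disc K (orth t) val \<phi> M'"
proof -
  have *: "dvquad.disc K (orth h) val \<phi> M = dvquad.disc K (orth s) val \<phi> M'"
    if s: "s \<in> carrier V" "\<phi> s s = \<phi> h h" "\<phi> (h \<ominus>\<^bsub>V\<^esub> s) (h \<ominus>\<^bsub>V\<^esub> s) \<noteq> \<zero>"
      and M'': "maximal_lattice K (pid 0) (orth s) \<phi> M'" for s
  proof (rule antisym)
    show "dvquad.disc K (orth s) val \<phi> M' \<le> dvquad.disc K (orth h) val \<phi> M"
      by (rule disc_orth_le[OF h s(1,2,3) M M''])
    have e: "s \<ominus>\<^bsub>V\<^esub> h = (\<ominus> \<one>) *\<^sub>V (h \<ominus>\<^bsub>V\<^esub> s)"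
      using s h by (simp add: smult_minus_1 M.minus_eq M.minus_add M.a_ac)
    have "\<phi> (s \<ominus>\<^bsub>V\<^esub> h) (s \<ominus>\<^bsub>V\<^esub> h) = \<phi> (h \<ominus>\<^bsub>V\<^esub> s) (h \<ominus>\<^bsub>V\<^esub> s)"
      unfolding e using s h by (subst phi_square_smult) (auto simp: l_minus)
    hence n: "\<phi> (s \<ominus>\<^bsub>V\<^esub> h) (s \<ominus>\<^bsub>V\<^esub> h) \<noteq> \<zero>" using s(3) by simp
    have n2: "\<phi> s s \<noteq> \<zero>" using s(2) h(2) by simp
    show "dvquad.disc K (orth h) val \<phi> M \<le> dvquad.disc K (orth s) val \<phi> M'"
      by (rule disc_orth_le[OF s(1) n2 h(1) s(2)[symmetric] n M'' M])
  qed
  show ?thesis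
  proof (cases "\<phi> (h \<ominus>\<^bsub>V\<^esub> t) (h \<ominus>\<^bsub>V\<^esub> t) = \<zero>")
    case False
    thus ?thesis using * t M' by blast
  next
    case True
    have mt: "\<ominus>\<^bsub>V\<^esub> t = (\<ominus> \<one>) *\<^sub>V t" using t by (simp add: smult_minus_1)
    have qm: "\<phi> (\<ominus>\<^bsub>V\<^esub> t) (\<ominus>\<^bsub>V\<^esub> t) = \<phi> h h" unfolding mt using t h by (simp add: phi_square_smult l_minus)
    have bm: "bil h (\<ominus>\<^bsub>V\<^esub> t) = \<ominus> bil h t"
      unfolding mt using bil_linfun(2)[OF h(1)] t h by (simp add: linfun_def l_minus)
    have e1: "\<phi> (h +\<^sub>V \<ominus>\<^bsub>V\<^esub> t) (h +\<^sub>V \<ominus>\<^bsub>V\<^esub> t) = \<phi> h h \<oplus> (\<phi> h h \<oplus> \<ominus> bil h t)"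
      using phi_square_add[OF h(1), of "\<ominus>\<^bsub>V\<^esub> t"] t qm bm by simp
    have e2: "\<phi> (h +\<^sub>V t) (h +\<^sub>V t) = \<phi> h h \<oplus> (\<phi> h h \<oplus> bil h t)"
      using phi_square_add[OF h(1) t(1)] t by simp
    have "\<phi> (h +\<^sub>V t) (h +\<^sub>V t) \<noteq> \<zero>"
    proof
      assume z: "\<phi> (h +\<^sub>V t) (h +\<^sub>V t) = \<zero>"
      have "(q \<oplus> (q \<oplus> \<ominus> b)) \<oplus> (q \<oplus> (q \<oplus> b)) = (q \<oplus> q) \<oplus> (q \<oplus> q)" if "q \<in> carrier K" "b \<in> carrier K" for q b
        using that by algebra
      note key = this
      have qc: "\<phi> h h \<in> carrier K" "bil h t \<in> carrier K" using h t by auto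
      have z1: "\<phi> h h \<oplus> (\<phi> h h \<oplus> \<ominus> bil h t) = \<zero>" using e1 True by (simp only: M.minus_eq)
      have z2: "\<phi> h h \<oplus> (\<phi> h h \<oplus> bil h t) = \<zero>" using e2 z by (simp only:)
      have "(\<phi> h h \<oplus> \<phi> h h) \<oplus> (\<phi> h h \<oplus> \<phi> h h) = \<zero> \<oplus> \<zero>"
        using key[OF qc] unfolding z1 z2 by (rule sym)
      hence "(\<phi> h h \<oplus> \<phi> h h) \<oplus> (\<phi> h h \<oplus> \<phi> h h) = \<zero>" by (simp only: R.l_zero R.zero_closed)
      hence "\<phi> h h \<oplus> \<phi> h h = \<zero>" by (rule D.double_eq_zero[OF R.a_closed[OF qc(1) qc(1)]])
      hence "\<phi> h h = \<zero>" by (rule D.double_eq_zero[OF qc(1)])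
      thus False using h(2) by contradiction
    qed
    moreover have "h \<ominus>\<^bsub>V\<^esub> (\<ominus>\<^bsub>V\<^esub> t) = h +\<^sub>V t" using h t by (simp add: M.minus_eq)
    ultimately show ?thesis using *[of "\<ominus>\<^bsub>V\<^esub> t"] t qm M' orth_space_uminus[OF t(1)] by simp
  qed
qed

end

subsection \<open>Index ideals and fractional ideals\<close>

context dvf
begin

abbreviation Ks where "Ks \<equiv> self_module K"

lemma vspace_self: "vspace K Ks"
proof -
  have "Module.module K Ks"
  proof (rule moduleI)
    show "abelian_group Ks"
      by (rule abelian_groupI) (auto simp: self_module_def a_ac intro: bexI[of _ "\<ominus> _"] l_neg)
  qed (auto simp: self_module_def l_distr r_distr m_assoc is_cring)
  thus ?thesis by (simp add: vspace_def vectorspace_def field_axioms)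
qed

lemma rsub_self: "rsub (pid 0) Ks (pid k)"
  using pid_mult[of _ 0 _ k] by (auto simp: rsub_def self_module_def pid_add)

text \<open>An element of least order generates. Products of ideals and index ideals are computed in
  this way.\<close>

lemma rspan_self_eq:
  assumes S: "S \<subseteq> pid k" and x: "x \<in> S" "x \<noteq> \<zero>" "val x = k"
  shows "rspan K (pid 0) Ks S = pid k"
proof
  interpret S: vspace K "Ks" by (rule vspace_self)
  show "rspan K (pid 0) Ks S \<subseteq> pid k" by (rule S.rspan_least[OF pid_subring S rsub_self])
  have "S \<subseteq> carrier Ks" using S pid_carrier[of k] by (auto simp: self_module_def)
  note r = S.rsub_rspan[OF pid_subring this]
  have xc: "x \<in> carrier K" using x S by auto
  show "pid k \<subseteq> rspan K (pid 0) Ks S"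
    using pid_eq_multiples[OF xc x(2)] x r(2) rsubD(4)[OF r(1)] by (auto simp: self_module_def)
qed

lemma self_btuple:
  assumes "x \<in> carrier K" "x \<noteq> \<zero>"
  shows "btuple K Ks 1 (\<lambda>_. x)"
    and "R' \<subseteq> carrier K ==> lspan R' Ks 1 (\<lambda>_. x) = {r \<otimes> x | r. r \<in> R'}"
proof -
  interpret S: vspace K "Ks" by (rule vspace_self)
  have l: "lc Ks 1 a (\<lambda>_. x) = a 0 \<otimes> x" if "a \<in> {..<1} \<rightarrow> carrier K" for a
  proof -
    have z: "lc Ks 0 a (\<lambda>_. x) = \<zero>" by (simp add: lc_def) (simp add: self_module_def)
    have "lc Ks (Suc 0) a (\<lambda>_. x) = a 0 \<otimes> x \<oplus> lc Ks 0 a (\<lambda>_. x)"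
      using S.lc_Suc[of a 0 "\<lambda>_. x"] that assms by (simp add: self_module_def)
    moreover have "a 0 \<in> carrier K" using that by auto
    ultimately show ?thesis using z assms by simp
  qed
  have ls: "lspan R' Ks 1 (\<lambda>_. x) = {r \<otimes> x | r. r \<in> R'}" if R': "R' \<subseteq> carrier K" for R'
  proof
    show "lspan R' Ks 1 (\<lambda>_. x) \<subseteq> {r \<otimes> x | r. r \<in> R'}"
    proof
      fix y assume "y \<in> lspan R' Ks 1 (\<lambda>_. x)"
      then obtain a where a: "a \<in> {..<1} \<rightarrow> R'" "y = lc Ks 1 a (\<lambda>_. x)"
        by (auto simp: lspan_def)
      hence "y = a 0 \<otimes> x" using l[of a] R' by (auto simp: Pi_def)
      moreover have "a 0 \<in> R'" using a(1) by auto
      ultimately show "y \<in> {r \<otimes> x | r. r \<in> R'}" by blast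
    qed
    show "{r \<otimes> x | r. r \<in> R'} \<subseteq> lspan R' Ks 1 (\<lambda>_. x)"
    proof
      fix y assume "y \<in> {r \<otimes> x | r. r \<in> R'}"
      then obtain r where r: "r \<in> R'" "y = r \<otimes> x" by blast
      hence "y = lc Ks 1 (\<lambda>_. r) (\<lambda>_. x)" using l[of "\<lambda>_. r"] R' by auto
      thus "y \<in> lspan R' Ks 1 (\<lambda>_. x)" unfolding lspan_def using r by blast
    qed
  qed
  thus "R' \<subseteq> carrier K ==> lspan R' Ks 1 (\<lambda>_. x) = {r \<otimes> x | r. r \<in> R'}" .
  show "btuple K Ks 1 (\<lambda>_. x)"
    unfolding btuple_def
  proof (intro conjI ballI impI allI)
    show "(\<lambda>_. x) \<in> {..<1} \<rightarrow> carrier Ks" using assms by (simp add: self_module_def)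
    show "carrier Ks \<subseteq> lspan (carrier K) Ks 1 (\<lambda>_. x)"
    proof
      fix y assume "y \<in> carrier Ks"
      hence y: "y \<in> carrier K" by (simp add: self_module_def)
      hence "y = (y \<otimes> inv x) \<otimes> x" "y \<otimes> inv x \<in> carrier K" using assms by auto
      thus "y \<in> lspan (carrier K) Ks 1 (\<lambda>_. x)" using ls[of "carrier K"] by blast
    qed
    fix a i assume a: "a \<in> {..<1} \<rightarrow> carrier K" "lc Ks 1 a (\<lambda>_. x) = \<zero>\<^bsub>Ks\<^esub>" "i < (1::nat)"
    hence "a 0 \<otimes> x = \<zero>" using l[OF a(1)] by (simp add: self_module_def)
    thus "a i = \<zero>" using a assms integral[of "a 0" x] by auto
  qed
qed

text \<open>\<open>K\<close> is viewed as a one-dimensional space over itself, whose lattices have a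
  single generator.\<close>

lemma carrier_frac_ideals: "carrier (frac_ideals K (pid 0)) = range pid"
proof -
  have b1: "btuple K Ks 1 (\<lambda>_. \<one>)" by (rule self_btuple) auto
  interpret S: vspace K "Ks" by (rule vspace_self)
  interpret S: dvspace K "Ks" val
    by unfold_locales (rule S.btuple_basis(3)[OF b1])
  have d1: "S.dim = 1" by (rule S.btuple_basis(4)[OF b1])
  have "S.latt A \<longleftrightarrow> A \<in> range pid" for A
  proof
    assume "S.latt A"
    then obtain b where b: "btuple K Ks 1 b" "A = lspan (pid 0) Ks 1 b"
      by (auto simp: S.latt_def d1)
    have bc: "b 0 \<in> carrier K" using funcset_mem[OF S.btupleD(1)[OF b(1)], of 0] by (simp add: self_module_def)
    have "A = lspan (pid 0) Ks 1 (\<lambda>_. b 0)"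
      unfolding b(2) by (rule S.lspan_cong[OF pid_subring]) (use bc in "auto simp: self_module_def")
    moreover have "b 0 \<noteq> \<zero>"
    proof
      assume z: "b 0 = \<zero>"
      have "lc Ks 1 (\<lambda>_. \<one>) b = \<one> \<odot>\<^bsub>Ks\<^esub> b 0 \<oplus>\<^bsub>Ks\<^esub> lc Ks 0 (\<lambda>_. \<one>) b"
        using S.lc_Suc[of "\<lambda>_. \<one>" 0 b] bc by (simp add: self_module_def)
      moreover have "lc Ks 0 (\<lambda>_. \<one>) b = \<zero>" by (simp add: lc_def) (simp add: self_module_def)
      ultimately have "lc Ks 1 (\<lambda>_. \<one>) b = \<zero>\<^bsub>Ks\<^esub>"
        using z by (simp add: self_module_def)
      thus False using S.btupleD(3)[OF b(1), of "\<lambda>_. \<one>" 0] by simp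
    qed
    ultimately have "A = pid (val (b 0))"
      using self_btuple(2)[OF bc _ pid_carrier] pid_eq_multiples[OF bc] by simp
    thus "A \<in> range pid" by simp
  next
    assume "A \<in> range pid"
    then obtain k where k: "A = pid k" by blast
    obtain x where x: "x \<in> carrier K" "x \<noteq> \<zero>" "val x = k" using ex_val by blast
    have "A = lspan (pid 0) Ks 1 (\<lambda>_. x)"
      using self_btuple(2)[OF x(1,2) pid_carrier] pid_eq_multiples[OF x(1,2)] x(3) k by simp
    thus "S.latt A" using self_btuple(1)[OF x(1,2)] by (auto simp: S.latt_def d1)
  qed
  thus ?thesis by (auto simp: frac_ideals_def S.is_lattice_iff_latt)
qed

lemma frac_mult: "pid k \<otimes>\<^bsub>frac_ideals K (pid 0)\<^esub> pid l = pid (k + l)"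
proof -
  obtain x y where x: "x \<in> carrier K" "x \<noteq> \<zero>" "val x = k" and y: "y \<in> carrier K" "y \<noteq> \<zero>" "val y = l"
    using ex_val[of k] ex_val[of l] by blast
  have "rspan K (pid 0) Ks {a \<otimes> b | a b. a \<in> pid k \<and> b \<in> pid l} = pid (k + l)"
  proof (rule rspan_self_eq[where x = "x \<otimes> y"])
    show "x \<otimes> y \<in> {a \<otimes> b | a b. a \<in> pid k \<and> b \<in> pid l}" using x y by (auto simp: pid_def)
  qed (use x y pid_mult in "auto simp: val_mult")
  thus ?thesis by (simp add: frac_ideals_def)
qed

lemma frac_one: "\<one>\<^bsub>frac_ideals K (pid 0)\<^esub> = pid 0"
  by (simp add: frac_ideals_def)

lemma group_frac_ideals: "comm_group (frac_ideals K (pid 0))"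
proof (rule comm_groupI)
  fix A assume "A \<in> carrier (frac_ideals K (pid 0))"
  then obtain k where "A = pid k" by (auto simp: carrier_frac_ideals)
  hence "pid (- k) \<otimes>\<^bsub>frac_ideals K (pid 0)\<^esub> A = \<one>\<^bsub>frac_ideals K (pid 0)\<^esub>"
    by (simp add: frac_mult frac_one)
  thus "\<exists>B\<in>carrier (frac_ideals K (pid 0)). B \<otimes>\<^bsub>frac_ideals K (pid 0)\<^esub> A = \<one>\<^bsub>frac_ideals K (pid 0)\<^esub>"
    by (auto simp: carrier_frac_ideals)
qed (auto simp: carrier_frac_ideals frac_mult frac_one add_ac)

lemma frac_int_pow: "pid 1 [^]\<^bsub>frac_ideals K (pid 0)\<^esub> (m :: int) = pid m"
proof -
  interpret G: comm_group "frac_ideals K (pid 0)" by (rule group_frac_ideals)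
  have nat: "pid 1 [^]\<^bsub>frac_ideals K (pid 0)\<^esub> n = pid (int n)" for n :: nat
    by (induction n) (auto simp: frac_mult frac_one add_ac)
  have inv: "inv\<^bsub>frac_ideals K (pid 0)\<^esub> (pid k) = pid (- k)" for k
    by (rule G.inv_equality) (auto simp: carrier_frac_ideals frac_mult frac_one)
  show ?thesis
    by (cases "m \<ge> 0") (simp_all add: int_pow_def2 nat inv)
qed

end

context dvspace
begin

lemma lin_aut_det:
  assumes a: "lin_aut K V \<alpha>" and l: "isb l"
  shows "lin_det K V \<alpha> \<in> carrier K \<and> lin_det K V \<alpha> \<noteq> \<zero> \<and>
    val (lin_det K V \<alpha>) = val (Dt (\<alpha> \<circ> l)) - val (Dt l) \<and> isb (\<alpha> \<circ> l)"
proof -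
  have h: "\<alpha> \<in> module_hom K V V" and inj: "inj_on \<alpha> (carrier V)" using a by (auto simp: lin_aut_def bij_betw_def)
  note lc = isbD[OF l]
  have al: "\<alpha> \<circ> l \<in> vtup dim" using lc module_hom_closed[OF h] by auto
  have z: "\<alpha> 0\<^sub>V = 0\<^sub>V" using hom_lc[OF h, of "\<lambda>_. \<zero>" 0 l] by (simp add: lc_def)
  have ib: "isb (\<alpha> \<circ> l)"
  proof (rule independent_btuple[OF fin_dim al])
    fix b i assume b: "b \<in> ktup dim" "lc V dim b (\<alpha> \<circ> l) = 0\<^sub>V" "i < dim"
    have "\<alpha> (lc V dim b l) = \<alpha> 0\<^sub>V" using hom_lc[OF h b(1) lc] b(2) z by simp
    hence "lc V dim b l = 0\<^sub>V" using inj b(1) lc by (auto simp: inj_on_def)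
    thus "b i = \<zero>" using btupleD(3)[OF l b(1) _ b(3)] by simp
  qed
  have e: "Dt (\<alpha> \<circ> l) = lin_det K V \<alpha> \<otimes> Dt l" by (rule tdet_image[OF ref h lc])
  have dc: "lin_det K V \<alpha> \<in> carrier K"
  proof -
    have "\<alpha> \<circ> ref \<in> vtup dim" using isbD[OF ref] module_hom_closed[OF h] by auto
    thus ?thesis using lin_det_eq[OF ref h] tdet_closed[OF ref] by simp
  qed
  moreover have "lin_det K V \<alpha> \<noteq> \<zero>" using e Dt_nz[OF ib] Dt_nz[OF l] by auto
  ultimately show ?thesis using e Dt_nz[OF l] ib by (auto simp: val_mult)
qed

text \<open>An admissible automorphism maps a basis of \<open>L\<close> into \<open>M\<close>, which
  bounds the order of its determinant from below; the one that takes a basis of \<open>L\<close> to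
  a basis of \<open>M\<close> attains the bound.\<close>

lemma index_ideal_eq:
  assumes L: "latt L" and M: "latt M"
  shows "index_ideal K (pid 0) V L M = pid (vol M - vol L)"
proof -
  obtain l m where lm: "isb l" "L = lat l" "isb m" "M = lat m" using L M by (auto simp: latt_def)
  let ?S = "{lin_det K V \<alpha> | \<alpha>. lin_aut K V \<alpha> \<and> \<alpha> ` L \<subseteq> M}"
  note det = lin_aut_det[OF _ lm(1)]
  note vl = vol_lat[OF lm(1), folded lm(2)]
  have "rspan K (pid 0) (self_module K) ?S = pid (vol M - vol L)"
  proof (rule rspan_self_eq)
    show "?S \<subseteq> pid (vol M - vol L)"
    proof
      fix d assume "d \<in> ?S"
      then obtain \<alpha> where \<alpha>: "d = lin_det K V \<alpha>" "lin_aut K V \<alpha>" "\<alpha> ` L \<subseteq> M" by blast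
      have "\<alpha> \<circ> l \<in> {..<dim} \<rightarrow> lat m" using \<alpha>(3) lat_gen[OF lm(1)] lm(2,4) by auto
      hence "vol M \<le> val (Dt (\<alpha> \<circ> l))"
        using lat_subset_val[OF lm(3), of "\<alpha> \<circ> l"] det[OF \<alpha>(2)] vol_lat[OF lm(3)] lm(4) by simp
      thus "d \<in> pid (vol M - vol L)" using det[OF \<alpha>(2)] \<alpha>(1) vl by (simp add: pid_def)
    qed
    let ?\<alpha> = "tmap dim l m"
    have a: "lin_aut K V ?\<alpha>" by (rule lin_aut_tmap[OF lm(1,3)])
    have h: "?\<alpha> \<in> module_hom K V V" using a by (simp add: lin_aut_def)
    have im: "?\<alpha> (l i) = m i" if "i < dim" for i using tmap(2)[OF lm(1) isbD[OF lm(3)] that] .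
    have "?\<alpha> x \<in> M" if "x \<in> L" for x
    proof -
      obtain c where c: "c \<in> {..<dim} \<rightarrow> pid 0" "x = lc V dim c l" using \<open>x \<in> L\<close> lm(2) by (auto simp: lspan_def)
      have cK: "c \<in> ktup dim" using c pid_carrier[of 0] by auto
      have "?\<alpha> x = lc V dim c (?\<alpha> \<circ> l)" using hom_lc[OF h cK isbD[OF lm(1)]] c by simp
      also have "\<dots> = lc V dim c m" by (rule lc_cong) (use im cK isbD[OF lm(3)] in auto)
      finally show ?thesis using c(1) lm(4) unfolding lspan_def by blast
    qed
    thus "lin_det K V ?\<alpha> \<in> ?S" using a by blast
    show "lin_det K V ?\<alpha> \<noteq> \<zero>" using det[OF a] by simp
    have "Dt (?\<alpha> \<circ> l) = Dt m"
      unfolding tdet_def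
      by (rule R.leibniz_det_cong) (use im is_mat_tcoord[OF ref isbD[OF lm(3)]] in auto)
    thus "val (lin_det K V ?\<alpha>) = vol M - vol L" using det[OF a] vol_lat[OF lm(3)] lm(4) vl by simp
  qed
  thus ?thesis by (simp add: index_ideal_def)
qed

end

context dvquad
begin

text \<open>The description of \<open>lambda_exp\<close> ranges over all vectors of \<open>L\<close>
  of length \<open>q\<close> and all maximal lattices in their complements, so the given
  \<open>h\<close> and \<open>M\<close> are compared with arbitrary ones. Uniqueness follows from
  the given pair alone.\<close>

theorem lambda_exp_eq:
  assumes L: "latt L" and h: "h \<in> L" "\<phi> h h = q" "q \<noteq> \<zero>"
    and M: "maximal_lattice K (pid 0) (orth h) \<phi> M"
    and m: "{bil h x | x. x \<in> L} = pid m"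
    and l: "int l = m + dvspace.vol K (orth h) val (L \<inter> carrier (orth h))
      - dvspace.vol K (orth h) val M"
  shows "lambda_exp K (pid 0) (pid 1) V \<phi> L q = l"
proof -
  have hV: "h \<in> carrier V" using h rsubD(1)[OF latt_rsub[OF L]] by auto
  interpret H: dvquad_vec K V val \<phi> h by unfold_locales (use h hV in auto)
  have main: "\<exists>m'. {bil t x | x. x \<in> L} = pid m' \<and>
      (\<forall>M'. maximal_lattice K (pid 0) (orth t) \<phi> M' -->
        index_ideal K (pid 0) (orth t) M' (L \<inter> carrier (orth t)) = pid (int l - m'))"
    if t: "t \<in> L" "\<phi> t t = q" for t
  proof -
    have tV: "t \<in> carrier V" using t rsubD(1)[OF latt_rsub[OF L]] by auto
    interpret T: dvquad_vec K V val \<phi> t by unfold_locales (use t h tV in auto)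
    obtain m0 where m0: "{bil h x | x. x \<in> L} = pid m0"
      "val (bil h h) + disc L = 2 * (m0 + H.W.vol (L \<inter> carrier H.W) - H.W.vol M) + H.W.disc M"
      using H.order_formula[OF L M] by blast
    have "m0 = m" using m0(1) m by simp
    \<comment> \<open>The exponent is expressed through the order of \<open>bil h h\<close> and two
      discriminants. The first belongs to \<open>L\<close>, and by \<open>disc_orth_unique\<close>
      the second is the same for all vectors of this length.\<close>
    hence 1: "val (bil h h) + disc L = 2 * int l + H.W.disc M" using m0(2) l by simp
    obtain m' where m': "{bil t x | x. x \<in> L} = pid m'" "T.W.latt (L \<inter> carrier T.W)"
      using T.disc_section[OF L] by blast
    have "index_ideal K (pid 0) T.W M' (L \<inter> carrier T.W) = pid (int l - m')"
      if M': "maximal_lattice K (pid 0) T.W \<phi> M'" for M'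
    proof -
      obtain m2 where m2: "{bil t x | x. x \<in> L} = pid m2"
        "val (bil t t) + disc L = 2 * (m2 + T.W.vol (L \<inter> carrier T.W) - T.W.vol M') + T.W.disc M'"
        using T.order_formula[OF L M'] by blast
      have e: "m2 = m'" using m2(1) m'(1) by simp
      have d: "H.W.disc M = T.W.disc M'"
        by (rule disc_orth_unique[OF hV _ tV _ M M']) (use t h in auto)
      have "bil t t = bil h h" using t h by (simp add: bil_def)
      hence "int l = m' + T.W.vol (L \<inter> carrier T.W) - T.W.vol M'" using 1 m2(2) e d by simp
      moreover have "T.W.latt M'" using M' by (simp add: T.W.maximal_lattice_iff)
      ultimately show ?thesis using T.W.index_ideal_eq[OF _ m'(2)] by simp
    qed
    thus ?thesis using m'(1) by blast
  qed
  show ?thesis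
    unfolding lambda_exp_def frac_int_pow bil_def[symmetric]
  proof (rule the_equality)
    show "\<forall>t\<in>L. \<phi> t t = q --> (\<exists>m'. {bil t x | x. x \<in> L} = pid m' \<and>
      (\<forall>M'. maximal_lattice K (pid 0) (orth t) \<phi> M' -->
        index_ideal K (pid 0) (orth t) M' (L \<inter> carrier (orth t)) = pid (int l - m')))"
      using main by blast
    fix l' assume "\<forall>t\<in>L. \<phi> t t = q --> (\<exists>m'. {bil t x | x. x \<in> L} = pid m' \<and>
      (\<forall>M'. maximal_lattice K (pid 0) (orth t) \<phi> M' -->
        index_ideal K (pid 0) (orth t) M' (L \<inter> carrier (orth t)) = pid (int l' - m')))"
    then obtain m' where m': "{bil h x | x. x \<in> L} = pid m'"
      "index_ideal K (pid 0) H.W M (L \<inter> carrier H.W) = pid (int l' - m')" using h M by blast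
    obtain m2 where m2: "{bil h x | x. x \<in> L} = pid m2"
      "index_ideal K (pid 0) H.W M (L \<inter> carrier H.W) = pid (int l - m2)" using main[OF h(1,2)] M by blast
    show "l' = l" using m' m2 by simp
  qed
qed

end

section \<open>The ring of integers of a number field\<close>

abbreviation \<gg> :: "'f::field_char_0 set" where "\<gg> \<equiv> alg_ints"

section \<open>The algebraic integers form a ring\<close>

definition zspan :: "'f::field_char_0 set => 'f set"
  where "zspan B = range (\<lambda>c :: 'f => int. \<Sum>b\<in>B. of_int (c b) * b)"

lemma zspanI: "x = (\<Sum>b\<in>B. of_int (c b) * b) ==> x \<in> zspan B"
  by (auto simp: zspan_def)

lemma zspan_add: "x \<in> zspan B ==> y \<in> zspan B ==> x + y \<in> zspan B"
proof -
  assume "x \<in> zspan B" "y \<in> zspan B"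
  then obtain c d :: "'a => int" where "x = (\<Sum>b\<in>B. of_int (c b) * b)" "y = (\<Sum>b\<in>B. of_int (d b) * b)"
    by (auto simp: zspan_def)
  hence "x + y = (\<Sum>b\<in>B. of_int (c b + d b) * b)"
    by (simp add: sum.distrib algebra_simps)
  thus "x + y \<in> zspan B" by (rule zspanI)
qed

lemma zspan_zmult: "x \<in> zspan B ==> of_int k * x \<in> zspan B"
proof -
  assume "x \<in> zspan B"
  then obtain c :: "'a => int" where "x = (\<Sum>b\<in>B. of_int (c b) * b)"
    by (auto simp: zspan_def)
  hence "of_int k * x = (\<Sum>b\<in>B. of_int (k * c b) * b)"
    by (simp add: sum_distrib_left mult.assoc)
  thus "of_int k * x \<in> zspan B" by (rule zspanI)
qed

lemma zspan_gen: "finite B ==> b \<in> B ==> b \<in> zspan B"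
proof -
  assume B: "finite B" "b \<in> B"
  have "b = (\<Sum>x\<in>B. of_int (if x = b then 1 else 0) * x)"
    using B by (simp add: if_distrib[of of_int] if_distrib[of "\<lambda>u. u * _"] sum.delta cong: if_cong)
  thus ?thesis by (rule zspanI)
qed

lemma zspan_sum: "(\<And>i. i \<in> I ==> f i \<in> zspan B) ==> sum f I \<in> zspan B"
proof (induction I rule: infinite_finite_induct)
  case (insert x F)
  thus ?case by (simp add: zspan_add)
qed (use zspanI[of 0 "\<lambda>_. 0" B] in auto)

lemma zspan_mult:
  assumes "\<And>b. b \<in> B ==> x * b \<in> zspan B" "y \<in> zspan B"
  shows "x * y \<in> zspan B"
proof -
  obtain c :: "'a => int" where "y = (\<Sum>b\<in>B. of_int (c b) * b)"
    using assms(2) by (auto simp: zspan_def)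
  hence "x * y = (\<Sum>b\<in>B. of_int (c b) * (x * b))" by (simp add: sum_distrib_left algebra_simps)
  thus ?thesis using assms(1) by (auto intro!: zspan_sum zspan_zmult)
qed

text \<open>The determinant trick: an element mapping a finitely generated group into itself is an eigenvalue
  of an integral matrix.\<close>

lemma algebraic_int_criterion:
  fixes z :: "'f::field_char_0"
  assumes fin: "finite B" and b0: "b0 \<in> B" "b0 \<noteq> 0" and st: "\<And>b. b \<in> B ==> z * b \<in> zspan B"
  shows "algebraic_int z"
proof -
  obtain bs where bs: "set bs = B" "distinct bs" using finite_distinct_list[OF fin] by blast
  define n where "n = length bs"
  have "\<forall>b\<in>B. \<exists>c :: 'f => int. z * b = (\<Sum>x\<in>B. of_int (c x) * x)"
    using st by (auto simp: zspan_def)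
  then obtain c :: "'f => 'f => int" where c: "\<And>b. b \<in> B ==> z * b = (\<Sum>x\<in>B. of_int (c b x) * x)"
    by metis
  define A where "A = mat n n (\<lambda>(i, j). c (bs ! i) (bs ! j))"
  define v where "v = vec n (\<lambda>i. bs ! i)"
  let ?A = "map_mat of_int A :: 'f mat"
  have A: "A \<in> carrier_mat n n" "?A \<in> carrier_mat n n" by (auto simp: A_def)
  have bij: "bij_betw (\<lambda>i. bs ! i) {0..<n} B"
    using bs bij_betw_nth[OF bs(2)] by (auto simp: n_def atLeast0LessThan)
  have "?A *\<^sub>v v = z \<cdot>\<^sub>v v"
  proof (rule eq_vecI)
    fix i assume "i < dim_vec (z \<cdot>\<^sub>v v)"
    hence i: "i < n" by (simp add: v_def)
    hence "(?A *\<^sub>v v) $ i = (\<Sum>j = 0..<n. of_int (c (bs ! i) (bs ! j)) * bs ! j)"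
      by (auto simp: A_def v_def scalar_prod_def)
    also have "\<dots> = (\<Sum>x\<in>B. of_int (c (bs ! i) x) * x)"
      using sum.reindex_bij_betw[OF bij, of "\<lambda>x. of_int (c (bs ! i) x) * x"] by simp
    also have "\<dots> = z * bs ! i" using c[of "bs ! i"] i bs(1) by (auto simp: n_def)
    finally show "(?A *\<^sub>v v) $ i = (z \<cdot>\<^sub>v v) $ i" using i by (simp add: v_def)
  qed (auto simp: A_def v_def)
  moreover have "v \<noteq> 0\<^sub>v n"
  proof
    assume z: "v = 0\<^sub>v n"
    obtain i where "i < n" "bs ! i = b0" using b0(1) bs(1) by (auto simp: n_def in_set_conv_nth)
    hence "v $ i = b0" by (simp add: v_def)
    thus False using z b0(2) \<open>i < n\<close> by simp
  qed
  ultimately have "eigenvalue ?A z"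
    unfolding eigenvalue_def eigenvector_def using A(2) by (intro exI[of _ v]) (auto simp: v_def)
  hence "poly (char_poly ?A) z = 0" using eigenvalue_root_char_poly[OF A(2)] by simp
  moreover have "char_poly ?A = map_poly of_int (char_poly A)"
    by (rule of_int_hom.char_poly_hom[OF A(1)])
  moreover have "lead_coeff (char_poly A) = 1" using degree_monic_char_poly[OF A(1)] by auto
  ultimately show ?thesis unfolding algebraic_int_altdef_ipoly by metis
qed

lemma algebraic_int_power_reduce:
  fixes x :: "'f::field_char_0"
  assumes "algebraic_int x"
  shows "\<exists>d>0. \<exists>a :: nat => int. x ^ d = (\<Sum>i<d. of_int (a i) * x ^ i)"
proof -
  obtain p :: "int poly" where p: "poly (map_poly of_int p) x = 0" "lead_coeff p = 1"
    using assms unfolding algebraic_int_altdef_ipoly by blast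
  let ?d = "degree p"
  have "(\<Sum>i\<le>?d. of_int (coeff p i) * x ^ i) = 0"
    using p(1) by (simp add: poly_altdef degree_map_poly coeff_map_poly)
  hence "(\<Sum>i<?d. of_int (coeff p i) * x ^ i) + x ^ ?d = 0"
    using p(2) by (simp add: lessThan_Suc_atMost[symmetric] algebra_simps)
  hence e: "x ^ ?d = (\<Sum>i<?d. of_int (- coeff p i) * x ^ i)"
    by (simp add: sum_negf eq_neg_iff_add_eq_0 add.commute)
  \<comment> \<open>In degree zero the relation would read \<open>1 = 0\<close>.\<close>
  moreover have "?d > 0" using e by (cases "?d = 0") auto
  ultimately show ?thesis by (intro exI[of _ ?d] conjI exI[of _ "\<lambda>i. - coeff p i"]) auto
qed

text \<open>The monomials in \<open>x\<close> and \<open>y\<close> below the degrees of their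
  integral relations generate a group that is stable under both multiplications.\<close>

lemma algebraic_int_plus_times:
  fixes x y :: "'f::field_char_0"
  assumes "algebraic_int x" "algebraic_int y"
  shows "algebraic_int (x + y)" "algebraic_int (x * y)"
proof -
  obtain d a where d: "d > 0" and a: "x ^ d = (\<Sum>i<d. of_int (a i) * x ^ i)"
    using algebraic_int_power_reduce[OF assms(1)] by blast
  obtain e c where e: "e > 0" and c: "y ^ e = (\<Sum>i<e. of_int (c i) * y ^ i)"
    using algebraic_int_power_reduce[OF assms(2)] by blast
  define B where "B = (\<lambda>(i, j). x ^ i * y ^ j) ` ({..<d} \<times> {..<e})"
  have fin: "finite B" by (simp add: B_def)
  have gen: "x ^ i * y ^ j \<in> zspan B" if "i < d" "j < e" for i j
    using that by (intro zspan_gen[OF fin]) (auto simp: B_def)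
  have xB: "x * b \<in> zspan B" if b: "b \<in> B" for b
  proof -
    obtain i j where ij: "i < d" "j < e" "b = x ^ i * y ^ j" using b by (auto simp: B_def)
    show ?thesis
    proof (cases "Suc i < d")
      case True
      thus ?thesis using gen[of "Suc i" j] ij by (simp add: mult.assoc)
    next
      case False
      hence "x * b = x ^ d * y ^ j" using ij by (metis Suc_lessI mult.assoc power_Suc)
      also have "\<dots> = (\<Sum>i<d. of_int (a i) * (x ^ i * y ^ j))"
        unfolding a by (simp add: sum_distrib_right mult.assoc)
      finally show ?thesis using gen ij by (auto intro!: zspan_sum zspan_zmult)
    qed
  qed
  have yB: "y * b \<in> zspan B" if b: "b \<in> B" for b
  proof -
    obtain i j where ij: "i < d" "j < e" "b = x ^ i * y ^ j" using b by (auto simp: B_def)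
    show ?thesis
    proof (cases "Suc j < e")
      case True
      thus ?thesis using gen[of i "Suc j"] ij by (simp add: algebra_simps)
    next
      case False
      hence "Suc j = e" using ij by simp
      hence "y * b = y ^ e * x ^ i" using ij by (auto simp: algebra_simps)
      also have "\<dots> = (\<Sum>j<e. of_int (c j) * (x ^ i * y ^ j))"
        unfolding c sum_distrib_right by (rule sum.cong) (auto simp: algebra_simps)
      finally show ?thesis using gen ij by (auto intro!: zspan_sum zspan_zmult)
    qed
  qed
  have "x ^ 0 * y ^ 0 \<in> B" unfolding B_def using d e by (intro image_eqI[of _ _ "(0, 0)"]) auto
  hence one: "1 \<in> B" by simp
  show "algebraic_int (x + y)"
    by (rule algebraic_int_criterion[OF fin one]) (auto simp: ring_distribs xB yB intro!: zspan_add)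
  show "algebraic_int (x * y)"
  proof (rule algebraic_int_criterion[OF fin one])
    fix b assume "b \<in> B"
    hence "y * b \<in> zspan B" by (rule yB)
    thus "x * y * b \<in> zspan B" unfolding mult.assoc using zspan_mult[of B x "y * b"] xB by blast
  qed simp
qed

lemma alg_ints_closed [simp, intro]:
  fixes x y :: "'f::field_char_0"
  shows "x \<in> \<gg> ==> y \<in> \<gg> ==> x + y \<in> \<gg>"
  "x \<in> \<gg> ==> y \<in> \<gg> ==> x * y \<in> \<gg>"
  "x \<in> \<gg> ==> - x \<in> \<gg>"
  "x \<in> \<gg> ==> y \<in> \<gg> ==> x - y \<in> \<gg>"
  "(0::'f) \<in> \<gg>" "(1::'f) \<in> \<gg>" "(of_int k :: 'f) \<in> \<gg>" "(of_nat n :: 'f) \<in> \<gg>"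
  using algebraic_int_plus_times(1)[of x "- y"]
  by (auto simp: alg_ints_def algebraic_int_plus_times int_imp_algebraic_int)

lemma alg_ints_power [simp, intro]: "x \<in> \<gg> ==> x ^ n \<in> \<gg>"
  by (induction n) auto

lemma alg_ints_sum: "(\<And>i. i \<in> I ==> f i \<in> \<gg>) ==> sum f I \<in> \<gg>"
  by (induction I rule: infinite_finite_induct) auto

section \<open>Denominators and finiteness of the residue rings\<close>

lemma common_denominator:
  assumes "finite S"
  shows "\<exists>D>0. \<forall>r\<in>S. \<exists>k. of_int D * r = (of_int k :: rat)"
  using assms
proof (induction S rule: finite_induct)
  case (insert r S)
  then obtain D where D: "D > 0" "\<And>r. r \<in> S ==> \<exists>k. of_int D * r = (of_int k :: rat)" by blast
  obtain a b where ab: "quotient_of r = (a, b)" by (cases "quotient_of r")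
  have b: "b > 0" "r = of_int a / of_int b"
    using quotient_of_denom_pos[OF ab] quotient_of_div[OF ab] by auto
  have "\<exists>k. of_int (D * b) * s = (of_int k :: rat)" if "s \<in> insert r S" for s
  proof (cases "s = r")
    case True
    hence "of_int (D * b) * s = (of_int (D * a) :: rat)" using b by simp
    thus ?thesis by blast
  next
    case False
    then obtain k where "of_int D * s = (of_int k :: rat)" using D(2) \<open>s \<in> _\<close> by blast
    hence "of_int (D * b) * s = (of_int (b * k) :: rat)" by (simp add: algebra_simps)
    thus ?thesis by blast
  qed
  thus ?case using D(1) b(1) by (intro exI[of _ "D * b"]) auto
qed (auto intro: exI[of _ 1])

locale nfield =
  fixes ty :: "'f::field_char_0 itself"
  assumes nf: "number_field TYPE('f)"
begin

text \<open>Multiplication by \<open>x\<close> has rational coefficients with respect to a finite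
  spanning set; after multiplication by their common denominator
  \<open>algebraic_int_criterion\<close> applies.\<close>

lemma ex_denominator: "\<exists>d>0. of_int d * x \<in> (\<gg> :: 'f set)"
proof -
  obtain B :: "'f set" where B: "finite B" "\<And>x. \<exists>c::'f => rat. x = (\<Sum>b\<in>B. of_rat (c b) * b)"
    using nf unfolding number_field_def by blast
  obtain c :: "'f => 'f => rat" where c: "\<And>y. y = (\<Sum>b\<in>B. of_rat (c y b) * b)" using B(2) by metis
  have "finite ((\<lambda>(b, b'). c (x * b) b') ` (B \<times> B))" using B(1) by simp
  from common_denominator[OF this] obtain D where D: "D > 0"
    "\<And>b b'. b \<in> B ==> b' \<in> B ==> \<exists>k. of_int D * c (x * b) b' = (of_int k :: rat)" by fastforce
  have "\<exists>b\<in>B. b \<noteq> 0"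
  proof (rule ccontr)
    assume "\<not> ?thesis"
    hence "(1::'f) = 0" using c[of 1] by simp
    thus False by simp
  qed
  then obtain b0 where b0: "b0 \<in> B" "b0 \<noteq> 0" by blast
  have "algebraic_int (of_int D * x)"
  proof (rule algebraic_int_criterion[OF B(1) b0])
    fix b assume b: "b \<in> B"
    obtain k where k: "\<And>b'. b' \<in> B ==> of_int D * c (x * b) b' = (of_int (k b') :: rat)" using D(2)[OF b] by metis
    have "of_int D * x * b = of_int D * (\<Sum>b'\<in>B. of_rat (c (x * b) b') * b')" using c[of "x * b"] by (simp add: mult.assoc)
    also have "\<dots> = (\<Sum>b'\<in>B. of_rat (of_int D * c (x * b) b') * b')"
      by (simp add: sum_distrib_left of_rat_mult mult.assoc)
    also have "\<dots> = (\<Sum>b'\<in>B. of_int (k b') * b')" by (rule sum.cong) (auto simp: k)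
    finally show "of_int D * x * b \<in> zspan B" by (rule zspanI)
  qed
  thus ?thesis using D(1) by (auto simp: alg_ints_def)
qed

text \<open>For prime \<open>p\<close>: the classes of \<open>X\<close> in the quotient of the ring
  of integers by \<open>p\<close> are distinct and linearly independent over the field with
  \<open>p\<close> elements.\<close>

definition zindep :: "int => 'f set => bool"
  where "zindep p X \<longleftrightarrow> finite X \<and> X \<subseteq> \<gg> \<and>
    (\<forall>c :: 'f => int. (\<exists>y\<in>\<gg>. (\<Sum>x\<in>X. of_int (c x) * x) = of_int p * y) --> (\<forall>x\<in>X. p dvd c x))"

text \<open>Integers independent modulo \<open>p\<close> are linearly independent over the rationals.\<close>

lemma zindep_bound: "\<exists>N. \<forall>p X. prime p \<and> zindep p X --> card X \<le> N"
proof -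
  interpret Q: vector_space "\<lambda>(q::rat) (x::'f). of_rat q * x"
    by unfold_locales (auto simp: of_rat_add of_rat_mult algebra_simps)
  obtain B :: "'f set" where B: "finite B" "\<And>x. \<exists>c::'f => rat. x = (\<Sum>b\<in>B. of_rat (c b) * b)"
    using nf unfolding number_field_def by blast
  have span: "x \<in> Q.span B" for x
  proof -
    obtain c where "x = (\<Sum>b\<in>B. of_rat (c b) * b)" using B(2) by blast
    thus ?thesis by (auto intro!: Q.span_sum Q.span_scale intro: Q.span_base)
  qed
  have "card X \<le> card B" if p: "prime p" and X: "zindep p X" for p X
  proof -
    have fX: "finite X" using X by (simp add: zindep_def)
    have "Q.independent X"
    proof
      assume "Q.dependent X"
      then obtain t u where t: "t \<subseteq> X" "(\<Sum>v\<in>t. of_rat (u v) * v) = 0" "\<exists>v\<in>t. u v \<noteq> 0"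
        unfolding Q.dependent_explicit by blast
      define w where "w v = (if v \<in> t then u v else 0)" for v
      have w: "(\<Sum>v\<in>X. of_rat (w v) * v) = 0" "\<exists>v\<in>X. w v \<noteq> 0"
      proof -
        have "(\<Sum>v\<in>X. of_rat (w v) * v) = (\<Sum>v\<in>t. of_rat (w v) * v)"
          by (rule sum.mono_neutral_right[OF fX t(1)]) (auto simp: w_def)
        thus "(\<Sum>v\<in>X. of_rat (w v) * v) = 0" using t(2) by (simp add: w_def)
        show "\<exists>v\<in>X. w v \<noteq> 0" using t(1,3) by (auto simp: w_def)
      qed
      obtain D where D: "D > 0" "\<And>v. v \<in> X ==> \<exists>k. of_int D * w v = (of_int k :: rat)"
        using common_denominator[of "w ` X"] fX by auto
      obtain k where k: "\<And>v. v \<in> X ==> of_int D * w v = (of_int (k v) :: rat)" using D(2) by metis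
      let ?P = "\<lambda>c :: 'f => int. (\<Sum>v\<in>X. of_int (c v) * v) = 0 \<and> (\<exists>v\<in>X. c v \<noteq> 0)"
      have "?P k"
      proof
        have "(\<Sum>v\<in>X. of_int (k v) * v) = (\<Sum>v\<in>X. of_rat (of_int D * w v) * v)"
          by (rule sum.cong) (auto simp: k)
        also have "\<dots> = of_int D * (\<Sum>v\<in>X. of_rat (w v) * v)"
          by (simp add: sum_distrib_left of_rat_mult mult.assoc)
        finally show "(\<Sum>v\<in>X. of_int (k v) * v) = 0" using w(1) by simp
        obtain v where v: "v \<in> X" "w v \<noteq> 0" using w(2) by blast
        hence "k v \<noteq> 0" using k[OF v(1)] D(1) by auto
        thus "\<exists>v\<in>X. k v \<noteq> 0" using v(1) by blast
      qed
      \<comment> \<open>An integral relation with the smallest total size of coefficients.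
        Independence modulo \<open>p\<close> makes all its coefficients divisible by
        \<open>p\<close>, and division gives a smaller one.\<close>
      then obtain c where c: "?P c" "\<And>c'. ?P c' ==> (\<Sum>v\<in>X. nat \<bar>c v\<bar>) \<le> (\<Sum>v\<in>X. nat \<bar>c' v\<bar>)"
        using ex_has_least_nat[of ?P k "\<lambda>c. \<Sum>v\<in>X. nat \<bar>c v\<bar>"] by blast
      have "(\<Sum>x\<in>X. of_int (c x) * x) = of_int p * 0" using c(1) by simp
      hence dv: "\<forall>x\<in>X. p dvd c x" using X unfolding zindep_def by (meson alg_ints_closed(5))
      define c' where "c' v = c v div p" for v
      have cc: "c v = p * c' v" if "v \<in> X" for v using dv that by (simp add: c'_def)
      have p1: "p > 1" using p by (rule prime_gt_1_int)
      have "of_int p * (\<Sum>v\<in>X. of_int (c' v) * v) = (\<Sum>v\<in>X. of_int (c v) * v)"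
        unfolding sum_distrib_left by (rule sum.cong) (auto simp: cc)
      hence s0: "(\<Sum>v\<in>X. of_int (c' v) * v) = 0" using c(1) p1 by simp
      obtain v where v: "v \<in> X" "c v \<noteq> 0" using c(1) by blast
      hence P': "?P c'" using s0 cc[OF v(1)] by auto
      have "(\<Sum>v\<in>X. nat \<bar>c' v\<bar>) < (\<Sum>v\<in>X. nat \<bar>c v\<bar>)"
      proof (rule sum_strict_mono_ex1[OF fX])
        show "\<forall>v\<in>X. nat \<bar>c' v\<bar> \<le> nat \<bar>c v\<bar>" using cc p1 by (auto simp: abs_mult nat_le_eq_zle mult_le_cancel_right1)
        have "c' v \<noteq> 0" using cc[OF v(1)] v(2) by auto
        hence "\<bar>c' v\<bar> < \<bar>c v\<bar>" using cc[OF v(1)] p1 by (simp add: abs_mult)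
        thus "\<exists>v\<in>X. nat \<bar>c' v\<bar> < nat \<bar>c v\<bar>" using v(1) by (intro bexI[of _ v]) auto
      qed
      thus False using c(2)[OF P'] by simp
    qed
    thus ?thesis using Q.independent_span_bound[OF B(1), of X] span by auto
  qed
  thus ?thesis by blast
qed

text \<open>A largest set independent modulo \<open>p\<close> exists by \<open>zindep_bound\<close>
  and spans the quotient, which is therefore finite. That the ring of integers is finitely generated
  over the rational integers is not presupposed.\<close>

lemma residues_prime:
  assumes p: "prime p"
  shows "\<exists>S. finite S \<and> S \<subseteq> (\<gg> :: 'f set) \<and> (\<forall>y\<in>\<gg>. \<exists>s\<in>S. \<exists>z\<in>\<gg>. y = s + of_int p * z)"
proof -
  obtain N where N: "\<And>X. zindep p X ==> card X \<le> N" using zindep_bound p by blast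
  have "zindep p {}" by (simp add: zindep_def)
  then obtain X where X: "zindep p X" "\<And>Y. zindep p Y ==> card Y \<le> card X"
    using ex_has_greatest_nat[of "zindep p" "{}" card "Suc N"] N by (metis le_imp_less_Suc)
  have fX: "finite X" and Xg: "X \<subseteq> \<gg>" using X(1) by (auto simp: zindep_def)
  have p1: "p > 1" using p by (rule prime_gt_1_int)
  let ?S = "(\<lambda>r. \<Sum>x\<in>X. of_int (r x) * x) ` (X \<rightarrow>\<^sub>E {0..<p})"
  have "finite ?S" using fX by (intro finite_imageI finite_PiE) auto
  moreover have "?S \<subseteq> \<gg>" using Xg by (auto intro!: alg_ints_sum)
  moreover have "\<exists>s\<in>?S. \<exists>z\<in>\<gg>. y = s + of_int p * z" if y: "y \<in> \<gg>" for y
  proof -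
    have "\<exists>a :: 'f => int. \<exists>z\<in>\<gg>. y = (\<Sum>x\<in>X. of_int (a x) * x) + of_int p * z"
    proof (cases "y \<in> X")
      case True
      have "(\<Sum>x\<in>X. of_int (if x = y then 1 else 0) * x) = y"
        using True fX by (simp add: if_distrib[of of_int] if_distrib[of "\<lambda>u. u * _"] sum.delta cong: if_cong)
      thus ?thesis by (intro exI[of _ "\<lambda>x. if x = y then 1 else 0"] bexI[of _ 0]) auto
    next
      case False
      have "\<not> zindep p (insert y X)" using X(2)[of "insert y X"] False fX by auto
      then obtain c :: "'f => int" and z where z: "z \<in> \<gg>" "(\<Sum>x\<in>insert y X. of_int (c x) * x) = of_int p * z"
        and nd: "\<exists>x\<in>insert y X. \<not> p dvd c x" using fX Xg y unfolding zindep_def by blast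
      have e: "of_int (c y) * y + (\<Sum>x\<in>X. of_int (c x) * x) = of_int p * z" using z(2) False fX by simp
      have "\<not> p dvd c y"
      proof
        assume d: "p dvd c y"
        then obtain k where k: "c y = p * k" by blast
        have "(\<Sum>x\<in>X. of_int (c x) * x) = of_int p * (z - of_int k * y)" using e k by (simp add: algebra_simps)
        hence "\<forall>x\<in>X. p dvd c x" using X(1) z(1) y unfolding zindep_def
          by (meson alg_ints_closed(2,4,7))
        thus False using nd d by auto
      qed
      \<comment> \<open>The coefficient of \<open>y\<close> is invertible modulo \<open>p\<close>; a
        Bezout identity then solves the relation for \<open>y\<close>.\<close>
      hence "coprime p (c y)" by (rule prime_imp_coprime[OF p])
      then obtain s t where st: "s * c y + t * p = 1" by (metis coprime_iff_gcd_eq_1 bezout_int gcd.commute)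
      have "y = of_int (s * c y + t * p) * y" using st by simp
      also have "\<dots> = of_int s * (of_int (c y) * y) + of_int p * (of_int t * y)" by (simp add: algebra_simps)
      also have "of_int (c y) * y = of_int p * z - (\<Sum>x\<in>X. of_int (c x) * x)" using e by (simp add: algebra_simps)
      finally have "y = (\<Sum>x\<in>X. of_int (- s * c x) * x) + of_int p * (of_int s * z + of_int t * y)"
        by (simp add: algebra_simps sum_distrib_left sum_negf)
      thus ?thesis using z(1) y by (intro exI[of _ "\<lambda>x. - s * c x"] bexI[of _ "of_int s * z + of_int t * y"]) auto
    qed
    then obtain a :: "'f => int" and z where az: "z \<in> \<gg>" "y = (\<Sum>x\<in>X. of_int (a x) * x) + of_int p * z" by blast
    let ?r = "\<lambda>x\<in>X. a x mod p"
    have "(\<Sum>x\<in>X. of_int (a x) * x) = (\<Sum>x\<in>X. of_int (?r x) * x) + of_int p * (\<Sum>x\<in>X. of_int (a x div p) * x)"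
    proof -
      have "of_int (a x) * x = of_int (?r x) * x + of_int p * (of_int (a x div p) * x)" if "x \<in> X" for x :: 'f
      proof -
        have "a x = ?r x + p * (a x div p)" using that by simp
        thus ?thesis by (metis (no_types) distrib_right mult.assoc of_int_add of_int_mult)
      qed
      thus ?thesis unfolding sum_distrib_left sum.distrib[symmetric] by (rule sum.cong[OF refl])
    qed
    hence "y = (\<Sum>x\<in>X. of_int (?r x) * x) + of_int p * ((\<Sum>x\<in>X. of_int (a x div p) * x) + z)"
      using az(2) by (simp add: algebra_simps)
    moreover have "?r \<in> X \<rightarrow>\<^sub>E {0..<p}" using p1 by auto
    moreover have "(\<Sum>x\<in>X. of_int (a x div p) * x) + z \<in> \<gg>" using az(1) Xg by (auto intro!: alg_ints_sum)
    ultimately show ?thesis by blast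
  qed
  ultimately show ?thesis by (intro exI[of _ ?S]) blast
qed

text \<open>One prime factor is split off at a time; representatives are combined as
  \<open>s + p s'\<close>.\<close>

lemma residues:
  assumes "m > 0"
  shows "\<exists>S. finite S \<and> S \<subseteq> (\<gg> :: 'f set) \<and> (\<forall>y\<in>\<gg>. \<exists>s\<in>S. \<exists>z\<in>\<gg>. y = s + of_int m * z)"
  using assms
proof (induction "nat m" arbitrary: m rule: less_induct)
  case less
  show ?case
  proof (cases "m = 1")
    case True
    thus ?thesis by (intro exI[of _ "{0}"]) auto
  next
    case False
    then obtain p where p: "prime p" "p dvd m" using less.prems prime_divisor_exists[of m] by auto
    then obtain m' where m': "m = p * m'" by blast
    have p1: "p > 1" using p(1) by (rule prime_gt_1_int)
    have m'0: "m' > 0" using m' less.prems p1 by (simp add: zero_less_mult_iff)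
    have "nat m' < nat m" using m' m'0 p1 by simp
    then obtain S' where S': "finite S'" "S' \<subseteq> (\<gg> :: 'f set)"
      "\<And>y. y \<in> \<gg> ==> \<exists>s\<in>S'. \<exists>z\<in>\<gg>. y = s + of_int m' * z" using less.hyps[OF \<open>nat m' < nat m\<close> m'0] by blast
    obtain S where S: "finite S" "S \<subseteq> (\<gg> :: 'f set)"
      "\<And>y. y \<in> \<gg> ==> \<exists>s\<in>S. \<exists>z\<in>\<gg>. y = s + of_int p * z" using residues_prime[OF p(1)] by blast
    let ?T = "(\<lambda>(s, s'). s + of_int p * s') ` (S \<times> S')"
    have "\<exists>t\<in>?T. \<exists>z\<in>\<gg>. y = t + of_int m * z" if y: "y \<in> \<gg>" for y
    proof -
      obtain s z where s: "s \<in> S" "z \<in> \<gg>" "y = s + of_int p * z" using S(3)[OF y] by blast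
      obtain s' z' where s': "s' \<in> S'" "z' \<in> \<gg>" "z = s' + of_int m' * z'" using S'(3)[OF s(2)] by blast
      have "y = (s + of_int p * s') + of_int m * z'" using s(3) s'(3) m' by (simp add: algebra_simps)
      thus ?thesis using s(1) s'(1,2) by (intro bexI[of _ "s + of_int p * s'"] bexI[of _ z']) auto
    qed
    moreover have "finite ?T" "?T \<subseteq> \<gg>" using S(1,2) S'(1,2) by (auto simp: subset_iff)
    ultimately show ?thesis by (intro exI[of _ ?T]) blast
  qed
qed

text \<open>Elements all of whose powers have a common denominator are integral: two powers agree modulo
  the ring of integers.\<close>

lemma almost_integral:
  assumes m: "m > 0" and x: "\<And>k. of_int m * x ^ k \<in> (\<gg> :: 'f set)"
  shows "x \<in> \<gg>"
proof -
  obtain S where S: "finite S" "\<And>y. y \<in> (\<gg> :: 'f set) ==> \<exists>s\<in>S. \<exists>z\<in>\<gg>. y = s + of_int m * z"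
    using residues[OF m] by blast
  obtain f where f: "\<And>k. f k \<in> S \<and> (\<exists>z\<in>\<gg>. of_int m * x ^ k = f k + of_int m * z)"
    using S(2)[OF x] by metis
  have "range f \<subseteq> S" using f by auto
  hence "\<not> inj f" using finite_subset[OF _ S(1)] range_inj_infinite by blast
  then obtain i j where "i \<noteq> j" "f i = f j" by (auto simp: inj_def)
  then obtain i j where ij: "i < j" "f i = f j" by (metis nat_neq_iff)
  obtain z z' where z: "z \<in> \<gg>" "of_int m * x ^ i = f i + of_int m * z"
    "z' \<in> \<gg>" "of_int m * x ^ j = f j + of_int m * z'" using f[of i] f[of j] by blast
  have "of_int m * (x ^ j - x ^ i) = of_int m * (z' - z)" using z ij by (simp add: algebra_simps)
  hence e: "x ^ j - x ^ i = z' - z" using m by simp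
  \<comment> \<open>The monic polynomial \<open>X^j - X^i\<close> takes an integral value at
    \<open>x\<close>, which makes \<open>x\<close> integral as well.\<close>
  let ?p = "monom 1 j - monom 1 i :: 'f poly"
  have deg: "degree ?p = j"
    using ij(1) degree_add_eq_left[of "- monom 1 i" "monom (1::'f) j"] by (simp add: degree_monom_eq)
  have "algebraic_int x"
  proof (rule algebraic_int_root[of "z' - z" ?p])
    show "algebraic_int (z' - z)" using z by (metis alg_ints_closed(4) alg_ints_def mem_Collect_eq)
    show "poly ?p x = z' - z" using e by (simp add: poly_monom)
    show "\<forall>i. coeff ?p i \<in> \<int>" by (auto simp: coeff_diff)
    show "lead_coeff ?p = 1" using ij(1) by (simp add: deg)
    show "degree ?p > 0" using deg ij by simp
  qed
  thus ?thesis by (simp add: alg_ints_def)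
qed

section \<open>Ideals and primes of the ring of integers\<close>

definition gideal :: "'f set => bool"
  where "gideal I \<longleftrightarrow> I \<subseteq> \<gg> \<and> 0 \<in> I \<and> (\<forall>x\<in>I. \<forall>y\<in>I. x + y \<in> I) \<and> (\<forall>r\<in>\<gg>. \<forall>x\<in>I. r * x \<in> I)"

lemma gidealD:
  assumes "gideal I"
  shows "x \<in> I ==> x \<in> \<gg>" "0 \<in> I" "x \<in> I ==> y \<in> I ==> x + y \<in> I"
    "r \<in> \<gg> ==> x \<in> I ==> r * x \<in> I" "x \<in> I ==> - x \<in> I" "x \<in> I ==> y \<in> I ==> x - y \<in> I"
proof -
  show *: "x \<in> I ==> x \<in> \<gg>" "0 \<in> I" "x \<in> I ==> y \<in> I ==> x + y \<in> I"
    "r \<in> \<gg> ==> x \<in> I ==> r * x \<in> I" for x y r using assms by (auto simp: gideal_def)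
  show m: "x \<in> I ==> - x \<in> I" for x using *(4)[of "- 1" x] by simp
  show "x \<in> I ==> y \<in> I ==> x - y \<in> I" using *(3)[of x "- y"] m[of y] by simp
qed

lemma gideal_contains_int:
  assumes "gideal I" "x \<in> I" "x \<noteq> 0"
  shows "\<exists>m>0. of_int m \<in> I"
proof -
  obtain d where d: "d > 0" "of_int d * (1 / x) \<in> (\<gg> :: 'f set)" using ex_denominator by blast
  hence "(of_int d * (1 / x)) * x \<in> I" using gidealD(4)[OF assms(1)] assms(2) by blast
  thus ?thesis using d(1) assms(3) by auto
qed

text \<open>An ideal containing \<open>m\<close> is determined by the representatives modulo
  \<open>m\<close> that it contains. This finiteness is used wherever a family of ideals needs a
  maximal member or a chain of ideals has to stop.\<close>

lemma finite_ideals_above: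
  assumes "m > 0" shows "finite {I. gideal I \<and> of_int m \<in> I}"
proof -
  obtain S where S: "finite S" "\<And>y. y \<in> (\<gg> :: 'f set) ==> \<exists>s\<in>S. \<exists>z\<in>\<gg>. y = s + of_int m * z"
    using residues[OF assms] by blast
  have sub: "I \<subseteq> J" if I: "gideal I" "of_int m \<in> I" and J: "gideal J" "of_int m \<in> J" and e: "I \<inter> S = J \<inter> S" for I J
  proof
    fix x assume x: "x \<in> I"
    then obtain s z where s: "s \<in> S" "z \<in> \<gg>" "x = s + of_int m * z" using S(2) gidealD(1)[OF I(1)] by blast
    have "s = x - z * of_int m" using s(3) by (simp add: algebra_simps)
    hence "s \<in> I" using gidealD(6)[OF I(1) x gidealD(4)[OF I(1) s(2) I(2)]] by simp
    hence "s \<in> J" using s(1) e by blast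
    hence "s + z * of_int m \<in> J" using gidealD(3,4)[OF J(1)] s(2) J(2) by blast
    thus "x \<in> J" using s(3) by (simp add: algebra_simps)
  qed
  have "inj_on (\<lambda>I. I \<inter> S) {I. gideal I \<and> of_int m \<in> I}"
    by (rule inj_onI) (use sub in blast)
  moreover have "finite ((\<lambda>I. I \<inter> S) ` {I. gideal I \<and> of_int m \<in> I})"
    by (rule finite_subset[of _ "Pow S"]) (use S(1) in auto)
  ultimately show ?thesis by (rule finite_imageD[rotated])
qed

lemma cring_alg_ints: "cring (class_ring\<lparr>carrier := (\<gg> :: 'f set)\<rparr>)"
proof (rule cringI)
  show "abelian_group (class_ring\<lparr>carrier := (\<gg> :: 'f set)\<rparr>)"
  proof (rule abelian_groupI)
    fix x assume "x \<in> carrier (class_ring\<lparr>carrier := (\<gg> :: 'f set)\<rparr>)"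
    thus "\<exists>y\<in>carrier (class_ring\<lparr>carrier := \<gg>\<rparr>).
        y \<oplus>\<^bsub>class_ring\<lparr>carrier := \<gg>\<rparr>\<^esub> x = \<zero>\<^bsub>class_ring\<lparr>carrier := \<gg>\<rparr>\<^esub>"
      by (intro bexI[of _ "- x"]) auto
  qed auto
  show "Group.comm_monoid (class_ring\<lparr>carrier := (\<gg> :: 'f set)\<rparr>)"
    by (rule comm_monoidI) auto
qed (auto simp: algebra_simps)

lemma ideal_iff_gideal: "ideal I (class_ring\<lparr>carrier := (\<gg> :: 'f set)\<rparr>) \<longleftrightarrow> gideal I"
proof
  let ?g = "class_ring\<lparr>carrier := (\<gg> :: 'f set)\<rparr>"
  assume "ideal I ?g"
  then interpret I: ideal I ?g .
  show "gideal I"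
    unfolding gideal_def
    using I.a_subset I.additive_subgroup_axioms additive_subgroup.zero_closed[of I ?g]
      additive_subgroup.a_closed[of I ?g] I.I_l_closed by auto
next
  let ?g = "class_ring\<lparr>carrier := (\<gg> :: 'f set)\<rparr>"
  assume I: "gideal I"
  interpret g: cring ?g by (rule cring_alg_ints)
  note d = gidealD[OF I]
  show "ideal I ?g"
  proof (rule idealI[OF g.ring_axioms])
    show "subgroup I (add_monoid ?g)"
    proof (rule subgroup.intro)
      fix x assume x: "x \<in> I"
      have "inv\<^bsub>add_monoid ?g\<^esub> x = - x"
        using g.minus_equality[of "- x" x] d(1)[OF x] by (simp add: a_inv_def)
      thus "inv\<^bsub>add_monoid ?g\<^esub> x \<in> I" using d(5)[OF x] by simp
    qed (use d in auto)
  next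
    fix a x assume "a \<in> I" "x \<in> carrier ?g"
    thus "x \<otimes>\<^bsub>?g\<^esub> a \<in> I" "a \<otimes>\<^bsub>?g\<^esub> x \<in> I" using d(4)[of x a] by (auto simp: mult.commute[of a x])
  qed
qed

lemma finite_primes_iff:
  "P \<in> finite_primes \<longleftrightarrow> gideal P \<and> 1 \<notin> P \<and>
    (\<forall>a\<in>\<gg>. \<forall>b\<in>\<gg>. a * b \<in> P --> a \<in> P \<or> b \<in> P) \<and> P \<noteq> {0}"
proof -
  have "gideal P ==> \<gg> \<noteq> P \<longleftrightarrow> 1 \<notin> P"
    using gidealD(1,4)[of P] alg_ints_closed(6) by (metis mult.right_neutral subset_antisym subsetI)
  thus ?thesis
    unfolding finite_primes_def primeideal_def primeideal_axioms_def ideal_iff_gideal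
    using cring_alg_ints by auto
qed

text \<open>The proper ideals above \<open>I\<close> containing a fixed nonzero integer of
  \<open>I\<close> are finite in number; a maximal one among them is prime.\<close>

lemma ex_prime_above:
  assumes I: "gideal I" "1 \<notin> I" "I \<noteq> {0}"
  shows "\<exists>P\<in>finite_primes. I \<subseteq> P"
proof -
  obtain x where "x \<in> I" "x \<noteq> 0" using I(3) gidealD(2)[OF I(1)] by blast
  then obtain m where m: "m > 0" "of_int m \<in> I" using gideal_contains_int[OF I(1)] by blast
  define F where "F = {J. gideal J \<and> of_int m \<in> J \<and> 1 \<notin> J \<and> I \<subseteq> J}"
  have "finite F" unfolding F_def by (rule finite_subset[OF _ finite_ideals_above[OF m(1)]]) auto
  moreover have "I \<in> F" using I m by (auto simp: F_def)
  ultimately have "\<exists>P\<in>F. \<forall>J\<in>F. P \<le> J --> P = J" by (intro finite_has_maximal) auto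
  then obtain P where P: "P \<in> F" "\<And>J. J \<in> F ==> P \<subseteq> J ==> P = J" by blast
  have gP: "gideal P" "1 \<notin> P" and Pm: "of_int m \<in> P" "I \<subseteq> P" using P(1) by (auto simp: F_def)
  note d = gidealD[OF gP(1)]
  have "b \<in> P" if ab: "a \<in> \<gg>" "b \<in> \<gg>" "a * b \<in> P" "a \<notin> P" for a b
  proof -
    let ?J = "{p + a * r | p r. p \<in> P \<and> r \<in> \<gg>}"
    have "gideal ?J"
      unfolding gideal_def
    proof (intro conjI ballI)
      show "?J \<subseteq> \<gg>" using d(1) ab(1) by auto
      show "0 \<in> ?J" using d(2) by (intro CollectI exI[of _ 0]) auto
      fix x y assume "x \<in> ?J" "y \<in> ?J"
      then obtain p r p' r' where *: "x = p + a * r" "y = p' + a * r'" "p \<in> P" "p' \<in> P" "r \<in> \<gg>" "r' \<in> \<gg>" by blast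
      have "x + y = (p + p') + a * (r + r')" using * by (simp add: algebra_simps)
      thus "x + y \<in> ?J" using * d(3) by blast
    next
      fix s x :: 'f assume "s \<in> \<gg>" "x \<in> ?J"
      then obtain p r where *: "x = p + a * r" "p \<in> P" "r \<in> \<gg>" by blast
      have "s * x = s * p + a * (s * r)" using * by (simp add: algebra_simps)
      thus "s * x \<in> ?J" using * d(4) \<open>s \<in> \<gg>\<close> by blast
    qed
    hence gJ: "gideal ?J" .
    have PJ: "P \<subseteq> ?J"
    proof
      fix x assume "x \<in> P"
      moreover have "x = x + a * 0" by simp
      ultimately show "x \<in> ?J" using alg_ints_closed(5) by blast
    qed
    have "a = 0 + a * 1" by simp
    hence aJ: "a \<in> ?J" using d(2) alg_ints_closed(6) by blast
    have "1 \<in> ?J"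
    proof (rule ccontr)
      assume "1 \<notin> ?J"
      hence "?J \<in> F" unfolding F_def using gJ PJ Pm by auto
      thus False using P(2)[OF _ PJ] aJ ab(4) by auto
    qed
    then obtain p r where pr: "1 = p + a * r" "p \<in> P" "r \<in> \<gg>" by blast
    have "b = b * p + r * (a * b)" using arg_cong[OF pr(1), of "\<lambda>z. z * b"] by (simp add: algebra_simps)
    thus "b \<in> P" using d(3,4) pr ab by metis
  qed
  moreover have "P \<noteq> {0}" using Pm(1) m(1) by auto
  ultimately have "P \<in> finite_primes" unfolding finite_primes_iff using gP by blast
  thus ?thesis using Pm(2) by blast
qed

lemma ex_denom: "\<exists>d\<in>\<gg> - {0}. d * x \<in> (\<gg> :: 'f set)"
proof -
  obtain d where "d > 0" "of_int d * x \<in> (\<gg> :: 'f set)" using ex_denominator by blast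
  thus ?thesis by (intro bexI[of _ "of_int d"]) auto
qed

text \<open>The multiplicative set \<open>X\<close> will be the nonzero algebraic integers or the
  complement of a prime, so that global and local clearing of denominators is one argument.\<close>

lemma common_multiple:
  fixes X :: "'f set"
  assumes "finite S" and X: "X \<subseteq> \<gg>" "1 \<in> X" "\<And>s t. s \<in> X ==> t \<in> X ==> s * t \<in> X"
    and mono: "\<And>d e s. s \<in> S ==> d \<in> X ==> e \<in> X ==> Q d s ==> Q (e * d) s"
    and "\<And>s. s \<in> S ==> \<exists>d\<in>X. Q d s"
  shows "\<exists>d\<in>X. \<forall>s\<in>S. Q d s"
  using assms(1,5,6)
proof (induction S rule: finite_induct)
  case (insert s S)
  then obtain d e where d: "d \<in> X" "\<forall>s\<in>S. Q d s" and e: "e \<in> X" "Q e s" by blast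
  have "Q (e * d) t" if "t \<in> S" for t using insert.prems(1)[of t d e] that d e by auto
  moreover have "Q (d * e) s" using insert.prems(1)[of s e d] d e by auto
  ultimately have "\<forall>t\<in>insert s S. Q (d * e) t" by (auto simp: mult.commute[of d e])
  thus ?case using X(3)[OF d(1) e(1)] by blast
qed (use X(2) in auto)

lemmas common_nonzero = common_multiple[where X = "\<gg> - {0}", simplified]

text \<open>Two powers of \<open>x\<close> agree modulo \<open>m\<close>. For \<open>x\<close>
  outside a prime that contains \<open>m\<close>, this provides an inverse of \<open>x\<close>
  modulo the prime.\<close>

lemma power_congruent:
  assumes m: "m > 0" and x: "x \<in> (\<gg> :: 'f set)"
  shows "\<exists>i k. \<exists>z\<in>\<gg>. x ^ i * (1 - x * x ^ k) = of_int m * z"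
proof -
  obtain S where S: "finite S" "\<And>y. y \<in> (\<gg> :: 'f set) ==> \<exists>r\<in>S. \<exists>z\<in>\<gg>. y = r + of_int m * z"
    using residues[OF m] by blast
  obtain f where f: "\<And>k. f k \<in> S \<and> (\<exists>z\<in>\<gg>. x ^ k = f k + of_int m * z)"
    using S(2)[OF alg_ints_power[OF x]] by metis
  hence "range f \<subseteq> S" by auto
  hence "\<not> inj f" using finite_subset[OF _ S(1)] range_inj_infinite by blast
  then obtain i j where "i \<noteq> j" "f i = f j" by (auto simp: inj_def)
  then obtain i j where ij: "i < j" "f i = f j" by (metis nat_neq_iff)
  obtain z z' where z: "z \<in> \<gg>" "x ^ i = f i + of_int m * z" "z' \<in> \<gg>" "x ^ j = f j + of_int m * z'"
    using f[of i] f[of j] by blast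
  have "i + Suc (j - i - 1) = j" using ij by simp
  hence "x ^ j = x ^ i * x ^ Suc (j - i - 1)" by (simp only: power_add[symmetric])
  moreover have "x ^ i - x ^ j = of_int m * (z - z')" using z ij by (simp add: algebra_simps)
  ultimately have "x ^ i * (1 - x * x ^ (j - i - 1)) = of_int m * (z - z')" by (simp add: algebra_simps)
  thus ?thesis using z by blast
qed

text \<open>For \<open>x\<close> in \<open>Q\<close> outside \<open>P\<close>,
  \<open>power_congruent\<close> puts some \<open>1 - x x^k\<close> into \<open>P\<close>, and then
  1 would lie in \<open>Q\<close>.\<close>

lemma primes_maximal:
  assumes P: "P \<in> finite_primes" and Q: "Q \<in> finite_primes" and PQ: "P \<subseteq> Q"
  shows "P = (Q :: 'f set)"
proof (rule ccontr)
  assume "P \<noteq> Q"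
  then obtain x where x: "x \<in> Q" "x \<notin> P" using PQ by blast
  have gP: "gideal P" and gQ: "gideal Q" and one: "1 \<notin> P" "1 \<notin> Q"
    and pr: "\<And>a b. a \<in> \<gg> ==> b \<in> \<gg> ==> a * b \<in> P ==> a \<in> P \<or> b \<in> P"
    using P Q by (auto simp: finite_primes_iff)
  have xg: "x \<in> \<gg>" using x(1) gidealD(1)[OF gQ] by blast
  obtain u where "u \<in> P" "u \<noteq> 0" using P gidealD(2)[OF gP] by (auto simp: finite_primes_iff)
  then obtain m where m: "m > 0" "of_int m \<in> P" using gideal_contains_int[OF gP] by blast
  obtain i k z where z: "z \<in> \<gg>" "x ^ i * (1 - x * x ^ k) = of_int m * z" using power_congruent[OF m(1) xg] by blast
  have "x ^ i * (1 - x * x ^ k) \<in> P" unfolding z(2) using gidealD(4)[OF gP z(1) m(2)] by (simp only: mult.commute)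
  moreover have "x ^ n \<notin> P" for n
    by (induction n) (use one x(2) pr xg in auto)
  ultimately have "1 - x * x ^ k \<in> P" using pr[of "x ^ i" "1 - x * x ^ k"] xg by auto
  moreover have "x ^ k * x \<in> Q" by (rule gidealD(4)[OF gQ alg_ints_power[OF xg] x(1)])
  ultimately have "(1 - x * x ^ k) + x ^ k * x \<in> Q" using PQ gidealD(3)[OF gQ] by blast
  thus False using one(2) by (simp add: mult.commute)
qed

end

subsection \<open>The valuation of a prime ideal\<close>

locale nprime = nfield ty for ty :: "'f::field_char_0 itself" +
  fixes P :: "'f set"
  assumes P: "P \<in> finite_primes"
begin

lemma gP: "gideal P" and one_P: "1 \<notin> P" and P_ne: "P \<noteq> {0}"
  using P by (auto simp: finite_primes_iff)

lemma prime_P: "a \<in> \<gg> ==> b \<in> \<gg> ==> a * b \<in> P ==> a \<in> P \<or> b \<in> P"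
  using P by (auto simp: finite_primes_iff)

lemmas P_ideal = gidealD[OF gP]

lemma P_compl_mult: "s \<in> \<gg> - P ==> t \<in> \<gg> - P ==> s * t \<in> \<gg> - P"
  using prime_P by auto

lemma P_compl_one: "1 \<in> \<gg> - P"
  using one_P by simp

lemma P_compl_nz: "s \<in> \<gg> - P ==> s \<noteq> 0"
  using P_ideal(2) by auto

text \<open>The local ring of \<open>P\<close>, realised inside the number field.\<close>

definition Rloc :: "'f set"
  where "Rloc = {x. \<exists>s\<in>\<gg> - P. s * x \<in> \<gg>}"

lemma RlocI: "s \<in> \<gg> - P ==> s * x \<in> \<gg> ==> x \<in> Rloc"
  by (auto simp: Rloc_def)

lemma alg_ints_Rloc: "x \<in> \<gg> ==> x \<in> Rloc"
  using RlocI[OF P_compl_one] by simp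

lemma Rloc_add: "x \<in> Rloc ==> y \<in> Rloc ==> x + y \<in> Rloc"
proof -
  assume "x \<in> Rloc" "y \<in> Rloc"
  then obtain s t where st: "s \<in> \<gg> - P" "s * x \<in> \<gg>" "t \<in> \<gg> - P" "t * y \<in> \<gg>"
    by (auto simp: Rloc_def)
  have "(s * t) * (x + y) = t * (s * x) + s * (t * y)" by (simp add: algebra_simps)
  hence "(s * t) * (x + y) \<in> \<gg>" using st by auto
  thus ?thesis using RlocI P_compl_mult st by blast
qed

lemma Rloc_mult: "x \<in> Rloc ==> y \<in> Rloc ==> x * y \<in> Rloc"
proof -
  assume "x \<in> Rloc" "y \<in> Rloc"
  then obtain s t where st: "s \<in> \<gg> - P" "s * x \<in> \<gg>" "t \<in> \<gg> - P" "t * y \<in> \<gg>"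
    by (auto simp: Rloc_def)
  have "(s * t) * (x * y) = (s * x) * (t * y)" by (simp add: algebra_simps)
  hence "(s * t) * (x * y) \<in> \<gg>" using alg_ints_closed(2)[OF st(2,4)] by (simp only:)
  thus ?thesis using RlocI P_compl_mult st by blast
qed

lemma P_int: "\<exists>m>0. of_int m \<in> P"
proof -
  obtain x where "x \<in> P" "x \<noteq> 0" using P_ne P_ideal(2) by blast
  thus ?thesis using gideal_contains_int[OF gP] by blast
qed

text \<open>Choosing \<open>b\<close> such that the annihilator of \<open>b\<close> modulo \<open>m\<close> is maximal makes this annihilator a
  prime ideal, hence equal to \<open>P\<close>; then \<open>b / m\<close> is inverse to a local generator of \<open>P\<close>.\<close>

lemma ex_uniformizer: "\<exists>\<pi>\<in>P. \<exists>y. (\<forall>x\<in>P. y * x \<in> \<gg>) \<and> y * \<pi> \<in> \<gg> - P"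
proof -
  obtain m where m: "m > 0" "of_int m \<in> P" using P_int by blast
  have m0: "of_int m \<noteq> (0::'f)" using m by simp
  have div: "b \<in> Rloc" if s: "s \<in> \<gg> - P" and b: "s * b \<in> Rloc" for s b
  proof -
    have "1 / s \<in> Rloc" using P_compl_nz[OF s] by (intro RlocI[OF s]) simp
    hence "(1 / s) * (s * b) \<in> Rloc" using Rloc_mult b by blast
    thus ?thesis using P_compl_nz[OF s] by simp
  qed
  define J where "J b = {r \<in> \<gg>. r * b \<in> Rloc}" for b
  have gJ: "gideal (J b)" for b
    using Rloc_add Rloc_mult[OF alg_ints_Rloc] alg_ints_Rloc[of 0]
    by (auto simp: gideal_def J_def distrib_right mult.assoc)
  have mJ: "of_int m \<in> J b" if "of_int m * b \<in> \<gg>" for b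
    using alg_ints_Rloc[OF that] by (simp add: J_def)
  define F where "F = {J b | b. of_int m * b \<in> \<gg> \<and> b \<notin> Rloc}"
  have "finite F"
    by (rule finite_subset[OF _ finite_ideals_above[OF m(1)]]) (use gJ mJ in "auto simp: F_def")
  moreover have "1 / of_int m \<notin> Rloc"
  proof
    assume "1 / of_int m \<in> Rloc"
    then obtain s where s: "s \<in> \<gg> - P" "s * (1 / of_int m) \<in> \<gg>" by (auto simp: Rloc_def)
    have "s * (1 / of_int m) * of_int m \<in> P" by (rule P_ideal(4)[OF s(2) m(2)])
    thus False using s(1) m0 by simp
  qed
  hence "J (1 / of_int m) \<in> F" using m0 unfolding F_def by force
  ultimately have "\<exists>I\<in>F. \<forall>I'\<in>F. I \<le> I' --> I = I'" by (intro finite_has_maximal) auto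
  then obtain b where b: "of_int m * b \<in> \<gg>" "b \<notin> Rloc" and max: "\<And>I'. I' \<in> F ==> J b \<subseteq> I' ==> J b = I'"
    by (auto simp: F_def)
  have Jprime: "r' \<in> J b" if r: "r \<in> \<gg>" "r' \<in> \<gg>" "r * r' \<in> J b" "r \<notin> J b" for r r'
  proof -
    have "of_int m * (r * b) \<in> \<gg>" using alg_ints_closed(2)[OF r(1) b(1)] by (simp add: mult.left_commute)
    moreover have "r * b \<notin> Rloc" using r(1,4) by (simp add: J_def)
    ultimately have "J (r * b) \<in> F" unfolding F_def by blast
    moreover have "J b \<subseteq> J (r * b)"
      using Rloc_mult[OF alg_ints_Rloc[OF r(1)]] by (auto simp: J_def mult.left_commute[of _ r])
    ultimately have "J b = J (r * b)" using max by blast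
    moreover have "r' \<in> J (r * b)" using r(2,3) by (auto simp: J_def algebra_simps)
    ultimately show ?thesis by simp
  qed
  have "1 \<notin> J b" "J b \<noteq> {0}" using b(2) mJ[OF b(1)] m0 by (auto simp: J_def)
  hence "J b \<in> finite_primes" unfolding finite_primes_iff using gJ Jprime by blast
  \<comment> \<open>Elements outside \<open>P\<close> are units of the local ring, so they do not
    annihilate \<open>b\<close>; maximality of primes turns the inclusion into an equality.\<close>
  moreover have "J b \<subseteq> P" using div b(2) by (auto simp: J_def)
  ultimately have JP: "J b = P" using primes_maximal[OF _ P] by blast
  obtain S where S: "finite S" "\<And>y. y \<in> (\<gg> :: 'f set) ==> \<exists>s\<in>S. \<exists>z\<in>\<gg>. y = s + of_int m * z"
    using residues[OF m(1)] by blast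
  \<comment> \<open>Denominators are cleared only for the representatives modulo \<open>m\<close>.
    Every other element of \<open>P\<close> differs from one of them by a multiple of
    \<open>m\<close>, and \<open>m b\<close> is integral.\<close>
  have "\<exists>t\<in>\<gg> - P. \<forall>x\<in>S \<inter> P. t * (x * b) \<in> \<gg>"
    by (rule common_multiple) (use S(1) P_compl_one P_compl_mult JP in "auto simp: J_def Rloc_def mult.assoc")
  then obtain t where t: "t \<in> \<gg> - P" "\<And>x. x \<in> S ==> x \<in> P ==> t * (x * b) \<in> \<gg>" by blast
  define y where "y = t * b"
  have yP: "y * x \<in> \<gg>" if x: "x \<in> P" for x
  proof -
    have xg: "x \<in> \<gg>" using x P_ideal by blast
    obtain r z where r: "r \<in> S" "z \<in> \<gg>" "x = r + of_int m * z" using S(2)[OF xg] by blast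
    have "r = x - z * of_int m" using r(3) by simp
    hence "r \<in> P" using P_ideal(6)[OF x P_ideal(4)[OF r(2) m(2)]] by simp
    hence "t * (r * b) + (t * z) * (of_int m * b) \<in> \<gg>" using t r(1,2) b(1) by auto
    thus ?thesis unfolding y_def r(3) by (simp add: algebra_simps)
  qed
  have yg: "y \<notin> Rloc" using div[OF t(1)] b(2) by (auto simp: y_def)
  \<comment> \<open>If \<open>y\<close> mapped \<open>P\<close> into itself, all products
    \<open>m y^k\<close> would be integral, and \<open>almost_integral\<close> would make
    \<open>y\<close> integral.\<close>
  have "\<exists>x\<in>P. y * x \<notin> P"
  proof (rule ccontr)
    assume "\<not> ?thesis"
    hence st: "\<And>x. x \<in> P ==> y * x \<in> P" by blast
    have "of_int m * y ^ k \<in> P" for k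
    proof (induction k)
      case (Suc k)
      have "of_int m * y ^ Suc k = y * (of_int m * y ^ k)" by (simp add: algebra_simps)
      thus ?case using st[OF Suc] by (simp only:)
    qed (use m in simp)
    hence "of_int m * y ^ k \<in> \<gg>" for k using P_ideal(1) by blast
    hence "y \<in> \<gg>" by (rule almost_integral[OF m(1)])
    thus False using yg alg_ints_Rloc by blast
  qed
  thus ?thesis using yP by blast
qed

definition unif :: 'f
  where "unif = (SOME \<pi>. \<pi> \<in> P \<and> (\<exists>y. (\<forall>x\<in>P. y * x \<in> \<gg>) \<and> y * \<pi> \<in> \<gg> - P))"

lemma unif: "unif \<in> P" "\<exists>y. (\<forall>x\<in>P. y * x \<in> \<gg>) \<and> y * unif \<in> \<gg> - P"
proof -
  have "\<exists>\<pi>. \<pi> \<in> P \<and> (\<exists>y. (\<forall>x\<in>P. y * x \<in> \<gg>) \<and> y * \<pi> \<in> \<gg> - P)"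
    using ex_uniformizer by blast
  from someI_ex[OF this] show "unif \<in> P" "\<exists>y. (\<forall>x\<in>P. y * x \<in> \<gg>) \<and> y * unif \<in> \<gg> - P"
    unfolding unif_def by blast+
qed

lemma unif_alg: "unif \<in> \<gg>" using unif(1) P_ideal(1) by blast

lemma unif_nz: "unif \<noteq> 0"
  using unif(2) P_ideal(2) by auto

text \<open>\<open>x\<close> is the \<open>k\<close>-th power of \<open>unif\<close> times the unit
  \<open>t/s\<close> of the local ring, written without a division.\<close>

definition pv :: "'f => int => bool"
  where "pv x k \<longleftrightarrow> (\<exists>s\<in>\<gg> - P. \<exists>t\<in>\<gg> - P. s * x = t * unif powi k)"

definition pval :: "'f => int"
  where "pval x = (THE k. pv x k)"

lemma unif_power_P: "n > 0 ==> unif ^ n \<in> P"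
  using P_ideal(4)[OF alg_ints_power[OF unif_alg, of "n - 1"] unif(1)] by (simp add: power_Suc2[symmetric])

text \<open>Two different exponents would make a product of elements outside \<open>P\<close> a
  multiple of a positive power of \<open>unif\<close>.\<close>

lemma pv_le: assumes "pv x k" "pv x l" shows "\<not> k < l"
proof
  assume kl: "k < l"
  obtain s t s' t' where st: "s \<in> \<gg> - P" "t \<in> \<gg> - P" "s * x = t * unif powi k"
    "s' \<in> \<gg> - P" "t' \<in> \<gg> - P" "s' * x = t' * unif powi l" using assms by (auto simp: pv_def)
  have pl: "unif powi l = unif powi k * unif ^ nat (l - k)"
    using kl unif_nz power_int_add[of unif k "l - k"] by (simp add: power_int_def)
  have "s' * t * unif powi k = s' * (s * x)" using st(3) by simp
  also have "\<dots> = s * (t' * unif powi l)" using st(6) by (simp add: algebra_simps)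
  also have "\<dots> = (s * t' * unif ^ nat (l - k)) * unif powi k" using pl by (simp add: algebra_simps)
  finally have "s' * t = s * t' * unif ^ nat (l - k)" using unif_nz by simp
  moreover have "s * t' * unif ^ nat (l - k) \<in> P"
    using P_ideal(4)[of "s * t'"] st unif_power_P[of "nat (l - k)"] kl by auto
  ultimately show False using P_compl_mult[OF st(4) st(2)] by simp
qed

lemma pval_eqI: "pv x k ==> pval x = k"
  unfolding pval_def by (rule the_equality, assumption) (metis pv_le linorder_neqE)

lemma pv_mult: "pv x k ==> pv y l ==> pv (x * y) (k + l)"
proof -
  assume "pv x k" "pv y l"
  then obtain s t s' t' where st: "s \<in> \<gg> - P" "t \<in> \<gg> - P" "s * x = t * unif powi k"
    "s' \<in> \<gg> - P" "t' \<in> \<gg> - P" "s' * y = t' * unif powi l" by (auto simp: pv_def)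
  have "(s * s') * (x * y) = (s * x) * (s' * y)" by (simp add: algebra_simps)
  also have "\<dots> = (t * t') * unif powi (k + l)" unfolding st using unif_nz by (simp add: power_int_add algebra_simps)
  finally show ?thesis unfolding pv_def using P_compl_mult st by blast
qed

text \<open>The element \<open>y\<close> that inverts \<open>P\<close> locally shows that
  \<open>unif\<close> generates \<open>P\<close> locally.\<close>

lemma P_multiple_unif:
  assumes "x \<in> P" shows "\<exists>u\<in>\<gg> - P. \<exists>a\<in>\<gg>. u * x = a * unif"
proof -
  obtain y where y: "\<And>x. x \<in> P ==> y * x \<in> \<gg>" "y * unif \<in> \<gg> - P" using unif(2) by blast
  have "(y * unif) * x = (y * x) * unif" by (simp add: algebra_simps)
  thus ?thesis using y assms by blast
qed

text \<open>If \<open>x\<close> were divisible by all powers of the uniformizer, the ideals \<open>\<pi>\<^sup>k R \<inter> \<gg>\<close> would all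
  contain a fixed integer, but only finitely many ideals do.\<close>

lemma pv_ex_int:
  assumes x: "x \<in> \<gg>" "x \<noteq> 0"
  shows "\<exists>k. pv x (int k)"
proof -
  define I where "I k = {a \<in> \<gg>. a / unif ^ k \<in> Rloc}" for k
  have gI: "gideal (I k)" for k
    using Rloc_add Rloc_mult[OF alg_ints_Rloc] alg_ints_Rloc[of 0]
    by (auto simp: gideal_def I_def add_divide_distrib simp flip: times_divide_eq_right)
  have not_all: "\<exists>k. x \<notin> I k"
  proof (rule ccontr)
    assume "\<not> ?thesis"
    hence xI: "\<And>k. x \<in> I k" by blast
    obtain d where d: "d > 0" "of_int d * (1 / x) \<in> (\<gg> :: 'f set)" using ex_denominator by blast
    have "of_int d \<in> I k" for k using gidealD(4)[OF gI d(2) xI] x by simp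
    hence "range I \<subseteq> {J. gideal J \<and> of_int d \<in> J}" using gI by auto
    hence "finite (range I)" using finite_ideals_above[OF d(1)] finite_subset by blast
    hence "\<not> inj I" using range_inj_infinite by blast
    then obtain i j where "i \<noteq> j" "I i = I j" by (auto simp: inj_def)
    then obtain i j where ij: "i < j" "I i = I j" by (metis nat_neq_iff)
    have "unif ^ i \<in> I i" using unif_alg unif_nz alg_ints_Rloc[of 1] by (simp add: I_def)
    hence "unif ^ i \<in> I j" by (simp only: ij(2))
    hence "unif ^ i / unif ^ j \<in> Rloc" by (simp add: I_def)
    then obtain s where s: "s \<in> \<gg> - P" "s * (unif ^ i / unif ^ j) \<in> \<gg>" unfolding Rloc_def by blast
    have "unif ^ j = unif ^ (j - i) * unif ^ i" using ij(1) by (simp add: power_add[symmetric])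
    hence "s * (unif ^ i / unif ^ j) * unif ^ (j - i) = s" using unif_nz by simp
    hence "s \<in> P" using P_ideal(4)[OF s(2) unif_power_P[of "j - i"]] ij by simp
    thus False using s(1) by simp
  qed
  define k where "k = (LEAST k. x \<notin> I k)"
  have k: "x \<notin> I k" unfolding k_def using not_all by (rule LeastI_ex)
  have "x \<in> I 0" using x alg_ints_Rloc by (simp add: I_def)
  then obtain l where l: "k = Suc l" using k by (cases k) auto
  have "x \<in> I l" using not_less_Least[of l "\<lambda>k. x \<notin> I k"] l k_def by simp
  then obtain s where s: "s \<in> \<gg> - P" "s * (x / unif ^ l) \<in> \<gg>" by (auto simp: I_def Rloc_def)
  define a where "a = s * (x / unif ^ l)"
  have a: "a \<in> \<gg>" "s * x = a * unif ^ l" using s(2) unif_nz by (auto simp: a_def)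
  have "a \<notin> P"
  proof
    assume "a \<in> P"
    then obtain u b where u: "u \<in> \<gg> - P" "b \<in> \<gg>" "u * a = b * unif" using P_multiple_unif by blast
    have "(u * s) * (x / unif ^ k) = u * a / unif" unfolding a_def l by (simp add: mult_ac)
    hence "(u * s) * (x / unif ^ k) = b" unfolding u(3) using unif_nz by simp
    hence "x \<in> I k" using x(1) u(2) RlocI[OF P_compl_mult[OF u(1) s(1)]] by (simp add: I_def)
    thus False using k by simp
  qed
  hence "pv x (int l)" unfolding pv_def using s(1) a by (auto simp: power_int_def)
  thus ?thesis by blast
qed

lemma pv_inverse: "pv x k ==> pv (1 / x) (- k)"
proof -
  assume "pv x k"
  then obtain s t where st: "s \<in> \<gg> - P" "t \<in> \<gg> - P" "s * x = t * unif powi k" by (auto simp: pv_def)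
  have nz: "x \<noteq> 0" using st unif_nz P_compl_nz by auto
  have "t * (1 / x) = s * unif powi (- k)" using st(3) nz unif_nz by (simp add: power_int_minus field_simps)
  thus ?thesis using st unfolding pv_def by blast
qed

lemma pv_ex: assumes "x \<noteq> 0" shows "pv x (pval x)"
proof -
  obtain d where d: "d > 0" "of_int d * x \<in> (\<gg> :: 'f set)" using ex_denominator by blast
  obtain k where k: "pv (of_int d * x) (int k)" using pv_ex_int[OF d(2)] assms d by auto
  obtain l where l: "pv (of_int d) (int l)" using pv_ex_int[of "of_int d"] d by auto
  have "pv ((of_int d * x) * (1 / of_int d)) (int k + - int l)" by (rule pv_mult[OF k pv_inverse[OF l]])
  hence "pv x (int k - int l)" using d by simp
  thus ?thesis using pval_eqI by simp
qed

lemma pval_mult: "x \<noteq> 0 ==> y \<noteq> 0 ==> pval (x * y) = pval x + pval y"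
  by (intro pval_eqI pv_mult pv_ex)

lemma pval_unif: "pval unif = 1"
  using P_compl_one by (intro pval_eqI) (auto simp: pv_def)

lemma pval_unit: "s \<in> \<gg> - P ==> pval s = 0"
  using P_compl_one by (intro pval_eqI) (auto simp: pv_def intro!: bexI[of _ 1])

lemma pval_alg_int: "x \<in> \<gg> ==> x \<noteq> 0 ==> pval x \<ge> 0"
  using pv_ex_int pval_eqI by fastforce

lemma pval_Rloc: assumes "x \<noteq> 0" shows "pval x \<ge> 0 \<longleftrightarrow> x \<in> Rloc"
proof
  assume k: "pval x \<ge> 0"
  obtain s t where st: "s \<in> \<gg> - P" "t \<in> \<gg> - P" "s * x = t * unif powi (pval x)"
    using pv_ex[OF assms] by (auto simp: pv_def)
  have "unif powi pval x = unif ^ nat (pval x)" using k by (simp add: power_int_def)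
  hence "s * x \<in> \<gg>" using st unif_alg by auto
  thus "x \<in> Rloc" by (rule RlocI[OF st(1)])
next
  assume "x \<in> Rloc"
  then obtain s where s: "s \<in> \<gg> - P" "s * x \<in> \<gg>" by (auto simp: Rloc_def)
  have "pval (s * x) \<ge> 0" using pval_alg_int[OF s(2)] assms P_compl_nz[OF s(1)] by simp
  thus "pval x \<ge> 0" using pval_mult[OF P_compl_nz[OF s(1)] assms] pval_unit[OF s(1)] by simp
qed

lemma pval_in_P: assumes "x \<in> \<gg>" "x \<noteq> 0" shows "x \<in> P \<longleftrightarrow> pval x \<ge> 1"
proof
  assume "x \<in> P"
  then obtain u a where u: "u \<in> \<gg> - P" "a \<in> \<gg>" "u * x = a * unif" using P_multiple_unif by blast
  have a0: "a \<noteq> 0" using u assms P_compl_nz by auto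
  have "pval (u * x) = pval a + 1" unfolding u(3) using pval_mult[OF a0 unif_nz] pval_unif by simp
  thus "pval x \<ge> 1" using pval_mult[OF P_compl_nz[OF u(1)] assms(2)] pval_unit[OF u(1)] pval_alg_int[OF u(2) a0] by simp
next
  assume "pval x \<ge> 1"
  thus "x \<in> P" using pval_unit[of x] assms by auto
qed

lemma pval_power_int: "x \<noteq> 0 ==> pval (x powi k) = k * pval x"
proof -
  assume x: "x \<noteq> 0"
  have 1: "pval 1 = 0" by (rule pval_unit[OF P_compl_one])
  have n: "pval (x ^ n) = int n * pval x" for n
    by (induction n) (use x 1 in "auto simp: pval_mult algebra_simps")
  have i: "pval (inverse y) = - pval y" if "y \<noteq> 0" for y
    using pval_mult[of y "inverse y"] that 1 by simp
  show ?thesis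
    using n[of "nat k"] n[of "nat (- k)"] i[of "x ^ nat (- k)"] x by (auto simp: power_int_def power_inverse)
qed

text \<open>Scaling by a power of \<open>unif\<close> reduces the claim to closure of the local ring
  under addition.\<close>

lemma pval_add:
  assumes "x \<noteq> 0" "y \<noteq> 0" "x + y \<noteq> 0"
  shows "min (pval x) (pval y) \<le> pval (x + y)"
proof -
  let ?k = "min (pval x) (pval y)"
  let ?u = "unif powi (- ?k)"
  have u: "?u \<noteq> 0" "pval ?u = - ?k" using unif_nz pval_power_int[OF unif_nz, of "- ?k"] pval_unif by auto
  have "?u * x \<in> Rloc" "?u * y \<in> Rloc"
    using pval_Rloc[of "?u * x"] pval_Rloc[of "?u * y"] u assms by (auto simp: pval_mult)
  hence "?u * (x + y) \<in> Rloc" using Rloc_add by (simp add: distrib_left)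
  hence "pval (?u * (x + y)) \<ge> 0" using pval_Rloc[of "?u * (x + y)"] u assms by simp
  thus ?thesis using u assms by (simp add: pval_mult)
qed

lemma dvf_pval: "dvf class_ring pval"
proof (intro dvf.intro dvf_axioms.intro)
  show "field (class_ring :: 'f ring)" by (rule class_field)
  show "\<exists>x\<in>carrier class_ring. x \<noteq> \<zero>\<^bsub>class_ring\<^esub> \<and> pval x = 1" using unif_nz pval_unif by auto
  show "\<one>\<^bsub>class_ring\<^esub> \<oplus>\<^bsub>class_ring\<^esub> \<one>\<^bsub>class_ring\<^esub> \<noteq> \<zero>\<^bsub>(class_ring :: 'f ring)\<^esub>" by simp
qed (use pval_mult pval_add in auto)

sublocale F: dvf "class_ring :: 'f ring" pval
  by (rule dvf_pval)

lemma pid_iff: "x \<in> F.pid k \<longleftrightarrow> x = 0 \<or> k \<le> pval x"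
  by (simp add: F.pid_def)

lemma Rloc_pid: "F.pid 0 = Rloc"
proof -
  have "x \<in> F.pid 0 \<longleftrightarrow> x \<in> Rloc" for x
    using pval_Rloc[of x] alg_ints_Rloc[of 0] by (cases "x = 0") (auto simp: F.pid_def)
  thus ?thesis by blast
qed

text \<open>Let \<open>s x\<close> be integral with \<open>s\<close> outside \<open>P\<close>. Some
  power \<open>s^(j+1)\<close> is congruent to 1 at \<open>P\<close> to the required precision, so
  \<open>s^j (s x)\<close> is an algebraic integer close to \<open>x\<close>.\<close>

lemma Rloc_approx:
  assumes x: "x \<in> Rloc"
  shows "\<exists>y\<in>\<gg>. x - y \<in> F.pid (int k)"
proof -
  obtain m0 where m0: "m0 > 0" "of_int m0 \<in> P" using P_int by blast
  let ?m = "m0 ^ k"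
  have mk: "?m > 0" using m0 by simp
  have vm: "int k \<le> pval (of_int ?m)"
  proof -
    have "pval (of_int m0) \<ge> 1" using pval_in_P[of "of_int m0"] m0 by simp
    moreover have "pval (of_int ?m) = int k * pval (of_int m0)"
      using pval_power_int[of "of_int m0" "int k"] m0 by (simp add: power_int_def)
    ultimately show ?thesis by (simp add: mult_le_cancel_left1)
  qed
  obtain s where s: "s \<in> \<gg> - P" "s * x \<in> \<gg>" using x by (auto simp: Rloc_def)
  have sg: "s \<in> \<gg>" using s by simp
  obtain i j z where z: "z \<in> \<gg>" "s ^ i * (1 - s * s ^ j) = of_int ?m * z" using power_congruent[OF mk sg] by blast
  let ?y = "s ^ j * (s * x)"
  have "s ^ i * (x - ?y) = s ^ i * (1 - s * s ^ j) * x" by (simp add: algebra_simps)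
  hence e2: "s ^ i * (x - ?y) = of_int ?m * (z * x)" unfolding z(2) by (simp add: mult.assoc)
  have "x - ?y \<in> F.pid (int k)"
  proof (cases "x - ?y = 0")
    case False
    have si: "s ^ i \<noteq> 0" using P_compl_nz[OF s(1)] by simp
    have "pval (s ^ i) = 0" using pval_power_int[OF P_compl_nz[OF s(1)], of "int i"] pval_unit[OF s(1)] by (simp add: power_int_def)
    hence 1: "pval (s ^ i * (x - ?y)) = pval (x - ?y)" using pval_mult[OF si False] by simp
    have nz: "z * x \<noteq> 0" using e2 si False by auto
    have mz: "of_int ?m \<noteq> (0::'f)" using m0 by simp
    have "z * x \<in> Rloc" using Rloc_mult[OF alg_ints_Rloc x] z by auto
    hence "pval (z * x) \<ge> 0" using pval_Rloc[OF nz] by simp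
    moreover have "pval (of_int ?m * (z * x)) = pval (of_int ?m) + pval (z * x)" by (rule pval_mult[OF mz nz])
    ultimately have "int k \<le> pval (x - ?y)" using 1 e2 vm by simp
    thus ?thesis by (simp add: pid_iff)
  qed (simp add: pid_iff)
  moreover have "?y \<in> \<gg>" using s sg by auto
  ultimately show ?thesis by blast
qed

end

subsection \<open>Lattices over the ring of integers\<close>

text \<open>The localization is taken inside \<open>V\<close> itself, so that modules at different
  primes can be intersected and compared with the original one.\<close>

definition loc :: "'f::field_char_0 set => ('f, 'v) module => 'v set => 'v set"
  where "loc P V N = {x \<in> carrier V. \<exists>s\<in>\<gg> - P. s \<odot>\<^bsub>V\<^esub> x \<in> N}"

abbreviation gself :: "('f::field_char_0, 'f) module"
  where "gself \<equiv> self_module class_ring"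

lemma self_simps [simp]:
  "carrier gself = UNIV" "x \<oplus>\<^bsub>gself\<^esub> y = x + y"
  "\<zero>\<^bsub>gself\<^esub> = 0" "x \<odot>\<^bsub>gself\<^esub> y = x * y"
  by (simp_all add: self_module_def)

context nfield
begin

lemma g_subring: "is_subring class_ring (\<gg> :: 'f set)"
proof -
  have "\<ominus>\<^bsub>class_ring\<^esub> x = - x" for x :: 'f
    by (simp add: class_ring_simps)
  thus ?thesis by (auto simp: is_subring_def)
qed

lemma half_not_int: "(1 / 2 :: 'f) \<notin> \<gg>"
proof
  assume "(1 / 2 :: 'f) \<in> \<gg>"
  hence "(1 / 2 :: 'f) \<in> \<int>" by (intro rational_algebraic_int_is_int) (auto simp: alg_ints_def)
  then obtain k where "(1 / 2 :: 'f) = of_int k" by (auto elim: Ints_cases)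
  hence "(of_int 1 :: 'f) = of_int (2 * k)" by (simp add: field_simps)
  hence "1 = 2 * k" by (simp only: of_int_eq_iff)
  thus False by presburger
qed

text \<open>2 is not a unit. Some prime is needed to import facts proved over valued fields into
  statements that mention no prime.\<close>

lemma ex_prime: "\<exists>P. P \<in> (finite_primes :: 'f set set)"
proof -
  let ?I = "{2 * x | x :: 'f. x \<in> \<gg>}"
  have "gideal ?I"
    unfolding gideal_def
  proof (intro conjI ballI)
    show "?I \<subseteq> \<gg>" using alg_ints_closed(2,7)[of 2] by auto
    show "0 \<in> ?I" by force
    fix x assume "x \<in> ?I"
    then obtain a where a: "x = 2 * a" "a \<in> \<gg>" by blast
    { fix y assume "y \<in> ?I"
      then obtain b where "y = 2 * b" "b \<in> \<gg>" by blast
      hence "x + y = 2 * (a + b)" "a + b \<in> \<gg>" using a by auto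
      thus "x + y \<in> ?I" by blast }
    { fix r :: 'f assume "r \<in> \<gg>"
      hence "r * x = 2 * (r * a)" "r * a \<in> \<gg>" using a by auto
      thus "r * x \<in> ?I" by blast }
  qed
  moreover have "1 \<notin> ?I"
  proof
    assume "1 \<in> ?I"
    then obtain x :: 'f where "1 = 2 * x" "x \<in> \<gg>" by blast
    moreover from this have "x = 1 / 2" by (simp add: field_simps)
    ultimately show False using half_not_int by simp
  qed
  moreover have "?I \<noteq> {0}"
  proof
    assume I: "?I = {0}"
    have "2 * 1 \<in> ?I" using alg_ints_closed(6) by blast
    thus False unfolding I by simp
  qed
  ultimately show ?thesis using ex_prime_above[of ?I] by blast
qed

lemma nprime: "(P :: 'f set) \<in> finite_primes ==> nprime P"
  by unfold_locales

end

locale nspace = nfield ty + vspace "class_ring :: 'f ring" V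
  for ty :: "'f::field_char_0 itself" and V :: "('f, 'v) module" +
  assumes fd: "vectorspace.fin_dim class_ring V"
begin

sublocale vspace_not2 class_ring V
  by unfold_locales simp

lemma dvspace: "P \<in> finite_primes ==> dvspace class_ring V (nprime.pval P)"
  by (intro dvspace.intro dvspace_axioms.intro vspace_axioms nprime.dvf_pval[OF nprime] fd)

lemma sm:
  assumes "x \<in> carrier V"
  shows "a *\<^sub>V x \<in> carrier V" "1 *\<^sub>V x = x" "(a * b) *\<^sub>V x = a *\<^sub>V (b *\<^sub>V x)"
    "(a + b) *\<^sub>V x = a *\<^sub>V x +\<^sub>V b *\<^sub>V x" "0 *\<^sub>V x = 0\<^sub>V"
    "y \<in> carrier V ==> a *\<^sub>V (x +\<^sub>V y) = a *\<^sub>V x +\<^sub>V a *\<^sub>V y"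
proof -
  show "a *\<^sub>V x \<in> carrier V" using smult_closed[of a x] assms by simp
  show "1 *\<^sub>V x = x" using smult_one[of x] assms by simp
  show "(a * b) *\<^sub>V x = a *\<^sub>V (b *\<^sub>V x)" using smult_assoc1[of a b x] assms by simp
  show "(a + b) *\<^sub>V x = a *\<^sub>V x +\<^sub>V b *\<^sub>V x" using smult_l_distr[of a b x] assms by simp
  show "0 *\<^sub>V x = 0\<^sub>V" using lmult_0[of x] assms by simp
  show "y \<in> carrier V ==> a *\<^sub>V (x +\<^sub>V y) = a *\<^sub>V x +\<^sub>V a *\<^sub>V y"
    using smult_r_distr[of a x y] assms by simp
qed

abbreviation glat :: "'v set => bool"
  where "glat \<equiv> is_lattice class_ring \<gg> V"

abbreviation gindex :: "'v set => 'v set => 'f set"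
  where "gindex \<equiv> index_ideal class_ring alg_ints V"

abbreviation gsub :: "'v set => bool"
  where "gsub \<equiv> rsub \<gg> V"

abbreviation isb :: "(nat => 'v) => bool"
  where "isb \<equiv> btuple class_ring V dim"

lemma glat_gens: "glat A ==> \<exists>T. finite T \<and> T \<subseteq> carrier V \<and> T \<subseteq> A \<and> A = rspan class_ring \<gg> V T"
  using rsub_rspan(2)[OF g_subring] by (auto simp: is_lattice_def)

lemma glat_gsub: "glat A ==> gsub A"
  using rsub_rspan(1)[OF g_subring] by (auto simp: is_lattice_def)

lemma glat_tuple: assumes "glat A" shows "\<exists>b. isb b \<and> b \<in> {..<dim} \<rightarrow> A"
proof -
  obtain B where B: "B \<subseteq> A" "basis B" using assms by (auto simp: is_lattice_def)
  have fB: "finite B" "card B = dim"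
    using B(2) fin_dim_li_fin[OF fd] dim_basis[of B] by (auto simp: basis_def)
  then obtain b where b: "bij_betw b {..<dim} B"
    using ex_bij_betw_nat_finite[of B] by (auto simp: atLeast0LessThan)
  hence "isb b" using basis_btuple[of b dim] B(2) by (simp add: bij_betw_def)
  moreover have "b \<in> {..<dim} \<rightarrow> A" using b B(1) by (auto simp: bij_betw_def)
  ultimately show ?thesis by blast
qed

lemma ex_multiple:
  assumes A: "gsub A" and b: "isb b" "b \<in> {..<dim} \<rightarrow> A" and x: "x \<in> carrier V"
  shows "\<exists>d\<in>\<gg> - {0}. d *\<^sub>V x \<in> A"
proof -
  note t = tcoord[OF b(1) x]
  have "\<exists>d. (d \<in> \<gg> \<and> d \<noteq> 0) \<and> (\<forall>r\<in>tcoord class_ring V dim b x ` {..<dim}. d * r \<in> \<gg>)"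
    using common_nonzero[of "tcoord class_ring V dim b x ` {..<dim}" "\<lambda>d r. d * r \<in> \<gg>"] ex_denom
    by (auto simp: mult.assoc)
  then obtain d where d: "d \<in> \<gg>" "d \<noteq> 0" "\<And>i. i < dim ==> d * tcoord class_ring V dim b x i \<in> \<gg>" by auto
  have "lc V dim (\<lambda>i. d * tcoord class_ring V dim b x i) b \<in> A"
    by (rule lc_rsub[OF g_subring A]) (use d b in auto)
  moreover have "lc V dim (\<lambda>i. d * tcoord class_ring V dim b x i) b = d *\<^sub>V x"
    using lc_smult[OF t(1) btupleD(1)[OF b(1)], of d] t(2) by simp
  ultimately show ?thesis using d by auto
qed

lemma scaled_tuple:
  assumes A: "gsub A" and b: "isb b" and ex: "\<And>x. x \<in> carrier V ==> \<exists>d\<in>\<gg> - {0}. d *\<^sub>V x \<in> A"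
  shows "\<exists>d\<in>\<gg> - {0}. isb (\<lambda>i. d *\<^sub>V b i) \<and> (\<lambda>i. d *\<^sub>V b i) \<in> {..<dim} \<rightarrow> A"
proof -
  have bV: "i < dim ==> b i \<in> carrier V" for i using btupleD(1)[OF b] by auto
  have "\<exists>d. (d \<in> \<gg> \<and> d \<noteq> 0) \<and> (\<forall>i\<in>{..<dim}. d *\<^sub>V b i \<in> A)"
    using common_nonzero[of "{..<dim}" "\<lambda>d i. d *\<^sub>V b i \<in> A"] ex bV rsubD(4)[OF A] by (auto simp: sm)
  then obtain d where d: "d \<in> \<gg>" "d \<noteq> 0" "\<And>i. i < dim ==> d *\<^sub>V b i \<in> A" by auto
  obtain P :: "'f set" where P: "P \<in> finite_primes" using ex_prime by blast
  interpret F: dvspace class_ring V "nprime.pval P" by (rule dvspace[OF P])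
  have "isb (\<lambda>i. d *\<^sub>V b i)" using F.isb_scale[OF b, of d] d by simp
  thus ?thesis using d by auto
qed

lemma ex_isb: "\<exists>b. isb b"
  using fin_dim_btuple[OF fd] .

text \<open>A fixed basis is divided by a common denominator of the generators.\<close>

lemma denominator_tuple:
  assumes A: "glat A"
  shows "\<exists>c. isb c \<and> A \<subseteq> lspan \<gg> V dim c"
proof -
  obtain T where T: "finite T" "T \<subseteq> carrier V" "A = rspan class_ring \<gg> V T" using glat_gens[OF A] by blast
  obtain b where b: "isb b" using ex_isb by blast
  note bV = btupleD(1)[OF b]
  let ?L = "lspan \<gg> V dim b"
  have L: "gsub ?L" by (rule rsub_lspan[OF g_subring bV])
  have "b \<in> {..<dim} \<rightarrow> ?L" using lspan_gen[OF g_subring bV] by auto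
  from ex_multiple[OF L b this]
  have "\<exists>d. (d \<in> \<gg> \<and> d \<noteq> 0) \<and> (\<forall>t\<in>T. d *\<^sub>V t \<in> ?L)"
    using common_nonzero[OF T(1), of "\<lambda>d t. d *\<^sub>V t \<in> ?L"] T(2) rsubD(4)[OF L]
    by (auto simp: sm subset_iff)
  then obtain d where d: "d \<in> \<gg>" "d \<noteq> 0" "\<And>t. t \<in> T ==> d *\<^sub>V t \<in> ?L" by auto
  obtain P :: "'f set" where P: "P \<in> finite_primes" using ex_prime by blast
  interpret F: dvspace class_ring V "nprime.pval P" by (rule dvspace[OF P])
  let ?c = "\<lambda>i. (1 / d) *\<^sub>V b i"
  have c: "isb ?c" using F.isb_scale[OF b, of "1 / d"] d by simp
  have "t \<in> lspan \<gg> V dim ?c" if t: "t \<in> T" for t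
  proof -
    have tV: "t \<in> carrier V" using t T(2) by blast
    obtain a where a: "a \<in> {..<dim} \<rightarrow> \<gg>" "d *\<^sub>V t = lc V dim a b" using d(3)[OF t] by (auto simp: lspan_def)
    have "lc V dim a b = d *\<^sub>V lc V dim a ?c"
    proof -
      have "lc V dim a b = lc V dim (\<lambda>i. d * a i) ?c"
        unfolding lc_def by (rule M.finsum_cong') (use bV d(2) in "auto simp: Pi_def sm(1) sm(3)[symmetric]")
      thus ?thesis using lc_smult[of a dim ?c d] btupleD(1)[OF c] by simp
    qed
    hence "(1 / d) *\<^sub>V (d *\<^sub>V t) = (1 / d) *\<^sub>V (d *\<^sub>V lc V dim a ?c)" using a(2) by simp
    hence "t = lc V dim a ?c"
      using tV d(2) lc_closed[of a dim ?c] btupleD(1)[OF c] by (simp add: sm(3)[symmetric] sm(2))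
    thus ?thesis using a(1) by (auto simp: lspan_def)
  qed
  hence "A \<subseteq> lspan \<gg> V dim ?c"
    unfolding T(3) by (intro rspan_least[OF g_subring] rsub_lspan[OF g_subring] btupleD(1)[OF c]) auto
  thus ?thesis using c by blast
qed

text \<open>\<open>N\<close> is trapped between \<open>m D\<close> and \<open>D\<close>, where \<open>D\<close> is the lattice with basis \<open>c\<close>, and \<open>D / m D\<close> is finite.\<close>

lemma glat_bounded:
  assumes N: "gsub N" and b: "isb b" "b \<in> {..<dim} \<rightarrow> N" and c: "isb c" "N \<subseteq> lspan \<gg> V dim c"
  shows "glat N"
proof -
  note cV = btupleD(1)[OF c(1)]
  have "\<exists>m>0. \<forall>i<dim. of_int m *\<^sub>V c i \<in> N"
  proof -
    have "\<exists>d. (d \<in> \<gg> \<and> d \<noteq> 0) \<and> (\<forall>i\<in>{..<dim}. d *\<^sub>V c i \<in> N)"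
      using common_nonzero[of "{..<dim}" "\<lambda>d i. d *\<^sub>V c i \<in> N"] ex_multiple[OF N b] cV rsubD(4)[OF N]
      by (auto simp: sm Pi_def)
    then obtain d where d: "d \<noteq> 0" "\<And>i. i < dim ==> d *\<^sub>V c i \<in> N" by auto
    obtain m where m: "m > 0" "of_int m * (1 / d) \<in> (\<gg> :: 'f set)" using ex_denominator by blast
    have "of_int m *\<^sub>V c i \<in> N" if i: "i < dim" for i
    proof -
      have "(of_int m * (1 / d)) *\<^sub>V (d *\<^sub>V c i) \<in> N" using rsubD(4)[OF N m(2) d(2)[OF i]] .
      moreover have "(of_int m * (1 / d)) *\<^sub>V (d *\<^sub>V c i) = of_int m *\<^sub>V c i"
        using d(1) cV i by (simp add: sm(3)[symmetric] Pi_def)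
      ultimately show ?thesis by simp
    qed
    thus ?thesis using m by blast
  qed
  then obtain m where m: "m > 0" "\<And>i. i < dim ==> of_int m *\<^sub>V c i \<in> N" by blast
  obtain S where S: "finite S" "S \<subseteq> (\<gg> :: 'f set)"
    "\<And>y. y \<in> \<gg> ==> \<exists>s\<in>S. \<exists>z\<in>\<gg>. y = s + of_int m * z" using residues[OF m(1)] by blast
  define mc where "mc i = of_int m *\<^sub>V c i" for i
  have mcV: "mc \<in> vtup dim" using cV by (auto simp: mc_def sm Pi_def)
  have mcN: "mc ` {..<dim} \<subseteq> N" using m(2) by (auto simp: mc_def)
  define E where "E = {..<dim} \<rightarrow>\<^sub>E S"
  have fE: "finite E" unfolding E_def using S(1) by (simp add: finite_PiE)
  define D where "D = lspan \<gg> V dim mc"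
  \<comment> \<open>For each class modulo the span of \<open>mc\<close> that meets \<open>N\<close>,
    one representative in \<open>N\<close> is kept; together with the vectors of \<open>mc\<close>
    these generate \<open>N\<close>.\<close>
  define pick where "pick s = (SOME x. x \<in> N \<and> (\<exists>y\<in>D. x = lc V dim s c +\<^sub>V y))" for s
  define G where "G = {s \<in> E. \<exists>x. x \<in> N \<and> (\<exists>y\<in>D. x = lc V dim s c +\<^sub>V y)}"
  have pick: "pick s \<in> N \<and> (\<exists>y\<in>D. pick s = lc V dim s c +\<^sub>V y)" if "s \<in> G" for s
    using that someI_ex[of "\<lambda>x. x \<in> N \<and> (\<exists>y\<in>D. x = lc V dim s c +\<^sub>V y)"] by (auto simp: G_def pick_def)
  define T where "T = mc ` {..<dim} \<union> pick ` G"
  have "finite G" unfolding G_def using fE by simp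
  moreover have "pick ` G \<subseteq> N" using pick by blast
  ultimately have T: "finite T" "T \<subseteq> N" unfolding T_def using mcN by auto
  have NV: "N \<subseteq> carrier V" using rsubD(1)[OF N] .
  let ?T = "rspan class_ring \<gg> V T"
  have rT: "gsub ?T" "T \<subseteq> ?T" using rsub_rspan[OF g_subring] T(2) NV by auto
  have DV: "D \<subseteq> carrier V" unfolding D_def using rsub_lspan[OF g_subring mcV] by (rule rsubD(1))
  have rD: "gsub D" unfolding D_def using rsub_lspan[OF g_subring mcV] .
  have DT: "D \<subseteq> ?T" unfolding D_def
    by (rule lspan_least[OF g_subring rT(1)]) (use rT(2) in "auto simp: T_def")
  have "x \<in> ?T" if x: "x \<in> N" for x
  proof -
    obtain a where a: "a \<in> {..<dim} \<rightarrow> \<gg>" "x = lc V dim a c" using c(2) x by (auto simp: lspan_def)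
    have "\<exists>s z. s \<in> S \<and> z \<in> \<gg> \<and> (i < dim --> a i = s + of_int m * z)" for i
      using S(3)[of "a i"] S(3)[of 0] a(1) by (cases "i < dim") (force simp: Pi_def)+
    then obtain s0 z where sz: "\<And>i. s0 i \<in> S \<and> z i \<in> \<gg> \<and> (i < dim --> a i = s0 i + of_int m * z i)" by metis
    define s where "s = restrict s0 {..<dim}"
    have sE: "s \<in> E" unfolding s_def E_def using sz by auto
    have sg: "s \<in> {..<dim} \<rightarrow> \<gg>" using sz S(2) by (auto simp: s_def)
    have "lc V dim a c = lc V dim s c +\<^sub>V lc V dim (\<lambda>i. of_int m * z i) c"
    proof -
      have "lc V dim a c = lc V dim (\<lambda>i. s i + of_int m * z i) c"
        by (rule lc_cong) (use sz cV in "auto simp: s_def")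
      thus ?thesis using lc_add[of s dim "\<lambda>i. of_int m * z i" c] cV by simp
    qed
    also have "lc V dim (\<lambda>i. of_int m * z i) c = lc V dim z mc"
      unfolding lc_def mc_def
      by (rule M.finsum_cong') (use cV in "auto simp: Pi_def sm(1) sm(3)[symmetric] mult.commute")
    finally have xs: "x = lc V dim s c +\<^sub>V lc V dim z mc" using a(2) by simp
    have zD: "lc V dim z mc \<in> D" unfolding D_def lspan_def using sz by blast
    have sG: "s \<in> G" unfolding G_def using sE x xs zD by blast
    then obtain y where y: "y \<in> D" "pick s = lc V dim s c +\<^sub>V y" using pick by blast
    have V: "lc V dim s c \<in> carrier V" "lc V dim z mc \<in> carrier V" "y \<in> carrier V"
      using lc_closed[of s dim c] cV zD y(1) DV by auto
    have e: "(-1) *\<^sub>V y = \<ominus>\<^bsub>V\<^esub> y" using smult_minus_1[OF V(3)] by (simp add: class_ring_simps)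
    have "x = pick s +\<^sub>V (lc V dim z mc +\<^sub>V (-1) *\<^sub>V y)"
      unfolding xs y(2) e using V by (simp add: M.a_ac M.r_neg2 M.r_neg1 M.r_neg M.l_neg)
    moreover have "pick s \<in> ?T" using rT(2) sG by (auto simp: T_def)
    moreover have "lc V dim z mc +\<^sub>V (-1) *\<^sub>V y \<in> D"
      using rsubD(3,4)[OF rD] zD y(1) alg_ints_closed(3)[OF alg_ints_closed(6)] by blast
    ultimately show ?thesis using rsubD(3)[OF rT(1)] DT by (simp add: subset_iff)
  qed
  moreover have "?T \<subseteq> N" by (rule rspan_least[OF g_subring T(2) N])
  ultimately have "N = ?T" by blast
  moreover have "basis (b ` {..<dim})" "b ` {..<dim} \<subseteq> N" using btuple_basis(2)[OF b(1)] b(2) by auto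
  ultimately show ?thesis unfolding is_lattice_def using T NV by blast
qed

end

subsection \<open>Localization of lattices\<close>

locale nlat = nprime ty P + nspace ty V
  for ty :: "'f::field_char_0 itself" and P :: "'f set" and V :: "('f, 'v) module"
begin

sublocale F: dvspace "class_ring :: 'f ring" V pval
  by (rule dvspace[OF P])

lemma unit_Rloc: "s \<in> \<gg> - P ==> 1 / s \<in> F.pid 0"
  using P_compl_nz by (auto simp: Rloc_pid intro!: RlocI)

lemma alg_ints_pid: "\<gg> \<subseteq> F.pid 0"
  using alg_ints_Rloc by (auto simp: Rloc_pid)

lemma locI: "x \<in> carrier V ==> s \<in> \<gg> - P ==> s *\<^sub>V x \<in> N ==> x \<in> loc P V N"
  by (auto simp: loc_def)

lemma loc_ext: "gsub N ==> N \<subseteq> loc P V N"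
  using P_compl_one rsubD(1) by (force simp: loc_def sm)

lemma loc_mono: "A \<subseteq> B ==> loc P V A \<subseteq> loc P V B"
  by (auto simp: loc_def)

lemma rsub_loc: assumes N: "gsub N" shows "rsub (F.pid 0) V (loc P V N)"
  unfolding rsub_def
proof (intro conjI ballI)
  note d = rsubD[OF N]
  show "loc P V N \<subseteq> carrier V" by (auto simp: loc_def)
  show "0\<^sub>V \<in> loc P V N" using loc_ext[OF N] d(2) by blast
  fix x assume "x \<in> loc P V N"
  then obtain s where x: "x \<in> carrier V" "s \<in> \<gg> - P" "s *\<^sub>V x \<in> N" by (auto simp: loc_def)
  { fix y assume "y \<in> loc P V N"
    then obtain t where y: "y \<in> carrier V" "t \<in> \<gg> - P" "t *\<^sub>V y \<in> N" by (auto simp: loc_def)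
    have "(s * t) *\<^sub>V (x +\<^sub>V y) = t *\<^sub>V (s *\<^sub>V x) +\<^sub>V s *\<^sub>V (t *\<^sub>V y)"
      using x(1) y(1) by (simp add: sm(1,6) sm(3)[symmetric] mult.commute)
    also have "\<dots> \<in> N" using d(3,4) x y by blast
    finally show "x +\<^sub>V y \<in> loc P V N" using x y P_compl_mult by (intro locI[of _ "s * t"]) auto }
  { fix r assume "r \<in> F.pid 0"
    then obtain t where r: "t \<in> \<gg> - P" "t * r \<in> \<gg>" by (auto simp: Rloc_pid Rloc_def)
    have "(t * s) *\<^sub>V (r *\<^sub>V x) = (t * r) *\<^sub>V (s *\<^sub>V x)"
      using x(1) by (simp add: sm(1) sm(3)[symmetric] algebra_simps)
    also have "\<dots> \<in> N" using d(4) x r by blast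
    finally show "r *\<^sub>V x \<in> loc P V N"
      using x r P_compl_mult sm(1) by (intro locI[of _ "t * s"]) auto }
qed

lemma loc_least:
  assumes A: "A \<subseteq> N" "A \<subseteq> carrier V" and N: "rsub (F.pid 0) V N" shows "loc P V A \<subseteq> N"
proof
  fix x assume "x \<in> loc P V A"
  then obtain s where x: "x \<in> carrier V" "s \<in> \<gg> - P" "s *\<^sub>V x \<in> A" by (auto simp: loc_def)
  have "(1 / s) *\<^sub>V (s *\<^sub>V x) \<in> N" using rsubD(4)[OF N unit_Rloc[OF x(2)]] x(3) A by blast
  moreover have "(1 / s) *\<^sub>V (s *\<^sub>V x) = x"
    using x(1) P_compl_nz[OF x(2)] by (simp add: sm(2) sm(3)[symmetric])
  ultimately show "x \<in> N" by simp
qed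

text \<open>Generators of a module also generate its localization; lattices therefore localize to
  lattices.\<close>

lemma loc_rspan:
  assumes S: "S \<subseteq> carrier V"
  shows "loc P V (rspan class_ring \<gg> V S) = rspan class_ring (F.pid 0) V S"
proof
  have r: "rsub (F.pid 0) V (rspan class_ring (F.pid 0) V S)" "S \<subseteq> rspan class_ring (F.pid 0) V S"
    using rsub_rspan[OF F.pid_subring S] by auto
  have g: "gsub (rspan class_ring \<gg> V S)" "S \<subseteq> rspan class_ring \<gg> V S"
    using rsub_rspan[OF g_subring S] by auto
  have "rspan class_ring \<gg> V S \<subseteq> rspan class_ring (F.pid 0) V S"
    by (rule rspan_least[OF g_subring r(2) rsub_mono[OF r(1) alg_ints_pid]])
  thus "loc P V (rspan class_ring \<gg> V S) \<subseteq> rspan class_ring (F.pid 0) V S"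
    by (rule loc_least[OF _ rsubD(1)[OF g(1)] r(1)])
  show "rspan class_ring (F.pid 0) V S \<subseteq> loc P V (rspan class_ring \<gg> V S)"
    by (rule rspan_least[OF F.pid_subring _ rsub_loc[OF g(1)]]) (use g(2) loc_ext[OF g(1)] in blast)
qed

lemma latt_loc: assumes A: "glat A" shows "F.latt (loc P V A)"
proof -
  obtain S B where S: "finite S" "S \<subseteq> carrier V" "A = rspan class_ring \<gg> V S"
    and B: "B \<subseteq> A" "basis B" using A by (auto simp: is_lattice_def)
  have "B \<subseteq> loc P V A" using loc_ext[OF glat_gsub[OF A]] B(1) by blast
  hence "is_lattice class_ring (F.pid 0) V (loc P V A)"
    unfolding is_lattice_def using S B(2) loc_rspan[OF S(2)] by blast
  thus ?thesis by (simp add: F.is_lattice_iff_latt)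
qed

end

context nspace
begin

lemma nlat: "P \<in> finite_primes ==> nlat P V"
  by (intro nlat.intro nprime nspace_axioms)

text \<open>The multipliers that take \<open>x\<close> into \<open>B\<close> form an ideal contained
  in no prime.\<close>

theorem local_global:
  assumes B: "gsub B" and x: "x \<in> carrier V" and l: "\<And>P. P \<in> finite_primes ==> x \<in> loc P V B"
  shows "x \<in> B"
proof (rule ccontr)
  assume n: "x \<notin> B"
  note d = rsubD[OF B]
  let ?I = "{s \<in> \<gg>. s *\<^sub>V x \<in> B}"
  have "gideal ?I"
    unfolding gideal_def using d x by (auto simp: sm)
  moreover have "1 \<notin> ?I" using n x by (simp add: sm)
  moreover have "?I \<noteq> {0}"
  proof -
    obtain P where P: "P \<in> (finite_primes :: 'f set set)" using ex_prime by blast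
    interpret nprime ty P by (rule nprime[OF P])
    obtain s where "s \<in> \<gg> - P" "s *\<^sub>V x \<in> B" using l[OF P] by (auto simp: loc_def)
    moreover have "s \<noteq> 0" using P_compl_nz calculation(1) by blast
    ultimately show ?thesis by blast
  qed
  ultimately obtain P where P: "P \<in> finite_primes" "?I \<subseteq> P" using ex_prime_above[of ?I] by blast
  thus False using l[OF P(1)] by (auto simp: loc_def)
qed

lemma local_global_sub:
  assumes "gsub A" "gsub B" "\<And>P. P \<in> finite_primes ==> loc P V A \<subseteq> loc P V B"
  shows "A \<subseteq> B"
proof
  fix x assume x: "x \<in> A"
  show "x \<in> B"
  proof (rule local_global[OF assms(2)])
    show "x \<in> carrier V" using x rsubD(1)[OF assms(1)] by blast
    fix P :: "'f set" assume P: "P \<in> finite_primes"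
    interpret nlat ty P V by (rule nlat[OF P])
    show "x \<in> loc P V B" using loc_ext[OF assms(1)] x assms(3)[OF P] by blast
  qed
qed

end

subsection \<open>Fractional ideals of the number field\<close>

abbreviation ideal_mult :: "'f::field_char_0 set => 'f set => 'f set" (infixl "\<cdot>" 70)
  where "A \<cdot> B \<equiv> A \<otimes>\<^bsub>global_frac_ideals\<^esub> B"

context nfield
begin

lemma nspace_self: "nspace (self_module (class_ring :: 'f ring))"
proof -
  obtain P where P: "P \<in> (finite_primes :: 'f set set)" using ex_prime by blast
  interpret nprime ty P by (rule nprime[OF P])
  interpret S: vspace class_ring "self_module (class_ring :: 'f ring)" by (rule F.vspace_self)
  show ?thesis
    by (intro nspace.intro nspace_axioms.intro nfield_axioms S.vspace_axioms
      S.btuple_basis(3)[OF F.self_btuple(1)[of 1]]) auto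
qed

interpretation S: nspace ty "self_module (class_ring :: 'f ring)"
  by (rule nspace_self)

lemma dim_self: "vectorspace.dim class_ring (self_module (class_ring :: 'f ring)) = 1"
  and self_tuple: "x \<noteq> 0 ==> btuple class_ring gself 1 (\<lambda>_. x :: 'f)"
proof -
  obtain P where P: "P \<in> (finite_primes :: 'f set set)" using ex_prime by blast
  interpret nprime ty P by (rule nprime[OF P])
  show b: "x \<noteq> 0 ==> btuple class_ring gself 1 (\<lambda>_. x :: 'f)" for x
    using F.self_btuple(1)[of x] by simp
  show "vectorspace.dim class_ring (self_module (class_ring :: 'f ring)) = 1"
    using S.btuple_basis(4)[OF F.self_btuple(1)[of 1]] by simp
qed

abbreviation FI :: "'f set set" where "FI \<equiv> carrier global_frac_ideals"

text \<open>Finite generation is traded for a common denominator. In the converse direction it is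
  recovered from \<open>glat_bounded\<close>.\<close>

lemma FI_iff: "A \<in> FI \<longleftrightarrow> rsub \<gg> gself A \<and> (\<exists>x\<in>A. x \<noteq> 0) \<and>
  (\<exists>d\<in>\<gg> - {0}. \<forall>x\<in>A. d * x \<in> \<gg>)"
proof
  assume "A \<in> FI"
  hence A: "S.glat A" by (simp add: frac_ideals_def)
  obtain b where b: "S.isb b" "b \<in> {..<S.dim} \<rightarrow> A" using S.glat_tuple[OF A] by blast
  obtain d where d: "d \<in> \<gg> - {0}" "d * 1 \<in> A" using S.ex_multiple[OF S.glat_gsub[OF A] b, of 1] by auto
  obtain T where T: "finite T" "A = rspan class_ring \<gg> gself T"
    using S.glat_gens[OF A] by blast
  have "\<exists>e. (e \<in> \<gg> \<and> e \<noteq> 0) \<and> (\<forall>t\<in>T. e * t \<in> \<gg>)"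
    using common_nonzero[OF T(1), of "\<lambda>d r. d * r \<in> \<gg>"] ex_denom by (auto simp: mult.assoc)
  then obtain e where e: "e \<in> \<gg> - {0}" "\<And>t. t \<in> T ==> e * t \<in> \<gg>" by auto
  have "A \<subseteq> {x. e * x \<in> \<gg>}"
    unfolding T(2) by (rule S.rspan_least[OF g_subring])
      (use e in "auto simp: rsub_def algebra_simps mult.left_commute[of e]")
  hence "\<forall>x\<in>A. e * x \<in> \<gg>" by blast
  thus "rsub \<gg> gself A \<and> (\<exists>x\<in>A. x \<noteq> 0) \<and>
      (\<exists>d\<in>\<gg> - {0}. \<forall>x\<in>A. d * x \<in> \<gg>)"
    using S.glat_gsub[OF A] d e(1) by auto
next
  assume a: "rsub \<gg> gself A \<and> (\<exists>x\<in>A. x \<noteq> 0) \<and>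
    (\<exists>d\<in>\<gg> - {0}. \<forall>x\<in>A. d * x \<in> \<gg>)"
  then obtain x d where x: "x \<in> A" "x \<noteq> 0" and d: "d \<in> \<gg> - {0}" "\<And>x. x \<in> A ==> d * x \<in> \<gg>" by blast
  have "A \<subseteq> lspan \<gg> gself 1 (\<lambda>_. 1 / d)"
  proof
    fix y assume y: "y \<in> A"
    have "lc gself 1 (\<lambda>_. d * y) (\<lambda>_. 1 / d) = y"
    proof -
      have "lc gself (Suc 0) (\<lambda>_. d * y) (\<lambda>_. 1 / d) = d * y * (1 / d)"
        using S.lc_Suc[of "\<lambda>_. d * y" 0 "\<lambda>_. 1 / d"] S.lc_zero[of 0] by simp
      thus ?thesis using d(1) by simp
    qed
    thus "y \<in> lspan \<gg> gself 1 (\<lambda>_. 1 / d)"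
      unfolding lspan_def using d(2)[OF y] by (intro CollectI exI[of _ "\<lambda>_. d * y"]) auto
  qed
  hence "S.glat A"
    using a S.glat_bounded[of A "\<lambda>_. x" "\<lambda>_. 1 / d"] self_tuple x d by (simp add: dim_self)
  thus "A \<in> FI" by (simp add: frac_ideals_def)
qed

lemma FI_sub: "A \<in> FI ==> S.gsub A" and FI_glat: "A \<in> FI ==> S.glat A"
  by (simp add: FI_iff) (simp add: frac_ideals_def)

end

text \<open>The order of an ideal at \<open>P\<close>, read off from its localization;
  \<open>loc_FI\<close> shows that it exists.\<close>

definition ordv :: "'f::field_char_0 set => 'f set => int"
  where "ordv P A = (THE k. loc P gself A = dvf.pid class_ring (nprime.pval P) k)"

context nprime
begin

interpretation S: nlat ty P "self_module (class_ring :: 'f ring)"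
  by (intro nlat.intro nprime_axioms nspace_self)

lemma ordv_eqI: "loc P gself A = F.pid k ==> ordv P A = k"
  unfolding ordv_def by (rule the_equality) auto

lemma loc_FI: assumes "A \<in> FI" shows "loc P gself A = F.pid (ordv P A)"
proof -
  have "S.F.latt (loc P gself A)" by (rule S.latt_loc[OF FI_glat[OF assms]])
  hence "loc P gself A \<in> carrier (frac_ideals class_ring (F.pid 0))"
    by (simp add: frac_ideals_def S.F.is_lattice_iff_latt)
  then obtain k where "loc P gself A = F.pid k" unfolding F.carrier_frac_ideals by blast
  thus ?thesis using ordv_eqI by simp
qed

lemma pid_mem_iff: "F.pid k \<subseteq> F.pid l \<longleftrightarrow> l \<le> k"
proof
  assume s: "F.pid k \<subseteq> F.pid l"
  obtain x where "x \<noteq> 0" "pval x = k" using F.ex_val[of k] by auto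
  thus "l \<le> k" using s by (auto simp: F.pid_def)
qed (auto simp: F.pid_def)

lemma ordv_mono: "A \<in> FI ==> B \<in> FI ==> A \<subseteq> B ==> ordv P B \<le> ordv P A"
  using S.loc_mono[of A B] loc_FI pid_mem_iff by simp

lemma ordv_mult:
  assumes A: "A \<in> FI" and B: "B \<in> FI"
  shows "ordv P (A \<cdot> B) = ordv P A + ordv P B"
proof (rule ordv_eqI)
  let ?S = "{a * b | a b. a \<in> A \<and> b \<in> B}"
    and ?T = "{a * b | a b. a \<in> F.pid (ordv P A) \<and> b \<in> F.pid (ordv P B)}"
    and ?r = "rspan class_ring (F.pid 0) gself"
  have "loc P gself (A \<cdot> B) = ?r ?S"
    using S.loc_rspan[of ?S] by (simp add: frac_ideals_def)
  also have "\<dots> = ?r ?T"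
  proof
    have r: "rsub (F.pid 0) gself (?r X)"
      "X \<subseteq> ?r X" for X :: "'f set"
      using S.rsub_rspan[OF F.pid_subring, of X] by auto
    have "A \<subseteq> F.pid (ordv P A)" "B \<subseteq> F.pid (ordv P B)"
      using S.loc_ext FI_sub A B loc_FI by blast+
    hence "?S \<subseteq> ?T" by blast
    thus "?r ?S \<subseteq> ?r ?T"
      by (intro S.rspan_least[OF F.pid_subring _ r(1)]) (use r(2) in blast)
    have "x \<in> ?r ?S" if x: "x \<in> ?T" for x
    proof -
      obtain a b where ab: "x = a * b" "a \<in> loc P gself A" "b \<in> loc P gself B"
        using x unfolding loc_FI[OF A] loc_FI[OF B] by blast
      then obtain s t where st: "s \<in> \<gg> - P" "s * a \<in> A" "t \<in> \<gg> - P" "t * b \<in> B" by (auto simp: loc_def)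
      have "(s * a) * (t * b) \<in> ?S" using st by blast
      hence "(s * a) * (t * b) \<in> ?r ?S" by (rule subsetD[OF r(2)])
      from rsubD(4)[OF r(1) S.unit_Rloc[OF P_compl_mult[OF st(1,3)]] this]
      have "(1 / (s * t)) * ((s * a) * (t * b)) \<in> ?r ?S"
        by (simp only: self_simps)
      moreover have "(1 / (s * t)) * ((s * a) * (t * b)) = x" using ab(1) P_compl_nz st by simp
      ultimately show ?thesis by simp
    qed
    thus "?r ?T \<subseteq> ?r ?S"
      by (intro S.rspan_least[OF F.pid_subring _ r(1)]) blast
  qed
  also have "\<dots> = F.pid (ordv P A) \<otimes>\<^bsub>frac_ideals class_ring (F.pid 0)\<^esub> F.pid (ordv P B)"
    by (simp add: frac_ideals_def)
  also have "\<dots> = F.pid (ordv P A + ordv P B)" by (rule F.frac_mult)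
  finally show "loc P gself (A \<cdot> B) = F.pid (ordv P A + ordv P B)" .
qed

lemma ordv_one: "ordv P \<gg> = 0"
  by (rule ordv_eqI) (auto simp: Rloc_pid Rloc_def loc_def)

lemma pid_scale: "c \<noteq> 0 ==> c * x \<in> F.pid (pval c + k) \<longleftrightarrow> x \<in> F.pid k"
  by (cases "x = 0") (auto simp: F.pid_def pval_mult)

lemma ordv_scale:
  assumes A: "A \<in> FI" and c: "c \<noteq> 0"
  shows "ordv P ((\<lambda>x. c * x) ` A) = pval c + ordv P A"
proof (rule ordv_eqI)
  have "x \<in> loc P gself ((\<lambda>x. c * x) ` A) \<longleftrightarrow> x / c \<in> loc P gself A" for x
  proof -
    have "s * x \<in> (\<lambda>x. c * x) ` A \<longleftrightarrow> s * (x / c) \<in> A" for s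
      using c by (auto simp: image_iff field_simps intro!: bexI[of _ "s * (x / c)"])
    thus ?thesis by (simp add: loc_def)
  qed
  hence "x \<in> loc P gself ((\<lambda>x. c * x) ` A) \<longleftrightarrow> x \<in> F.pid (pval c + ordv P A)" for x
    using pid_scale[OF c, of "x / c" "ordv P A"] c loc_FI[OF A] by simp
  thus "loc P gself ((\<lambda>x. c * x) ` A) = F.pid (pval c + ordv P A)" by blast
qed

lemma P_FI: "P \<in> FI"
proof -
  obtain m where "m > 0" "of_int m \<in> P" using P_int by blast
  hence "\<exists>x\<in>P. x \<noteq> 0" by (intro bexI[of _ "of_int m"]) auto
  thus ?thesis unfolding FI_iff using P_ideal by (auto simp: rsub_def intro!: bexI[of _ 1])
qed

lemma ordv_self: "ordv P P = 1"
proof (rule ordv_eqI)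
  have "x \<in> loc P gself P \<longleftrightarrow> x \<in> F.pid 1" for x
  proof
    assume "x \<in> loc P gself P"
    then obtain s where s: "s \<in> \<gg> - P" "s * x \<in> P" by (auto simp: loc_def)
    show "x \<in> F.pid 1"
    proof (cases "x = 0")
      case False
      have "s * x \<in> \<gg>" using s P_ideal(1) by blast
      hence "pval (s * x) \<ge> 1" using pval_in_P[of "s * x"] s False P_compl_nz by simp
      thus ?thesis using pval_mult[of s x] pval_unit[OF s(1)] P_compl_nz[OF s(1)] False by (simp add: pid_iff)
    qed (simp add: pid_iff)
  next
    assume x: "x \<in> F.pid 1"
    hence "x \<in> F.pid 0" by (auto simp: F.pid_def)
    then obtain s where s: "s \<in> \<gg> - P" "s * x \<in> \<gg>" by (auto simp: Rloc_pid Rloc_def)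
    have "s * x \<in> P"
    proof (cases "x = 0")
      case False
      hence "pval (s * x) \<ge> 1" using x pval_mult[of s x] pval_unit[OF s(1)] P_compl_nz[OF s(1)] by (simp add: pid_iff)
      thus ?thesis using pval_in_P[OF s(2)] False P_compl_nz[OF s(1)] by simp
    qed (use P_ideal(2) in simp)
    thus "x \<in> loc P gself P" using s by (auto simp: loc_def)
  qed
  thus "loc P gself P = F.pid 1" by blast
qed

text \<open>As primes are maximal, \<open>Q\<close> contains an element outside \<open>P\<close>,
  which is a unit at \<open>P\<close>.\<close>

lemma ordv_other: assumes Q: "Q \<in> finite_primes" "Q \<noteq> P" shows "ordv P Q = 0"
proof (rule ordv_eqI)
  interpret Q: nprime ty Q by (rule nprime[OF Q(1)])
  obtain x where x: "x \<in> Q" "x \<in> \<gg> - P" using primes_maximal[OF Q(1) P] Q(2) Q.P_ideal(1) by blast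
  have "y \<in> loc P gself Q" if y: "y \<in> Rloc" for y
  proof -
    obtain s where s: "s \<in> \<gg> - P" "s * y \<in> \<gg>" using y by (auto simp: Rloc_def)
    have "(s * x) * y \<in> Q" using Q.P_ideal(4)[OF s(2) x(1)] by (simp add: algebra_simps)
    thus ?thesis using P_compl_mult[OF s(1) x(2)] by (auto simp: loc_def)
  qed
  moreover have "y \<in> Rloc" if "y \<in> loc P gself Q" for y
    using that Q.P_ideal(1) by (auto simp: loc_def Rloc_def)
  ultimately show "loc P gself Q = F.pid 0" unfolding Rloc_pid by blast
qed

end

context nfield
begin

interpretation S: nspace ty "self_module (class_ring :: 'f ring)"
  by (rule nspace_self)

lemma FI_le:
  assumes A: "A \<in> FI" and B: "B \<in> FI" and "\<And>P. P \<in> finite_primes ==> ordv P B \<le> ordv P A"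
  shows "A \<subseteq> B"
proof (rule S.local_global_sub[OF FI_sub[OF A] FI_sub[OF B]])
  fix P :: "'f set" assume P: "P \<in> finite_primes"
  interpret nprime ty P by (rule nprime[OF P])
  show "loc P gself A \<subseteq> loc P gself B"
    using assms(3)[OF P] loc_FI A B pid_mem_iff by simp
qed

lemma FI_eqI:
  "A \<in> FI ==> B \<in> FI ==> (\<And>P. P \<in> finite_primes ==> ordv P A = ordv P B) ==> A = B"
  using FI_le[of A B] FI_le[of B A] by force

lemma FI_mult: assumes A: "A \<in> FI" and B: "B \<in> FI" shows "A \<cdot> B \<in> FI"
proof -
  obtain x d where x: "x \<in> A" "x \<noteq> 0" "d \<in> \<gg> - {0}" "\<And>x. x \<in> A ==> d * x \<in> \<gg>" using A unfolding FI_iff by blast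
  obtain y e where y: "y \<in> B" "y \<noteq> 0" "e \<in> \<gg> - {0}" "\<And>x. x \<in> B ==> e * x \<in> \<gg>" using B unfolding FI_iff by blast
  let ?S = "{a * b | a b. a \<in> A \<and> b \<in> B}"
  let ?M = "rspan class_ring \<gg> gself ?S"
  have r: "S.gsub ?M" "?S \<subseteq> ?M" using S.rsub_rspan[OF g_subring, of ?S] by auto
  have "?M \<subseteq> {z. d * e * z \<in> \<gg>}"
  proof (rule S.rspan_least[OF g_subring])
    show "?S \<subseteq> {z. d * e * z \<in> \<gg>}"
    proof
      fix z assume "z \<in> ?S"
      then obtain a b where ab: "z = a * b" "a \<in> A" "b \<in> B" by blast
      have "(d * a) * (e * b) \<in> \<gg>" using x(4)[OF ab(2)] y(4)[OF ab(3)] by blast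
      thus "z \<in> {z. d * e * z \<in> \<gg>}" using ab(1) by (simp add: algebra_simps)
    qed
    have "d * e * (r * z) \<in> \<gg>" if "r \<in> \<gg>" "d * e * z \<in> \<gg>" for r z
      using alg_ints_closed(2)[OF that] by (simp only: mult.left_commute mult.assoc)
    thus "S.gsub {z. d * e * z \<in> \<gg>}" by (auto simp: rsub_def distrib_left)
  qed
  moreover have "x * y \<in> ?M" using r(2) x(1) y(1) by blast
  moreover have "d * e \<in> \<gg> - {0}" "x * y \<noteq> 0" using x y by auto
  ultimately have "?M \<in> FI" unfolding FI_iff using r(1) by blast
  thus ?thesis by (simp add: frac_ideals_def)
qed

lemma FI_one: "\<gg> \<in> FI"
  unfolding FI_iff by (auto simp: rsub_def intro!: bexI[of _ 1])

lemma FI_scale: assumes A: "A \<in> FI" and c: "c \<noteq> 0" shows "(\<lambda>x. c * x) ` A \<in> FI"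
proof -
  obtain x d where x: "x \<in> A" "x \<noteq> 0" "d \<in> \<gg> - {0}" "\<And>x. x \<in> A ==> d * x \<in> \<gg>" using A unfolding FI_iff by blast
  note d = rsubD[OF FI_sub[OF A]]
  obtain e where e: "e \<in> \<gg> - {0}" "e * c \<in> \<gg>" using ex_denom by blast
  have "e * d * (c * z) \<in> \<gg>" if "z \<in> A" for z
    using alg_ints_closed(2)[OF e(2) x(4)[OF that]] by (simp add: algebra_simps)
  hence "\<exists>d\<in>\<gg> - {0}. \<forall>x\<in>(\<lambda>x. c * x) ` A. d * x \<in> \<gg>"
    using e(1) x(3) by (intro bexI[of _ "e * d"]) auto
  moreover have "S.gsub ((\<lambda>x. c * x) ` A)"
    unfolding rsub_def using d(2,3,4)
    by (auto simp: image_iff distrib_left[symmetric] mult.left_commute[of _ c])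
  ultimately show ?thesis unfolding FI_iff using x(1,2) c by auto
qed

text \<open>The monoid laws hold for the orders at every prime, hence for the ideals by
  \<open>FI_eqI\<close>.\<close>

lemma comm_monoid_FI: "Group.comm_monoid (global_frac_ideals :: 'f set monoid)"
proof (rule comm_monoidI)
  have one: "\<one>\<^bsub>global_frac_ideals\<^esub> = (\<gg> :: 'f set)" by (simp add: frac_ideals_def)
  fix A B C :: "'f set" assume A: "A \<in> FI" and B: "B \<in> FI" and C: "C \<in> FI"
  show "A \<cdot> B \<cdot> C = A \<cdot> (B \<cdot> C)"
    by (rule FI_eqI) (use A B C FI_mult nprime.ordv_mult[OF nprime] in simp_all)
  show "A \<cdot> B = B \<cdot> A"
    by (rule FI_eqI) (use A B FI_mult nprime.ordv_mult[OF nprime] in simp_all)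
  show "\<one>\<^bsub>global_frac_ideals\<^esub> \<cdot> A = A"
    unfolding one by (rule FI_eqI) (use A FI_one FI_mult nprime.ordv_mult[OF nprime] nprime.ordv_one[OF nprime] in simp_all)
qed (use FI_one FI_mult in "auto simp: frac_ideals_def")

interpretation G: Group.comm_monoid "global_frac_ideals :: 'f set monoid"
  by (rule comm_monoid_FI)

lemma ordv_pow: "P \<in> finite_primes ==> A \<in> FI ==> ordv P (A [^]\<^bsub>global_frac_ideals\<^esub> (n::nat)) = int n * ordv P A"
proof (induction n)
  case 0
  thus ?case using nprime.ordv_one[OF nprime[OF 0(1)]] by (simp add: frac_ideals_def)
next
  case (Suc n)
  thus ?case using nprime.ordv_mult[OF nprime[OF Suc.prems(1)], of "A [^]\<^bsub>global_frac_ideals\<^esub> n" A]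
    by (simp add: algebra_simps)
qed

lemma ordv_finprod:
  assumes "P \<in> finite_primes" "finite I" "f \<in> I \<rightarrow> FI"
  shows "ordv P (\<Otimes>\<^bsub>global_frac_ideals\<^esub>i\<in>I. f i) = (\<Sum>i\<in>I. ordv P (f i))"
  using assms(2,3)
proof (induction I rule: finite_induct)
  case empty
  show ?case unfolding G.finprod_empty using nprime.ordv_one[OF nprime[OF assms(1)]] by (simp add: frac_ideals_def)
next
  case (insert i I)
  thus ?case using nprime.ordv_mult[OF nprime[OF assms(1)]] by simp
qed

text \<open>A nonzero integer \<open>m\<close> of \<open>A\<close> lies in every prime of the
  support, and only finitely many ideals contain it. The product is then compared with
  \<open>A\<close> prime by prime.\<close>

theorem prime_product:
  assumes A: "A \<in> FI" "A \<subseteq> \<gg>" and e: "\<And>P. P \<in> finite_primes ==> ordv P A = int (e P)"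
  shows "is_prime_product A e"
proof -
  have FIP: "P \<in> finite_primes ==> P \<in> FI" for P using nprime.P_FI[OF nprime] by blast
  let ?E = "{P \<in> finite_primes. e P \<noteq> 0}"
  obtain x where x: "x \<in> A" "x \<noteq> 0" using A(1) unfolding FI_iff by blast
  have xg: "x \<in> \<gg>" using x A(2) by blast
  obtain m where m: "m > 0" "of_int m * (1 / x) \<in> (\<gg> :: 'f set)" using ex_denominator by blast
  have "of_int m * (1 / x) * x \<in> A" using rsubD(4)[OF FI_sub[OF A(1)] m(2) x(1)] by simp
  hence mA: "of_int m \<in> A" using x(2) by simp
  have "?E \<subseteq> {I. gideal I \<and> of_int m \<in> I}"
  proof
    fix P assume "P \<in> ?E"
    hence Pe: "P \<in> finite_primes" "e P \<noteq> 0" by auto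
    interpret nprime ty P by (rule nprime[OF Pe(1)])
    interpret L: nlat ty P "self_module (class_ring :: 'f ring)" by (intro nlat.intro nprime_axioms nspace_self)
    have "of_int m \<in> F.pid (int (e P))" using L.loc_ext[OF FI_sub[OF A(1)]] mA loc_FI[OF A(1)] e[OF Pe(1)] by auto
    hence "pval (of_int m) \<ge> 1" using Pe(2) m(1) by (auto simp: pid_iff)
    thus "P \<in> {I. gideal I \<and> of_int m \<in> I}" using pval_in_P[of "of_int m"] m(1) gP by simp
  qed
  hence fin: "finite ?E" using finite_ideals_above[OF m(1)] finite_subset by blast
  let ?f = "\<lambda>P. P [^]\<^bsub>global_frac_ideals\<^esub> e P"
  have f: "?f \<in> ?E \<rightarrow> FI" using FIP by auto
  have "A = (\<Otimes>\<^bsub>global_frac_ideals\<^esub>P\<in>?E. ?f P)"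
  proof (rule FI_eqI[OF A(1)])
    show "(\<Otimes>\<^bsub>global_frac_ideals\<^esub>P\<in>?E. ?f P) \<in> FI" by (rule G.finprod_closed[OF f])
    fix Q :: "'f set" assume Q: "Q \<in> finite_primes"
    interpret nprime ty Q by (rule nprime[OF Q])
    have "ordv Q (\<Otimes>\<^bsub>global_frac_ideals\<^esub>P\<in>?E. ?f P) = (\<Sum>P\<in>?E. ordv Q (?f P))"
      by (rule ordv_finprod[OF Q fin f])
    also have "\<dots> = (\<Sum>P\<in>?E. if P = Q then int (e P) else 0)"
      by (rule sum.cong) (use ordv_pow[OF Q] FIP ordv_self ordv_other in auto)
    also have "\<dots> = int (e Q)" using Q fin by (simp add: sum.delta)
    finally show "ordv Q A = ordv Q (\<Otimes>\<^bsub>global_frac_ideals\<^esub>P\<in>?E. ?f P)" using e[OF Q] by simp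
  qed
  thus ?thesis using fin by (simp add: is_prime_product_def)
qed

end

subsection \<open>Index ideals over the ring of integers\<close>

context nlat
begin

text \<open>Multiplication of \<open>\<alpha>\<close> by an element \<open>s\<close> outside
  \<open>P\<close> clears the denominators of the images of finitely many generators. It does not
  change the order of the determinant, as \<open>s\<close> is a unit at \<open>P\<close>.\<close>

lemma index_scaled:
  assumes A: "glat A" and B: "gsub B" and \<alpha>: "lin_aut class_ring V \<alpha>" "\<alpha> ` loc P V A \<subseteq> loc P V B"
  shows "\<exists>\<beta>. lin_aut class_ring V \<beta> \<and> \<beta> ` A \<subseteq> B \<and> lin_det class_ring V \<alpha> / lin_det class_ring V \<beta> \<in> F.pid 0 \<and>
    lin_det class_ring V \<beta> \<noteq> 0"
proof -
  have h: "\<alpha> \<in> module_hom class_ring V V" and bij: "bij_betw \<alpha> (carrier V) (carrier V)" using \<alpha>(1) by (auto simp: lin_aut_def)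
  have hV: "x \<in> carrier V ==> \<alpha> x \<in> carrier V" and hs: "x \<in> carrier V ==> \<alpha> (a *\<^sub>V x) = a *\<^sub>V \<alpha> x"
    and ha: "x \<in> carrier V ==> y \<in> carrier V ==> \<alpha> (x +\<^sub>V y) = \<alpha> x +\<^sub>V \<alpha> y" for x y a
    using h by (auto simp: LinearCombinations.module_hom_def Pi_def)
  obtain T where T: "finite T" "T \<subseteq> carrier V" "T \<subseteq> A" "A = rspan class_ring \<gg> V T" using glat_gens[OF A] by blast
  have "\<exists>s\<in>\<gg> - P. \<forall>t\<in>T. s *\<^sub>V \<alpha> t \<in> B"
  proof (rule common_multiple[OF T(1)])
    fix t assume t: "t \<in> T"
    hence "\<alpha> t \<in> loc P V B" using \<alpha>(2) loc_ext[OF glat_gsub[OF A]] T(3) by blast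
    thus "\<exists>s\<in>\<gg> - P. s *\<^sub>V \<alpha> t \<in> B" by (auto simp: loc_def)
    fix d e assume "d \<in> \<gg> - P" "e \<in> \<gg> - P" "d *\<^sub>V \<alpha> t \<in> B"
    thus "(e * d) *\<^sub>V \<alpha> t \<in> B" using rsubD(4)[OF B, of e] hV T(2) t by (auto simp: sm)
  qed (use P_compl_one P_compl_mult in auto)
  then obtain s where s: "s \<in> \<gg> - P" "\<And>t. t \<in> T ==> s *\<^sub>V \<alpha> t \<in> B" by blast
  have s0: "s \<noteq> 0" using P_compl_nz[OF s(1)] .
  define \<beta> where "\<beta> x = s *\<^sub>V \<alpha> x" for x
  have bh: "\<beta> \<in> module_hom class_ring V V"
    unfolding LinearCombinations.module_hom_def \<beta>_def using hV ha hs
    by (auto simp: sm(1,6) sm(3)[symmetric] mult.commute)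
  have "bij_betw \<beta> (carrier V) (carrier V)"
  proof -
    have "bij_betw (\<lambda>x. s *\<^sub>V x) (carrier V) (carrier V)"
      by (rule bij_betwI[where g = "\<lambda>x. (1 / s) *\<^sub>V x"])
        (use s0 in "auto simp: sm(1,2) sm(3)[symmetric]")
    from bij_betw_trans[OF bij this] show ?thesis by (simp add: \<beta>_def[abs_def] comp_def)
  qed
  hence ba: "lin_aut class_ring V \<beta>" using bh by (simp add: lin_aut_def)
  have "A \<subseteq> {x \<in> carrier V. \<beta> x \<in> B}"
  proof -
    have "gsub {x \<in> carrier V. \<beta> x \<in> B}"
      unfolding rsub_def
    proof (intro conjI ballI)
      have "\<beta> 0\<^sub>V = 0\<^sub>V" using hom_lc[OF bh, of "\<lambda>_. 0" 0] by (simp add: lc_def)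
      thus "0\<^sub>V \<in> {x \<in> carrier V. \<beta> x \<in> B}" using rsubD(2)[OF B] by simp
    next
      fix x y assume "x \<in> {x \<in> carrier V. \<beta> x \<in> B}" "y \<in> {x \<in> carrier V. \<beta> x \<in> B}"
      thus "x +\<^sub>V y \<in> {x \<in> carrier V. \<beta> x \<in> B}"
        using rsubD(3)[OF B] bh by (auto simp: LinearCombinations.module_hom_def)
    next
      fix r :: 'f and x assume "r \<in> \<gg>" "x \<in> {x \<in> carrier V. \<beta> x \<in> B}"
      thus "r *\<^sub>V x \<in> {x \<in> carrier V. \<beta> x \<in> B}"
        using rsubD(4)[OF B] bh by (auto simp: LinearCombinations.module_hom_def sm)
    qed auto
    thus ?thesis unfolding T(4) using s(2) T(2)
      by (intro rspan_least[OF g_subring]) (auto simp: \<beta>_def)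
  qed
  hence bA: "\<beta> ` A \<subseteq> B" by blast
  define l where "l = F.ref"
  have l: "isb l" unfolding l_def by (rule F.ref)
  note da = F.lin_aut_det[OF \<alpha>(1) l] and db = F.lin_aut_det[OF ba l]
  have ia: "isb (\<alpha> \<circ> l)" and ib: "isb (\<beta> \<circ> l)" using da db by auto
  note ca = btupleD(1)[OF ia] and cb = btupleD(1)[OF ib]
  have "F.lat (\<alpha> \<circ> l) = F.lat (\<beta> \<circ> l)"
  proof (rule lspan_eqI[OF F.pid_subring ca cb])
    fix i assume i: "i < dim"
    have li: "\<alpha> (l i) \<in> carrier V" using ca i by auto
    show "(\<beta> \<circ> l) i \<in> F.lat (\<alpha> \<circ> l)"
      using rsubD(4)[OF F.rsub_lat[OF ia], of s] F.lat_gen[OF ia i] s(1) alg_ints_pid by (auto simp: \<beta>_def)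
    have "(1 / s) *\<^sub>V (\<beta> \<circ> l) i \<in> F.lat (\<beta> \<circ> l)"
      by (rule rsubD(4)[OF F.rsub_lat[OF ib] unit_Rloc[OF s(1)] F.lat_gen[OF ib i]])
    thus "(\<alpha> \<circ> l) i \<in> F.lat (\<beta> \<circ> l)"
      using li s0 by (simp add: \<beta>_def sm(2) sm(3)[symmetric])
  qed
  hence "pval (F.Dt (\<alpha> \<circ> l)) = pval (F.Dt (\<beta> \<circ> l))" using F.vol_lat[OF ia] F.vol_lat[OF ib] by simp
  hence "pval (lin_det class_ring V \<alpha>) = pval (lin_det class_ring V \<beta>)" using da db by simp
  moreover have nz: "lin_det class_ring V \<alpha> \<noteq> 0" "lin_det class_ring V \<beta> \<noteq> 0" using da db by auto
  moreover have "pval (lin_det class_ring V \<alpha>) = pval (lin_det class_ring V \<alpha> / lin_det class_ring V \<beta>) + pval (lin_det class_ring V \<beta>)"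
    using pval_mult[of "lin_det class_ring V \<alpha> / lin_det class_ring V \<beta>" "lin_det class_ring V \<beta>"] nz by simp
  ultimately have "lin_det class_ring V \<alpha> / lin_det class_ring V \<beta> \<in> F.pid 0" by (simp add: pid_iff)
  thus ?thesis using ba nz(2) bA by (intro exI[of _ \<beta>]) auto
qed

text \<open>By \<open>index_scaled\<close> each local automorphism can be replaced by a global one
  whose determinant has the same order, so the determinants of both kinds span the same local
  ideal.\<close>

lemma index_loc:
  assumes A: "glat A" and B: "glat B"
  shows "loc P gself (gindex A B) = F.pid (F.vol (loc P V B) - F.vol (loc P V A))"
    and "\<exists>\<alpha>. lin_aut class_ring V \<alpha> \<and> \<alpha> ` A \<subseteq> B"
proof -
  interpret S: nlat ty P "self_module (class_ring :: 'f ring)"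
    by (intro nlat.intro nprime_axioms nspace_self)
  define S where "S = {lin_det class_ring V \<alpha> | \<alpha>. lin_aut class_ring V \<alpha> \<and> \<alpha> ` A \<subseteq> B}"
  define S' where "S' = {lin_det class_ring V \<alpha> | \<alpha>. lin_aut class_ring V \<alpha> \<and> \<alpha> ` loc P V A \<subseteq> loc P V B}"
  let ?r = "rspan class_ring (F.pid 0) gself"
  have r: "rsub (F.pid 0) gself (?r X)" "X \<subseteq> ?r X" for X :: "'f set"
    using S.rsub_rspan[OF F.pid_subring, of X] by auto
  have "S \<subseteq> S'"
  proof
    fix d assume "d \<in> S"
    then obtain \<alpha> where \<alpha>: "d = lin_det class_ring V \<alpha>" "lin_aut class_ring V \<alpha>" "\<alpha> ` A \<subseteq> B" by (auto simp: S_def)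
    have h: "\<And>x. x \<in> carrier V ==> \<alpha> x \<in> carrier V" "\<And>x a. x \<in> carrier V ==> \<alpha> (a *\<^sub>V x) = a *\<^sub>V \<alpha> x"
      using \<alpha>(2) by (auto simp: lin_aut_def LinearCombinations.module_hom_def Pi_def)
    have "\<alpha> ` loc P V A \<subseteq> loc P V B"
    proof
      fix y assume "y \<in> \<alpha> ` loc P V A"
      then obtain x where x: "y = \<alpha> x" "x \<in> loc P V A" by blast
      obtain s where s: "x \<in> carrier V" "s \<in> \<gg> - P" "s *\<^sub>V x \<in> A" using x(2) by (auto simp: loc_def)
      have "\<alpha> (s *\<^sub>V x) \<in> B" using \<alpha>(3) s(3) by blast
      thus "y \<in> loc P V B" using s h x(1) by (intro locI[of _ s]) auto
    qed
    thus "d \<in> S'" using \<alpha> by (auto simp: S'_def)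
  qed
  hence 1: "?r S \<subseteq> ?r S'" using S.rspan_least[OF F.pid_subring _ r(1)] r(2) by blast
  have *: "\<exists>\<beta>. lin_aut class_ring V \<beta> \<and> \<beta> ` A \<subseteq> B \<and> d \<in> ?r S" if "d \<in> S'" for d
  proof -
    obtain \<alpha> where \<alpha>: "d = lin_det class_ring V \<alpha>" "lin_aut class_ring V \<alpha>" "\<alpha> ` loc P V A \<subseteq> loc P V B"
      using \<open>d \<in> S'\<close> by (auto simp: S'_def)
    obtain \<beta> where \<beta>: "lin_aut class_ring V \<beta>" "\<beta> ` A \<subseteq> B" "d / lin_det class_ring V \<beta> \<in> F.pid 0" "lin_det class_ring V \<beta> \<noteq> 0"
      using index_scaled[OF A glat_gsub[OF B] \<alpha>(2,3)] \<alpha>(1) by blast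
    have "lin_det class_ring V \<beta> \<in> ?r S" by (rule subsetD[OF r(2)]) (use \<beta> in "auto simp: S_def")
    from rsubD(4)[OF r(1) \<beta>(3) this] have "d \<in> ?r S" using \<beta>(4) by simp
    thus ?thesis using \<beta> by blast
  qed
  hence "?r S' \<subseteq> ?r S" by (intro S.rspan_least[OF F.pid_subring _ r(1)]) blast
  hence e: "?r S = ?r S'" using 1 by blast
  have "gindex A B = rspan class_ring \<gg> gself S"
    by (simp add: index_ideal_def S_def)
  hence "loc P gself (gindex A B) = ?r S'" using S.loc_rspan[of S] e by simp
  also have v: "?r S' = F.pid (F.vol (loc P V B) - F.vol (loc P V A))"
    using F.index_ideal_eq[OF latt_loc[OF A] latt_loc[OF B]] by (simp only: index_ideal_def S'_def)
  finally show "loc P gself (gindex A B) = F.pid (F.vol (loc P V B) - F.vol (loc P V A))" .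
  \<comment> \<open>The empty set would span the zero module, but the local index ideal is nonzero.
    This supplies the global automorphism of the second claim.\<close>
  have "S' \<noteq> {}"
  proof
    assume "S' = {}"
    moreover have "rsub (F.pid 0) gself {0 :: 'f}" by (auto simp: rsub_def)
    ultimately have "?r S' \<subseteq> {0}" using S.rspan_least[OF F.pid_subring, of "{}" "{0}"] by simp
    moreover obtain x where x: "x \<noteq> 0" "pval x = F.vol (loc P V B) - F.vol (loc P V A)" using F.ex_val by auto
    hence "x \<in> ?r S'" unfolding v pid_iff by simp
    ultimately show False using x(1) by blast
  qed
  thus "\<exists>\<alpha>. lin_aut class_ring V \<alpha> \<and> \<alpha> ` A \<subseteq> B" using * by blast
qed

lemma ordv_index:
  "glat A ==> glat B ==> ordv P (gindex A B) = F.vol (loc P V B) - F.vol (loc P V A)"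
  by (rule ordv_eqI[OF index_loc(1)])

end

context nspace
begin

text \<open>With a basis \<open>b\<close> inside \<open>A\<close> and a basis \<open>c\<close> whose
  span contains \<open>B\<close>, admissible automorphisms have integral matrices from
  \<open>b\<close> to \<open>c\<close>; their determinants therefore have a common
  denominator.\<close>

lemma index_FI:
  assumes A: "glat A" and B: "glat B"
  shows "gindex A B \<in> FI"
proof -
  interpret S: nspace ty "self_module (class_ring :: 'f ring)" by (rule nspace_self)
  obtain P :: "'f set" where P: "P \<in> finite_primes" using ex_prime by blast
  interpret L: nlat ty P V by (rule nlat[OF P])
  define S where "S = {lin_det class_ring V \<alpha> | \<alpha>. lin_aut class_ring V \<alpha> \<and> \<alpha> ` A \<subseteq> B}"
  let ?I = "rspan class_ring \<gg> gself S"
  have r: "S.gsub ?I" "S \<subseteq> ?I" using S.rsub_rspan[OF g_subring, of S] by auto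
  obtain b where b: "isb b" "b \<in> {..<dim} \<rightarrow> A" using glat_tuple[OF A] by blast
  obtain c where c: "isb c" "B \<subseteq> lspan \<gg> V dim c" using denominator_tuple[OF B] by blast
  let ?\<delta> = "tdet class_ring V dim b c"
  obtain d where d: "d \<in> \<gg> - {0}" "d * ?\<delta> \<in> \<gg>" using ex_denom by blast
  have "d * lin_det class_ring V \<alpha> \<in> \<gg>" if \<alpha>: "lin_aut class_ring V \<alpha>" "\<alpha> ` A \<subseteq> B" for \<alpha>
  proof -
    have h: "\<alpha> \<in> module_hom class_ring V V" using \<alpha>(1) by (simp add: lin_aut_def)
    have "\<exists>a. a \<in> {..<dim} \<rightarrow> \<gg> \<and> (i < dim --> \<alpha> (b i) = lc V dim a c)" for i
    proof (cases "i < dim")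
      case True
      hence "\<alpha> (b i) \<in> lspan \<gg> V dim c" using b(2) \<alpha>(2) c(2) by blast
      thus ?thesis by (auto simp: lspan_def)
    qed (auto intro: exI[of _ "\<lambda>_. 0"])
    then obtain M where M: "\<And>i. M i \<in> {..<dim} \<rightarrow> \<gg> \<and> (i < dim --> \<alpha> (b i) = lc V dim (M i) c)" by metis
    have "tdet class_ring V dim b (\<alpha> \<circ> b) = leibniz_det class_ring dim M * ?\<delta>"
      using tdet_lc[OF b(1) btupleD(1)[OF c(1)], of M "\<alpha> \<circ> b"] M by (simp add: R.is_mat_def)
    hence "lin_det class_ring V \<alpha> = leibniz_det class_ring dim M * ?\<delta>" using lin_det_eq[OF b(1) h] by simp
    moreover have "leibniz_det class_ring dim M \<in> \<gg>"
      by (rule L.F.det_in_subring[OF g_subring]) (use M in auto)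
    ultimately show ?thesis using alg_ints_closed(2)[of "leibniz_det class_ring dim M" "d * ?\<delta>"] d(2)
      by (simp add: mult.left_commute)
  qed
  hence "S \<subseteq> {x. d * x \<in> \<gg>}" by (auto simp: S_def)
  hence "?I \<subseteq> {x. d * x \<in> \<gg>}"
    by (rule S.rspan_least[OF g_subring]) (auto simp: rsub_def distrib_left mult.left_commute[of d])
  moreover have "\<exists>x\<in>?I. x \<noteq> 0"
  proof -
    obtain \<alpha> where \<alpha>: "lin_aut class_ring V \<alpha>" "\<alpha> ` A \<subseteq> B" using L.index_loc(2)[OF A B] by blast
    hence "lin_det class_ring V \<alpha> \<in> ?I" using r(2) by (auto simp: S_def)
    thus ?thesis using L.F.lin_aut_det[OF \<alpha>(1) b(1)] by auto
  qed
  ultimately have "?I \<in> FI" unfolding FI_iff using r(1) d(1) by blast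
  thus ?thesis by (simp add: index_ideal_def S_def)
qed

end

section \<open>Quadratic spaces over a number field\<close>

locale nquad = nspace ty V for ty :: "'f::field_char_0 itself" and V :: "('f, 'v) module" +
  fixes \<phi> :: "'v => 'v => 'f"
  assumes qs: "quadratic_space class_ring V \<phi>"

locale nquad_loc = nlat ty P V + nquad ty V \<phi>
  for ty :: "'f::field_char_0 itself" and P :: "'f set" and V :: "('f, 'v) module" and \<phi>
begin

sublocale F: dvquad "class_ring :: 'f ring" V pval \<phi>
  by unfold_locales (rule qs)

lemma bil_eq: "F.bil x y = 2 * \<phi> x y"
  by (simp add: F.bil_def)

end

context nquad
begin

abbreviation gmax :: "'v set => bool"
  where "gmax \<equiv> maximal_lattice class_ring alg_ints V \<phi>"

abbreviation gdisc :: "'v set => 'f set"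
  where "gdisc \<equiv> discr_ideal class_ring alg_ints V \<phi>"

lemma nquad_loc: "P \<in> finite_primes ==> nquad_loc P V \<phi>"
  by (intro nquad_loc.intro nlat nquad_axioms)

lemma phi_smult [simp]:
  assumes "x \<in> carrier V" "y \<in> carrier V"
  shows "\<phi> (a *\<^sub>V x) y = a * \<phi> x y" "\<phi> x (a *\<^sub>V y) = a * \<phi> x y"
    and "\<phi> 0\<^sub>V y = 0" "\<phi> x 0\<^sub>V = 0"
proof -
  have s: "\<phi> (a *\<^sub>V u) v = a * \<phi> u v" "\<phi> u v = \<phi> v u" if "u \<in> carrier V" "v \<in> carrier V" for u v a
  proof -
    show "\<phi> u v = \<phi> v u" using qs that by (simp add: quadratic_space_def)
    have "\<forall>a\<in>carrier (class_ring :: 'f ring). \<forall>x\<in>carrier V. \<forall>y\<in>carrier V. \<phi> (a *\<^sub>V x) y = a \<otimes>\<^bsub>class_ring\<^esub> \<phi> x y"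
      using qs unfolding quadratic_space_def by (elim conjE)
    thus "\<phi> (a *\<^sub>V u) v = a * \<phi> u v" using that by simp
  qed
  show 1: "\<phi> (a *\<^sub>V x) y = a * \<phi> x y" by (rule s(1)[OF assms])
  show "\<phi> x (a *\<^sub>V y) = a * \<phi> x y"
    using s(1)[OF assms(2,1), of a] s(2)[of x "a *\<^sub>V y"] s(2)[OF assms] assms sm(1) by simp
  show z: "\<phi> 0\<^sub>V y = 0" using s(1)[OF assms, of 0] sm(5)[OF assms(1)] by simp
  show "\<phi> x 0\<^sub>V = 0" using s(1)[OF assms(2,1), of 0] sm(5)[OF assms(2)] s(2)[of x "0\<^sub>V"] assms by simp
qed

lemma phi_add [simp]:
  assumes "x \<in> carrier V" "y \<in> carrier V" "z \<in> carrier V"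
  shows "\<phi> (x +\<^sub>V y) z = \<phi> x z + \<phi> y z" "\<phi> z (x +\<^sub>V y) = \<phi> z x + \<phi> z y"
proof -
  have s: "\<phi> (u +\<^sub>V v) w = \<phi> u w + \<phi> v w" "\<phi> u v = \<phi> v u" if "u \<in> carrier V" "v \<in> carrier V" "w \<in> carrier V" for u v w
  proof -
    show "\<phi> u v = \<phi> v u" using qs that by (simp add: quadratic_space_def)
    have "\<forall>x\<in>carrier V. \<forall>y\<in>carrier V. \<forall>z\<in>carrier V. \<phi> (x +\<^sub>V y) z = \<phi> x z \<oplus>\<^bsub>class_ring\<^esub> \<phi> y z"
      using qs unfolding quadratic_space_def by (elim conjE)
    thus "\<phi> (u +\<^sub>V v) w = \<phi> u w + \<phi> v w" using that by simp
  qed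
  show "\<phi> (x +\<^sub>V y) z = \<phi> x z + \<phi> y z" by (rule s(1)[OF assms])
  show "\<phi> z (x +\<^sub>V y) = \<phi> z x + \<phi> z y"
    using s(1)[OF assms] s(2)[of z "x +\<^sub>V y" z] s(2)[of z x z] s(2)[of z y z] assms by simp
qed

lemma phi_sym: "x \<in> carrier V ==> y \<in> carrier V ==> \<phi> x y = \<phi> y x"
  using qs by (simp add: quadratic_space_def)

lemma integral_bil:
  assumes N: "gsub N" "\<And>x. x \<in> N ==> \<phi> x x \<in> \<gg>" and xy: "x \<in> N" "y \<in> N"
  shows "2 * \<phi> x y \<in> \<gg>"
proof -
  have c: "x \<in> carrier V" "y \<in> carrier V" using rsubD(1)[OF N(1)] xy by auto
  have "\<phi> (x +\<^sub>V y) (x +\<^sub>V y) - \<phi> x x - \<phi> y y \<in> \<gg>"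
    using N(2) rsubD(3)[OF N(1) xy] xy by blast
  thus ?thesis using c phi_sym[OF c] by (simp add: algebra_simps)
qed

text \<open>A module that pairs integrally with a basis is contained in the lattice spanned by the
  dual basis, so \<open>glat_bounded\<close> applies.\<close>

lemma glat_integral:
  assumes N: "gsub N" and b: "isb b" "b \<in> {..<dim} \<rightarrow> N" and i: "\<And>x i. x \<in> N ==> i < dim ==> 2 * \<phi> x (b i) \<in> \<gg>"
  shows "glat N"
proof -
  obtain P :: "'f set" where P: "P \<in> finite_primes" using ex_prime by blast
  interpret L: nquad_loc ty P V \<phi> by (rule nquad_loc[OF P])
  obtain b' where b': "isb b'" "\<forall>i<dim. \<forall>j<dim. L.F.bil (b' j) (b i) = (if i = j then 1 else 0)"
    using L.F.ex_dual_basis[OF b(1)] by auto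
  have "N \<subseteq> lspan \<gg> V dim b'"
  proof
    fix x assume x: "x \<in> N"
    have "x = lc V dim (\<lambda>i. L.F.bil x (b i)) b'"
      by (rule L.F.dual_coords[OF b(1) b'(1)]) (use b'(2) rsubD(1)[OF N] x in auto)
    thus "x \<in> lspan \<gg> V dim b'" unfolding lspan_def L.bil_eq using i[OF x] by blast
  qed
  thus ?thesis by (rule glat_bounded[OF N b b'(1)])
qed

abbreviation gdual :: "'v set => 'v set"
  where "gdual \<equiv> dual_lattice class_ring \<gg> V \<phi>"

lemma gdual_eq: "gdual A = {x \<in> carrier V. \<forall>y\<in>A. 2 * \<phi> x y \<in> \<gg>}"
  by (simp add: dual_lattice_def)

lemma gsub_functional: "x \<in> carrier V ==> gsub {y \<in> carrier V. 2 * \<phi> x y \<in> \<gg>}"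
proof -
  assume x: "x \<in> carrier V"
  have "2 * (r * \<phi> x y) \<in> \<gg>" if "r \<in> \<gg>" "2 * \<phi> x y \<in> \<gg>" for r y
    using alg_ints_closed(2)[OF that] by (simp add: mult.left_commute)
  thus ?thesis using x by (auto simp: rsub_def sm distrib_left)
qed

text \<open>With nonzero multipliers this shows that the dual is a lattice; with multipliers outside
  \<open>P\<close> it shows that taking duals commutes with localization.\<close>

lemma dual_multiple:
  assumes A: "glat A" and X: "X \<subseteq> \<gg>" "1 \<in> X" "\<And>s t. s \<in> X ==> t \<in> X ==> s * t \<in> X"
    and x: "x \<in> carrier V" and ex: "\<And>y. y \<in> A ==> \<exists>d\<in>X. d * (2 * \<phi> x y) \<in> \<gg>"
  shows "\<exists>d\<in>X. d *\<^sub>V x \<in> gdual A"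
proof -
  obtain T where T: "finite T" "T \<subseteq> carrier V" "T \<subseteq> A" "A = rspan class_ring \<gg> V T" using glat_gens[OF A] by blast
  have "\<exists>d\<in>X. \<forall>t\<in>T. d * (2 * \<phi> x t) \<in> \<gg>"
    by (rule common_multiple[OF T(1) X]) (use ex T(3) X(1) in "auto simp: mult.assoc")
  then obtain d where d: "d \<in> X" "\<And>t. t \<in> T ==> d * (2 * \<phi> x t) \<in> \<gg>" by blast
  have dx: "d *\<^sub>V x \<in> carrier V" using x by (rule sm(1))
  have "A \<subseteq> {y \<in> carrier V. 2 * \<phi> (d *\<^sub>V x) y \<in> \<gg>}"
    unfolding T(4)
  proof (rule rspan_least[OF g_subring _ gsub_functional[OF dx]])
    show "T \<subseteq> {y \<in> carrier V. 2 * \<phi> (d *\<^sub>V x) y \<in> \<gg>}"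
    proof
      fix t assume t: "t \<in> T"
      hence "t \<in> carrier V" using T(2) by blast
      thus "t \<in> {y \<in> carrier V. 2 * \<phi> (d *\<^sub>V x) y \<in> \<gg>}"
        using d(2)[OF t] x by (simp add: mult.left_commute)
    qed
  qed
  thus ?thesis using d(1) dx by (auto simp: gdual_eq)
qed

lemma gsub_dual: assumes "A \<subseteq> carrier V" shows "gsub (gdual A)"
proof -
  have "2 * (r * \<phi> x y) \<in> \<gg>" if "r \<in> \<gg>" "2 * \<phi> x y \<in> \<gg>" for r x y
    using alg_ints_closed(2)[OF that] by (simp add: mult.left_commute)
  thus ?thesis using assms unfolding rsub_def gdual_eq by (auto simp: sm distrib_left subset_iff)
qed

lemma glat_dual: assumes A: "glat A" shows "glat (gdual A)"
proof -
  note AV = rsubD(1)[OF glat_gsub[OF A]]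
  obtain b where b: "isb b" "b \<in> {..<dim} \<rightarrow> A" using glat_tuple[OF A] by blast
  have ex: "\<exists>d\<in>\<gg> - {0}. d *\<^sub>V x \<in> gdual A" if "x \<in> carrier V" for x
    by (rule dual_multiple[OF A _ _ _ that]) (use ex_denom in auto)
  obtain d where d: "d \<in> \<gg> - {0}" "isb (\<lambda>i. d *\<^sub>V b i)" "(\<lambda>i. d *\<^sub>V b i) \<in> {..<dim} \<rightarrow> gdual A"
    using scaled_tuple[OF gsub_dual[OF AV] b(1) ex] by blast
  show ?thesis
  proof (rule glat_integral[OF gsub_dual[OF AV] d(2,3)])
    fix x i assume x: "x \<in> gdual A" "i < dim"
    have "d *\<^sub>V b i \<in> A" using rsubD(4)[OF glat_gsub[OF A], of d] d(1) b(2) x(2) by auto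
    thus "2 * \<phi> x (d *\<^sub>V b i) \<in> \<gg>" using x(1) by (simp add: gdual_eq)
  qed
qed

lemma maximal_iff:
  "gmax M \<longleftrightarrow> glat M \<and> (\<forall>x\<in>M. \<phi> x x \<in> \<gg>) \<and>
    (\<forall>L. glat L \<and> (\<forall>x\<in>L. \<phi> x x \<in> \<gg>) \<and> M \<subseteq> L --> L = M)"
  unfolding maximal_lattice_def VectorSpace.maximal_def by blast

end

context nquad_loc
begin

lemma loc_dual: assumes A: "glat A" shows "loc P V (gdual A) = F.dual (loc P V A)"
proof
  note AV = rsubD(1)[OF glat_gsub[OF A]]
  show "loc P V (gdual A) \<subseteq> F.dual (loc P V A)"
  proof
    fix x assume "x \<in> loc P V (gdual A)"
    then obtain s where x: "x \<in> carrier V" "s \<in> \<gg> - P" "s *\<^sub>V x \<in> gdual A" by (auto simp: loc_def)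
    have "F.bil x y \<in> F.pid 0" if "y \<in> loc P V A" for y
    proof -
      obtain t where y: "y \<in> carrier V" "t \<in> \<gg> - P" "t *\<^sub>V y \<in> A" using \<open>y \<in> loc P V A\<close> by (auto simp: loc_def)
      have "2 * \<phi> (s *\<^sub>V x) (t *\<^sub>V y) \<in> \<gg>" using x(3) y(3) by (simp add: gdual_eq)
      hence "(s * t) * (2 * \<phi> x y) \<in> \<gg>" using x(1) y(1) sm(1) by (simp add: algebra_simps)
      thus ?thesis unfolding Rloc_pid bil_eq using P_compl_mult[OF x(2) y(2)] by (rule RlocI[rotated])
    qed
    thus "x \<in> F.dual (loc P V A)" using x(1) by (simp add: F.dual_def)
  qed
  show "F.dual (loc P V A) \<subseteq> loc P V (gdual A)"
  proof
    fix x assume x: "x \<in> F.dual (loc P V A)"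
    hence xV: "x \<in> carrier V" by (simp add: F.dual_def)
    have "\<exists>d\<in>\<gg> - P. d *\<^sub>V x \<in> gdual A"
    proof (rule dual_multiple[OF A _ _ _ xV])
      fix y assume "y \<in> A"
      hence "F.bil x y \<in> F.pid 0" using x loc_ext[OF glat_gsub[OF A]] by (auto simp: F.dual_def)
      thus "\<exists>d\<in>\<gg> - P. d * (2 * \<phi> x y) \<in> \<gg>" unfolding Rloc_pid bil_eq by (auto simp: Rloc_def)
    qed (use P_compl_one P_compl_mult in auto)
    thus "x \<in> loc P V (gdual A)" using xV by (auto simp: loc_def)
  qed
qed

lemma loc_integral:
  assumes "\<And>x. x \<in> M ==> \<phi> x x \<in> \<gg>" and x: "x \<in> loc P V M"
  shows "\<phi> x x \<in> Rloc"
proof -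
  obtain s where s: "x \<in> carrier V" "s \<in> \<gg> - P" "s *\<^sub>V x \<in> M" using x by (auto simp: loc_def)
  have "(s * s) * \<phi> x x \<in> \<gg>" using assms(1)[OF s(3)] s(1) sm(1) by (simp add: algebra_simps)
  thus ?thesis by (rule RlocI[OF P_compl_mult[OF s(2,2)]])
qed

text \<open>An integral superlattice of the localization at \<open>P\<close> is glued with the localizations at the other primes.
  That an element \<open>y\<close> of it has a multiple \<open>e y\<close>, with \<open>e\<close> prime to \<open>P\<close>, in the glued lattice is seen by dividing
  \<open>P\<close> out of any nonzero multiplier.\<close>

theorem maximal_loc:
  assumes M: "gmax M"
  shows "maximal_lattice class_ring (F.pid 0) V \<phi> (loc P V M)"
proof -
  have gM: "glat M" and iM: "\<And>x. x \<in> M ==> \<phi> x x \<in> \<gg>"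
    and mx: "\<And>L. glat L ==> (\<forall>x\<in>L. \<phi> x x \<in> \<gg>) ==> M \<subseteq> L ==> L = M"
    using M by (auto simp: maximal_iff)
  note rM = glat_gsub[OF gM]
  have MV: "M \<subseteq> carrier V" using rsubD(1)[OF rM] .
  interpret S: nlat ty P "self_module (class_ring :: 'f ring)"
    by (intro nlat.intro nprime_axioms nspace_self)
  have "N = loc P V M" if N: "F.latt N" "F.integral_on N" "loc P V M \<subseteq> N" for N
  proof -
    note rN = F.latt_rsub[OF N(1)]
    have rl: "gsub (loc Q V M)" if "Q \<in> finite_primes" for Q
    proof -
      interpret Q: nlat ty Q V by (rule nlat[OF that])
      show ?thesis using rsub_mono[OF Q.rsub_loc[OF rM] Q.alg_ints_pid] .
    qed
    \<comment> \<open>The glued lattice: it is to agree with \<open>N\<close> at \<open>P\<close>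
      and with \<open>M\<close> at the other primes.\<close>
    define M' where "M' = {x \<in> N. \<forall>Q\<in>finite_primes. Q \<noteq> P --> x \<in> loc Q V M}"
    have M'N: "M' \<subseteq> N" by (auto simp: M'_def)
    have gM': "gsub M'"
      unfolding rsub_def M'_def using rsubD[OF rsub_mono[OF rN alg_ints_pid]] rsubD[OF rl] by auto
    have MM': "M \<subseteq> M'"
    proof
      fix x assume x: "x \<in> M"
      have "x \<in> loc Q V M" if "Q \<in> finite_primes" for Q
      proof -
        interpret Q: nlat ty Q V by (rule nlat[OF that])
        show ?thesis using x Q.loc_ext[OF rM] by blast
      qed
      thus "x \<in> M'" using N(3) P by (auto simp: M'_def)
    qed
    have iM': "\<phi> x x \<in> \<gg>" if x: "x \<in> M'" for x
    proof (rule S.local_global)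
      fix Q :: "'f set" assume Q: "Q \<in> finite_primes"
      interpret Q: nquad_loc ty Q V \<phi> by (rule nquad_loc[OF Q])
      have "\<phi> x x \<in> Q.Rloc"
      proof (cases "Q = P")
        case True
        thus ?thesis using x N(2) M'N Rloc_pid by (auto simp: F.integral_on_def)
      next
        case False
        thus ?thesis using Q.loc_integral[OF iM] x Q by (auto simp: M'_def)
      qed
      thus "\<phi> x x \<in> loc Q gself \<gg>" by (auto simp: Q.Rloc_def loc_def)
    qed (auto simp: rsub_def)
    obtain b where b: "isb b" "b \<in> {..<dim} \<rightarrow> M" using glat_tuple[OF gM] by blast
    have "glat M'"
    proof (rule glat_integral[OF gM' b(1)])
      show "b \<in> {..<dim} \<rightarrow> M'" using b(2) MM' by auto
      fix x i assume "x \<in> M'" "i < dim"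
      thus "2 * \<phi> x (b i) \<in> \<gg>" using integral_bil[OF gM' iM'] b(2) MM' by auto
    qed
    hence M'M: "M' = M" using mx iM' MM' by blast
    have "y \<in> loc P V M" if y: "y \<in> N" for y
    proof -
      have yV: "y \<in> carrier V" using y rsubD(1)[OF rN] by blast
      \<comment> \<open>Multipliers that take \<open>y\<close> into \<open>M\<close> at every prime
        other than \<open>P\<close>. One of least order at \<open>P\<close> is shown to lie outside
        \<open>P\<close>.\<close>
      define J where "J e \<longleftrightarrow> e \<in> \<gg> \<and> e \<noteq> 0 \<and> (\<forall>Q\<in>finite_primes. Q \<noteq> P --> e *\<^sub>V y \<in> loc Q V M)" for e
      obtain e0 where "e0 \<in> \<gg> - {0}" "e0 *\<^sub>V y \<in> M" using ex_multiple[OF rM b yV] by blast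
      hence "J e0" using MM' by (auto simp: J_def M'_def)
      from ex_has_least_nat[of J, OF this, of "\<lambda>e. nat (pval e)"]
      obtain e where e: "J e" "\<And>f. J f ==> nat (pval e) \<le> nat (pval f)" by blast
      have eg: "e \<in> \<gg>" "e \<noteq> 0" using e(1) by (auto simp: J_def)
      have "e \<notin> P"
      proof
        assume eP: "e \<in> P"
        hence pe: "pval e \<ge> 1" using pval_in_P eg by simp
        obtain z where z: "\<And>x. x \<in> P ==> z * x \<in> \<gg>" "z * unif \<in> \<gg> - P" using unif(2) by blast
        have z0: "z \<noteq> 0" using P_compl_nz[OF z(2)] by auto
        have pz: "pval z = - 1" using pval_unit[OF z(2)] pval_mult[OF z0 unif_nz] pval_unif by simp
        \<comment> \<open>At \<open>Q\<close> take \<open>x\<close> in \<open>P\<close> outside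
          \<open>Q\<close>. Then \<open>z x\<close> is integral and \<open>x\<close> is a unit at
          \<open>Q\<close>, so that multiplication by \<open>z\<close> does not leave the
          localization.\<close>
        have "(z * e) *\<^sub>V y \<in> loc Q V M" if Q: "Q \<in> finite_primes" "Q \<noteq> P" for Q
        proof -
          interpret Q: nlat ty Q V by (rule nlat[OF Q(1)])
          obtain x where x: "x \<in> P" "x \<notin> Q" using primes_maximal[OF P Q(1)] Q(2) by blast
          have xc: "x \<in> \<gg> - Q" using x P_ideal(1) by blast
          have "(z * x) *\<^sub>V (e *\<^sub>V y) \<in> loc Q V M"
            using rsubD(4)[OF rl[OF Q(1)] z(1)[OF x(1)]] e(1) Q by (simp add: J_def)
          from rsubD(4)[OF Q.rsub_loc[OF rM] Q.unit_Rloc[OF xc] this]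
          show ?thesis using Q.P_compl_nz[OF xc] yV
            by (simp add: sm(1) sm(3)[symmetric] mult.commute)
        qed
        hence "J (z * e)" using z(1)[OF eP] z0 eg(2) by (simp add: J_def)
        from e(2)[OF this] show False using pval_mult[OF z0 eg(2)] pz pe by simp
      qed
      hence es: "e \<in> \<gg> - P" using eg by simp
      have "e *\<^sub>V y \<in> N" using rsubD(4)[OF rN] eg(1) alg_ints_pid y by blast
      hence "e *\<^sub>V y \<in> M'" using e(1) by (simp add: M'_def J_def)
      thus ?thesis using locI[OF yV es] M'M by simp
    qed
    thus ?thesis using N(3) by blast
  qed
  moreover have "F.integral_on (loc P V M)" using loc_integral[OF iM] by (simp add: F.integral_on_def Rloc_pid)
  ultimately show ?thesis unfolding F.maximal_lattice_iff using latt_loc[OF gM] by blast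
qed

lemma ordv_discr: "glat A ==> ordv P (gdisc A) = F.disc (loc P V A)"
  using ordv_index[OF glat_dual] loc_dual by (simp add: discr_ideal_def F.disc_def)

end

subsection \<open>The ideal \<open>\<bb>(q)\<close>\<close>

locale nquad_vec = nquad ty V \<phi> for ty :: "'f::field_char_0 itself" and V :: "('f, 'v) module" and \<phi> +
  fixes h :: 'v
  assumes hV: "h \<in> carrier V" and hq: "\<phi> h h \<noteq> 0"
begin

abbreviation W :: "('f, 'v) module" where "W \<equiv> orth_space class_ring V \<phi> h"

lemma dvquad_vec: "P \<in> finite_primes ==> dvquad_vec class_ring V (nprime.pval P) \<phi> h"
proof -
  assume P: "P \<in> finite_primes"
  interpret L: nquad_loc ty P V \<phi> by (rule nquad_loc[OF P])
  show ?thesis by unfold_locales (use hV hq in auto)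
qed

lemma nquad_W: "nquad W \<phi>"
proof -
  obtain P :: "'f set" where P: "P \<in> finite_primes" using ex_prime by blast
  interpret H: dvquad_vec class_ring V "nprime.pval P" \<phi> h by (rule dvquad_vec[OF P])
  show ?thesis by unfold_locales (use H.W.fin_dim H.quadratic_space_W in auto)
qed

sublocale W: nquad ty W \<phi>
  by (rule nquad_W)

lemma carrier_W: "x \<in> carrier W \<longleftrightarrow> x \<in> carrier V \<and> \<phi> x h = 0"
  by (simp add: orth_space_def)

lemma loc_W: assumes "x \<in> carrier W" shows "x \<in> loc P W (L \<inter> carrier W) \<longleftrightarrow> x \<in> loc P V L"
proof -
  have "s *\<^sub>V x \<in> carrier W" for s using assms hV by (simp add: carrier_W sm(1))
  thus ?thesis using assms by (auto simp: loc_def carrier_W) (auto simp: orth_space_def)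
qed

lemma loc_section: "loc P W (L \<inter> carrier W) = loc P V L \<inter> carrier W"
proof -
  have "loc P W (L \<inter> carrier W) \<subseteq> carrier W" by (auto simp: loc_def)
  thus ?thesis using loc_W by blast
qed

context
  fixes L M
  assumes L: "gmax L" and M: "W.gmax M"
begin

lemma gL: "glat L" and iL: "x \<in> L ==> \<phi> x x \<in> \<gg>" and gM: "W.glat M"
  using L M by (auto simp: maximal_iff W.maximal_iff)

lemma rL: "gsub L" and LV: "x \<in> L ==> x \<in> carrier V"
  using glat_gsub[OF gL] rsubD(1)[OF glat_gsub[OF gL]] by auto

lemma section_glat: "W.glat (L \<inter> carrier W)"
proof -
  have sm: "0\<^sub>V \<in> carrier W" "x \<in> carrier W ==> y \<in> carrier W ==> x +\<^sub>V y \<in> carrier W"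
    "x \<in> carrier W ==> a *\<^sub>V x \<in> carrier W" for x y a
    using hV by (auto simp: carrier_W sm(1))
  have r: "W.gsub (L \<inter> carrier W)"
    using rsubD[OF rL] sm by (auto simp: rsub_def orth_space_def)
  obtain b0 where b0: "isb b0" "b0 \<in> {..<dim} \<rightarrow> L" using glat_tuple[OF gL] by blast
  have ex: "\<exists>d\<in>\<gg> - {0}. d \<odot>\<^bsub>W\<^esub> x \<in> L \<inter> carrier W" if x: "x \<in> carrier W" for x
    using ex_multiple[OF rL b0, of x] x sm(3)[OF x] by (auto simp: carrier_W) (auto simp: orth_space_def)
  obtain b where "W.isb b" using W.ex_isb by blast
  then obtain d where d: "W.isb (\<lambda>i. d \<odot>\<^bsub>W\<^esub> b i)" "(\<lambda>i. d \<odot>\<^bsub>W\<^esub> b i) \<in> {..<W.dim} \<rightarrow> L \<inter> carrier W"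
    using W.scaled_tuple[OF r _ ex] by blast
  show ?thesis
  proof (rule W.glat_integral[OF r d])
    fix x i assume "x \<in> L \<inter> carrier W" "i < W.dim"
    moreover have "d \<odot>\<^bsub>W\<^esub> b i \<in> L" if "i < W.dim" using d(2) that by blast
    ultimately show "2 * \<phi> x (d \<odot>\<^bsub>W\<^esub> b i) \<in> \<gg>" using integral_bil[OF rL iL] by blast
  qed
qed

abbreviation sindex :: "'f set"
  where "sindex \<equiv> W.gindex M (L \<inter> carrier W)"

lemma section_FI: "sindex \<in> FI"
  by (rule W.index_FI[OF gM section_glat])

abbreviation hvals :: "'f set"
  where "hvals \<equiv> (\<lambda>x. 2 * \<phi> h x) ` L"

lemma hvals_FI: "hvals \<in> FI"
proof -
  obtain b0 where b0: "isb b0" "b0 \<in> {..<dim} \<rightarrow> L" using glat_tuple[OF gL] by blast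
  obtain d where d: "d \<in> \<gg> - {0}" "d *\<^sub>V h \<in> L" using ex_multiple[OF rL b0 hV] by blast
  have "d * (2 * \<phi> h x) \<in> \<gg>" if "x \<in> L" for x
    using integral_bil[OF rL iL d(2) that] LV[OF that] hV by (simp add: mult.left_commute)
  moreover have "2 * \<phi> h (d *\<^sub>V h) \<in> hvals" using d(2) by blast
  moreover have "2 * \<phi> h (d *\<^sub>V h) \<noteq> 0" using d(1) hq hV by simp
  moreover have "rsub \<gg> gself hvals"
    unfolding rsub_def
  proof (intro conjI ballI)
    show "\<zero>\<^bsub>gself\<^esub> \<in> hvals" using rsubD(2)[OF rL] hV by (force simp: image_iff)
    fix u assume "u \<in> hvals"
    then obtain x where x: "x \<in> L" "u = 2 * \<phi> h x" by blast
    { fix v assume "v \<in> hvals"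
      then obtain y where y: "y \<in> L" "v = 2 * \<phi> h y" by blast
      have "u \<oplus>\<^bsub>gself\<^esub> v = 2 * \<phi> h (x +\<^sub>V y)" using x y LV hV by (simp add: distrib_left)
      thus "u \<oplus>\<^bsub>gself\<^esub> v \<in> hvals" using rsubD(3)[OF rL x(1) y(1)] by (rule image_eqI) }
    { fix r :: 'f assume "r \<in> \<gg>"
      hence "r *\<^sub>V x \<in> L" using rsubD(4)[OF rL _ x(1)] by blast
      moreover have "r \<odot>\<^bsub>gself\<^esub> u = 2 * \<phi> h (r *\<^sub>V x)" using x LV hV by simp
      ultimately show "r \<odot>\<^bsub>gself\<^esub> u \<in> hvals" by (rule rev_image_eqI) }
  qed simp
  ultimately show ?thesis unfolding FI_iff using d(1) by blast
qed

text \<open>The local results apply at \<open>P\<close> because \<open>maximal_loc\<close> keeps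
  both lattices maximal and \<open>loc_section\<close> identifies the localized section with the
  section of the localization.\<close>

lemma ordv_formula:
  assumes P: "P \<in> finite_primes"
  shows "(\<lambda>x. 2 * \<phi> h x) ` loc P V L = dvf.pid class_ring (nprime.pval P) (ordv P hvals)"
    and "ordv P sindex = dvspace.vol class_ring W (nprime.pval P) (loc P V L \<inter> carrier W)
      - dvspace.vol class_ring W (nprime.pval P) (loc P W M)"
    and "nprime.pval P (2 * \<phi> h h) + ordv P (gdisc L) =
      2 * (ordv P hvals + ordv P sindex) + ordv P (W.gdisc M)"
    and "0 \<le> ordv P sindex"
proof -
  interpret Q: nquad_loc ty P V \<phi> by (rule nquad_loc[OF P])
  interpret WQ: nquad_loc ty P W \<phi> by (rule W.nquad_loc[OF P])
  interpret H: dvquad_vec class_ring V Q.pval \<phi> h by (rule dvquad_vec[OF P])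
  let ?L = "loc P V L"
  have lL: "Q.F.latt ?L" by (rule Q.latt_loc[OF gL])
  have mM: "maximal_lattice class_ring (Q.F.pid 0) W \<phi> (loc P W M)" by (rule WQ.maximal_loc[OF M])
  obtain m where m: "{Q.F.bil h x | x. x \<in> ?L} = Q.F.pid m"
    "Q.pval (Q.F.bil h h) + Q.F.disc ?L = 2 * (m + WQ.F.vol (?L \<inter> carrier W) - WQ.F.vol (loc P W M)) + WQ.F.disc (loc P W M)"
    using H.order_formula[OF lL mM] by blast
  have im: "(\<lambda>x. 2 * \<phi> h x) ` ?L = Q.F.pid m" using m(1) by (auto simp: Q.F.bil_def)
  have "u \<in> loc P gself hvals \<longleftrightarrow> u \<in> (\<lambda>x. 2 * \<phi> h x) ` ?L" for u
  proof
    assume "u \<in> loc P gself hvals"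
    then obtain s x where s: "s \<in> \<gg> - P" "s * u = 2 * \<phi> h x" "x \<in> L" by (auto simp: loc_def)
    note s0 = Q.P_compl_nz[OF s(1)] and xV = LV[OF s(3)]
    have "(1 / s) *\<^sub>V x \<in> ?L"
      using s s0 xV by (intro Q.locI[of _ s]) (auto simp: sm(1,2) sm(3)[symmetric])
    moreover have "u = 2 * \<phi> h ((1 / s) *\<^sub>V x)" using s(2) s0 xV hV by (simp add: field_simps)
    ultimately show "u \<in> (\<lambda>x. 2 * \<phi> h x) ` ?L" by (rule rev_image_eqI)
  next
    assume "u \<in> (\<lambda>x. 2 * \<phi> h x) ` ?L"
    then obtain s x where s: "x \<in> carrier V" "s \<in> \<gg> - P" "s *\<^sub>V x \<in> L" "u = 2 * \<phi> h x" by (auto simp: loc_def)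
    have "s * u = 2 * \<phi> h (s *\<^sub>V x)" using s hV by simp
    hence "s * u \<in> hvals" using s(3) by (rule image_eqI)
    thus "u \<in> loc P gself hvals" using s(2) by (auto simp: loc_def)
  qed
  hence "loc P gself hvals = (\<lambda>x. 2 * \<phi> h x) ` ?L" by blast
  hence o: "ordv P hvals = m" using Q.ordv_eqI im by simp
  thus "(\<lambda>x. 2 * \<phi> h x) ` ?L = Q.F.pid (ordv P hvals)" using im by simp
  show oi: "ordv P sindex = dvspace.vol class_ring W Q.pval (?L \<inter> carrier W) - dvspace.vol class_ring W Q.pval (loc P W M)"
    using WQ.ordv_index[OF gM section_glat] by (simp add: loc_section)
  show "Q.pval (2 * \<phi> h h) + ordv P (gdisc L) =
      2 * (ordv P hvals + ordv P sindex) + ordv P (W.gdisc M)"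
    using m(2) o oi Q.ordv_discr[OF gL] WQ.ordv_discr[OF gM] by (simp add: Q.bil_eq)
  have "Q.F.integral_on ?L" using Q.maximal_loc[OF L] by (simp add: Q.F.maximal_lattice_iff)
  thus "0 \<le> ordv P sindex" using H.vol_section_ge[OF lL _ mM] oi by simp
qed

end

lemma discr_FI: "gmax L ==> gdisc L \<in> FI"
  unfolding discr_ideal_def by (auto simp: maximal_iff intro!: index_FI glat_dual)

text \<open>The description of \<open>ideal_b\<close> ranges over all vectors of this length and all
  maximal lattices. Its relation is checked at each prime, where the two discriminants do not depend
  on the choices; uniqueness holds since an integer is determined by its double.\<close>

theorem ideal_b_eq:
  assumes L: "gmax L" and M: "W.gmax M"
  shows "ideal_b class_ring \<gg> V \<phi> (\<phi> h h) = hvals L \<cdot> sindex L M"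
  unfolding ideal_b_def
proof (rule the_equality)
  let ?b = "hvals L \<cdot> sindex L M"
  have v: "hvals L \<in> FI" by (rule hvals_FI[OF L M])
  have s: "sindex L M \<in> FI" by (rule section_FI[OF L M])
  have b: "?b \<in> FI" using FI_mult v s by blast
  have dW: "W.gdisc M \<in> FI"
    unfolding discr_ideal_def using M by (auto simp: W.maximal_iff intro!: W.index_FI W.glat_dual)
  have coset: "c <#\<^bsub>class_ring\<^esub> A = (\<lambda>x. c * x) ` A" for c :: 'f and A by (auto simp: l_coset_def)
  have rel: "(\<phi> h h \<oplus>\<^bsub>class_ring\<^esub> \<phi> h h) <#\<^bsub>class_ring\<^esub> gdisc L' =
      ?b \<cdot> ?b \<cdot> discr_ideal class_ring \<gg> (orth_space class_ring V \<phi> h') \<phi> M'"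
    if h': "h' \<in> carrier V" "\<phi> h' h' = \<phi> h h" "gmax L'"
      "maximal_lattice class_ring \<gg> (orth_space class_ring V \<phi> h') \<phi> M'" for h' L' M'
  proof -
    interpret N: nquad_vec ty V \<phi> h' by unfold_locales (use h' hq in auto)
    have dW': "N.W.gdisc M' \<in> FI"
      unfolding discr_ideal_def using h'(4) by (auto simp: N.W.maximal_iff intro!: N.W.index_FI N.W.glat_dual)
    have q2: "2 * \<phi> h h \<noteq> 0" using hq by simp
    note dV = discr_FI[OF h'(3)]
    have "(\<lambda>x. 2 * \<phi> h h * x) ` gdisc L' =
      ?b \<cdot> ?b \<cdot> N.W.gdisc M'"
    proof (rule FI_eqI)
      fix P :: "'f set" assume P: "P \<in> finite_primes"
      interpret Q: nquad_loc ty P V \<phi> by (rule nquad_loc[OF P])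
      interpret WQ: nquad_loc ty P W \<phi> by (rule W.nquad_loc[OF P])
      interpret WN: nquad_loc ty P N.W \<phi> by (rule N.W.nquad_loc[OF P])
      have "ordv P (gdisc L') = ordv P (gdisc L)"
        using Q.ordv_discr Q.F.disc_maximal_unique(2)[OF Q.maximal_loc[OF L] Q.maximal_loc[OF h'(3)]] L h'(3)
        by (simp add: maximal_iff)
      moreover have "ordv P (N.W.gdisc M') = ordv P (W.gdisc M)"
        using WQ.ordv_discr[OF gM[OF L M]] WN.ordv_discr[OF N.gM[OF h'(3,4)]]
          Q.F.disc_orth_unique[OF hV _ h'(1,2) WQ.maximal_loc[OF M] WN.maximal_loc[OF h'(4)]] hq by simp
      ultimately show "ordv P ((\<lambda>x. 2 * \<phi> h h * x) ` gdisc L') =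
        ordv P (?b \<cdot> ?b \<cdot> N.W.gdisc M')"
        using ordv_formula(3)[OF L M P] Q.ordv_scale[OF dV q2] Q.ordv_mult FI_mult[OF b b] b v s dW' by simp
    qed (use FI_scale[OF dV q2] FI_mult b dW' in auto)
    thus ?thesis unfolding coset by simp
  qed
  show "?b \<in> FI \<and> (\<forall>h' L' M'. h' \<in> carrier V \<and> \<phi> h' h' = \<phi> h h \<and> gmax L' \<and>
      maximal_lattice class_ring \<gg> (orth_space class_ring V \<phi> h') \<phi> M' -->
      (\<phi> h h \<oplus>\<^bsub>class_ring\<^esub> \<phi> h h) <#\<^bsub>class_ring\<^esub> gdisc L' =
      ?b \<cdot> ?b \<cdot> discr_ideal class_ring \<gg> (orth_space class_ring V \<phi> h') \<phi> M')"
    using b rel by blast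
  fix c assume "c \<in> FI \<and> (\<forall>h' L' M'. h' \<in> carrier V \<and> \<phi> h' h' = \<phi> h h \<and> gmax L' \<and>
      maximal_lattice class_ring \<gg> (orth_space class_ring V \<phi> h') \<phi> M' -->
      (\<phi> h h \<oplus>\<^bsub>class_ring\<^esub> \<phi> h h) <#\<^bsub>class_ring\<^esub> gdisc L' =
      c \<cdot> c \<cdot> discr_ideal class_ring \<gg> (orth_space class_ring V \<phi> h') \<phi> M')"
  hence c: "c \<in> FI" and "(\<phi> h h \<oplus>\<^bsub>class_ring\<^esub> \<phi> h h) <#\<^bsub>class_ring\<^esub> gdisc L =
      c \<cdot> c \<cdot> W.gdisc M"
    using hV L M by blast+
  hence e: "c \<cdot> c \<cdot> W.gdisc M =
      ?b \<cdot> ?b \<cdot> W.gdisc M"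
    using rel[OF hV refl L M] by (simp only:)
  show "c = ?b"
  proof (rule FI_eqI[OF c b])
    fix P :: "'f set" assume P: "P \<in> finite_primes"
    interpret nprime ty P by (rule nprime[OF P])
    show "ordv P c = ordv P ?b"
      using arg_cong[OF e, of "ordv P"] ordv_mult[OF FI_mult[OF c c] dW] ordv_mult[OF FI_mult[OF b b] dW]
        ordv_mult[OF c c] ordv_mult[OF b b] by simp
  qed
qed

context
  fixes L M
  assumes L: "gmax L" and M: "W.gmax M"
begin

abbreviation \<bb> :: "'f set"
  where "\<bb> \<equiv> ideal_b class_ring \<gg> V \<phi> (\<phi> h h)"

lemma b_FI: "\<bb> \<in> FI"
  using ideal_b_eq[OF L M] FI_mult hvals_FI[OF L M] section_FI[OF L M] by simp

lemma ordv_b: "P \<in> finite_primes ==> ordv P \<bb> = ordv P (hvals L) + ordv P (sindex L M)"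
  using ideal_b_eq[OF L M] nprime.ordv_mult[OF nprime] hvals_FI[OF L M] section_FI[OF L M] by simp

text \<open>Division by 2 scales both sides, so the identity reduces to the formula for \<bb>(q) at
  each prime.\<close>

lemma phi_mult_index: "\<phi> h ` L \<cdot> sindex L M = (\<lambda>x. x / 2) ` \<bb>"
proof -
  have half: "(\<lambda>x. x / 2) ` A = (\<lambda>x. 1 / 2 * x) ` A" for A :: "'f set" by (rule image_cong) auto
  have "\<phi> h ` L = (\<lambda>x. 1 / 2 * x) ` hvals L" by (auto simp: image_iff)
  moreover have "(\<lambda>x. 1 / 2 * x) ` hvals L \<cdot> sindex L M = (\<lambda>x. 1 / 2 * x) ` \<bb>"
  proof (rule FI_eqI)
    show "(\<lambda>x. 1 / 2 * x) ` hvals L \<cdot> sindex L M \<in> FI"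
      by (rule FI_mult[OF FI_scale[OF hvals_FI[OF L M]] section_FI[OF L M]]) simp
    show "(\<lambda>x. 1 / 2 * x) ` \<bb> \<in> FI" by (rule FI_scale[OF b_FI]) simp
    fix P :: "'f set" assume P: "P \<in> finite_primes"
    interpret nprime ty P by (rule nprime[OF P])
    have "(1 / 2 :: 'f) \<noteq> 0" by simp
    thus "ordv P ((\<lambda>x. 1 / 2 * x) ` hvals L \<cdot> sindex L M) = ordv P ((\<lambda>x. 1 / 2 * x) ` \<bb>)"
      using ordv_mult[OF FI_scale[OF hvals_FI[OF L M]] section_FI[OF L M], of "1 / 2"]
        ordv_scale[OF hvals_FI[OF L M], of "1 / 2"] ordv_scale[OF b_FI, of "1 / 2"] ordv_b[OF P] by simp
  qed
  ultimately show ?thesis unfolding half by simp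
qed

lemma b_sub: "\<bb> \<subseteq> hvals L"
  by (rule FI_le[OF b_FI hvals_FI[OF L M]]) (use ordv_b ordv_formula(4)[OF L M] in auto)

text \<open>The vector \<open>c h\<close> has the complement \<open>W\<close> again, hence admits
  the same \<open>M\<close> with the same index; only the ideal of values is multiplied by
  \<open>c\<close>.\<close>

lemma scale:
  assumes c: "c \<in> \<gg>" "c \<noteq> 0"
  shows "ideal_b class_ring \<gg> V \<phi> (c\<^sup>2 * \<phi> h h) = (\<lambda>x. c * x) ` \<bb>"
    and "orth_space class_ring V \<phi> (c *\<^sub>V h) = W"
proof -
  have cq: "\<phi> (c *\<^sub>V h) (c *\<^sub>V h) = c\<^sup>2 * \<phi> h h" using hV sm(1) by (simp add: power2_eq_square)
  interpret C: nquad_vec ty V \<phi> "c *\<^sub>V h" by unfold_locales (use cq hV hq c sm(1) in auto)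
  have "{x \<in> carrier V. \<phi> x (c *\<^sub>V h) = 0} = {x \<in> carrier V. \<phi> x h = 0}" using hV c(2) by auto
  thus W: "C.W = W" by (simp add: orth_space_def)
  have "C.hvals L = (\<lambda>x. c * x) ` hvals L"
    using LV[OF L M] hV by (force simp: image_iff)
  hence "ideal_b class_ring \<gg> V \<phi> (c\<^sup>2 * \<phi> h h) = (\<lambda>x. c * x) ` hvals L \<cdot> sindex L M"
    using C.ideal_b_eq[OF L] M W cq by simp
  also have "\<dots> = (\<lambda>x. c * x) ` \<bb>"
  proof (rule FI_eqI)
    show "(\<lambda>x. c * x) ` hvals L \<cdot> sindex L M \<in> FI"
      by (rule FI_mult[OF FI_scale[OF hvals_FI[OF L M] c(2)] section_FI[OF L M]])
    show "(\<lambda>x. c * x) ` \<bb> \<in> FI" by (rule FI_scale[OF b_FI c(2)])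
    fix P :: "'f set" assume P: "P \<in> finite_primes"
    interpret nprime ty P by (rule nprime[OF P])
    show "ordv P ((\<lambda>x. c * x) ` hvals L \<cdot> sindex L M) = ordv P ((\<lambda>x. c * x) ` \<bb>)"
      using ordv_mult[OF FI_scale[OF hvals_FI[OF L M] c(2)] section_FI[OF L M]]
        ordv_scale[OF hvals_FI[OF L M] c(2)] ordv_scale[OF b_FI c(2)] ordv_b[OF P] by simp
  qed
  finally show "ideal_b class_ring \<gg> V \<phi> (c\<^sup>2 * \<phi> h h) = (\<lambda>x. c * x) ` \<bb>" .
qed

end

end

section \<open>Completions\<close>

context nprime
begin

abbreviation C where "C \<equiv> completion P"
abbreviation tc where "tc \<equiv> to_completion P"
abbreviation CS where "CS \<equiv> cauchy_seqs P"
abbreviation NS where "NS \<equiv> null_seqs P"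
abbreviation CR where "CR \<equiv> cauchy_ring P"
abbreviation add_C (infixl "\<oplus>\<^sub>C" 65) where "x \<oplus>\<^sub>C y \<equiv> x \<oplus>\<^bsub>C\<^esub> y"
abbreviation mult_C (infixl "\<otimes>\<^sub>C" 70) where "x \<otimes>\<^sub>C y \<equiv> x \<otimes>\<^bsub>C\<^esub> y"
abbreviation zero_C ("\<zero>\<^sub>C") where "\<zero>\<^sub>C \<equiv> \<zero>\<^bsub>C\<^esub>"
abbreviation one_C ("\<one>\<^sub>C") where "\<one>\<^sub>C \<equiv> \<one>\<^bsub>C\<^esub>"

section \<open>Cauchy sequences and null sequences at a prime\<close>

lemma pid_plus: "x \<in> F.pid k ==> y \<in> F.pid k ==> x + y \<in> F.pid k"
  and pid_minus: "x \<in> F.pid k ==> y \<in> F.pid k ==> x - y \<in> F.pid k"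
  and pid_times: "x \<in> F.pid k ==> y \<in> F.pid l ==> x * y \<in> F.pid (k + l)"
  and pid_0: "0 \<in> F.pid k" and pid_anti: "x \<in> F.pid k ==> l \<le> k ==> x \<in> F.pid l"
proof -
  show p: "x \<in> F.pid k ==> y \<in> F.pid k ==> x + y \<in> F.pid k" for x y using F.pid_add[of x k y] by simp
  have u: "y \<in> F.pid k ==> - y \<in> F.pid k" for y using F.pid_uminus[of y k] by (simp add: class_ring_simps)
  show "x \<in> F.pid k ==> y \<in> F.pid k ==> x - y \<in> F.pid k" using p[of x "- y"] u by simp
  show "x \<in> F.pid k ==> y \<in> F.pid l ==> x * y \<in> F.pid (k + l)" using F.pid_mult[of x k y l] by simp
qed (auto simp: pid_iff)

text \<open>The equality case of the ultrametric inequality: a perturbation of larger order does not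
  change the order.\<close>

lemma pid_ultra:
  assumes "x \<noteq> 0" "x - y \<in> F.pid k" "pval x < k"
  shows "y \<noteq> 0 \<and> pval y = pval x"
proof -
  have y: "y = x - (x - y)" by simp
  have "y \<in> F.pid (pval x)" by (subst y, rule pid_minus) (use assms pid_anti in "auto simp: pid_iff")
  moreover have "y \<notin> F.pid (pval x + 1)"
  proof
    assume "y \<in> F.pid (pval x + 1)"
    hence "y + (x - y) \<in> F.pid (pval x + 1)" by (rule pid_plus) (use assms pid_anti in auto)
    thus False using assms(1) by (simp add: pid_iff)
  qed
  ultimately show ?thesis by (auto simp: pid_iff)
qed

text \<open>Connects the topology of the definitions, given by powers of the ideal \<open>P\<close>,
  with the valuation.\<close>

lemma ord_ge_eq: "ord_ge P k = F.pid (int k)"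
proof -
  have "P [^]\<^bsub>global_frac_ideals\<^esub> k \<in> FI"
    using Group.monoid.nat_pow_closed[OF Group.comm_monoid.axioms(1)[OF comm_monoid_FI] P_FI] .
  hence "loc P gself (P [^]\<^bsub>global_frac_ideals\<^esub> k) = F.pid (int k)"
    using loc_FI ordv_pow[OF P P_FI] ordv_self by simp
  moreover have "ord_ge P k = loc P gself (P [^]\<^bsub>global_frac_ideals\<^esub> k)"
    by (auto simp: ord_ge_def loc_def)
  ultimately show ?thesis by simp
qed

lemma cauchy_iff: "s \<in> CS \<longleftrightarrow> (\<forall>k. \<exists>n. \<forall>i\<ge>n. \<forall>j\<ge>n. s i - s j \<in> F.pid k)"
proof
  assume s: "s \<in> CS"
  show "\<forall>k. \<exists>n. \<forall>i\<ge>n. \<forall>j\<ge>n. s i - s j \<in> F.pid k"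
  proof
    fix k
    have "k \<le> int (nat k)" by simp
    thus "\<exists>n. \<forall>i\<ge>n. \<forall>j\<ge>n. s i - s j \<in> F.pid k"
      using s pid_anti unfolding cauchy_seqs_def ord_ge_eq by blast
  qed
qed (simp add: cauchy_seqs_def ord_ge_eq)

lemma null_iff: "s \<in> NS \<longleftrightarrow> (\<forall>k. \<exists>n. \<forall>i\<ge>n. s i \<in> F.pid k)"
proof
  assume s: "s \<in> NS"
  show "\<forall>k. \<exists>n. \<forall>i\<ge>n. s i \<in> F.pid k"
  proof
    fix k
    have "k \<le> int (nat k)" by simp
    thus "\<exists>n. \<forall>i\<ge>n. s i \<in> F.pid k"
      using s pid_anti unfolding null_seqs_def ord_ge_eq by blast
  qed
qed (simp add: null_seqs_def ord_ge_eq)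

lemma null_add: assumes "s \<in> NS" "t \<in> NS" shows "(\<lambda>i. s i + t i) \<in> NS"
  unfolding null_iff
proof
  fix k
  obtain m n where "\<forall>i\<ge>m. s i \<in> F.pid k" "\<forall>i\<ge>n. t i \<in> F.pid k" using assms unfolding null_iff by blast
  thus "\<exists>n. \<forall>i\<ge>n. s i + t i \<in> F.pid k" by (intro exI[of _ "max m n"]) (auto intro: pid_plus)
qed

lemma null_uminus: assumes "s \<in> NS" shows "(\<lambda>i. - s i) \<in> NS"
proof -
  have "- x \<in> F.pid k" if "x \<in> F.pid k" for x k using pid_minus[OF pid_0 that] by simp
  thus ?thesis using assms unfolding null_iff by blast
qed

lemma null_diff: "s \<in> NS ==> t \<in> NS ==> (\<lambda>i. s i - t i) \<in> NS"
  using null_add[OF _ null_uminus] by fastforce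

lemma null_zero: "(\<lambda>_. 0) \<in> NS"
  by (simp add: null_iff pid_0)

lemma null_cauchy: assumes "s \<in> NS" shows "s \<in> CS"
  unfolding cauchy_iff
proof
  fix k
  obtain n where "\<forall>i\<ge>n. s i \<in> F.pid k" using assms unfolding null_iff by blast
  thus "\<exists>n. \<forall>i\<ge>n. \<forall>j\<ge>n. s i - s j \<in> F.pid k" using pid_minus by blast
qed

lemma cauchy_const: "(\<lambda>_. x) \<in> CS"
  by (simp add: cauchy_iff pid_0)

lemma cauchy_add: assumes "s \<in> CS" "t \<in> CS" shows "(\<lambda>i. s i + t i) \<in> CS"
  unfolding cauchy_iff
proof
  fix k
  obtain m n where "\<forall>i\<ge>m. \<forall>j\<ge>m. s i - s j \<in> F.pid k" "\<forall>i\<ge>n. \<forall>j\<ge>n. t i - t j \<in> F.pid k"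
    using assms unfolding cauchy_iff by blast
  hence "(s i - s j) + (t i - t j) \<in> F.pid k" if "i \<ge> max m n" "j \<ge> max m n" for i j
    by (intro pid_plus) (use that in auto)
  moreover have "(s i - s j) + (t i - t j) = (s i + t i) - (s j + t j)" for i j by simp
  ultimately show "\<exists>n. \<forall>i\<ge>n. \<forall>j\<ge>n. (s i + t i) - (s j + t j) \<in> F.pid k" by metis
qed

lemma cauchy_bounded: assumes "s \<in> CS" shows "\<exists>b n. \<forall>i\<ge>n. s i \<in> F.pid b"
proof -
  obtain n where n: "\<forall>i\<ge>n. \<forall>j\<ge>n. s i - s j \<in> F.pid 0" using assms unfolding cauchy_iff by blast
  let ?b = "min 0 (pval (s n))"
  have "s i \<in> F.pid ?b" if "i \<ge> n" for i
  proof -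
    have "s i - s n \<in> F.pid ?b" using n that pid_anti[of "s i - s n" 0 ?b] by simp
    moreover have "s n \<in> F.pid ?b" by (simp add: pid_iff)
    ultimately have "(s i - s n) + s n \<in> F.pid ?b" by (rule pid_plus)
    thus ?thesis by simp
  qed
  thus ?thesis by blast
qed

lemma null_mult:
  assumes "s \<in> CS" "t \<in> NS" shows "(\<lambda>i. s i * t i) \<in> NS"
  unfolding null_iff
proof
  fix k
  obtain b m where m: "\<forall>i\<ge>m. s i \<in> F.pid b" using cauchy_bounded[OF assms(1)] by blast
  obtain n where n: "\<forall>i\<ge>n. t i \<in> F.pid (k - b)" using assms(2) unfolding null_iff by blast
  have "s i * t i \<in> F.pid k" if "i \<ge> max m n" for i
    using pid_times[of "s i" b "t i" "k - b"] m n that by simp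
  thus "\<exists>n. \<forall>i\<ge>n. s i * t i \<in> F.pid k" by blast
qed

lemma cauchy_mult: assumes s: "s \<in> CS" and t: "t \<in> CS" shows "(\<lambda>i. s i * t i) \<in> CS"
  unfolding cauchy_iff
proof
  fix k
  obtain b m where m: "\<forall>i\<ge>m. s i \<in> F.pid b" using cauchy_bounded[OF s] by blast
  obtain c n where n: "\<forall>i\<ge>n. t i \<in> F.pid c" using cauchy_bounded[OF t] by blast
  obtain m' where m': "\<forall>i\<ge>m'. \<forall>j\<ge>m'. s i - s j \<in> F.pid (k - c)" using s unfolding cauchy_iff by blast
  obtain n' where n': "\<forall>i\<ge>n'. \<forall>j\<ge>n'. t i - t j \<in> F.pid (k - b)" using t unfolding cauchy_iff by blast
  have "s i * t i - s j * t j \<in> F.pid k" if ij: "i \<ge> max (max m n) (max m' n')" "j \<ge> max (max m n) (max m' n')" for i j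
  proof -
    have "s i * (t i - t j) + (s i - s j) * t j \<in> F.pid k"
      by (rule pid_plus)
        (use pid_times[of "s i" b "t i - t j" "k - b"] pid_times[of "s i - s j" "k - c" "t j" c] m n m' n' ij in auto)
    thus ?thesis by (simp add: algebra_simps)
  qed
  thus "\<exists>n. \<forall>i\<ge>n. \<forall>j\<ge>n. s i * t i - s j * t j \<in> F.pid k" by blast
qed

lemma cauchy_uminus: "s \<in> CS ==> (\<lambda>i. - s i) \<in> CS"
  using cauchy_mult[OF cauchy_const[of "-1"], of s] by simp

text \<open>Terms with arbitrarily large indices have order below some \<open>k\<close>, and
  eventually all differences have order at least \<open>k\<close>; \<open>pid_ultra\<close> then
  fixes the order.\<close>

lemma cauchy_eventual:
  assumes s: "s \<in> CS" "s \<notin> NS"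
  shows "\<exists>v n. \<forall>i\<ge>n. s i \<noteq> 0 \<and> pval (s i) = v"
proof -
  obtain k where k: "\<And>n. \<exists>i\<ge>n. s i \<notin> F.pid k" using s(2) unfolding null_iff by blast
  obtain n where n: "\<forall>i\<ge>n. \<forall>j\<ge>n. s i - s j \<in> F.pid k" using s(1) unfolding cauchy_iff by blast
  obtain m where m: "m \<ge> n" "s m \<notin> F.pid k" using k by blast
  hence "s m \<noteq> 0" "pval (s m) < k" by (auto simp: pid_iff)
  hence "s i \<noteq> 0 \<and> pval (s i) = pval (s m)" if "i \<ge> n" for i using pid_ultra[of "s m" "s i" k] n m(1) that by blast
  thus ?thesis by blast
qed

lemma cauchy_inverse:
  assumes s: "s \<in> CS" "s \<notin> NS"
  shows "\<exists>t\<in>CS. (\<lambda>i. s i * t i - 1) \<in> NS"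
proof -
  obtain v n where n: "\<And>i. i \<ge> n ==> s i \<noteq> 0 \<and> pval (s i) = v" using cauchy_eventual[OF s] by blast
  have inv: "1 / s i \<in> F.pid (- v)" if i: "i \<ge> n" for i
    using pval_mult[of "s i" "1 / s i"] n[OF i] F.val_one by (auto simp: pid_iff)
  have "(\<lambda>i. 1 / s i) \<in> CS"
    unfolding cauchy_iff
  proof
    fix k
    \<comment> \<open>The extra precision \<open>2 * v\<close> makes up for the two divisions by
      terms of order \<open>v\<close>.\<close>
    obtain m where m: "\<forall>i\<ge>m. \<forall>j\<ge>m. s i - s j \<in> F.pid (k + 2 * v)" using s(1) unfolding cauchy_iff by blast
    have "1 / s i - 1 / s j \<in> F.pid k" if ij: "i \<ge> max m n" "j \<ge> max m n" for i j
    proof -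
      have "(s j - s i) * (1 / s i * (1 / s j)) \<in> F.pid ((k + 2 * v) + (- v + - v))"
        by (intro pid_times inv) (use m ij in auto)
      moreover have "(s j - s i) * (1 / s i * (1 / s j)) = 1 / s i - 1 / s j" using n ij by (simp add: field_simps)
      ultimately show ?thesis by simp
    qed
    thus "\<exists>n. \<forall>i\<ge>n. \<forall>j\<ge>n. 1 / s i - 1 / s j \<in> F.pid k" by blast
  qed
  moreover have "(\<lambda>i. s i * (1 / s i) - 1) \<in> NS"
    unfolding null_iff using n pid_0 by auto
  ultimately show ?thesis
    by (intro bexI[of "\<lambda>t. (\<lambda>i. s i * t i - 1) \<in> NS" "\<lambda>i. 1 / s i"])
qed

lemma cring_cauchy: "cring (CR)"
proof (rule cringI)
  show "abelian_group (CR)"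
  proof (rule abelian_groupI)
    fix s assume "s \<in> carrier (CR)"
    thus "\<exists>t\<in>carrier (CR). t \<oplus>\<^bsub>CR\<^esub> s = \<zero>\<^bsub>CR\<^esub>"
      using cauchy_uminus by (intro bexI[of _ "\<lambda>i. - s i"]) (auto simp: cauchy_ring_def)
  qed (use cauchy_add cauchy_const[of 0] in "auto simp: cauchy_ring_def algebra_simps")
  show "Group.comm_monoid (CR)"
    by (rule comm_monoidI) (use cauchy_mult cauchy_const[of 1] in "auto simp: cauchy_ring_def algebra_simps")
qed (auto simp: cauchy_ring_def algebra_simps)

interpretation CR: cring "CR"
  by (rule cring_cauchy)

lemma ideal_null: "ideal (NS) (CR)"
proof (rule idealI[OF CR.ring_axioms])
  show "subgroup (NS) (add_monoid (CR))"
  proof (rule subgroup.intro)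
    fix s assume s: "s \<in> NS"
    have "inv\<^bsub>add_monoid (CR)\<^esub> s = (\<lambda>i. - s i)"
      using CR.minus_equality[of "\<lambda>i. - s i" s] null_cauchy[OF s] cauchy_uminus
      by (simp add: a_inv_def cauchy_ring_def)
    thus "inv\<^bsub>add_monoid (CR)\<^esub> s \<in> NS" using null_uminus[OF s] by simp
  qed (use null_cauchy null_add null_zero in "auto simp: cauchy_ring_def")
next
  fix a x assume "a \<in> NS" "x \<in> carrier (CR)"
  thus "x \<otimes>\<^bsub>CR\<^esub> a \<in> NS" "a \<otimes>\<^bsub>CR\<^esub> x \<in> NS"
    using null_mult[of x a] by (auto simp: cauchy_ring_def mult.commute)
qed

interpretation NS: ideal "NS" "CR"
  by (rule ideal_null)

abbreviation cls :: "(nat => 'f) => (nat => 'f) set"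
  where "cls s \<equiv> NS +>\<^bsub>CR\<^esub> s"

lemma cls_eq_set: "cls s = {t. (\<lambda>i. t i - s i) \<in> NS}"
proof -
  have "cls s = {\<lambda>i. u i + s i | u. u \<in> NS}" by (auto simp: a_r_coset_def' cauchy_ring_def)
  moreover have "\<exists>u. t = (\<lambda>i. u i + s i) \<and> u \<in> NS" if "(\<lambda>i. t i - s i) \<in> NS" for t
    using that by (intro exI[of _ "\<lambda>i. t i - s i"]) auto
  ultimately show ?thesis by auto
qed

lemma cls_eq: "cls s = cls t \<longleftrightarrow> (\<lambda>i. s i - t i) \<in> NS"
proof
  assume "cls s = cls t"
  moreover have "s \<in> cls s" using null_zero by (simp add: cls_eq_set)
  ultimately show "(\<lambda>i. s i - t i) \<in> NS" by (simp add: cls_eq_set)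
next
  assume n: "(\<lambda>i. s i - t i) \<in> NS"
  have "u \<in> cls s \<longleftrightarrow> u \<in> cls t" for u
    using null_add[of "\<lambda>i. u i - s i", OF _ n] null_diff[of "\<lambda>i. u i - t i", OF _ n] by (auto simp: cls_eq_set)
  thus "cls s = cls t" by blast
qed

lemma cls_simps:
  "carrier (C) = cls ` CS"
  "s \<in> CS ==> t \<in> CS ==> cls s \<oplus>\<^sub>C cls t = cls (\<lambda>i. s i + t i)"
  "s \<in> CS ==> t \<in> CS ==> cls s \<otimes>\<^sub>C cls t = cls (\<lambda>i. s i * t i)"
  "\<zero>\<^sub>C = cls (\<lambda>_. 0)" "\<one>\<^sub>C = cls (\<lambda>_. 1)"
proof -
  note hom = NS.rcos_ring_hom
  have c: "carrier (CR) = CS" by (simp add: cauchy_ring_def)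
  show "carrier (C) = cls ` CS"
    by (auto simp: completion_def FactRing_def A_RCOSETS_def' c)
  show "s \<in> CS ==> t \<in> CS ==> cls s \<oplus>\<^sub>C cls t = cls (\<lambda>i. s i + t i)"
    using ring_hom_add[OF hom, of s t] by (simp add: c completion_def) (simp add: cauchy_ring_def)
  show "s \<in> CS ==> t \<in> CS ==> cls s \<otimes>\<^sub>C cls t = cls (\<lambda>i. s i * t i)"
    using ring_hom_mult[OF hom, of s t] by (simp add: c completion_def) (simp add: cauchy_ring_def)
  show "\<zero>\<^sub>C = cls (\<lambda>_. 0)" by (simp add: completion_def FactRing_def cls_eq_set)
  show "\<one>\<^sub>C = cls (\<lambda>_. 1)"
    using ring_hom_one[OF hom] by (simp add: completion_def) (simp add: cauchy_ring_def)
qed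

lemma cls_zero: "cls s = \<zero>\<^sub>C \<longleftrightarrow> s \<in> NS"
  unfolding cls_simps cls_eq by simp

section \<open>The completion as a discretely valued field\<close>

lemma field_completion: "field (C)"
proof -
  interpret Q: cring "C" unfolding completion_def by (rule NS.quotient_is_cring[OF cring_cauchy])
  show ?thesis
  proof (rule Q.cring_fieldI)
    have "\<zero>\<^sub>C \<noteq> \<one>\<^sub>C"
    proof
      assume "\<zero>\<^sub>C = \<one>\<^sub>C"
      hence "(\<lambda>_. 0 - 1) \<in> NS" unfolding cls_simps cls_eq .
      hence "(0 - 1 :: 'f) \<in> F.pid 1" unfolding null_iff by blast
      hence "0 - (0 - 1) \<in> F.pid 1" by (rule pid_minus[OF pid_0])
      thus False using F.val_one by (simp add: pid_iff)
    qed
    moreover have "x \<in> Units (C)" if x: "x \<in> carrier (C)" "x \<noteq> \<zero>\<^sub>C" for x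
    proof -
      obtain s where s: "s \<in> CS" "x = cls s" using x(1) by (auto simp: cls_simps(1))
      obtain t where t: "t \<in> CS" "(\<lambda>i. s i * t i - 1) \<in> NS"
        using cauchy_inverse[OF s(1)] x(2) s(2) cls_zero by blast
      have "x \<otimes>\<^sub>C cls t = \<one>\<^sub>C" using s t by (simp add: cls_simps cls_eq)
      moreover have "cls t \<in> carrier (C)" using t(1) by (simp add: cls_simps)
      ultimately show ?thesis using x(1) Q.m_comm[OF x(1)] unfolding Units_def by auto
    qed
    moreover have "x \<noteq> \<zero>\<^sub>C" if "x \<in> Units (C)" for x
      using that calculation(1) Q.Units_closed[OF that] unfolding Units_def by auto
    ultimately show "Units (C) = carrier (C) - {\<zero>\<^sub>C}"
      using Q.Units_closed by blast
  qed
qed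

interpretation C: field "C"
  by (rule field_completion)

text \<open>The order that the terms of a representing sequence have from some index on; for nonzero
  classes it exists by \<open>cauchy_eventual\<close>.\<close>

definition cval :: "(nat => 'f) set => int"
  where "cval c = (THE v. \<exists>s\<in>CS. c = cls s \<and> (\<exists>n. \<forall>i\<ge>n. s i \<noteq> 0 \<and> pval (s i) = v))"

lemma cval_eqI:
  assumes s: "s \<in> CS" "\<forall>i\<ge>n. s i \<noteq> 0 \<and> pval (s i) = v"
  shows "cval (cls s) = v"
  unfolding cval_def
proof (rule the_equality)
  show "\<exists>t\<in>CS. cls s = cls t \<and> (\<exists>n. \<forall>i\<ge>n. t i \<noteq> 0 \<and> pval (t i) = v)" using s by blast
  fix w assume "\<exists>t\<in>CS. cls s = cls t \<and> (\<exists>n. \<forall>i\<ge>n. t i \<noteq> 0 \<and> pval (t i) = w)"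
  then obtain t m where t: "(\<lambda>i. s i - t i) \<in> NS" "\<forall>i\<ge>m. t i \<noteq> 0 \<and> pval (t i) = w" unfolding cls_eq by blast
  obtain l where l: "\<forall>i\<ge>l. s i - t i \<in> F.pid (v + 1)" using t(1) unfolding null_iff by blast
  let ?i = "max l (max m n)"
  have "pval (t ?i) = pval (s ?i)" using pid_ultra[of "s ?i" "t ?i" "v + 1"] l s(2) by simp
  thus "w = v" using t(2) s(2) by simp
qed

lemma cval_ex:
  assumes "s \<in> CS" "cls s \<noteq> \<zero>\<^sub>C"
  shows "\<exists>n. \<forall>i\<ge>n. s i \<noteq> 0 \<and> pval (s i) = cval (cls s)"
proof -
  obtain v n where vn: "\<forall>i\<ge>n. s i \<noteq> 0 \<and> pval (s i) = v" using cauchy_eventual[OF assms(1)] assms(2) cls_zero by blast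
  thus ?thesis using cval_eqI[OF assms(1)] by blast
qed

lemma tc_cls: "tc x = cls (\<lambda>_. x)"
  by (simp add: to_completion_def)

lemma tc_zero: "tc x = \<zero>\<^sub>C \<longleftrightarrow> x = 0"
proof
  assume "tc x = \<zero>\<^sub>C"
  hence "x \<in> F.pid (pval x + 1)" unfolding tc_cls cls_zero null_iff by blast
  thus "x = 0" by (auto simp: pid_iff)
qed (simp add: tc_cls cls_simps(4))

lemma tc_hom:
  "tc x \<in> carrier (C)"
  "tc (x + y) = tc x \<oplus>\<^sub>C tc y"
  "tc (x * y) = tc x \<otimes>\<^sub>C tc y"
  "tc 1 = \<one>\<^sub>C" "tc 0 = \<zero>\<^sub>C"
  using cauchy_const by (auto simp: tc_cls cls_simps)

lemma tc_val: "x \<noteq> 0 ==> cval (tc x) = pval x"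
  unfolding tc_cls by (rule cval_eqI[OF cauchy_const]) auto

lemma dvf_completion: "dvf (C) cval"
proof (intro dvf.intro dvf_axioms.intro field_completion)
  fix x y assume x: "x \<in> carrier (C)" and y: "y \<in> carrier (C)"
    and nz: "x \<noteq> \<zero>\<^sub>C" "y \<noteq> \<zero>\<^sub>C"
  obtain s t where st: "s \<in> CS" "x = cls s" "t \<in> CS" "y = cls t"
    using x y by (auto simp: cls_simps(1))
  obtain m n where m: "\<forall>i\<ge>m. s i \<noteq> 0 \<and> pval (s i) = cval x" and n: "\<forall>i\<ge>n. t i \<noteq> 0 \<and> pval (t i) = cval y"
    using cval_ex[OF st(1)] cval_ex[OF st(3)] nz st by blast
  show "cval (x \<otimes>\<^sub>C y) = cval x + cval y"
    unfolding st(2,4) cls_simps(3)[OF st(1,3)]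
    by (rule cval_eqI[OF cauchy_mult[OF st(1,3)], of "max m n"]) (use m n st pval_mult in auto)
  assume "x \<oplus>\<^sub>C y \<noteq> \<zero>\<^sub>C"
  then obtain l where l: "\<forall>i\<ge>l. s i + t i \<noteq> 0 \<and> pval (s i + t i) = cval (x \<oplus>\<^sub>C y)"
    using cval_ex[OF cauchy_add[OF st(1,3)]] st cls_simps(2)[OF st(1,3)] by auto
  let ?i = "max l (max m n)"
  show "min (cval x) (cval y) \<le> cval (x \<oplus>\<^sub>C y)"
    using pval_add[of "s ?i" "t ?i"] l m n by simp
next
  show "\<exists>x\<in>carrier (C). x \<noteq> \<zero>\<^sub>C \<and> cval x = 1"
    using tc_hom(1)[of unif] tc_zero[of unif] unif_nz tc_val[OF unif_nz] pval_unif by auto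
  have "\<one>\<^sub>C \<oplus>\<^sub>C \<one>\<^sub>C = tc 2"
    using tc_hom(2)[of 1 1] tc_hom(4) by simp
  thus "\<one>\<^sub>C \<oplus>\<^sub>C \<one>\<^sub>C \<noteq> \<zero>\<^sub>C" using tc_zero[of 2] by simp
qed

sublocale C: dvf "C" cval
  by (rule dvf_completion)

lemma tc_pid: "tc x \<in> C.pid k \<longleftrightarrow> x \<in> F.pid k"
  by (cases "x = 0") (use tc_hom(1) tc_zero[of x] tc_val[of x] in "auto simp: C.pid_def F.pid_def")

lemma cls_pid:
  assumes s: "s \<in> CS"
  shows "cls s \<in> C.pid k \<longleftrightarrow> (\<exists>n. \<forall>i\<ge>n. s i \<in> F.pid k)"
proof (cases "cls s = \<zero>\<^sub>C")
  case True
  thus ?thesis using cls_zero[of s] null_iff[of s] C.pid_zero by metis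
next
  case False
  obtain n where n: "\<forall>i\<ge>n. s i \<noteq> 0 \<and> pval (s i) = cval (cls s)" using cval_ex[OF s False] by blast
  have "cls s \<in> C.pid k \<longleftrightarrow> k \<le> cval (cls s)" using False s by (simp add: C.pid_def cls_simps(1))
  also have "\<dots> \<longleftrightarrow> (\<exists>n. \<forall>i\<ge>n. s i \<in> F.pid k)"
  proof
    show "k \<le> cval (cls s) ==> \<exists>n. \<forall>i\<ge>n. s i \<in> F.pid k" using n by (intro exI[of _ n]) (auto simp: pid_iff)
    assume "\<exists>n. \<forall>i\<ge>n. s i \<in> F.pid k"
    then obtain m where "\<forall>i\<ge>m. s i \<in> F.pid k" by blast
    hence "s (max m n) \<in> F.pid k" by simp
    thus "k \<le> cval (cls s)" using n by (simp add: pid_iff)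
  qed
  finally show ?thesis .
qed

lemma completion_dense:
  assumes "c \<in> carrier (C)"
  shows "\<exists>x. c \<ominus>\<^bsub>C\<^esub> tc x \<in> C.pid k"
proof -
  obtain s where s: "s \<in> CS" "c = cls s" using assms by (auto simp: cls_simps(1))
  obtain n where n: "\<forall>i\<ge>n. \<forall>j\<ge>n. s i - s j \<in> F.pid k" using s(1) unfolding cauchy_iff by blast
  have d: "(\<lambda>i. s i + - s n) \<in> CS" by (rule cauchy_add[OF s(1) cauchy_const])
  have "tc (- s n) \<oplus>\<^sub>C tc (s n) = \<zero>\<^sub>C"
    using tc_hom(2)[of "- s n" "s n"] tc_hom(5) by simp
  hence "\<ominus>\<^bsub>C\<^esub> tc (s n) = tc (- s n)"
    by (rule C.minus_equality) (rule tc_hom(1))+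
  hence "c \<ominus>\<^bsub>C\<^esub> tc (s n) = cls (\<lambda>i. s i + - s n)"
    unfolding a_minus_def s(2) using cls_simps(2)[OF s(1) cauchy_const[of "- s n"]] by (simp add: tc_cls)
  moreover have "cls (\<lambda>i. s i + - s n) \<in> C.pid k" unfolding cls_pid[OF d] using n by auto
  ultimately show ?thesis by metis
qed

text \<open>The \<open>i\<close>-th term of a sequence is replaced by an element of \<open>A\<close>
  with precision \<open>i\<close>, which does not change the class.\<close>

lemma closure_eq:
  assumes A: "A \<subseteq> F.pid k" and ap: "\<And>x m. x \<in> F.pid k ==> \<exists>y\<in>A. x - y \<in> F.pid (int m)" and z: "0 \<in> A"
  shows "closure_in_completion P A = C.pid k"
proof
  show "closure_in_completion P A \<subseteq> C.pid k"
  proof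
    fix c assume "c \<in> closure_in_completion P A"
    then obtain s where s: "s \<in> CS" "c = cls s" "range s \<subseteq> A" unfolding closure_in_completion_def by blast
    have "\<forall>i\<ge>0. s i \<in> F.pid k" using s(3) A by blast
    thus "c \<in> C.pid k" using cls_pid[OF s(1)] s(2) by blast
  qed
  show "C.pid k \<subseteq> closure_in_completion P A"
  proof
    fix c assume c: "c \<in> C.pid k"
    then obtain s where s: "s \<in> CS" "c = cls s" using C.pid_carrier by (auto simp: cls_simps(1))
    obtain n where n: "\<forall>i\<ge>n. s i \<in> F.pid k" using c cls_pid[OF s(1)] s(2) by blast
    \<comment> \<open>Before index \<open>n\<close> the terms may lie outside
      \<open>F.pid k\<close>; zero serves there as a default value in \<open>A\<close>.\<close>
    have "\<exists>y. y \<in> A \<and> (i \<ge> n --> s i - y \<in> F.pid (int i))" for i using ap[of "s i" i] n z by (cases "i \<ge> n") auto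
    then obtain t where t: "\<And>i. t i \<in> A \<and> (i \<ge> n --> s i - t i \<in> F.pid (int i))" by metis
    have nl: "(\<lambda>i. s i - t i) \<in> NS"
      unfolding null_iff
    proof
      fix k
      have "s i - t i \<in> F.pid k" if "i \<ge> max n (nat k)" for i
        using t[of i] that pid_anti[of "s i - t i" "int i" k] by (simp add: nat_le_iff)
      thus "\<exists>n. \<forall>i\<ge>n. s i - t i \<in> F.pid k" by blast
    qed
    have "(\<lambda>i. s i + - (s i - t i)) \<in> CS" by (rule cauchy_add[OF s(1) null_cauchy[OF null_uminus[OF nl]]])
    hence "t \<in> CS" by simp
    moreover have "c = cls t" using s(2) nl cls_eq by simp
    ultimately show "c \<in> closure_in_completion P A" unfolding closure_in_completion_def using t by blast
  qed
qed

lemma local_ints_eq: "local_ints P = C.pid 0"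
  by (rule closure_eq) (use alg_ints_Rloc Rloc_approx in "auto simp: Rloc_pid")

lemma local_prime_eq: "local_prime P = C.pid 1"
proof (rule closure_eq)
  have "x \<in> F.pid 1" if "x \<in> P" for x
    using pval_in_P[of x] P_ideal(1) that by (cases "x = 0") (auto simp: pid_iff)
  thus "P \<subseteq> F.pid 1" by blast
  fix x m assume x: "x \<in> F.pid 1"
  hence "x \<in> Rloc" unfolding Rloc_pid[symmetric] by (rule pid_anti) simp
  \<comment> \<open>Precision \<open>Suc m\<close> instead of \<open>m\<close>: it is at least 1
    even for \<open>m = 0\<close>, which keeps \<open>y\<close> in \<open>P\<close>.\<close>
  from Rloc_approx[OF this, of "Suc m"] obtain y where y: "y \<in> \<gg>" "x - y \<in> F.pid (int (Suc m))" by blast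
  have "x - (x - y) \<in> F.pid 1" by (rule pid_minus[OF x pid_anti[OF y(2)]]) simp
  hence "y \<in> P" using y(1) pval_in_P[of y] P_ideal(2) by (cases "y = 0") (auto simp: pid_iff)
  thus "\<exists>y\<in>P. x - y \<in> F.pid (int m)" using pid_anti[OF y(2), of "int m"] by auto
qed (rule P_ideal(2))

end

subsection \<open>Extension of scalars to a completion\<close>

text \<open>Abstract because the extension is needed a second time, for the complement of a vector.
  The target there is the complement of its image in the completed space, which is not itself given
  as a \<open>local_space\<close>.\<close>

locale base_change = dvquad K V val \<phi> + N: dvquad K' V' val' \<phi>'
  for K :: "'k ring" (structure) and V :: "('k, 'v) module" and val and \<phi>
    and K' :: "'l ring" and V' :: "('l, 'w) module" and val' and \<phi>' +
  fixes \<sigma> :: "'k => 'l" and \<iota> :: "'v => 'w"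
  assumes \<sigma>_hom: "\<sigma> \<in> ring_hom K K'"
    and \<sigma>_nz: "a \<in> carrier K ==> a \<noteq> \<zero> ==> \<sigma> a \<noteq> \<zero>\<^bsub>K'\<^esub>"
    and \<sigma>_val: "a \<in> carrier K ==> a \<noteq> \<zero> ==> val' (\<sigma> a) = val a"
    and \<iota>_closed: "u \<in> carrier V ==> \<iota> u \<in> carrier V'"
    and \<iota>_add: "u \<in> carrier V ==> w \<in> carrier V ==> \<iota> (u \<oplus>\<^bsub>V\<^esub> w) = \<iota> u \<oplus>\<^bsub>V'\<^esub> \<iota> w"
    and \<iota>_smult: "a \<in> carrier K ==> u \<in> carrier V ==> \<iota> (a \<odot>\<^bsub>V\<^esub> u) = \<sigma> a \<odot>\<^bsub>V'\<^esub> \<iota> u"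
    and \<iota>_phi: "u \<in> carrier V ==> w \<in> carrier V ==> \<phi>' (\<iota> u) (\<iota> w) = \<sigma> (\<phi> u w)"
    and \<iota>_basis: "\<exists>b. isb b \<and> btuple K' V' dim (\<iota> \<circ> b)"
    and dense: "c \<in> carrier K' ==> \<exists>x\<in>carrier K. c \<oplus>\<^bsub>K'\<^esub> \<sigma> x \<in> N.pid 0"
begin

interpretation H: ring_hom_cring K K' \<sigma>
  by (intro ring_hom_cring.intro ring_hom_cring_axioms.intro \<sigma>_hom R.is_cring N.R.is_cring)

lemma \<sigma>_pid: "x \<in> carrier K ==> \<sigma> x \<in> N.pid k \<longleftrightarrow> x \<in> pid k"
  using \<sigma>_nz[of x] \<sigma>_val[of x] H.hom_zero by (cases "x = \<zero>") (auto simp: pid_def N.pid_def)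

lemma dim_eq: "N.dim = dim"
  using \<iota>_basis N.btuple_basis(4) by blast

lemma \<sigma>_tuple: "a \<in> ktup n ==> \<sigma> \<circ> a \<in> {..<n} \<rightarrow> carrier K'"
  and \<iota>_tuple: "b \<in> vtup n ==> \<iota> \<circ> b \<in> {..<n} \<rightarrow> carrier V'"
  using \<iota>_closed by (auto simp: Pi_def)

lemma \<iota>_zero: "\<iota> 0\<^sub>V = \<zero>\<^bsub>V'\<^esub>"
  using \<iota>_smult[of \<zero> "0\<^sub>V"] \<iota>_closed[of "0\<^sub>V"] by simp

lemma \<iota>_lc:
  assumes "a \<in> ktup n" "b \<in> vtup n"
  shows "\<iota> (lc V n a b) = lc V' n (\<sigma> \<circ> a) (\<iota> \<circ> b)"
  using assms
proof (induction n)
  case 0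
  thus ?case using \<iota>_zero by (simp add: lc_def)
next
  case (Suc n)
  hence ab: "a \<in> ktup n" "b \<in> vtup n" "a n \<in> carrier K" "b n \<in> carrier V" by auto
  show ?case
    unfolding lc_Suc[OF Suc.prems] N.lc_Suc[OF \<sigma>_tuple[OF Suc.prems(1)] \<iota>_tuple[OF Suc.prems(2)]]
    using ab Suc.IH[OF ab(1,2)] by (simp add: \<iota>_add \<iota>_smult comp_def)
qed

lemma leibniz_hom:
  assumes "R.is_mat n A"
  shows "leibniz_det K' n (\<lambda>i j. \<sigma> (A i j)) = \<sigma> (leibniz_det K n A)"
proof -
  have p: "(\<Otimes>\<^bsub>K'\<^esub>i\<in>{..<n}. \<sigma> (A i (p i))) = \<sigma> (\<Otimes>i\<in>{..<n}. A i (p i))"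
    and c: "(\<Otimes>i\<in>{..<n}. A i (p i)) \<in> carrier K" if "p permutes {..<n}" for p
  proof -
    have m: "(\<lambda>i. A i (p i)) \<in> ktup n"
      using assms permutes_in_image[OF that] by (auto simp: R.is_mat_def)
    thus "(\<Otimes>i\<in>{..<n}. A i (p i)) \<in> carrier K" by (rule R.finprod_closed)
    show "(\<Otimes>\<^bsub>K'\<^esub>i\<in>{..<n}. \<sigma> (A i (p i))) = \<sigma> (\<Otimes>i\<in>{..<n}. A i (p i))"
      using H.hom_finprod[OF m] by (simp add: comp_def)
  qed
  have "leibniz_det K' n (\<lambda>i j. \<sigma> (A i j)) = (\<Oplus>\<^bsub>K'\<^esub>p\<in>{p. p permutes {..<n}}.
      \<sigma> (if evenperm p then (\<Otimes>i\<in>{..<n}. A i (p i)) else \<ominus> (\<Otimes>i\<in>{..<n}. A i (p i))))"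
    unfolding leibniz_det_def by (rule N.R.finsum_cong') (auto simp: p c)
  also have "\<dots> = \<sigma> (leibniz_det K n A)"
    unfolding leibniz_det_def by (subst H.hom_finsum) (auto simp: c comp_def)
  finally show ?thesis .
qed

text \<open>Determinants before and after extension differ by a factor that belongs to the reference
  tuples, so differences of volumes are preserved.\<close>

lemma \<iota>_tdet:
  assumes b: "isb b" "c \<in> vtup dim" and e: "btuple K' V' dim e"
  shows "tdet K' V' dim e (\<iota> \<circ> c) = \<sigma> (tdet K V dim b c) \<otimes>\<^bsub>K'\<^esub> tdet K' V' dim e (\<iota> \<circ> b)"
proof -
  let ?A = "\<lambda>i. tcoord K V dim b (c i)"
  have A: "R.is_mat dim ?A" by (rule is_mat_tcoord[OF b])
  have "tdet K' V' dim e (\<iota> \<circ> c) = leibniz_det K' dim (\<lambda>i j. \<sigma> (?A i j)) \<otimes>\<^bsub>K'\<^esub> tdet K' V' dim e (\<iota> \<circ> b)"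
  proof (rule N.tdet_lc[OF e \<iota>_tuple[OF btupleD(1)[OF b(1)]]])
    show "N.R.is_mat dim (\<lambda>i j. \<sigma> (?A i j))" using A by (auto simp: R.is_mat_def N.R.is_mat_def)
    fix i assume i: "i < dim"
    have ci: "c i \<in> carrier V" using b(2) i by auto
    have "\<iota> (c i) = lc V' dim (\<sigma> \<circ> ?A i) (\<iota> \<circ> b)"
      using \<iota>_lc[OF tcoord(1)[OF b(1) ci] btupleD(1)[OF b(1)]] tcoord(2)[OF b(1) ci] by simp
    thus "(\<iota> \<circ> c) i = lc V' dim (\<lambda>j. \<sigma> (?A i j)) (\<iota> \<circ> b)" by (simp add: comp_def)
  qed
  thus ?thesis using leibniz_hom[OF A] by (simp add: tdet_def)
qed

lemma \<iota>_btuple: assumes b: "isb b" shows "btuple K' V' dim (\<iota> \<circ> b)"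
proof -
  obtain e where e: "isb e" "btuple K' V' dim (\<iota> \<circ> e)" using \<iota>_basis by blast
  show ?thesis
  proof (rule N.tdet_btuple[OF e(2) \<iota>_tuple[OF btupleD(1)[OF b]]])
    have "tdet K V dim e b \<in> carrier K" "tdet K V dim e b \<noteq> \<zero>"
      using tdet_closed[OF e(1) btupleD(1)[OF b]] tdet_nonzero[OF e(1) b] by auto
    thus "tdet K' V' dim (\<iota> \<circ> e) (\<iota> \<circ> b) \<noteq> \<zero>\<^bsub>K'\<^esub>"
      unfolding \<iota>_tdet[OF e(1) btupleD(1)[OF b] e(2)] N.tdet_self[OF e(2)] using \<sigma>_nz by simp
  qed
qed

definition ext :: "'v set => 'w set"
  where "ext L = rspan K' (N.pid 0) V' (\<iota> ` L)"

lemma ext_lat: assumes b: "isb b" shows "ext (lat b) = N.lat (\<iota> \<circ> b)"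
proof
  have ib: "N.isb (\<iota> \<circ> b)" using \<iota>_btuple[OF b] dim_eq by simp
  have LV: "\<iota> ` lat b \<subseteq> carrier V'" using rsubD(1)[OF rsub_lat[OF b]] \<iota>_closed by auto
  have "\<iota> x \<in> N.lat (\<iota> \<circ> b)" if "x \<in> lat b" for x
  proof -
    obtain a where a: "a \<in> {..<dim} \<rightarrow> pid 0" "x = lc V dim a b" using \<open>x \<in> lat b\<close> by (auto simp: lspan_def)
    have aK: "a \<in> ktup dim" using a(1) pid_carrier[of 0] by auto
    have "\<iota> x = lc V' dim (\<sigma> \<circ> a) (\<iota> \<circ> b)" unfolding a(2) by (rule \<iota>_lc[OF aK isbD[OF b]])
    moreover have "\<sigma> \<circ> a \<in> {..<dim} \<rightarrow> N.pid 0" using a(1) aK \<sigma>_pid by (auto simp: Pi_def)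
    ultimately show ?thesis unfolding lspan_def dim_eq by blast
  qed
  thus "ext (lat b) \<subseteq> N.lat (\<iota> \<circ> b)"
    unfolding ext_def by (intro N.rspan_least[OF N.pid_subring _ N.rsub_lat[OF ib]]) auto
  note r = N.rsub_rspan[OF N.pid_subring LV]
  show "N.lat (\<iota> \<circ> b) \<subseteq> ext (lat b)"
    unfolding ext_def by (rule N.lspan_least[OF N.pid_subring r(1)]) (use lat_gen[OF b] r(2) dim_eq in auto)
qed

lemma latt_ext: "latt A ==> N.latt (ext A)"
  using ext_lat \<iota>_btuple dim_eq unfolding latt_def N.latt_def by metis

lemma \<iota>_ext: assumes "latt A" "x \<in> A" shows "\<iota> x \<in> ext A"
proof -
  have "\<iota> ` A \<subseteq> carrier V'" using rsubD(1)[OF latt_rsub[OF assms(1)]] \<iota>_closed by auto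
  thus ?thesis using N.rsub_rspan(2)[OF N.pid_subring] assms(2) unfolding ext_def by blast
qed

lemma vol_ext:
  assumes "latt A" "latt B"
  shows "N.vol (ext A) - N.vol (ext B) = vol A - vol B"
proof -
  obtain a b where ab: "isb a" "A = lat a" "isb b" "B = lat b" using assms by (auto simp: latt_def)
  have ia: "N.isb (\<iota> \<circ> a)" and ib: "N.isb (\<iota> \<circ> b)" using \<iota>_btuple ab dim_eq by auto
  have rf: "btuple K' V' dim N.ref" using N.ref dim_eq by simp
  let ?d = "tdet K V dim b a"
  have d: "?d \<in> carrier K" "?d \<noteq> \<zero>" using tdet_closed[OF ab(3) isbD[OF ab(1)]] tdet_nonzero[OF ab(3,1)] by auto
  have "N.Dt (\<iota> \<circ> a) = \<sigma> ?d \<otimes>\<^bsub>K'\<^esub> N.Dt (\<iota> \<circ> b)" using \<iota>_tdet[OF ab(3) isbD[OF ab(1)] rf] dim_eq by simp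
  hence 1: "val' (N.Dt (\<iota> \<circ> a)) = val ?d + val' (N.Dt (\<iota> \<circ> b))"
    using N.val_mult[of "\<sigma> ?d" "N.Dt (\<iota> \<circ> b)"] N.Dt_nz[OF ib] \<sigma>_nz[OF d] \<sigma>_val[OF d] d(1) by simp
  have "Dt a = ?d \<otimes> Dt b"
    unfolding tdet_def[of K V dim b a]
  proof (rule tdet_lc[OF ref isbD[OF ab(3)] is_mat_tcoord[OF ab(3) isbD[OF ab(1)]]])
    fix i assume "i < dim"
    hence "a i \<in> carrier V" using isbD[OF ab(1)] by auto
    thus "a i = lc V dim (tcoord K V dim b (a i)) b" by (rule tcoord(2)[OF ab(3), symmetric])
  qed
  hence "val (Dt a) = val ?d + val (Dt b)" using val_mult[OF d(1) _ d(2)] Dt_nz[OF ab(3)] by simp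
  thus ?thesis using 1 ext_lat ab vol_lat N.vol_lat[OF ia] N.vol_lat[OF ib] by simp
qed

text \<open>Each coordinate of \<open>y\<close> is approximated by an element of \<open>K\<close>
  with an integral error; the errors are the coordinates of \<open>z\<close>.\<close>

lemma approx:
  assumes b: "isb b" and y: "y \<in> carrier V'"
  shows "\<exists>x\<in>carrier V. \<exists>z\<in>N.lat (\<iota> \<circ> b). y = \<iota> x \<oplus>\<^bsub>V'\<^esub> z"
proof -
  have ib: "N.isb (\<iota> \<circ> b)" using \<iota>_btuple[OF b] dim_eq by simp
  note t = N.tcoord[OF ib y, unfolded dim_eq] and bV = isbD[OF b] and ibV = N.isbD[OF ib, unfolded dim_eq]
  let ?a = "tcoord K' V' dim (\<iota> \<circ> b) y"
  have "\<exists>x. x \<in> carrier K \<and> (i < dim --> ?a i \<oplus>\<^bsub>K'\<^esub> \<sigma> x \<in> N.pid 0)" for i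
    using dense[of "?a i"] t(3)[of i] R.zero_closed by (cases "i < dim") auto
  then obtain r where r: "\<And>i. r i \<in> carrier K \<and> (i < dim --> ?a i \<oplus>\<^bsub>K'\<^esub> \<sigma> (r i) \<in> N.pid 0)" by metis
  define s where "s i = ?a i \<oplus>\<^bsub>K'\<^esub> \<sigma> (r i)" for i
  have s: "s \<in> {..<dim} \<rightarrow> N.pid 0" using r by (auto simp: s_def)
  have sK: "s \<in> {..<dim} \<rightarrow> carrier K'" using s N.pid_carrier[of 0] by auto
  let ?x = "lc V dim (\<lambda>i. \<ominus> r i) b" and ?z = "lc V' dim s (\<iota> \<circ> b)"
  have rn: "(\<lambda>i. \<ominus> r i) \<in> ktup dim" using r by auto
  have "y = lc V' dim ?a (\<iota> \<circ> b)" using t(2) by simp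
  also have "\<dots> = lc V' dim (\<lambda>i. (\<sigma> \<circ> (\<lambda>i. \<ominus> r i)) i \<oplus>\<^bsub>K'\<^esub> s i) (\<iota> \<circ> b)"
  proof (rule N.lc_cong)
    fix i assume i: "i < dim"
    show "?a i = (\<sigma> \<circ> (\<lambda>i. \<ominus> r i)) i \<oplus>\<^bsub>K'\<^esub> s i"
      using t(3)[OF i] r H.hom_a_inv[of "r i"] by (simp add: s_def N.R.a_ac N.R.r_neg1 N.R.r_neg2 N.R.r_neg N.R.l_neg)
  qed (use ibV sK r in "auto simp: Pi_def")
  also have "\<dots> = \<iota> ?x \<oplus>\<^bsub>V'\<^esub> ?z"
    using N.lc_add[OF \<sigma>_tuple[OF rn] sK ibV] \<iota>_lc[OF rn bV] by simp
  finally have "y = \<iota> ?x \<oplus>\<^bsub>V'\<^esub> ?z" .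
  moreover have "?x \<in> carrier V" using lc_closed[OF rn bV] .
  moreover have "?z \<in> N.lat (\<iota> \<circ> b)" unfolding lspan_def dim_eq using s by blast
  ultimately show ?thesis by blast
qed

text \<open>In an integral lattice above the extension of \<open>M\<close>, every vector is a vector
  \<open>u\<close> of \<open>V\<close> plus an element of that extension. Adjoining \<open>u\<close>
  to \<open>M\<close> gives an integral lattice of \<open>V\<close>, so \<open>u\<close> already
  lies in \<open>M\<close>.\<close>

theorem maximal_ext:
  assumes M: "maximal_lattice K (pid 0) V \<phi> M"
  shows "maximal_lattice K' (N.pid 0) V' \<phi>' (ext M)"
proof -
  have lM: "latt M" and iM: "integral_on M" and mx: "\<And>L. latt L ==> integral_on L ==> M \<subseteq> L ==> L = M"
    using M by (auto simp: maximal_lattice_iff)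
  obtain b where b: "isb b" "M = lat b" using lM by (rule lattE)
  have ib: "N.isb (\<iota> \<circ> b)" using \<iota>_btuple[OF b(1)] dim_eq by simp
  let ?M = "N.lat (\<iota> \<circ> b)"
  have e: "ext M = ?M" unfolding b(2) by (rule ext_lat[OF b(1)])
  have lM': "N.latt ?M" using ib by (auto simp: N.latt_def)
  note rM = N.latt_rsub[OF lM'] and bV = isbD[OF b(1)]
  have MV: "?M \<subseteq> carrier V'" by (rule rsubD(1)[OF rM])
  have "b i \<in> M" "b i \<in> carrier V" if "i < dim" for i using lat_gen[OF b(1) that] b(2) bV that by auto
  moreover from this have "bil (b i) (b j) \<in> pid 0" if "i < dim" "j < dim" for i j
    using integral_bil[OF latt_rsub[OF lM] iM] that by blast
  ultimately have "N.integral_on ?M"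
    using iM \<iota>_phi \<sigma>_pid dim_eq N.isbD[OF ib] H.hom_add
    by (intro N.integral_lspan) (auto simp: integral_on_def N.bil_def bil_def simp flip: H.hom_add)
  moreover have "N' = ?M" if N': "N.latt N'" "N.integral_on N'" "?M \<subseteq> N'" for N'
  proof
    note rN = N.latt_rsub[OF N'(1)]
    show "N' \<subseteq> ?M"
    proof
      fix y assume y: "y \<in> N'"
      hence yV: "y \<in> carrier V'" using rsubD(1)[OF rN] by blast
      obtain u z where uz: "u \<in> carrier V" "z \<in> ?M" and y2: "y = \<iota> u \<oplus>\<^bsub>V'\<^esub> z" using approx[OF b(1) yV] by blast
      have zV: "z \<in> carrier V'" and iu: "\<iota> u \<in> carrier V'" using uz MV \<iota>_closed by auto
      have "\<ominus>\<^bsub>K'\<^esub> \<one>\<^bsub>K'\<^esub> \<in> N.pid 0" using N.pid_uminus[OF N.pid_one] .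
      hence "y \<oplus>\<^bsub>V'\<^esub> (\<ominus>\<^bsub>K'\<^esub> \<one>\<^bsub>K'\<^esub>) \<odot>\<^bsub>V'\<^esub> z \<in> N'" using rsubD(3,4)[OF rN] y N'(3) uz(2) by blast
      moreover have "y \<oplus>\<^bsub>V'\<^esub> (\<ominus>\<^bsub>K'\<^esub> \<one>\<^bsub>K'\<^esub>) \<odot>\<^bsub>V'\<^esub> z = \<iota> u"
        unfolding y2 using iu zV by (simp add: N.smult_l_minus N.M.a_assoc N.M.r_neg)
      ultimately have iuN: "\<iota> u \<in> N'" by simp
      define S where "S = insert u (b ` {..<dim})"
      have S: "finite S" "S \<subseteq> carrier V" unfolding S_def using uz(1) bV by auto
      define L where "L = rspan K (pid 0) V S"
      note rL = rsub_rspan[OF pid_subring S(2), folded L_def]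
      have bL: "b ` {..<dim} \<subseteq> L" using rL(2) by (auto simp: S_def)
      have "is_lattice K (pid 0) V L"
        unfolding is_lattice_def using S btuple_basis(2)[OF b(1)] L_def bL by blast
      hence lL: "latt L" by (simp add: is_lattice_iff_latt)
      have MsL: "M \<subseteq> L" unfolding b(2) by (rule lspan_least[OF pid_subring rL(1)]) (use bL in auto)
      have "rsub (pid 0) V {v \<in> carrier V. \<iota> v \<in> N'}"
        unfolding rsub_def using rsubD[OF rN] \<iota>_zero \<iota>_add \<iota>_smult \<sigma>_pid pid_carrier[of 0]
        by (auto simp: subset_iff)
      moreover have "S \<subseteq> {v \<in> carrier V. \<iota> v \<in> N'}"
      proof -
        have "\<iota> (b i) \<in> N'" if "i < dim" for i using N.lat_gen[OF ib, of i] that dim_eq N'(3) by auto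
        thus ?thesis using S(2) iuN by (auto simp: S_def)
      qed
      ultimately have LN: "L \<subseteq> {v \<in> carrier V. \<iota> v \<in> N'}" unfolding L_def by (intro rspan_least[OF pid_subring])
      have "integral_on L"
        unfolding integral_on_def
      proof
        fix v assume "v \<in> L"
        hence v: "v \<in> carrier V" "\<iota> v \<in> N'" using LN by auto
        hence "\<sigma> (\<phi> v v) \<in> N.pid 0" using N'(2) \<iota>_phi by (auto simp: N.integral_on_def)
        thus "\<phi> v v \<in> pid 0" using \<sigma>_pid v(1) by simp
      qed
      hence "L = M" using mx lL MsL by blast
      hence "u \<in> M" using rL(2) by (auto simp: S_def)
      hence "\<iota> u \<in> ?M" using \<iota>_ext[OF lM] e by simp
      thus "y \<in> ?M" unfolding y2 using rsubD(3)[OF rM] uz(2) by blast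
    qed
  qed (rule N'(3))
  ultimately show ?thesis unfolding e N.maximal_lattice_iff using lM' by blast
qed

text \<open>A basis of \<open>L\<close> adapted to \<open>h\<close> stays adapted after extension.
  It identifies the section of the extended lattice with the extension of the section, so
  \<open>lambda_exp_eq\<close> can be fed with data coming from \<open>V\<close>.\<close>

theorem lambda_ext:
  assumes L: "latt L" and h: "h \<in> L" "\<phi> h h \<noteq> \<zero>"
    and M: "maximal_lattice K (pid 0) (orth_space K V \<phi> h) \<phi> M"
    and m: "{bil h x | x. x \<in> L} = pid m"
    and l: "int l = m + dvspace.vol K (orth_space K V \<phi> h) val (L \<inter> carrier (orth_space K V \<phi> h))
      - dvspace.vol K (orth_space K V \<phi> h) val M"
  shows "lambda_exp K' (N.pid 0) (N.pid 1) V' \<phi>' (ext L) (\<sigma> (\<phi> h h)) = l"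
proof -
  have hV: "h \<in> carrier V" using h(1) rsubD(1)[OF latt_rsub[OF L]] by blast
  interpret A: dvquad_vec K V val \<phi> h by unfold_locales (use hV h in auto)
  have h': "\<iota> h \<in> carrier V'" "\<phi>' (\<iota> h) (\<iota> h) = \<sigma> (\<phi> h h)" "\<sigma> (\<phi> h h) \<noteq> \<zero>\<^bsub>K'\<^esub>"
    using hV \<iota>_closed \<iota>_phi \<sigma>_nz h(2) by auto
  interpret B: dvquad_vec K' V' val' \<phi>' "\<iota> h" by unfold_locales (use h' in auto)
  obtain b where b: "isb b" "L = lat b" using L by (rule lattE)
  obtain k c where c: "A.adapted k c" "lat c = L" using A.ex_adapted[OF b(1)] b(2) by auto
  note cc = A.adapted_carrier[OF c(1)]
  have ic: "isb c" and dk: "dim = Suc k" and ck: "\<phi> h (c k) \<noteq> \<zero>" using c(1) unfolding A.adapted_def by blast+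
  have iW: "\<iota> x \<in> carrier B.W" if "x \<in> carrier A.W" for x
    using that hV \<iota>_closed \<iota>_phi[of x h] H.hom_zero by (simp add: A.carrier_W B.carrier_W)
  have c': "B.adapted k (\<iota> \<circ> c)"
    unfolding B.adapted_def using \<iota>_btuple[OF ic] dim_eq dk cc iW \<iota>_phi[OF hV cc(4)] \<sigma>_nz ck hV
    by (auto simp: Pi_def)
  interpret W: base_change K A.W val \<phi> K' B.W val' \<phi>' \<sigma> \<iota>
  proof (intro base_change.intro base_change_axioms.intro A.W.dvquad_axioms B.W.dvquad_axioms \<sigma>_hom \<sigma>_nz \<sigma>_val iW)
    fix x y assume "x \<in> carrier A.W" "y \<in> carrier A.W"
    thus "\<iota> (x \<oplus>\<^bsub>A.W\<^esub> y) = \<iota> x \<oplus>\<^bsub>B.W\<^esub> \<iota> y" "\<phi>' (\<iota> x) (\<iota> y) = \<sigma> (\<phi> x y)"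
      using \<iota>_add \<iota>_phi A.W_V by simp_all
  next
    fix a x assume "a \<in> carrier K" "x \<in> carrier A.W"
    thus "\<iota> (a \<odot>\<^bsub>A.W\<^esub> x) = \<sigma> a \<odot>\<^bsub>B.W\<^esub> \<iota> x" using \<iota>_smult A.W_V by simp
  next
    have "btuple K' B.W k (\<iota> \<circ> c)" by (rule B.adapted_btuple_W[OF c'])
    thus "\<exists>b. A.W.isb b \<and> btuple K' B.W A.W.dim (\<iota> \<circ> b)"
      using A.lattice_section(2)[OF c(1)] A.W_dim[OF c(1)] by (intro exI[of _ c]) simp
  next
    fix d assume "d \<in> carrier K'"
    thus "\<exists>x\<in>carrier K. d \<oplus>\<^bsub>K'\<^esub> \<sigma> x \<in> N.pid 0" by (rule dense)
  qed
  have eL: "ext L = N.lat (\<iota> \<circ> c)" using ext_lat[OF ic] c(2) by simp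
  have LW: "L \<inter> carrier A.W = A.W.lat c" "A.W.isb c" using A.lattice_section[OF c(1)] c(2) by auto
  have "ext L \<inter> carrier B.W = B.W.lat (\<iota> \<circ> c)" using B.lattice_section(1)[OF c'] eL by simp
  also have "\<dots> = W.ext (L \<inter> carrier A.W)" using W.ext_lat[OF LW(2)] LW(1) by simp
  finally have sec: "ext L \<inter> carrier B.W = W.ext (L \<inter> carrier A.W)" .
  have lLW: "A.W.latt (L \<inter> carrier A.W)" unfolding LW(1) A.W.latt_def using LW(2) by blast
  have lM: "A.W.latt M" using M by (simp add: A.W.maximal_lattice_iff)
  have bc: "N.bil (\<iota> h) (\<iota> (c k)) = \<sigma> (bil h (c k))"
    using hV cc(4) \<iota>_phi by (simp add: bil_def N.bil_def)
  have "m = val (bil h (c k))" using A.bil_image_adapted(1)[OF c(1)] c(2) m by simp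
  hence "{N.bil (\<iota> h) x | x. x \<in> ext L} = N.pid m"
    using B.bil_image_adapted(1)[OF c'] eL bc \<sigma>_val A.bil_image_adapted(2)[OF c(1)] hV cc(4) by simp
  moreover have "int l = m + dvspace.vol K' B.W val' (ext L \<inter> carrier B.W) - dvspace.vol K' B.W val' (W.ext M)"
    unfolding sec using l W.vol_ext[OF lLW lM] by simp
  ultimately show ?thesis
    by (intro N.lambda_exp_eq[OF latt_ext[OF L] \<iota>_ext[OF L h(1)] h'(2,3) W.maximal_ext[OF M]])
qed

end

subsection \<open>Localization of a quadratic space\<close>

context nquad_loc
begin

abbreviation LS where "LS \<equiv> local_space P V"
abbreviation \<phi>v where "\<phi>v \<equiv> local_form P V \<phi>"
abbreviation \<iota> where "\<iota> \<equiv> to_local_space P V"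

interpretation H: ring_hom_cring "class_ring :: 'f ring" C tc
  by (intro ring_hom_cring.intro ring_hom_cring_axioms.intro ring_hom_memI F.is_cring C.is_cring)
    (use tc_hom in auto)

lemma some_basis: "basis (some_basis V)" "finite (some_basis V)"
proof -
  show "basis (some_basis V)"
    unfolding some_basis_def using finite_basis_exists[OF fd] someI_ex[of basis] by blast
  thus "finite (some_basis V)" using fin_dim_li_fin[OF fd] by (auto simp: basis_def)
qed

text \<open>Enumerates the basis that underlies \<open>local_space\<close>, which makes the results
  on tuples available.\<close>

definition bt :: "nat => 'v"
  where "bt = (SOME b. bij_betw b {..<dim} (some_basis V))"

lemma bij_bt: "bij_betw bt {..<dim} (some_basis V)"
proof -
  have "\<exists>b. bij_betw b {..<dim} (some_basis V)"
    using ex_bij_betw_nat_finite[OF some_basis(2)] dim_basis[OF some_basis(2,1)] by (auto simp: atLeast0LessThan)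
  thus ?thesis unfolding bt_def by (rule someI_ex)
qed

lemma img_bt: "bt ` {..<dim} = some_basis V" and inj_bt: "inj_on bt {..<dim}"
  using bij_bt by (auto simp: bij_betw_def)

lemma isb_bt: "isb bt"
  by (rule basis_btuple) (use some_basis img_bt inj_bt in auto)

lemma bt_mem: "i < dim ==> bt i \<in> some_basis V" and bt_V: "i < dim ==> bt i \<in> carrier V"
  using img_bt btupleD(1)[OF isb_bt] by auto

lemma bt_cases: "b \<in> some_basis V ==> (\<And>i. i < dim ==> b = bt i ==> thesis) ==> thesis"
  using img_bt by auto

lemma coords_bt:
  assumes x: "x \<in> carrier V" and i: "i < dim"
  shows "coords V x (bt i) = tcoord class_ring V dim bt x i"
proof -
  have "some_basis V \<subseteq> carrier V" using some_basis(1) by (auto simp: basis_def)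
  hence "\<exists>!a. a \<in> some_basis V \<rightarrow>\<^sub>E UNIV \<and> lincomb a (some_basis V) = x"
    using basis_criterion[OF some_basis(2)] some_basis(1) x by simp
  from theI'[OF this] have c: "lincomb (coords V x) (some_basis V) = x" unfolding coords_def by blast
  have "lc V dim (coords V x \<circ> bt) bt = x"
    using lincomb_image[OF inj_bt btupleD(1)[OF isb_bt], of "coords V x"] c img_bt by simp
  thus ?thesis
    using lc_inject[OF isb_bt _ tcoord(1)[OF isb_bt x], of "coords V x \<circ> bt" i] tcoord(2)[OF isb_bt x] i by simp
qed

lemma LS_simps:
  "carrier LS = some_basis V \<rightarrow>\<^sub>E carrier C"
  "b \<in> some_basis V ==> (x \<oplus>\<^bsub>LS\<^esub> y) b = x b \<oplus>\<^sub>C y b"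
  "b \<in> some_basis V ==> (c \<odot>\<^bsub>LS\<^esub> x) b = c \<otimes>\<^sub>C x b"
  "b \<in> some_basis V ==> \<zero>\<^bsub>LS\<^esub> b = \<zero>\<^sub>C"
  by (simp_all add: local_space_def C.func_space_def)

lemma LS_ext: "x \<in> carrier LS ==> y \<in> carrier LS ==> (\<And>i. i < dim ==> x (bt i) = y (bt i)) ==> x = y"
  unfolding LS_simps(1) by (rule PiE_ext) (auto elim: bt_cases)

lemma LS_bt: "x \<in> carrier LS ==> i < dim ==> x (bt i) \<in> carrier C"
  unfolding LS_simps(1) using bt_mem by auto

lemma vspace_LS: "vspace C LS"
proof -
  have "Module.module C LS" unfolding local_space_def by (rule C.func_space_is_module)
  thus ?thesis by (intro vspace.intro vectorspace.intro C.field_axioms)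
qed

interpretation N: vspace C LS
  by (rule vspace_LS)

lemma \<iota>_bt: "x \<in> carrier V ==> i < dim ==> \<iota> x (bt i) = tc (tcoord class_ring V dim bt x i)"
  using coords_bt bt_mem by (simp add: to_local_space_def)

lemma \<iota>_closed: "\<iota> x \<in> carrier LS"
  unfolding LS_simps(1) to_local_space_def using tc_hom(1) by auto

lemma \<iota>_linear:
  assumes "x \<in> carrier V"
  shows "y \<in> carrier V ==> \<iota> (x +\<^sub>V y) = \<iota> x \<oplus>\<^bsub>LS\<^esub> \<iota> y" "\<iota> (a *\<^sub>V x) = tc a \<odot>\<^bsub>LS\<^esub> \<iota> x"
proof -
  show "\<iota> (x +\<^sub>V y) = \<iota> x \<oplus>\<^bsub>LS\<^esub> \<iota> y" if y: "y \<in> carrier V"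
  proof (rule LS_ext)
    fix i assume i: "i < dim"
    show "\<iota> (x +\<^sub>V y) (bt i) = (\<iota> x \<oplus>\<^bsub>LS\<^esub> \<iota> y) (bt i)"
      using tcoord_add[OF isb_bt assms y i] i assms y bt_mem[OF i] tc_hom(2) by (simp add: \<iota>_bt LS_simps)
  qed (use \<iota>_closed N.M.a_closed in auto)
  show "\<iota> (a *\<^sub>V x) = tc a \<odot>\<^bsub>LS\<^esub> \<iota> x"
  proof (rule LS_ext)
    fix i assume i: "i < dim"
    show "\<iota> (a *\<^sub>V x) (bt i) = (tc a \<odot>\<^bsub>LS\<^esub> \<iota> x) (bt i)"
      using tcoord_smult[OF isb_bt assms, of a i] i assms bt_mem[OF i] tc_hom(3) sm(1)[OF assms]
      by (simp add: \<iota>_bt LS_simps)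
  qed (use \<iota>_closed N.smult_closed tc_hom(1) in auto)
qed

lemma eval_linfun: "i < dim ==> N.linfun (\<lambda>x. x (bt i))"
  unfolding N.linfun_def using LS_bt bt_mem LS_simps by auto

lemma lc_eval:
  assumes a: "a \<in> {..<dim} \<rightarrow> carrier C" and j: "j < dim"
  shows "lc LS dim a (\<iota> \<circ> bt) (bt j) = a j"
proof -
  have i: "\<iota> (bt i) (bt j) = (if i = j then \<one>\<^sub>C else \<zero>\<^sub>C)" if "i < dim" for i
    using \<iota>_bt[OF bt_V[OF that] j] tcoord_self[OF isb_bt that j] tc_hom(4,5) by simp
  have "lc LS dim a (\<iota> \<circ> bt) (bt j) = (\<Oplus>\<^bsub>C\<^esub>i\<in>{..<dim}. a i \<otimes>\<^sub>C \<iota> (bt i) (bt j))"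
    using N.linfun_lc[OF eval_linfun[OF j] a, of "\<iota> \<circ> bt"] \<iota>_closed by simp
  also have "\<dots> = a j \<otimes>\<^sub>C \<iota> (bt j) (bt j)"
    by (rule C.finsum_single) (use j i a in "auto simp: Pi_def")
  finally show ?thesis using i[OF j] a j by (simp add: Pi_def)
qed

lemma btuple_LS: "btuple C LS dim (\<iota> \<circ> bt)"
  unfolding btuple_def
proof (intro conjI ballI impI allI subsetI)
  show e: "\<iota> \<circ> bt \<in> {..<dim} \<rightarrow> carrier LS" using \<iota>_closed by auto
  fix x assume x: "x \<in> carrier LS"
  have a: "x \<circ> bt \<in> {..<dim} \<rightarrow> carrier C" using LS_bt[OF x] by auto
  have "x = lc LS dim (x \<circ> bt) (\<iota> \<circ> bt)"
    by (rule LS_ext[OF x N.lc_closed[OF a e]]) (use lc_eval[OF a] in simp)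
  thus "x \<in> lspan (carrier C) LS dim (\<iota> \<circ> bt)" unfolding lspan_def using a by blast
next
  fix a i assume "a \<in> {..<dim} \<rightarrow> carrier C" "lc LS dim a (\<iota> \<circ> bt) = \<zero>\<^bsub>LS\<^esub>" "i < dim"
  thus "a i = \<zero>\<^sub>C" using lc_eval[of a i] LS_simps(4)[OF bt_mem] by simp
qed

text \<open>The pairing of \<open>y\<close> with the \<open>i\<close>-th basis vector, split off so
  that linearity of the form in the first argument becomes visible.\<close>

definition T :: "nat => ('v => (nat => 'f) set) => (nat => 'f) set"
  where "T i y = (\<Oplus>\<^bsub>C\<^esub>j\<in>{..<dim}. y (bt j) \<otimes>\<^sub>C tc (\<phi> (bt i) (bt j)))"

lemma T_closed: "y \<in> carrier LS ==> T i y \<in> carrier C"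
  unfolding T_def by (rule C.finsum_closed) (use LS_bt tc_hom(1) in auto)

lemma form_tuple:
  assumes x: "x \<in> carrier LS" and y: "y \<in> carrier LS"
  shows "\<phi>v x y = (\<Oplus>\<^bsub>C\<^esub>i\<in>{..<dim}. \<Oplus>\<^bsub>C\<^esub>j\<in>{..<dim}. x (bt i) \<otimes>\<^sub>C y (bt j) \<otimes>\<^sub>C tc (\<phi> (bt i) (bt j)))"
    and "\<phi>v x y = (\<Oplus>\<^bsub>C\<^esub>i\<in>{..<dim}. x (bt i) \<otimes>\<^sub>C T i y)"
proof -
  have xc: "b \<in> some_basis V ==> x b \<in> carrier C" "b \<in> some_basis V ==> y b \<in> carrier C" for b
    using x y by (auto simp: LS_simps)
  have re: "(\<Oplus>\<^bsub>C\<^esub>b\<in>some_basis V. f b) = (\<Oplus>\<^bsub>C\<^esub>i\<in>{..<dim}. f (bt i))" if "f \<in> some_basis V \<rightarrow> carrier C" for f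
    using C.finsum_reindex[OF _ inj_bt, of f] that img_bt by simp
  have "\<phi>v x y = (\<Oplus>\<^bsub>C\<^esub>b\<in>some_basis V. \<Oplus>\<^bsub>C\<^esub>j\<in>{..<dim}. x b \<otimes>\<^sub>C y (bt j) \<otimes>\<^sub>C tc (\<phi> b (bt j)))"
    unfolding local_form_def
    by (rule C.finsum_cong'[OF refl]) (use xc tc_hom(1) bt_mem in "auto simp: re intro!: C.finsum_closed")
  also have "\<dots> = (\<Oplus>\<^bsub>C\<^esub>i\<in>{..<dim}. \<Oplus>\<^bsub>C\<^esub>j\<in>{..<dim}. x (bt i) \<otimes>\<^sub>C y (bt j) \<otimes>\<^sub>C tc (\<phi> (bt i) (bt j)))"
    by (rule re) (use xc tc_hom(1) bt_mem in "auto intro!: C.finsum_closed")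
  finally show 1: "\<phi>v x y = (\<Oplus>\<^bsub>C\<^esub>i\<in>{..<dim}. \<Oplus>\<^bsub>C\<^esub>j\<in>{..<dim}. x (bt i) \<otimes>\<^sub>C y (bt j) \<otimes>\<^sub>C tc (\<phi> (bt i) (bt j)))" .
  also have "\<dots> = (\<Oplus>\<^bsub>C\<^esub>i\<in>{..<dim}. x (bt i) \<otimes>\<^sub>C T i y)"
  proof (rule C.finsum_cong'[OF refl])
    fix i assume i: "i \<in> {..<dim}"
    hence xi: "x (bt i) \<in> carrier C" using LS_bt[OF x] by simp
    have "x (bt i) \<otimes>\<^sub>C T i y = (\<Oplus>\<^bsub>C\<^esub>j\<in>{..<dim}. x (bt i) \<otimes>\<^sub>C (y (bt j) \<otimes>\<^sub>C tc (\<phi> (bt i) (bt j))))"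
      unfolding T_def by (rule C.finsum_rdistr) (use xi LS_bt[OF y] tc_hom(1) in auto)
    also have "\<dots> = (\<Oplus>\<^bsub>C\<^esub>j\<in>{..<dim}. x (bt i) \<otimes>\<^sub>C y (bt j) \<otimes>\<^sub>C tc (\<phi> (bt i) (bt j)))"
      by (rule C.finsum_cong'[OF refl]) (use xi LS_bt[OF y] tc_hom(1) in "auto simp: C.m_assoc")
    finally show "(\<Oplus>\<^bsub>C\<^esub>j\<in>{..<dim}. x (bt i) \<otimes>\<^sub>C y (bt j) \<otimes>\<^sub>C tc (\<phi> (bt i) (bt j))) = x (bt i) \<otimes>\<^sub>C T i y" by simp
  qed (use LS_bt[OF x] T_closed[OF y] in auto)
  finally show "\<phi>v x y = (\<Oplus>\<^bsub>C\<^esub>i\<in>{..<dim}. x (bt i) \<otimes>\<^sub>C T i y)" .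
qed

lemma T_\<iota>:
  assumes x: "x \<in> carrier V" and i: "i < dim"
  shows "T i (\<iota> x) = tc (\<phi> (bt i) x)"
proof -
  note t = tcoord[OF isb_bt x]
  let ?c = "tcoord class_ring V dim bt x"
  have "\<phi> (bt i) x = (\<Oplus>\<^bsub>class_ring\<^esub>j\<in>{..<dim}. ?c j * \<phi> (bt i) (bt j))"
    using linfun_lc[OF F.phi_linfun(2)[OF bt_V[OF i]] t(1) btupleD(1)[OF isb_bt]] t(2) by simp
  hence "tc (\<phi> (bt i) x) = (\<Oplus>\<^bsub>C\<^esub>j\<in>{..<dim}. (tc \<circ> (\<lambda>j. ?c j * \<phi> (bt i) (bt j))) j)"
    using H.hom_finsum[of "\<lambda>j. ?c j * \<phi> (bt i) (bt j)" "{..<dim}"] by simp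
  also have "\<dots> = T i (\<iota> x)"
    unfolding T_def by (rule C.finsum_cong'[OF refl])
      (use \<iota>_bt[OF x] tc_hom(1,3) in auto)
  finally show ?thesis by simp
qed

lemma \<iota>_form:
  assumes x: "x \<in> carrier V" and y: "y \<in> carrier V"
  shows "\<phi>v (\<iota> x) (\<iota> y) = tc (\<phi> x y)"
proof -
  note t = tcoord[OF isb_bt x]
  let ?c = "tcoord class_ring V dim bt x"
  have "\<phi> x y = (\<Oplus>\<^bsub>class_ring\<^esub>j\<in>{..<dim}. ?c j * \<phi> (bt j) y)"
    using linfun_lc[OF F.phi_linfun(1)[OF y] t(1) btupleD(1)[OF isb_bt]] t(2) by simp
  hence "tc (\<phi> x y) = (\<Oplus>\<^bsub>C\<^esub>j\<in>{..<dim}. (tc \<circ> (\<lambda>j. ?c j * \<phi> (bt j) y)) j)"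
    using H.hom_finsum[of "\<lambda>j. ?c j * \<phi> (bt j) y" "{..<dim}"] by simp
  also have "\<dots> = \<phi>v (\<iota> x) (\<iota> y)"
    unfolding form_tuple(2)[OF \<iota>_closed \<iota>_closed] by (rule C.finsum_cong'[OF refl])
      (use \<iota>_bt[OF x] T_\<iota>[OF y] tc_hom(1,3) in auto)
  finally show ?thesis by simp
qed

lemma quadratic_space_LS: "quadratic_space C LS \<phi>v"
  unfolding quadratic_space_def
proof (intro conjI ballI impI)
  show "vectorspace C LS" by (rule N.vectorspace_axioms)
  show "N.fin_dim" by (rule N.btuple_basis(3)[OF btuple_LS])
next
  fix x y assume x: "x \<in> carrier LS" and y: "y \<in> carrier LS"
  note xb = LS_bt[OF x] and yb = LS_bt[OF y]
  show "\<phi>v x y \<in> carrier C"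
    unfolding form_tuple(2)[OF x y] by (rule C.finsum_closed) (use xb T_closed[OF y] in auto)
  have "\<phi>v x y = (\<Oplus>\<^bsub>C\<^esub>j\<in>{..<dim}. \<Oplus>\<^bsub>C\<^esub>i\<in>{..<dim}. x (bt i) \<otimes>\<^sub>C y (bt j) \<otimes>\<^sub>C tc (\<phi> (bt i) (bt j)))"
    unfolding form_tuple(1)[OF x y] by (rule C.finsum_swap) (use xb yb tc_hom(1) in auto)
  also have "\<dots> = \<phi>v y x"
    unfolding form_tuple(1)[OF y x] using xb yb tc_hom(1) phi_sym bt_V
    by (intro C.finsum_cong'[OF refl]) (auto simp: C.m_comm[of "y _"] intro!: C.finsum_closed C.finsum_cong')
  finally show "\<phi>v x y = \<phi>v y x" .
next
  fix x y z assume x: "x \<in> carrier LS" and y: "y \<in> carrier LS" and z: "z \<in> carrier LS"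
  have "\<phi>v (x \<oplus>\<^bsub>LS\<^esub> y) z = (\<Oplus>\<^bsub>C\<^esub>i\<in>{..<dim}. x (bt i) \<otimes>\<^sub>C T i z \<oplus>\<^sub>C y (bt i) \<otimes>\<^sub>C T i z)"
    unfolding form_tuple(2)[OF N.M.a_closed[OF x y] z]
    by (rule C.finsum_cong'[OF refl]) (use LS_bt[OF x] LS_bt[OF y] T_closed[OF z] bt_mem in "auto simp: LS_simps C.l_distr")
  also have "\<dots> = \<phi>v x z \<oplus>\<^sub>C \<phi>v y z"
    unfolding form_tuple(2)[OF x z] form_tuple(2)[OF y z]
    by (rule C.finsum_addf) (use LS_bt[OF x] LS_bt[OF y] T_closed[OF z] in auto)
  finally show "\<phi>v (x \<oplus>\<^bsub>LS\<^esub> y) z = \<phi>v x z \<oplus>\<^sub>C \<phi>v y z" .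
next
  fix a x z assume a: "a \<in> carrier C" and x: "x \<in> carrier LS" and z: "z \<in> carrier LS"
  have "\<phi>v (a \<odot>\<^bsub>LS\<^esub> x) z = (\<Oplus>\<^bsub>C\<^esub>i\<in>{..<dim}. a \<otimes>\<^sub>C (x (bt i) \<otimes>\<^sub>C T i z))"
    unfolding form_tuple(2)[OF N.smult_closed[OF a x] z]
    by (rule C.finsum_cong'[OF refl]) (use a LS_bt[OF x] T_closed[OF z] bt_mem in "auto simp: LS_simps C.m_assoc")
  also have "\<dots> = a \<otimes>\<^sub>C \<phi>v x z"
    unfolding form_tuple(2)[OF x z]
    by (rule C.finsum_rdistr[symmetric]) (use a LS_bt[OF x] T_closed[OF z] in auto)
  finally show "\<phi>v (a \<odot>\<^bsub>LS\<^esub> x) z = a \<otimes>\<^sub>C \<phi>v x z" .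
next
  fix y assume y: "y \<in> carrier LS" and z: "\<forall>x\<in>carrier LS. \<phi>v y x = \<zero>\<^sub>C"
  \<comment> \<open>Pairing with the images of the dual basis isolates one coordinate of
    \<open>y\<close>. The factor 1/2 below arises because duality refers to
    \<open>bil\<close>.\<close>
  obtain b' where b': "isb b'" "\<forall>i<dim. \<forall>j<dim. F.bil (b' j) (bt i) = (if i = j then 1 else 0)"
    using F.ex_dual_basis[OF isb_bt] by auto
  have "y (bt j) = \<zero>\<^sub>C" if j: "j < dim" for j
  proof -
    have bj: "b' j \<in> carrier V" using btupleD(1)[OF b'(1)] j by auto
    have f: "\<phi> (bt i) (b' j) = (if i = j then 1 / 2 else 0)" if "i < dim" for i
    proof -
      have "2 * \<phi> (b' j) (bt i) = (if i = j then 1 else 0)" using b'(2)[rule_format, OF that j] by (simp only: bil_eq)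
      thus ?thesis using phi_sym[OF bj bt_V[OF that]] by (cases "i = j") (simp_all add: field_simps)
    qed
    have "\<phi>v y (\<iota> (b' j)) = y (bt j) \<otimes>\<^sub>C T j (\<iota> (b' j))"
      unfolding form_tuple(2)[OF y \<iota>_closed]
      by (rule C.finsum_single) (use j LS_bt[OF y] T_\<iota>[OF bj] f tc_hom(1,5) in auto)
    hence "y (bt j) \<otimes>\<^sub>C tc (1 / 2) = \<zero>\<^sub>C" using z \<iota>_closed T_\<iota>[OF bj j] f[OF j] by simp
    thus ?thesis using C.integral[OF _ LS_bt[OF y j] tc_hom(1)[of "1 / 2"]] tc_zero[of "1 / 2"] by simp
  qed
  thus "y = \<zero>\<^bsub>LS\<^esub>" by (intro LS_ext[OF y N.M.zero_closed]) (use LS_simps(4)[OF bt_mem] in simp)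
qed

lemma base_change: "base_change class_ring V pval \<phi> C LS cval \<phi>v tc \<iota>"
proof (intro base_change.intro base_change_axioms.intro F.dvquad_axioms)
  show "dvquad C LS cval \<phi>v"
    by (intro dvquad.intro dvspace.intro dvspace_axioms.intro dvquad_axioms.intro vspace_LS C.dvf_axioms
      quadratic_space_LS N.btuple_basis(3)[OF btuple_LS])
  show "tc \<in> ring_hom class_ring C" by (rule H.homh)
  show "\<exists>b. isb b \<and> btuple C LS dim (\<iota> \<circ> b)" using isb_bt btuple_LS by blast
  fix c assume c: "c \<in> carrier C"
  obtain x where "c \<ominus>\<^bsub>C\<^esub> tc x \<in> C.pid 0" using completion_dense[OF c] by blast
  moreover have "\<ominus>\<^bsub>C\<^esub> tc x = tc (- x)" using H.hom_a_inv[of x] by (simp add: class_ring_simps)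
  ultimately show "\<exists>x\<in>carrier class_ring. c \<oplus>\<^sub>C tc x \<in> C.pid 0" by (intro bexI[of _ "- x"]) (auto simp: a_minus_def)
qed (use tc_zero tc_val \<iota>_closed \<iota>_linear \<iota>_form in auto)

interpretation B: base_change "class_ring :: 'f ring" V pval \<phi> C LS cval \<phi>v tc \<iota>
  by (rule base_change)

text \<open>The local lattice is spanned by the image of \<open>L\<close> itself. Passing to
  \<open>loc P V L\<close> only divides by elements outside \<open>P\<close>, which become units of
  the completed ring.\<close>

lemma local_lattice_ext:
  assumes L: "glat L"
  shows "local_lattice P V L = B.ext (loc P V L)"
proof
  note rL = glat_gsub[OF L]
  have c: "\<iota> ` A \<subseteq> carrier LS" for A using \<iota>_closed by blast
  note r = N.rsub_rspan[OF C.pid_subring c]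
  have e: "local_lattice P V L = rspan C (C.pid 0) LS (\<iota> ` L)" unfolding local_lattice_def local_ints_eq ..
  show "local_lattice P V L \<subseteq> B.ext (loc P V L)"
    unfolding e B.ext_def by (rule N.rspan_least[OF C.pid_subring _ r(1)]) (use r(2) loc_ext[OF rL] in blast)
  show "B.ext (loc P V L) \<subseteq> local_lattice P V L"
    unfolding e B.ext_def
  proof (rule N.rspan_least[OF C.pid_subring _ r(1)])
    show "\<iota> ` loc P V L \<subseteq> rspan C (C.pid 0) LS (\<iota> ` L)"
    proof
      fix u assume "u \<in> \<iota> ` loc P V L"
      then obtain x s where x: "u = \<iota> x" "x \<in> carrier V" "s \<in> \<gg> - P" "s *\<^sub>V x \<in> L" by (auto simp: loc_def)
      have "\<iota> (s *\<^sub>V x) \<in> rspan C (C.pid 0) LS (\<iota> ` L)" using r(2) x(4) by blast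
      moreover have "tc (1 / s) \<in> C.pid 0" using unit_Rloc[OF x(3)] tc_pid by simp
      ultimately have "tc (1 / s) \<odot>\<^bsub>LS\<^esub> \<iota> (s *\<^sub>V x) \<in> rspan C (C.pid 0) LS (\<iota> ` L)" using rsubD(4)[OF r(1)] by blast
      moreover have "tc (1 / s) \<odot>\<^bsub>LS\<^esub> \<iota> (s *\<^sub>V x) = u"
        using \<iota>_linear(2)[OF sm(1)[OF x(2)], of "1 / s" s] x(1,2) P_compl_nz[OF x(3)]
        by (simp add: sm(2) sm(3)[symmetric])
      ultimately show "u \<in> rspan C (C.pid 0) LS (\<iota> ` L)" by simp
    qed
  qed
qed

end

context nquad_vec
begin

lemma lambda_at_eq:
  assumes L: "gmax L" and M: "W.gmax M"
    and h: "h \<in> L" and P: "P \<in> finite_primes"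
  shows "int (lambda_at P V \<phi> L (\<phi> h h)) = ordv P (ideal_b class_ring \<gg> V \<phi> (\<phi> h h))"
proof -
  interpret Q: nquad_loc ty P V \<phi> by (rule nquad_loc[OF P])
  interpret WQ: nquad_loc ty P W \<phi> by (rule W.nquad_loc[OF P])
  interpret B: base_change "class_ring :: 'f ring" V Q.pval \<phi> "completion P" "local_space P V" Q.cval
    "local_form P V \<phi>" "to_completion P" "to_local_space P V" by (rule Q.base_change)
  note f = ordv_formula[OF L M P]
  \<comment> \<open>As \<open>h\<close> lies in \<open>L\<close>, its doubled products with
    \<open>L\<close> are integral; hence the sum of the two orders is nonnegative and survives the
    passage to \<open>nat\<close>.\<close>
  have "hvals L \<subseteq> \<gg>" using integral_bil[OF rL[OF L M] iL[OF L M] h] by auto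
  hence "0 \<le> ordv P (hvals L)" using Q.ordv_mono[OF hvals_FI[OF L M] FI_one] Q.ordv_one by simp
  hence l: "int (nat (ordv P (hvals L) + ordv P (sindex L M))) = ordv P (hvals L) + ordv P (sindex L M)"
    using f(4) by simp
  have "lambda_at P V \<phi> L (\<phi> h h) = nat (ordv P (hvals L) + ordv P (sindex L M))"
    unfolding lambda_at_def Q.local_ints_eq Q.local_prime_eq Q.local_lattice_ext[OF gL[OF L M]]
  proof (rule B.lambda_ext)
    show "Q.F.latt (loc P V L)" by (rule Q.latt_loc[OF gL[OF L M]])
    show "h \<in> loc P V L" using Q.loc_ext[OF rL[OF L M]] h by blast
    show "\<phi> h h \<noteq> \<zero>\<^bsub>class_ring\<^esub>" using hq by simp
    show "maximal_lattice class_ring (Q.F.pid 0) W \<phi> (loc P W M)" by (rule WQ.maximal_loc[OF M])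
    show "{Q.F.bil h x | x. x \<in> loc P V L} = Q.F.pid (ordv P (hvals L))" using f(1) by (auto simp: Q.bil_eq)
    show "int (nat (ordv P (hvals L) + ordv P (sindex L M))) = ordv P (hvals L) +
      dvspace.vol class_ring W Q.pval (loc P V L \<inter> carrier W) - dvspace.vol class_ring W Q.pval (loc P W M)"
      using l f(2) by simp
  qed
  thus ?thesis using l ordv_b[OF L M P] by simp
qed

lemma product_formula:
  assumes L: "gmax L" and M: "W.gmax M"
    and h: "h \<in> L"
  shows "is_prime_product (ideal_b class_ring \<gg> V \<phi> (\<phi> h h)) (\<lambda>P. lambda_at P V \<phi> L (\<phi> h h))"
    and "hvals L \<subseteq> \<gg>"
proof -
  show s: "hvals L \<subseteq> \<gg>" using integral_bil[OF rL[OF L M] iL[OF L M] h] by auto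
  show "is_prime_product (ideal_b class_ring \<gg> V \<phi> (\<phi> h h)) (\<lambda>P. lambda_at P V \<phi> L (\<phi> h h))"
    by (rule prime_product[OF b_FI[OF L M]]) (use b_sub[OF L M] s lambda_at_eq[OF L M h] in auto)
qed

end

theorem theorem4p2:
  fixes V W :: "('f::field_char_0, 'v) module"
    and \<phi> :: "'v \<Rightarrow> 'v \<Rightarrow> 'f"
    and L M :: "'v set" and h :: 'v and q :: 'f
    and \<bb> :: "'f \<Rightarrow> 'f set"
  assumes "number_field TYPE('f)"
    and "quadratic_space class_ring V \<phi>"
    and "vectorspace.dim class_ring V > 1"
    and "maximal_lattice class_ring alg_ints V \<phi> L"
    and "h \<in> carrier V"
    and "q = \<phi> h h" and "q \<noteq> 0"
    and "W = orth_space class_ring V \<phi> h"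
    and "maximal_lattice class_ring alg_ints W \<phi> M"
    and "\<bb> = ideal_b class_ring alg_ints V \<phi>"
  shows
    "(\<phi> h ` L) \<otimes>\<^bsub>global_frac_ideals\<^esub>
        index_ideal class_ring alg_ints W M (L \<inter> carrier W) = (\<lambda>x. x / 2) ` \<bb> q \<and>
     (\<forall>c\<in>alg_ints. c \<noteq> 0 \<and> c \<odot>\<^bsub>V\<^esub> h \<in> L \<longrightarrow>
        (\<lambda>x. c * x) ` \<bb> q = \<bb> (c\<^sup>2 * q) \<and>
        is_prime_product (\<bb> (c\<^sup>2 * q)) (\<lambda>P. lambda_at P V \<phi> L (c\<^sup>2 * q)) \<and>
        \<bb> q \<subseteq> (\<lambda>x. 2 * \<phi> h x) ` L \<and>
        (\<lambda>x. 2 * \<phi> h x) ` L \<subseteq> (\<lambda>x. x / c) ` alg_ints) \<and>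
     (h \<in> L \<longrightarrow>
        is_prime_product (\<bb> q) (\<lambda>P. lambda_at P V \<phi> L q) \<and>
        \<bb> q \<subseteq> (\<lambda>x. 2 * \<phi> h x) ` L \<and>
        (\<lambda>x. 2 * \<phi> h x) ` L \<subseteq> alg_ints)"
proof -
  note L = assms(4) and M = assms(9)[unfolded assms(8)]
  have vs: "vectorspace class_ring V" using assms(2) by (simp add: quadratic_space_def)
  interpret N: nquad_vec "TYPE('f)" V \<phi> h
  proof (intro nquad_vec.intro nquad.intro nspace.intro nspace_axioms.intro nquad_axioms.intro
      nquad_vec_axioms.intro nfield.intro vspace.intro vs assms(1,2,5))
    show "vectorspace.fin_dim class_ring V" using assms(2) by (simp add: quadratic_space_def)
    show "\<phi> h h \<noteq> 0" using assms(6,7) by simp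
  qed
  have "(\<lambda>x. c * x) ` \<bb> q = \<bb> (c\<^sup>2 * q) \<and>
      is_prime_product (\<bb> (c\<^sup>2 * q)) (\<lambda>P. lambda_at P V \<phi> L (c\<^sup>2 * q)) \<and>
      (\<lambda>x. 2 * \<phi> h x) ` L \<subseteq> (\<lambda>x. x / c) ` alg_ints"
    if c: "c \<in> alg_ints" "c \<noteq> 0" "c \<odot>\<^bsub>V\<^esub> h \<in> L" for c
  proof -
    note s = N.scale[OF L M c(1,2)]
    have cq: "\<phi> (c \<odot>\<^bsub>V\<^esub> h) (c \<odot>\<^bsub>V\<^esub> h) = c\<^sup>2 * q"
      using assms(5,6) N.sm(1) by (simp add: power2_eq_square)
    \<comment> \<open>The case of a multiplier \<open>c\<close> is the case of a vector in
      \<open>L\<close>, applied to \<open>c h\<close>, with the same \<open>M\<close>; dividing by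
      \<open>c\<close> at the end recovers the values at \<open>h\<close>.\<close>
    interpret C: nquad_vec "TYPE('f)" V \<phi> "c \<odot>\<^bsub>V\<^esub> h"
      by unfold_locales (use cq c assms(5,7) N.sm(1) in auto)
    have M': "maximal_lattice class_ring alg_ints C.W \<phi> M" using M s(2) by simp
    note p = C.product_formula[OF L M' c(3)]
    have "2 * \<phi> h x = (2 * \<phi> (c \<odot>\<^bsub>V\<^esub> h) x) / c" if "x \<in> L" for x
      using N.LV[OF L M that] assms(5) c(2) by simp
    hence "(\<lambda>x. 2 * \<phi> h x) ` L \<subseteq> (\<lambda>x. x / c) ` alg_ints" using p(2) by (force simp: image_subset_iff)
    thus ?thesis using p(1) s(1) cq assms(6,10) by simp
  qed
  thus ?thesis
    using N.phi_mult_index[OF L M] N.b_sub[OF L M] N.product_formula[OF L M] assms(6,8,10) by simp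
qed

end
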